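(* Let $G$ be a finite abelian group and $\mathbb{F}$ a field. Denote by $\mathrm{E}_{\mathbb{F}}^{\mathrm{simple}}(G)$ the set of isomorphism classes (as $G$-algebras) of simple $G$-Galois extensions of $\mathbb{F}$. Then the mapping $\mathrm{E}_{\mathbb{F}}^{\mathrm{simple}}(G)\to\mathfrak{T}_{\mathbb{F}}(G)$ sending the isomorphism class of $\mathcal{C}$ to the triple $\Psi(\mathcal{C})$ is a bijection.
   Context: All algebras are associative, unital and finite-dimensional. A $G$-Galois extension of $\mathbb{F}$ is a finite-dimensional unital $\mathbb{F}$-algebra $\mathcal{C}$ with a faithful action of $G$ by automorphisms such that $\mathcal{C}^G=\mathbb{F}1$ and $\mathcal{C}\otimes_{\mathbb{F}}\mathcal{C}\to\mathrm{Maps}(G,\mathcal{C})$, $a\otimes b\mapsto(g\mapsto a(g\cdot b))$, is bijective. It is simple if it is simple as an algebra. Fix an algebraic closure $\overline{\mathbb{F}}$ of $\mathbb{F}$. Let $\mathfrak{Z}_{\mathbb{F}}(G)$ be the set of pairs $(\mathbb{L},\theta)$ where (1) $\mathbb{L}\subset\overline{\mathbb{F}}$ is a finite Galois extension of $\mathbb{F}$; (2) $\theta:G\to\mathrm{Gal}(\mathbb{L}/\mathbb{F})$ is a surjective homomorphism such that, for $K=\ker\theta$: (i) $K$ admits a nondegenerate alternating bicharacter with values in $\mathbb{F}^\times$ (equivalently, $K\simeq A\times A$ for some abelian group $A$ and $\mathbb{F}$ contains a primitive root of unity of degree $\exp(K)$); (ii) every character $K\to\mathbb{F}^\times$ can be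 extended to a $1$-cocycle $G\to\mathbb{L}^\times$ (with $G$ acting on $\mathbb{L}^\times$ via $\theta$). For every $(\mathbb{L},\theta)\in\mathfrak{Z}_{\mathbb{F}}(G)$, fix an extension of every character $K\to\mathbb{F}^\times$ to a $1$-cocycle $G\to\mathbb{L}^\times$, and let $\Xi(\mathbb{L},\theta)\subset Z^1(G,\mathbb{L}^\times)$ be the resulting set of $1$-cocycles. For $l\in\mathbb{L}^\times$, $\mathrm{d}l$ is the $1$-coboundary $g\mapsto\theta_g(l)l^{-1}$. $\mathfrak{T}_{\mathbb{F}}(G)$ is the set of triples $(\mathbb{L},\theta,\xi)$ with $(\mathbb{L},\theta)\in\mathfrak{Z}_{\mathbb{F}}(G)$ and $\xi=\tau B^2(K,\mathbb{F}^\times)\in Z^2(K,\mathbb{L}^\times)/B^2(K,\mathbb{F}^\times)$ (trivial actions of $K=\ker\theta$) such that the alternating bicharacter $\beta(k_1,k_2)=\tau(k_1,k_2)\tau(k_2,k_1)^{-1}$ is nondegenerate and $f_{k_1}f_{k_2}=\mathrm{d}(\tau(k_1,k_2))f_{k_1k_2}$ for all $k_1,k_2\in K$, where $f_k$ is the unique element of $\Xi(\mathbb{L},\theta)$ with $f_k|_K=\beta(\cdot,k)$. A simple $G$-Galois extension $\mathcal{C}$ (with action $\sigma:G\to\mathrm{Aut}_{\mathbb{F}}(\mathcal{C})$) carries a $G$-grading $\mathcal{C}_h=\{a\in\mathcal{C}\mid ab=\sigma_h(b)a\ \forall b\in\mathcal{C}\}$; its support $K$ is the kernel of $\bar\sigma:g\mapsto\sigma_g|_{Z(\mathcal{C})}$,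 all nonzero homogeneous elements are invertible, and $\mathcal{C}_e=Z(\mathcal{C})$ is a field that is Galois over $\mathbb{F}$. The nondegenerate alternating bicharacter $\beta:K\times K\to\mathbb{F}^\times$ is $\beta(k_1,k_2)=c_1c_2c_1^{-1}c_2^{-1}$ for any nonzero $c_i\in\mathcal{C}_{k_i}$. $\Psi(\mathcal{C})=(\mathbb{L},\theta,\xi)$ is defined by: $\mathbb{L}$ is the unique subfield of $\overline{\mathbb{F}}$ isomorphic to $Z(\mathcal{C})$ over $\mathbb{F}$; $\theta$ is the unique homomorphism $G\to\mathrm{Gal}(\mathbb{L}/\mathbb{F})$ such that $\mathbb{L}$ with the action $\theta$ is isomorphic to $Z(\mathcal{C})$ with the action $\bar\sigma$ as a $G$-algebra over $\mathbb{F}$; $\xi=\tau B^2(K,\mathbb{F}^\times)$ where $\tau(k_1,k_2)=\iota^{-1}(X_{k_1}X_{k_2}X_{k_1k_2}^{-1})$, $\iota:\mathbb{L}\to Z(\mathcal{C})$ is an isomorphism over $\mathbb{F}$, and $0\ne X_k\in\mathcal{C}_k$ are chosen such that $\sigma_g(X_k)=\iota(f_k(g))X_k$ for all $g\in G$, with $f_k$ the unique element of $\Xi(\mathbb{L},\theta)$ such that $f_k|_K=\beta(\cdot,k)$. (Such $X_k$ exist, and $\xi$ does not depend on the choices of $X_k$ and $\iota$.) *)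

theory Defs
  imports "HOL-Algebra.Algebra"
begin

text \<open>
  Throughout, an algebraic closure is a field \<open>\<Omega>\<close> with a subfield \<open>F\<close> such that
  \<^term>\<open>algebraic_closure \<Omega> F\<close>; the base field is the ring \<open>\<Omega>\<lparr>carrier := F\<rparr>\<close>, and
  intermediate fields are subsets \<open>L\<close> of the carrier of \<open>\<Omega>\<close>. Maps that occur as mathematical
  objects in their own right (automorphisms, \<open>\<theta>\<close>, characters, cochains) are extensional, so
  that HOL equality is equality on the domain.
\<close>


section \<open>Field extensions\<close>

definition mult_group :: "('a, 'm) ring_scheme \<Rightarrow> 'a set \<Rightarrow> 'a monoid"
  where "mult_group \<Omega> L = units_of (\<Omega>\<lparr>carrier := L\<rparr>)"

definition Gal_group :: "('a, 'm) ring_scheme \<Rightarrow> 'a set \<Rightarrow> 'a set \<Rightarrow> ('a \<Rightarrow> 'a) monoid"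
  where "Gal_group \<Omega> F L =
    BijGroup L \<lparr>carrier := {s \<in> Bij L.
      s \<in> ring_hom (\<Omega>\<lparr>carrier := L\<rparr>) (\<Omega>\<lparr>carrier := L\<rparr>) \<and> (\<forall>x\<in>F. s x = x)}\<rparr>"

definition finite_Galois :: "('a, 'm) ring_scheme \<Rightarrow> 'a set \<Rightarrow> 'a set \<Rightarrow> bool"
  where "finite_Galois \<Omega> F L \<longleftrightarrow>
    subfield L \<Omega> \<and> F \<subseteq> L \<and> ring.finite_dimension \<Omega> F L \<and>
    {x \<in> L. \<forall>s\<in>carrier (Gal_group \<Omega> F L). s x = x} = F"


section \<open>Characters, bicharacters and cocycles\<close>

definition characters :: "('g, 'n) monoid_scheme \<Rightarrow> ('b, 'm) monoid_scheme \<Rightarrow> ('g \<Rightarrow> 'b) set"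
  where "characters K M = hom K M \<inter> extensional (carrier K)"

definition alternating_bicharacter ::
    "('g, 'n) monoid_scheme \<Rightarrow> ('b, 'm) monoid_scheme \<Rightarrow> ('g \<Rightarrow> 'g \<Rightarrow> 'b) \<Rightarrow> bool"
  where "alternating_bicharacter K M \<beta> \<longleftrightarrow>
    (\<forall>x\<in>carrier K. (\<lambda>y. \<beta> x y) \<in> hom K M) \<and>
    (\<forall>y\<in>carrier K. (\<lambda>x. \<beta> x y) \<in> hom K M) \<and>
    (\<forall>x\<in>carrier K. \<beta> x x = \<one>\<^bsub>M\<^esub>)"

definition nondegenerate ::
    "('g, 'n) monoid_scheme \<Rightarrow> ('b, 'm) monoid_scheme \<Rightarrow> ('g \<Rightarrow> 'g \<Rightarrow> 'b) \<Rightarrow> bool"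
  where "nondegenerate K M \<beta> \<longleftrightarrow>
    (\<forall>x\<in>carrier K. (\<forall>y\<in>carrier K. \<beta> x y = \<one>\<^bsub>M\<^esub>) \<longrightarrow> x = \<one>\<^bsub>K\<^esub>)"

definition cocycles1 ::
    "('g, 'n) monoid_scheme \<Rightarrow> ('b, 'm) monoid_scheme \<Rightarrow> ('g \<Rightarrow> 'b \<Rightarrow> 'b) \<Rightarrow> ('g \<Rightarrow> 'b) set"
  where "cocycles1 G M act =
    {f \<in> carrier G \<rightarrow>\<^sub>E carrier M.
      \<forall>g\<in>carrier G. \<forall>h\<in>carrier G. f (g \<otimes>\<^bsub>G\<^esub> h) = f g \<otimes>\<^bsub>M\<^esub> act g (f h)}"

definition coboundary1 :: "('b, 'm) monoid_scheme \<Rightarrow> ('g \<Rightarrow> 'b \<Rightarrow> 'b) \<Rightarrow> 'b \<Rightarrow> 'g \<Rightarrow> 'b"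
  where "coboundary1 M act l g = act g l \<otimes>\<^bsub>M\<^esub> inv\<^bsub>M\<^esub> l"

text \<open>Two-cochains with trivial action on the coefficients.\<close>

definition cocycle_group2 ::
    "('g, 'n) monoid_scheme \<Rightarrow> ('b, 'm) monoid_scheme \<Rightarrow> ('g \<times> 'g \<Rightarrow> 'b) monoid"
  where "cocycle_group2 K M =
    product_group (carrier K \<times> carrier K) (\<lambda>_. M)
      \<lparr>carrier := {t \<in> carrier K \<times> carrier K \<rightarrow>\<^sub>E carrier M.
        \<forall>x\<in>carrier K. \<forall>y\<in>carrier K. \<forall>z\<in>carrier K.
          t (x, y) \<otimes>\<^bsub>M\<^esub> t (x \<otimes>\<^bsub>K\<^esub> y, z) = t (x, y \<otimes>\<^bsub>K\<^esub> z) \<otimes>\<^bsub>M\<^esub> t (y, z)}\<rparr>"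

definition coboundaries2 ::
    "('g, 'n) monoid_scheme \<Rightarrow> ('b, 'm) monoid_scheme \<Rightarrow> ('g \<times> 'g \<Rightarrow> 'b) set"
  where "coboundaries2 K M =
    {(\<lambda>(x, y)\<in>carrier K \<times> carrier K. c x \<otimes>\<^bsub>M\<^esub> c y \<otimes>\<^bsub>M\<^esub> inv\<^bsub>M\<^esub> c (x \<otimes>\<^bsub>K\<^esub> y)) | c.
      c \<in> carrier K \<rightarrow> carrier M}"


section \<open>Algebras and tensor products\<close>

text \<open>Associative unital algebras; the library locale \<^locale>\<open>algebra\<close> is the commutative case.\<close>

locale assoc_algebra = module R A + ring A for R (structure) and A (structure) +
  assumes smult_mult_left:
      "\<lbrakk>r \<in> carrier R; x \<in> carrier A; y \<in> carrier A\<rbrakk> \<Longrightarrow>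
        (r \<odot>\<^bsub>A\<^esub> x) \<otimes>\<^bsub>A\<^esub> y = r \<odot>\<^bsub>A\<^esub> (x \<otimes>\<^bsub>A\<^esub> y)"
    and smult_mult_right:
      "\<lbrakk>r \<in> carrier R; x \<in> carrier A; y \<in> carrier A\<rbrakk> \<Longrightarrow>
        x \<otimes>\<^bsub>A\<^esub> (r \<odot>\<^bsub>A\<^esub> y) = r \<odot>\<^bsub>A\<^esub> (x \<otimes>\<^bsub>A\<^esub> y)"

definition scalars :: "('r, 'm) ring_scheme \<Rightarrow> ('r, 'c, 'k) module_scheme \<Rightarrow> 'c set"
  where "scalars R A = (\<lambda>r. r \<odot>\<^bsub>A\<^esub> \<one>\<^bsub>A\<^esub>) ` carrier R"

text \<open>
  The library's notion of dimension is relative to a subfield of the ring, here the subfield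
  of scalar multiples of the identity.
\<close>

definition fd_algebra :: "('r, 'm) ring_scheme \<Rightarrow> ('r, 'c, 'k) module_scheme \<Rightarrow> bool"
  where "fd_algebra R A \<longleftrightarrow>
    assoc_algebra R A \<and> ring.finite_dimension A (scalars R A) (carrier A)"

definition linear_on ::
    "('r, 'm) ring_scheme \<Rightarrow> ('r, 'c, 'k) module_scheme \<Rightarrow> ('r, 'd, 'l) module_scheme \<Rightarrow>
      ('c \<Rightarrow> 'd) \<Rightarrow> bool"
  where "linear_on R A B f \<longleftrightarrow>
    (\<forall>r\<in>carrier R. \<forall>x\<in>carrier A. f (r \<odot>\<^bsub>A\<^esub> x) = r \<odot>\<^bsub>B\<^esub> f x)"

definition alg_aut_group ::
    "('r, 'm) ring_scheme \<Rightarrow> ('r, 'c, 'k) module_scheme \<Rightarrow> ('c \<Rightarrow> 'c) monoid"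
  where "alg_aut_group R A =
    BijGroup (carrier A) \<lparr>carrier := {s \<in> Bij (carrier A). s \<in> ring_hom A A \<and> linear_on R A A s}\<rparr>"

definition simple_ring :: "('c, 'k) ring_scheme \<Rightarrow> bool"
  where "simple_ring A \<longleftrightarrow>
    carrier A \<noteq> {\<zero>\<^bsub>A\<^esub>} \<and> (\<forall>I. ideal I A \<longrightarrow> I = {\<zero>\<^bsub>A\<^esub>} \<or> I = carrier A)"

definition ring_center :: "('c, 'k) ring_scheme \<Rightarrow> 'c set"
  where "ring_center A = {z \<in> carrier A. \<forall>a\<in>carrier A. z \<otimes>\<^bsub>A\<^esub> a = a \<otimes>\<^bsub>A\<^esub> z}"

text \<open>
  The tensor product of modules as an abelian group: the free abelian group on the pairs modulo
  biadditivity and balancedness.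
\<close>

definition tensor_relations ::
    "('r, 'm) ring_scheme \<Rightarrow> ('r, 'c, 'k) module_scheme \<Rightarrow> ('r, 'd, 'l) module_scheme \<Rightarrow>
      ('c \<times> 'd \<Rightarrow>\<^sub>0 int) set"
  where "tensor_relations R M N =
    {frag_of (x \<oplus>\<^bsub>M\<^esub> x', y) - frag_of (x, y) - frag_of (x', y) | x x' y.
      x \<in> carrier M \<and> x' \<in> carrier M \<and> y \<in> carrier N} \<union>
    {frag_of (x, y \<oplus>\<^bsub>N\<^esub> y') - frag_of (x, y) - frag_of (x, y') | x y y'.
      x \<in> carrier M \<and> y \<in> carrier N \<and> y' \<in> carrier N} \<union>
    {frag_of (r \<odot>\<^bsub>M\<^esub> x, y) - frag_of (x, r \<odot>\<^bsub>N\<^esub> y) | r x y.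
      r \<in> carrier R \<and> x \<in> carrier M \<and> y \<in> carrier N}"

definition tensor_kernel ::
    "('r, 'm) ring_scheme \<Rightarrow> ('r, 'c, 'k) module_scheme \<Rightarrow> ('r, 'd, 'l) module_scheme \<Rightarrow>
      ('c \<times> 'd \<Rightarrow>\<^sub>0 int) set"
  where "tensor_kernel R M N =
    generate (free_Abelian_group (carrier M \<times> carrier N)) (tensor_relations R M N)"

definition tensor_product ::
    "('r, 'm) ring_scheme \<Rightarrow> ('r, 'c, 'k) module_scheme \<Rightarrow> ('r, 'd, 'l) module_scheme \<Rightarrow>
      ('c \<times> 'd \<Rightarrow>\<^sub>0 int) set monoid"
  where "tensor_product R M N =
    free_Abelian_group (carrier M \<times> carrier N) Mod tensor_kernel R M N"

definition pure_tensor ::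
    "('r, 'm) ring_scheme \<Rightarrow> ('r, 'c, 'k) module_scheme \<Rightarrow> ('r, 'd, 'l) module_scheme \<Rightarrow>
      'c \<Rightarrow> 'd \<Rightarrow> ('c \<times> 'd \<Rightarrow>\<^sub>0 int) set"
  where "pure_tensor R M N x y =
    tensor_kernel R M N #>\<^bsub>free_Abelian_group (carrier M \<times> carrier N)\<^esub> frag_of (x, y)"


section \<open>Galois extensions of a field with noncommutative total algebra\<close>

text \<open>
  A \<open>G\<close>-algebra is a pair of an algebra \<open>C\<close> and an action \<open>\<sigma>\<close>. In the last clause below,
  \<open>\<kappa>\<close> is the canonical map from the tensor square of \<open>C\<close> to \<open>Maps(G, C)\<close>: pure tensors
  generate the tensor product, so it is the only homomorphism with the prescribed values.
\<close>

definition Galois_extension ::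
    "('r, 'm) ring_scheme \<Rightarrow> ('g, 'n) monoid_scheme \<Rightarrow>
      ('r, 'c, 'k) module_scheme \<Rightarrow> ('g \<Rightarrow> 'c \<Rightarrow> 'c) \<Rightarrow> bool"
  where "Galois_extension R G C \<sigma> \<longleftrightarrow>
    fd_algebra R C \<and>
    \<sigma> \<in> hom G (alg_aut_group R C) \<and> inj_on \<sigma> (carrier G) \<and>
    {x \<in> carrier C. \<forall>g\<in>carrier G. \<sigma> g x = x} = scalars R C \<and>
    (\<exists>\<kappa> \<in> iso (tensor_product R C C) (product_group (carrier G) (\<lambda>_. add_monoid C)).
      \<forall>a\<in>carrier C. \<forall>b\<in>carrier C.
        \<kappa> (pure_tensor R C C a b) = (\<lambda>g\<in>carrier G. a \<otimes>\<^bsub>C\<^esub> \<sigma> g b))"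

definition simple_Galois_extensions ::
    "('r, 'm) ring_scheme \<Rightarrow> ('g, 'n) monoid_scheme \<Rightarrow>
      (('r, 'c) module \<times> ('g \<Rightarrow> 'c \<Rightarrow> 'c)) set"
  where "simple_Galois_extensions R G =
    {(C, \<sigma>). Galois_extension R G C \<sigma> \<and> simple_ring C}"

definition G_algebra_isomorphic ::
    "('r, 'm) ring_scheme \<Rightarrow> ('g, 'n) monoid_scheme \<Rightarrow>
      ('r, 'c, 'k) module_scheme \<Rightarrow> ('g \<Rightarrow> 'c \<Rightarrow> 'c) \<Rightarrow>
      ('r, 'd, 'l) module_scheme \<Rightarrow> ('g \<Rightarrow> 'd \<Rightarrow> 'd) \<Rightarrow> bool"
  where "G_algebra_isomorphic R G C \<sigma> D \<rho> \<longleftrightarrow>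
    (\<exists>\<phi>\<in>ring_iso C D. linear_on R C D \<phi> \<and>
      (\<forall>g\<in>carrier G. \<forall>x\<in>carrier C. \<phi> (\<sigma> g x) = \<rho> g (\<phi> x)))"

definition iso_rel ::
    "('r, 'm) ring_scheme \<Rightarrow> ('g, 'n) monoid_scheme \<Rightarrow>
      (('r, 'c) module \<times> ('g \<Rightarrow> 'c \<Rightarrow> 'c)) rel"
  where "iso_rel R G =
    {((C, \<sigma>), (D, \<rho>)). (C, \<sigma>) \<in> simple_Galois_extensions R G \<and>
      (D, \<rho>) \<in> simple_Galois_extensions R G \<and> G_algebra_isomorphic R G C \<sigma> D \<rho>}"

definition E_simple ::
    "('r, 'm) ring_scheme \<Rightarrow> ('g, 'n) monoid_scheme \<Rightarrow>
      (('r, 'c) module \<times> ('g \<Rightarrow> 'c \<Rightarrow> 'c)) set set"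
  where "E_simple R G = simple_Galois_extensions R G // iso_rel R G"


section \<open>The classifying data\<close>

definition ker_group ::
    "('a, 'm) ring_scheme \<Rightarrow> 'a set \<Rightarrow> ('g, 'n) monoid_scheme \<Rightarrow>
      'a set \<Rightarrow> ('g \<Rightarrow> 'a \<Rightarrow> 'a) \<Rightarrow> ('g, 'n) monoid_scheme"
  where "ker_group \<Omega> F G L \<theta> = G\<lparr>carrier := kernel G (Gal_group \<Omega> F L) \<theta>\<rparr>"

definition Z_set ::
    "('a, 'm) ring_scheme \<Rightarrow> 'a set \<Rightarrow> ('g, 'n) monoid_scheme \<Rightarrow>
      ('a set \<times> ('g \<Rightarrow> 'a \<Rightarrow> 'a)) set"
  where "Z_set \<Omega> F G =
    {(L, \<theta>).
      finite_Galois \<Omega> F L \<and>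
      \<theta> \<in> epi G (Gal_group \<Omega> F L) \<and> \<theta> \<in> extensional (carrier G) \<and>
      (let K = ker_group \<Omega> F G L \<theta> in
        (\<exists>\<beta>. alternating_bicharacter K (mult_group \<Omega> F) \<beta> \<and>
             nondegenerate K (mult_group \<Omega> F) \<beta>) \<and>
        (\<forall>\<chi>\<in>characters K (mult_group \<Omega> F).
           \<exists>f\<in>cocycles1 G (mult_group \<Omega> L) \<theta>. restrict f (carrier K) = \<chi>))}"

text \<open>
  The fixed choice of extensions is a function \<open>e\<close>: the character \<open>\<chi>\<close> of the kernel of
  \<open>\<theta>\<close> is extended to \<open>e L \<theta> \<chi>\<close>.
\<close>

definition extension_choice ::
    "('a, 'm) ring_scheme \<Rightarrow> 'a set \<Rightarrow> ('g, 'n) monoid_scheme \<Rightarrow>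
      ('a set \<Rightarrow> ('g \<Rightarrow> 'a \<Rightarrow> 'a) \<Rightarrow> ('g \<Rightarrow> 'a) \<Rightarrow> 'g \<Rightarrow> 'a) \<Rightarrow> bool"
  where "extension_choice \<Omega> F G e \<longleftrightarrow>
    (\<forall>(L, \<theta>)\<in>Z_set \<Omega> F G. let K = ker_group \<Omega> F G L \<theta> in
      \<forall>\<chi>\<in>characters K (mult_group \<Omega> F).
        e L \<theta> \<chi> \<in> cocycles1 G (mult_group \<Omega> L) \<theta> \<and> restrict (e L \<theta> \<chi>) (carrier K) = \<chi>)"

definition Xi ::
    "('a, 'm) ring_scheme \<Rightarrow> 'a set \<Rightarrow> ('g, 'n) monoid_scheme \<Rightarrow>
      ('a set \<Rightarrow> ('g \<Rightarrow> 'a \<Rightarrow> 'a) \<Rightarrow> ('g \<Rightarrow> 'a) \<Rightarrow> 'g \<Rightarrow> 'a) \<Rightarrow>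
      'a set \<Rightarrow> ('g \<Rightarrow> 'a \<Rightarrow> 'a) \<Rightarrow> ('g \<Rightarrow> 'a) set"
  where "Xi \<Omega> F G e L \<theta> = e L \<theta> ` characters (ker_group \<Omega> F G L \<theta>) (mult_group \<Omega> F)"

text \<open>The cocycle \<open>f\<^sub>k\<close> attached to a bicharacter \<open>\<beta>\<close>.\<close>

definition Xi_ext ::
    "('a, 'm) ring_scheme \<Rightarrow> 'a set \<Rightarrow> ('g, 'n) monoid_scheme \<Rightarrow>
      ('a set \<Rightarrow> ('g \<Rightarrow> 'a \<Rightarrow> 'a) \<Rightarrow> ('g \<Rightarrow> 'a) \<Rightarrow> 'g \<Rightarrow> 'a) \<Rightarrow>
      'a set \<Rightarrow> ('g \<Rightarrow> 'a \<Rightarrow> 'a) \<Rightarrow> ('g \<Rightarrow> 'g \<Rightarrow> 'a) \<Rightarrow> 'g \<Rightarrow> 'g \<Rightarrow> 'a"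
  where "Xi_ext \<Omega> F G e L \<theta> \<beta> k =
    (THE f. f \<in> Xi \<Omega> F G e L \<theta> \<and> (\<forall>x\<in>carrier (ker_group \<Omega> F G L \<theta>). f x = \<beta> x k))"

definition coset_B2 ::
    "('a, 'm) ring_scheme \<Rightarrow> 'a set \<Rightarrow> ('g, 'n) monoid_scheme \<Rightarrow>
      'a set \<Rightarrow> ('g \<times> 'g \<Rightarrow> 'a) \<Rightarrow> ('g \<times> 'g \<Rightarrow> 'a) set"
  where "coset_B2 \<Omega> F K L \<tau> =
    coboundaries2 K (mult_group \<Omega> F) #>\<^bsub>cocycle_group2 K (mult_group \<Omega> L)\<^esub> \<tau>"

text \<open>
  For \<open>(L, \<theta>)\<close> in \<^const>\<open>Z_set\<close>, the \<open>\<beta>\<close> below is an alternating bicharacter with values in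
  \<open>F\<close>: its values are roots of unity of order dividing the exponent of the kernel, and \<open>F\<close>
  contains all of these.
\<close>

definition T_set ::
    "('a, 'm) ring_scheme \<Rightarrow> 'a set \<Rightarrow> ('g, 'n) monoid_scheme \<Rightarrow>
      ('a set \<Rightarrow> ('g \<Rightarrow> 'a \<Rightarrow> 'a) \<Rightarrow> ('g \<Rightarrow> 'a) \<Rightarrow> 'g \<Rightarrow> 'a) \<Rightarrow>
      ('a set \<times> ('g \<Rightarrow> 'a \<Rightarrow> 'a) \<times> ('g \<times> 'g \<Rightarrow> 'a) set) set"
  where "T_set \<Omega> F G e =
    {(L, \<theta>, \<xi>). (L, \<theta>) \<in> Z_set \<Omega> F G \<and>
      (let K = ker_group \<Omega> F G L \<theta>; M = mult_group \<Omega> L in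
        \<exists>\<tau>\<in>carrier (cocycle_group2 K M).
          \<xi> = coset_B2 \<Omega> F K L \<tau> \<and>
          (let \<beta> = (\<lambda>x y. \<tau> (x, y) \<otimes>\<^bsub>M\<^esub> inv\<^bsub>M\<^esub> \<tau> (y, x)); f = Xi_ext \<Omega> F G e L \<theta> \<beta> in
            nondegenerate K M \<beta> \<and>
            (\<forall>x\<in>carrier K. \<forall>y\<in>carrier K. \<forall>g\<in>carrier G.
              f x g \<otimes>\<^bsub>M\<^esub> f y g =
                coboundary1 M \<theta> (\<tau> (x, y)) g \<otimes>\<^bsub>M\<^esub> f (x \<otimes>\<^bsub>K\<^esub> y) g)))}"


section \<open>The invariants of a simple Galois extension\<close>

definition homogeneous ::
    "('c, 'k) ring_scheme \<Rightarrow> ('g \<Rightarrow> 'c \<Rightarrow> 'c) \<Rightarrow> 'g \<Rightarrow> 'c set"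
  where "homogeneous C \<sigma> h =
    {a \<in> carrier C. \<forall>b\<in>carrier C. a \<otimes>\<^bsub>C\<^esub> b = \<sigma> h b \<otimes>\<^bsub>C\<^esub> a}"

definition commutation_bichar ::
    "('r, 'm) ring_scheme \<Rightarrow> ('r, 'c, 'k) module_scheme \<Rightarrow> ('g \<Rightarrow> 'c \<Rightarrow> 'c) \<Rightarrow> 'g \<Rightarrow> 'g \<Rightarrow> 'r"
  where "commutation_bichar R C \<sigma> x y =
    (THE r. r \<in> carrier R \<and>
      (\<forall>c\<in>homogeneous C \<sigma> x - {\<zero>\<^bsub>C\<^esub>}. \<forall>d\<in>homogeneous C \<sigma> y - {\<zero>\<^bsub>C\<^esub>}.
        c \<otimes>\<^bsub>C\<^esub> d \<otimes>\<^bsub>C\<^esub> inv\<^bsub>C\<^esub> c \<otimes>\<^bsub>C\<^esub> inv\<^bsub>C\<^esub> d = r \<odot>\<^bsub>C\<^esub> \<one>\<^bsub>C\<^esub>))"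

definition center_isos ::
    "('a, 'm) ring_scheme \<Rightarrow> 'a set \<Rightarrow> 'a set \<Rightarrow> ('a, 'c, 'k) module_scheme \<Rightarrow> ('a \<Rightarrow> 'c) set"
  where "center_isos \<Omega> F L C =
    {\<iota> \<in> ring_iso (\<Omega>\<lparr>carrier := L\<rparr>) (C\<lparr>carrier := ring_center C\<rparr>).
      \<forall>r\<in>F. \<iota> r = r \<odot>\<^bsub>C\<^esub> \<one>\<^bsub>C\<^esub>}"

definition Psi_field ::
    "('a, 'm) ring_scheme \<Rightarrow> 'a set \<Rightarrow> ('a, 'c, 'k) module_scheme \<Rightarrow> 'a set"
  where "Psi_field \<Omega> F C =
    (THE L. subfield L \<Omega> \<and> F \<subseteq> L \<and> center_isos \<Omega> F L C \<noteq> {})"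

definition Psi_action ::
    "('a, 'm) ring_scheme \<Rightarrow> 'a set \<Rightarrow> ('g, 'n) monoid_scheme \<Rightarrow>
      ('a, 'c, 'k) module_scheme \<Rightarrow> ('g \<Rightarrow> 'c \<Rightarrow> 'c) \<Rightarrow> 'g \<Rightarrow> 'a \<Rightarrow> 'a"
  where "Psi_action \<Omega> F G C \<sigma> =
    (let L = Psi_field \<Omega> F C in
      THE \<theta>. \<theta> \<in> hom G (Gal_group \<Omega> F L) \<and> \<theta> \<in> extensional (carrier G) \<and>
        (\<exists>\<iota>\<in>center_isos \<Omega> F L C. \<forall>g\<in>carrier G. \<forall>x\<in>L. \<iota> (\<theta> g x) = \<sigma> g (\<iota> x)))"

definition Psi_class ::
    "('a, 'm) ring_scheme \<Rightarrow> 'a set \<Rightarrow> ('g, 'n) monoid_scheme \<Rightarrow>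
      ('a set \<Rightarrow> ('g \<Rightarrow> 'a \<Rightarrow> 'a) \<Rightarrow> ('g \<Rightarrow> 'a) \<Rightarrow> 'g \<Rightarrow> 'a) \<Rightarrow>
      ('a, 'c, 'k) module_scheme \<Rightarrow> ('g \<Rightarrow> 'c \<Rightarrow> 'c) \<Rightarrow> ('g \<times> 'g \<Rightarrow> 'a) set"
  where "Psi_class \<Omega> F G e C \<sigma> =
    (let L = Psi_field \<Omega> F C; \<theta> = Psi_action \<Omega> F G C \<sigma>; K = ker_group \<Omega> F G L \<theta>;
         f = Xi_ext \<Omega> F G e L \<theta> (commutation_bichar (\<Omega>\<lparr>carrier := F\<rparr>) C \<sigma>) in
      THE \<xi>. \<exists>\<iota>\<in>center_isos \<Omega> F L C. \<exists>u.
        (\<forall>k\<in>carrier K. u k \<in> homogeneous C \<sigma> k - {\<zero>\<^bsub>C\<^esub>} \<and>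
          (\<forall>g\<in>carrier G. \<sigma> g (u k) = \<iota> (f k g) \<otimes>\<^bsub>C\<^esub> u k)) \<and>
        \<xi> = coset_B2 \<Omega> F K L
          (\<lambda>(x, y)\<in>carrier K \<times> carrier K.
            inv_into L \<iota> (u x \<otimes>\<^bsub>C\<^esub> u y \<otimes>\<^bsub>C\<^esub> inv\<^bsub>C\<^esub> u (x \<otimes>\<^bsub>K\<^esub> y))))"

definition Psi ::
    "('a, 'm) ring_scheme \<Rightarrow> 'a set \<Rightarrow> ('g, 'n) monoid_scheme \<Rightarrow>
      ('a set \<Rightarrow> ('g \<Rightarrow> 'a \<Rightarrow> 'a) \<Rightarrow> ('g \<Rightarrow> 'a) \<Rightarrow> 'g \<Rightarrow> 'a) \<Rightarrow>
      ('a, 'c) module \<times> ('g \<Rightarrow> 'c \<Rightarrow> 'c) \<Rightarrow>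
      'a set \<times> ('g \<Rightarrow> 'a \<Rightarrow> 'a) \<times> ('g \<times> 'g \<Rightarrow> 'a) set"
  where "Psi \<Omega> F G e = (\<lambda>(C, \<sigma>).
    (Psi_field \<Omega> F C, Psi_action \<Omega> F G C \<sigma>, Psi_class \<Omega> F G e C \<sigma>))"

end

theory Submission
  imports Defs
begin

text \<open>
  If \<open>C\<close> is a simple \<open>G\<close>-Galois extension, the preimage of \<open>g \<mapsto> \<delta>\<^sub>g\<close> under the canonical map
  splits \<open>C\<close> into its homogeneous components, so that \<open>C\<close> is a crossed product
  \<open>\<Oplus> L u\<^sub>k\<close> over the kernel \<open>K\<close> of the action on the centre \<open>L\<close>, with \<open>u\<^sub>k u\<^sub>l = \<tau>(k, l) u\<^sub>k\<^sub>l\<close> and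
  \<open>\<sigma>\<^sub>g(u\<^sub>k) = f\<^sub>k(g) u\<^sub>k\<close>. By Hilbert's theorem 90 the \<open>u\<^sub>k\<close> can be rescaled so that the \<open>f\<^sub>k\<close> are
  the chosen extensions of their restrictions to \<open>K\<close>; the remaining freedom is a factor in \<open>F\<close> for
  each \<open>k\<close>, which changes \<open>\<tau>\<close> by a coboundary. Two crossed products with the same data are
  isomorphic coordinatewise. Conversely, the crossed product built from a triple is simple and
  Galois because the nondegenerate bicharacter separates the \<open>u\<^sub>k\<close> and \<open>Gal(L/F)\<close> separates
  the points of \<open>L\<close>, which makes \<open>\<delta>\<^sub>1\<close> lie in the image of the canonical map.
\<close>

section \<open>Sums over lists\<close>

text \<open>The canonical map is known only through its values on pure tensors, so the argument
  works with finite lists of pairs. A list representing delta at the identity serves at once as a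
  dual basis, as a projection onto homogeneous components and as a filter for coordinates. The other
  engine is Dedekind independence with coefficients in a noncommutative ring. It does the work of
  dimension counts: it identifies the support of the grading with all of K, shows that every
  embedding of L over F comes from G, and that every F-valued character of K is one of the
  \<open>f k\<close>. Three obstacles shape the rest. Isomorphisms from L to the centre are not
  unique, but two of them differ by some theta_h with h in G, and commutativity of G makes theta and
  the cocycle class independent of the choice. For a triple, the bicharacter of tau is a priori
  L-valued and must be shown to lie in F before its chosen extensions exist. Finally, isomorphism
  classes are formed over one fixed type, so the constructed algebra, whose elements are functions
  from K to L, has to be copied into that type through coordinates over F.\<close>

definition lprod :: "('m, 'z) monoid_scheme \<Rightarrow> ('t \<Rightarrow> 'm) \<Rightarrow> 't list \<Rightarrow> 'm"
  where "lprod M B ts = foldr (\<lambda>t s. B t \<otimes>\<^bsub>M\<^esub> s) ts \<one>\<^bsub>M\<^esub>"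

text \<open>A tensor is handled as a list of pairs, in which repetitions count. Reading the same
  fold in \<open>add_monoid A\<close> gives sums in a ring, so one set of lemmas covers these sums
  and the products of pure tensors in the tensor group.\<close>

abbreviation lsum :: "('m, 'z) ring_scheme \<Rightarrow> ('t \<Rightarrow> 'm) \<Rightarrow> 't list \<Rightarrow> 'm"
  where "lsum A \<equiv> lprod (add_monoid A)"

lemma lprod_Nil [simp]: "lprod M B [] = \<one>\<^bsub>M\<^esub>"
  and lprod_Cons [simp]: "lprod M B (t # ts) = B t \<otimes>\<^bsub>M\<^esub> lprod M B ts"
  by (simp_all add: lprod_def)

lemma lprod_map: "lprod M B (map f ts) = lprod M (\<lambda>t. B (f t)) ts"
  by (induction ts) simp_all

lemma lprod_cong: "(\<And>t. t \<in> set ts \<Longrightarrow> B t = B' t) \<Longrightarrow> lprod M B ts = lprod M B' ts"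
  by (induction ts) simp_all

lemma lsum_carrier_update [simp]: "lsum (A\<lparr>carrier := L\<rparr>) B ts = lsum A B ts"
  by (induction ts) simp_all

context comm_monoid
begin

lemma lprod_closed [simp]: "(\<And>t. t \<in> set ts \<Longrightarrow> B t \<in> carrier G) \<Longrightarrow> lprod G B ts \<in> carrier G"
  by (induction ts) simp_all

lemma lprod_one: "(\<And>t. t \<in> set ts \<Longrightarrow> B t = \<one>) \<Longrightarrow> lprod G B ts = \<one>"
  by (induction ts) simp_all

lemma lprod_append:
  "\<lbrakk>\<And>t. t \<in> set ts \<Longrightarrow> B t \<in> carrier G; \<And>t. t \<in> set ss \<Longrightarrow> B t \<in> carrier G\<rbrakk>
    \<Longrightarrow> lprod G B (ts @ ss) = lprod G B ts \<otimes> lprod G B ss"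
  by (induction ts) (simp_all add: m_assoc lprod_closed)

lemma lprod_mult:
  "\<lbrakk>\<And>t. t \<in> set ts \<Longrightarrow> B t \<in> carrier G; \<And>t. t \<in> set ts \<Longrightarrow> B' t \<in> carrier G\<rbrakk>
    \<Longrightarrow> lprod G (\<lambda>t. B t \<otimes> B' t) ts = lprod G B ts \<otimes> lprod G B' ts"
  by (induction ts) (simp_all add: m_ac lprod_closed)

lemma lprod_concat:
  "(\<And>t s. \<lbrakk>t \<in> set ts; s \<in> set (F t)\<rbrakk> \<Longrightarrow> B s \<in> carrier G)
    \<Longrightarrow> lprod G B (concat (map F ts)) = lprod G (\<lambda>t. lprod G B (F t)) ts"
proof (induction ts)
  case (Cons t ts)
  then have "lprod G B (F t @ concat (map F ts)) = lprod G B (F t) \<otimes> lprod G B (concat (map F ts))"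
    by (intro lprod_append) auto
  moreover have "lprod G B (concat (map F ts)) = lprod G (\<lambda>t. lprod G B (F t)) ts"
    by (rule Cons.IH) (use Cons.prems in auto)
  ultimately show ?case by simp
qed simp

lemma lprod_swap:
  "(\<And>t s. \<lbrakk>t \<in> set ts; s \<in> set ss\<rbrakk> \<Longrightarrow> B t s \<in> carrier G)
    \<Longrightarrow> lprod G (\<lambda>t. lprod G (B t) ss) ts = lprod G (\<lambda>s. lprod G (\<lambda>t. B t s) ts) ss"
proof (induction ts)
  case Nil
  show ?case by (simp add: lprod_one)
next
  case (Cons t ts)
  have "lprod G (\<lambda>s. lprod G (\<lambda>t. B t s) (t # ts)) ss
      = lprod G (B t) ss \<otimes> lprod G (\<lambda>s. lprod G (\<lambda>t. B t s) ts) ss"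
    unfolding lprod_Cons by (rule lprod_mult) (use Cons.prems in auto)
  with Cons show ?case by simp
qed

lemma finprod_lprod:
  assumes "finite I" "\<And>i t. \<lbrakk>i \<in> I; t \<in> set ts\<rbrakk> \<Longrightarrow> B i t \<in> carrier G"
  shows "(\<Otimes>i\<in>I. lprod G (B i) ts) = lprod G (\<lambda>t. \<Otimes>i\<in>I. B i t) ts"
  using assms(2)
proof (induction ts)
  case Nil
  show ?case by (simp add: finprod_one_eqI)
next
  case (Cons t ts)
  have "(\<Otimes>i\<in>I. lprod G (B i) (t # ts)) = (\<Otimes>i\<in>I. B i t) \<otimes> (\<Otimes>i\<in>I. lprod G (B i) ts)"
    unfolding lprod_Cons by (rule finprod_multf) (use Cons.prems in auto)
  with Cons show ?case by simp
qed

end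

lemma lprod_hom:
  assumes "monoid M" "h \<in> hom M N" "h \<one>\<^bsub>M\<^esub> = \<one>\<^bsub>N\<^esub>" "\<And>t. t \<in> set ts \<Longrightarrow> B t \<in> carrier M"
  shows "h (lprod M B ts) = lprod N (\<lambda>t. h (B t)) ts"
proof -
  have "lprod M B ts \<in> carrier M \<and> h (lprod M B ts) = lprod N (\<lambda>t. h (B t)) ts"
    using assms(4)
    by (induction ts) (use assms in \<open>auto simp: monoid.m_closed hom_mult intro: monoid.one_closed\<close>)
  then show ?thesis ..
qed

lemmas (in abelian_monoid) lsum_closed = comm_monoid.lprod_closed [OF a_comm_monoid, simplified]
  and lsum_zero = comm_monoid.lprod_one [OF a_comm_monoid, simplified]
  and lsum_append = comm_monoid.lprod_append [OF a_comm_monoid, simplified]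
  and lsum_add = comm_monoid.lprod_mult [OF a_comm_monoid, simplified]
  and lsum_concat = comm_monoid.lprod_concat [OF a_comm_monoid, simplified]
  and lsum_swap = comm_monoid.lprod_swap [OF a_comm_monoid, simplified]
  and finsum_lsum = comm_monoid.finprod_lprod [OF a_comm_monoid, simplified, folded finsum_def]

context abelian_group
begin

lemma additive_zero:
  assumes "abelian_group B" "h \<in> carrier G \<rightarrow> carrier B"
    "\<And>x y. \<lbrakk>x \<in> carrier G; y \<in> carrier G\<rbrakk> \<Longrightarrow> h (x \<oplus> y) = h x \<oplus>\<^bsub>B\<^esub> h y"
  shows "h \<zero> = \<zero>\<^bsub>B\<^esub>"
proof -
  interpret B: abelian_group B by fact
  have "h \<zero> \<in> carrier B" using assms(2) by auto
  moreover have "h \<zero> \<oplus>\<^bsub>B\<^esub> h \<zero> = h \<zero>" using assms(3)[of \<zero> \<zero>] by simp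
  ultimately show ?thesis by (metis B.add.r_cancel_one)
qed

lemma lsum_hom:
  assumes "abelian_group B" "h \<in> carrier G \<rightarrow> carrier B"
    "\<And>x y. \<lbrakk>x \<in> carrier G; y \<in> carrier G\<rbrakk> \<Longrightarrow> h (x \<oplus> y) = h x \<oplus>\<^bsub>B\<^esub> h y"
    "\<And>t. t \<in> set ts \<Longrightarrow> f t \<in> carrier G"
  shows "h (lsum G f ts) = lsum B (\<lambda>t. h (f t)) ts"
proof (rule lprod_hom)
  show "Group.monoid (add_monoid G)" by (simp add: a_comm_monoid comm_monoid.axioms(1))
  show "h \<in> hom (add_monoid G) (add_monoid B)" using assms(2,3) by (auto simp: hom_def)
  show "h \<one>\<^bsub>add_monoid G\<^esub> = \<one>\<^bsub>add_monoid B\<^esub>" using additive_zero[OF assms(1-3)] by simp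
qed (use assms(4) in simp)

lemma finsum_hom:
  assumes "abelian_group B" "h \<in> carrier G \<rightarrow> carrier B"
    "\<And>x y. \<lbrakk>x \<in> carrier G; y \<in> carrier G\<rbrakk> \<Longrightarrow> h (x \<oplus> y) = h x \<oplus>\<^bsub>B\<^esub> h y"
    "\<And>t. t \<in> I \<Longrightarrow> f t \<in> carrier G"
  shows "h (finsum G f I) = finsum B (\<lambda>t. h (f t)) I"
proof (cases "finite I")
  case True
  interpret B: abelian_group B by fact
  from True assms(4) show ?thesis
  proof (induction I)
    case (insert i I)
    then have *: "f \<in> I \<rightarrow> carrier G" "f i \<in> carrier G" by auto
    then have "(\<lambda>t. h (f t)) \<in> I \<rightarrow> carrier B" "h (f i) \<in> carrier B" using assms(2) by auto
    with insert * show ?case by (simp add: finsum_insert B.finsum_insert assms(3) finsum_closed)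
  qed (simp add: additive_zero[OF assms(1-3)])
next
  case False
  interpret B: abelian_group B by fact
  show ?thesis using False by (simp add: finsum_infinite B.finsum_infinite additive_zero[OF assms(1-3)])
qed

lemma finsum_swap:
  assumes "finite I" "finite J" "\<And>i j. \<lbrakk>i \<in> I; j \<in> J\<rbrakk> \<Longrightarrow> f i j \<in> carrier G"
  shows "(\<Oplus>i\<in>I. \<Oplus>j\<in>J. f i j) = (\<Oplus>j\<in>J. \<Oplus>i\<in>I. f i j)"
  using assms(1,3)
proof (induction I)
  case empty
  show ?case by (simp add: add.finprod_one_eqI)
next
  case (insert i I)
  have "(\<Oplus>j\<in>J. \<Oplus>i\<in>insert i I. f i j) = (\<Oplus>j\<in>J. f i j \<oplus> (\<Oplus>i\<in>I. f i j))"
    by (rule finsum_cong') (use insert in \<open>auto intro!: finsum_insert finsum_closed a_closed\<close>)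
  also have "\<dots> = (\<Oplus>j\<in>J. f i j) \<oplus> (\<Oplus>j\<in>J. \<Oplus>i\<in>I. f i j)"
    by (rule finsum_addf) (use insert in \<open>auto intro!: finsum_closed\<close>)
  also have "\<dots> = (\<Oplus>i\<in>insert i I. \<Oplus>j\<in>J. f i j)"
    using insert by (subst finsum_insert) (auto intro!: finsum_closed)
  finally show ?case by simp
qed

end

context ring
begin

lemma lsum_mult_left:
  assumes "c \<in> carrier R" "\<And>t. t \<in> set ts \<Longrightarrow> f t \<in> carrier R"
  shows "c \<otimes> lsum R f ts = lsum R (\<lambda>t. c \<otimes> f t) ts"
  by (rule lsum_hom[OF abelian_group_axioms]) (use assms in \<open>auto simp: r_distr\<close>)

lemma lsum_mult_right:
  assumes "c \<in> carrier R" "\<And>t. t \<in> set ts \<Longrightarrow> f t \<in> carrier R"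
  shows "lsum R f ts \<otimes> c = lsum R (\<lambda>t. f t \<otimes> c) ts"
  by (rule lsum_hom[OF abelian_group_axioms, where h="\<lambda>x. x \<otimes> c"]) (use assms in \<open>auto simp: l_distr\<close>)

text \<open>The classical induction, arranged for noncommutative coefficients: the coefficients
  range over the whole ring and stand on the left, only the values in \<open>Z\<close> commute with
  each other, and nonzero differences of values can be cancelled on the right. The domain
  \<open>S\<close> just carries a multiplication \<open>m\<close> and a point \<open>e\<close> where
  all characters are one, so that it can be a set of group elements as well as the multiplicative
  monoid of a field.\<close>

lemma dedekind_independence:
  assumes fin: "finite I"
    and val: "\<And>i g. \<lbrakk>i \<in> I; g \<in> S\<rbrakk> \<Longrightarrow> \<chi> i g \<in> Z" and Z: "Z \<subseteq> carrier R"
    and comm: "\<And>x y. \<lbrakk>x \<in> Z; y \<in> Z\<rbrakk> \<Longrightarrow> x \<otimes> y = y \<otimes> x"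
    and cancel: "\<And>x y c. \<lbrakk>x \<in> Z; y \<in> Z; x \<noteq> y; c \<in> carrier R; c \<otimes> (x \<ominus> y) = \<zero>\<rbrakk> \<Longrightarrow> c = \<zero>"
    and S: "\<And>g h. \<lbrakk>g \<in> S; h \<in> S\<rbrakk> \<Longrightarrow> m g h \<in> S"
    and mult: "\<And>i g h. \<lbrakk>i \<in> I; g \<in> S; h \<in> S\<rbrakk> \<Longrightarrow> \<chi> i (m g h) = \<chi> i g \<otimes> \<chi> i h"
    and one: "e \<in> S" "\<And>i. i \<in> I \<Longrightarrow> \<chi> i e = \<one>"
    and dist: "\<And>i i'. \<lbrakk>i \<in> I; i' \<in> I; i \<noteq> i'\<rbrakk> \<Longrightarrow> \<exists>g\<in>S. \<chi> i g \<noteq> \<chi> i' g"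
    and c: "\<And>i. i \<in> I \<Longrightarrow> c i \<in> carrier R"
    and rel: "\<And>g. g \<in> S \<Longrightarrow> (\<Oplus>i\<in>I. c i \<otimes> \<chi> i g) = \<zero>"
    and i: "i \<in> I"
  shows "c i = \<zero>"
  using fin val mult one(2) dist c rel i
proof (induction I arbitrary: c i rule: finite_induct)
  case (insert j I)
  have \<chi>: "\<chi> i g \<in> carrier R" if "i \<in> insert j I" "g \<in> S" for i g
    using insert.prems(1) Z that by blast
  note c = insert.prems(5)
  \<comment> \<open>Multiplying the relation at g by \<chi> j h and subtracting it from the relation
    at \<open>m g h\<close> removes the index j; the induction hypothesis applies to the
    coefficients that remain.\<close>
  have *: "c i \<otimes> (\<chi> i h \<ominus> \<chi> j h) = \<zero>" if i: "i \<in> I" and h: "h \<in> S" for i h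
  proof (rule insert.IH[of "\<lambda>i. c i \<otimes> (\<chi> i h \<ominus> \<chi> j h)" i])
    fix g assume g: "g \<in> S"
    have "\<zero> = (\<Oplus>i\<in>insert j I. c i \<otimes> \<chi> i (m g h)) \<ominus> (\<Oplus>i\<in>insert j I. c i \<otimes> \<chi> i g) \<otimes> \<chi> j h"
      using insert.prems(6)[OF g] insert.prems(6)[OF S[OF g h]] \<chi> h by (simp add: minus_eq)
    also have "\<dots> = (\<Oplus>i\<in>insert j I. c i \<otimes> \<chi> i g \<otimes> \<chi> i h) \<ominus> (\<Oplus>i\<in>insert j I. c i \<otimes> \<chi> i g \<otimes> \<chi> j h)"
    proof -
      have "(\<Oplus>i\<in>insert j I. c i \<otimes> \<chi> i (m g h)) = (\<Oplus>i\<in>insert j I. c i \<otimes> \<chi> i g \<otimes> \<chi> i h)"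
        by (rule finsum_cong') (use insert.prems(2) c \<chi> g h m_assoc in \<open>auto\<close>)
      moreover have "(\<Oplus>i\<in>insert j I. c i \<otimes> \<chi> i g) \<otimes> \<chi> j h = (\<Oplus>i\<in>insert j I. c i \<otimes> \<chi> i g \<otimes> \<chi> j h)"
        by (rule finsum_ldistr) (use insert.hyps c \<chi> g h in auto)
      ultimately show ?thesis by simp
    qed
    also have "\<dots> = (\<Oplus>i\<in>I. c i \<otimes> \<chi> i g \<otimes> \<chi> i h) \<ominus> (\<Oplus>i\<in>I. c i \<otimes> \<chi> i g \<otimes> \<chi> j h)"
    proof -
      have "a \<oplus> x \<ominus> (a \<oplus> y) = x \<ominus> y" if "a \<in> carrier R" "x \<in> carrier R" "y \<in> carrier R" for a x y
        using that by algebra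
      moreover have "(\<Oplus>i\<in>I. c i \<otimes> \<chi> i g \<otimes> \<chi> i h) \<in> carrier R" "(\<Oplus>i\<in>I. c i \<otimes> \<chi> i g \<otimes> \<chi> j h) \<in> carrier R"
        "c j \<otimes> \<chi> j g \<otimes> \<chi> j h \<in> carrier R"
        using c \<chi> g h by (auto intro!: finsum_closed)
      ultimately show ?thesis using insert.hyps c \<chi> g h by (subst (1 2) finsum_insert) auto
    qed
    also have "\<dots> = (\<Oplus>i\<in>I. c i \<otimes> \<chi> i g \<otimes> \<chi> i h \<oplus> \<ominus> (c i \<otimes> \<chi> i g \<otimes> \<chi> j h))"
    proof -
      have "\<ominus> (\<Oplus>i\<in>I. c i \<otimes> \<chi> i g \<otimes> \<chi> j h) = (\<Oplus>i\<in>I. \<ominus> (c i \<otimes> \<chi> i g \<otimes> \<chi> j h))"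
        by (rule finsum_hom[OF abelian_group_axioms, where h="\<lambda>x. \<ominus> x"]) (use c \<chi> g h minus_add in auto)
      then show ?thesis unfolding minus_eq using c \<chi> g h by (subst finsum_addf) auto
    qed
    also have "\<dots> = (\<Oplus>i\<in>I. c i \<otimes> (\<chi> i h \<ominus> \<chi> j h) \<otimes> \<chi> i g)"
    proof (rule finsum_cong')
      fix i assume i: "i \<in> I"
      have C: "c i \<in> carrier R" "\<chi> i g \<in> carrier R" "\<chi> i h \<in> carrier R" "\<chi> j h \<in> carrier R"
        using i c \<chi> g h by auto
      have "\<chi> i g \<otimes> \<chi> i h = \<chi> i h \<otimes> \<chi> i g" "\<chi> i g \<otimes> \<chi> j h = \<chi> j h \<otimes> \<chi> i g"
        using comm insert.prems(1) i g h by auto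
      then show "c i \<otimes> \<chi> i g \<otimes> \<chi> i h \<oplus> \<ominus> (c i \<otimes> \<chi> i g \<otimes> \<chi> j h) = c i \<otimes> (\<chi> i h \<ominus> \<chi> j h) \<otimes> \<chi> i g"
        using C by (simp add: m_assoc minus_eq r_distr l_distr r_minus l_minus)
    qed (use c \<chi> g h in auto)
    finally show "(\<Oplus>i\<in>I. c i \<otimes> (\<chi> i h \<ominus> \<chi> j h) \<otimes> \<chi> i g) = \<zero>" by simp
  qed (use insert.prems(1-4) c \<chi> i h in auto)
  have zero: "c i = \<zero>" if i: "i \<in> I" for i
  proof -
    obtain g where g: "g \<in> S" "\<chi> i g \<noteq> \<chi> j g" using insert.prems(4)[of i j] i insert.hyps by auto
    show ?thesis by (rule cancel[OF _ _ g(2)]) (use insert.prems(1) i g *[OF i g(1)] c in auto)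
  qed
  \<comment> \<open>At \<open>e\<close> all characters are one, so once the other coefficients
    vanish the relation reads c j = 0.\<close>
  have "(\<Oplus>i\<in>insert j I. c i \<otimes> \<chi> i e) = c j"
  proof -
    have "(\<Oplus>i\<in>I. c i \<otimes> \<chi> i e) = \<zero>"
      by (rule add.finprod_one_eqI) (use zero \<chi> one in auto)
    then show ?thesis using insert.hyps c \<chi> one insert.prems(3) by (subst finsum_insert) auto
  qed
  then have "c j = \<zero>" using insert.prems(6)[OF one(1)] by simp
  with zero insert.prems(7) show ?case by auto
qed simp

end

text \<open>Write z as the sum over i of \<alpha> i z times delta at i, replace delta by the dual
  tensor and exchange the sums: the inner sum over i becomes a trace. Thus the first legs of the
  dual tensor span the ring over the traces. The legs are multiplied in the order b, a because
  \<alpha> i z has to meet \<alpha> i b.\<close>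

lemma (in ring) trace_expansion:
  assumes I: "finite I" "i\<^sub>0 \<in> I"
    and closed: "\<And>i x. \<lbrakk>i \<in> I; x \<in> carrier R\<rbrakk> \<Longrightarrow> \<alpha> i x \<in> carrier R"
    and mult: "\<And>i x y. \<lbrakk>i \<in> I; x \<in> carrier R; y \<in> carrier R\<rbrakk> \<Longrightarrow> \<alpha> i (x \<otimes> y) = \<alpha> i x \<otimes> \<alpha> i y"
    and id: "\<alpha> i\<^sub>0 z = z"
    and ts: "set ts \<subseteq> carrier R \<times> carrier R"
    and dual: "\<And>i. i \<in> I \<Longrightarrow> lsum R (\<lambda>(a, b). \<alpha> i b \<otimes> a) ts = (if i\<^sub>0 = i then \<one> else \<zero>)"
    and z: "z \<in> carrier R"
  shows "z = lsum R (\<lambda>(a, b). (\<Oplus>i\<in>I. \<alpha> i (z \<otimes> b)) \<otimes> a) ts"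
proof -
  have "lsum R (\<lambda>(a, b). (\<Oplus>i\<in>I. \<alpha> i (z \<otimes> b)) \<otimes> a) ts
      = lsum R (\<lambda>t. \<Oplus>i\<in>I. \<alpha> i z \<otimes> (case t of (a, b) \<Rightarrow> \<alpha> i b \<otimes> a)) ts"
  proof (rule lprod_cong, clarify)
    fix a b assume "(a, b) \<in> set ts"
    then have [simp]: "a \<in> carrier R" "b \<in> carrier R" using ts by auto
    have "(\<Oplus>i\<in>I. \<alpha> i (z \<otimes> b)) \<otimes> a = (\<Oplus>i\<in>I. \<alpha> i (z \<otimes> b) \<otimes> a)"
      by (rule finsum_ldistr) (use I closed z in auto)
    also have "\<dots> = (\<Oplus>i\<in>I. \<alpha> i z \<otimes> (\<alpha> i b \<otimes> a))"
      by (rule finsum_cong') (use closed z mult m_assoc in auto)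
    finally show "(\<Oplus>i\<in>I. \<alpha> i (z \<otimes> b)) \<otimes> a = (\<Oplus>i\<in>I. \<alpha> i z \<otimes> (\<alpha> i b \<otimes> a))" .
  qed
  also have "\<dots> = (\<Oplus>i\<in>I. lsum R (\<lambda>t. \<alpha> i z \<otimes> (case t of (a, b) \<Rightarrow> \<alpha> i b \<otimes> a)) ts)"
    by (rule finsum_lsum[symmetric]) (use I closed z ts in auto)
  also have "\<dots> = (\<Oplus>i\<in>I. if i\<^sub>0 = i then \<alpha> i z else \<zero>)"
  proof (rule finsum_cong')
    fix i assume i: "i \<in> I"
    have "lsum R (\<lambda>t. \<alpha> i z \<otimes> (case t of (a, b) \<Rightarrow> \<alpha> i b \<otimes> a)) ts
        = \<alpha> i z \<otimes> lsum R (\<lambda>(a, b). \<alpha> i b \<otimes> a) ts"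
      by (rule lsum_mult_left[symmetric]) (use closed z ts i in auto)
    then show "lsum R (\<lambda>t. \<alpha> i z \<otimes> (case t of (a, b) \<Rightarrow> \<alpha> i b \<otimes> a)) ts = (if i\<^sub>0 = i then \<alpha> i z else \<zero>)"
      using dual[OF i] closed[OF i z] by simp
  qed (use closed z in auto)
  also have "\<dots> = z" using add.finprod_singleton[of i\<^sub>0 I "\<lambda>i. \<alpha> i z"] I closed z id by (simp add: finsum_def Pi_def)
  finally show ?thesis by simp
qed

text \<open>Functions on a set of ring endomorphisms coming from a tensor, acting from either side.\<close>

definition bi_sum :: "('c, 'k) ring_scheme \<Rightarrow> ('g \<Rightarrow> 'c \<Rightarrow> 'c) \<Rightarrow> 'g set \<Rightarrow> ('g \<Rightarrow> 'c) \<Rightarrow> bool"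
  where "bi_sum A \<sigma> S \<phi> \<longleftrightarrow>
    (\<exists>ts. set ts \<subseteq> carrier A \<times> carrier A \<and> (\<forall>g\<in>S. \<phi> g = lsum A (\<lambda>(a, b). a \<otimes>\<^bsub>A\<^esub> \<sigma> g b) ts)) \<and>
    (\<exists>ts. set ts \<subseteq> carrier A \<times> carrier A \<and> (\<forall>g\<in>S. \<phi> g = lsum A (\<lambda>(a, b). \<sigma> g b \<otimes>\<^bsub>A\<^esub> a) ts))"

context ring
begin

text \<open>Nesting the tensors realises the product: the tensor of \<phi> is inserted between the
  two legs of each term of the tensor of \<psi>, which is allowed because \<phi> g is central. The
  two orders of the legs need separate lists since the ring is not commutative.\<close>

lemma bi_sum_mult:
  assumes closed: "\<And>g x. \<lbrakk>g \<in> S; x \<in> carrier R\<rbrakk> \<Longrightarrow> \<alpha> g x \<in> carrier R"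
    and mult: "\<And>g x y. \<lbrakk>g \<in> S; x \<in> carrier R; y \<in> carrier R\<rbrakk> \<Longrightarrow> \<alpha> g (x \<otimes> y) = \<alpha> g x \<otimes> \<alpha> g y"
    and \<phi>: "bi_sum R \<alpha> S \<phi>" and \<psi>: "bi_sum R \<alpha> S \<psi>"
    and central: "\<And>g x. \<lbrakk>g \<in> S; x \<in> carrier R\<rbrakk> \<Longrightarrow> \<phi> g \<otimes> x = x \<otimes> \<phi> g"
  shows "bi_sum R \<alpha> S (\<lambda>g. \<phi> g \<otimes> \<psi> g)"
proof -
  obtain ts ts' where ts: "set ts \<subseteq> carrier R \<times> carrier R" "\<And>g. g \<in> S \<Longrightarrow> \<phi> g = lsum R (\<lambda>(a, b). a \<otimes> \<alpha> g b) ts"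
    and ts': "set ts' \<subseteq> carrier R \<times> carrier R" "\<And>g. g \<in> S \<Longrightarrow> \<phi> g = lsum R (\<lambda>(a, b). \<alpha> g b \<otimes> a) ts'"
    using \<phi> unfolding bi_sum_def by metis
  obtain us us' where us: "set us \<subseteq> carrier R \<times> carrier R" "\<And>g. g \<in> S \<Longrightarrow> \<psi> g = lsum R (\<lambda>(a, b). a \<otimes> \<alpha> g b) us"
    and us': "set us' \<subseteq> carrier R \<times> carrier R" "\<And>g. g \<in> S \<Longrightarrow> \<psi> g = lsum R (\<lambda>(a, b). \<alpha> g b \<otimes> a) us'"
    using \<psi> unfolding bi_sum_def by metis
  have D: "(a, b) \<in> set ts \<Longrightarrow> a \<in> carrier R \<and> b \<in> carrier R"
    "(a, b) \<in> set ts' \<Longrightarrow> a \<in> carrier R \<and> b \<in> carrier R"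
    "(a, b) \<in> set us \<Longrightarrow> a \<in> carrier R \<and> b \<in> carrier R"
    "(a, b) \<in> set us' \<Longrightarrow> a \<in> carrier R \<and> b \<in> carrier R" for a b
    using ts(1) ts'(1) us(1) us'(1) by auto
  have \<phi>c: "\<phi> g \<in> carrier R" if "g \<in> S" for g
    unfolding ts(2)[OF that] using that closed by (intro lsum_closed) (auto dest!: D)
  define vs where "vs = concat (map (\<lambda>(c, d). map (\<lambda>(a, b). (c \<otimes> a, b \<otimes> d)) ts) us)"
  define vs' where "vs' = concat (map (\<lambda>(c, d). map (\<lambda>(a, b). (a \<otimes> c, d \<otimes> b)) ts') us')"
  have *: "\<phi> g \<otimes> \<psi> g = lsum R (\<lambda>(a, b). a \<otimes> \<alpha> g b) vs" if g: "g \<in> S" for g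
  proof -
    have "\<phi> g \<otimes> \<psi> g = lsum R (\<lambda>u. \<phi> g \<otimes> (case u of (a, b) \<Rightarrow> a \<otimes> \<alpha> g b)) us"
      unfolding us(2)[OF g] by (rule lsum_mult_left) (use \<phi>c g closed in \<open>auto dest!: D\<close>)
    also have "\<dots> = lsum R (\<lambda>u. lsum R (\<lambda>(a, b). a \<otimes> \<alpha> g b) (case u of (c, d) \<Rightarrow> map (\<lambda>(a, b). (c \<otimes> a, b \<otimes> d)) ts)) us"
    proof (rule lprod_cong, clarify)
      fix c d assume "(c, d) \<in> set us"
      then have *: "c \<in> carrier R" "d \<in> carrier R" by (auto dest!: D)
      note [simp] = *
      have "\<phi> g \<otimes> (c \<otimes> \<alpha> g d) = c \<otimes> \<phi> g \<otimes> \<alpha> g d" using \<phi>c closed g central by (simp add: m_assoc[symmetric])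
      also have "\<dots> = lsum R (\<lambda>t. c \<otimes> (case t of (a, b) \<Rightarrow> a \<otimes> \<alpha> g b) \<otimes> \<alpha> g d) ts"
        unfolding ts(2)[OF g] using closed g
        by (subst lsum_mult_left; (subst lsum_mult_right)?) (auto dest!: D)
      also have "\<dots> = lsum R (\<lambda>(a, b). a \<otimes> \<alpha> g b) (map (\<lambda>(a, b). (c \<otimes> a, b \<otimes> d)) ts)"
        unfolding lprod_map
        by (rule lprod_cong) (use closed g mult in \<open>auto simp: m_assoc dest!: D\<close>)
      finally show "\<phi> g \<otimes> (c \<otimes> \<alpha> g d) = lsum R (\<lambda>(a, b). a \<otimes> \<alpha> g b) (map (\<lambda>(a, b). (c \<otimes> a, b \<otimes> d)) ts)" .
    qed
    also have "\<dots> = lsum R (\<lambda>(a, b). a \<otimes> \<alpha> g b) vs"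
      unfolding vs_def by (rule lsum_concat[symmetric]) (use closed g in \<open>auto dest!: D\<close>)
    finally show ?thesis .
  qed
  have **: "\<phi> g \<otimes> \<psi> g = lsum R (\<lambda>(a, b). \<alpha> g b \<otimes> a) vs'" if g: "g \<in> S" for g
  proof -
    have "\<phi> g \<otimes> \<psi> g = lsum R (\<lambda>u. \<phi> g \<otimes> (case u of (a, b) \<Rightarrow> \<alpha> g b \<otimes> a)) us'"
      unfolding us'(2)[OF g] by (rule lsum_mult_left) (use \<phi>c g closed in \<open>auto dest!: D\<close>)
    also have "\<dots> = lsum R (\<lambda>u. lsum R (\<lambda>(a, b). \<alpha> g b \<otimes> a) (case u of (c, d) \<Rightarrow> map (\<lambda>(a, b). (a \<otimes> c, d \<otimes> b)) ts')) us'"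
    proof (rule lprod_cong, clarify)
      fix c d assume "(c, d) \<in> set us'"
      then have *: "c \<in> carrier R" "d \<in> carrier R" by (auto dest!: D)
      note [simp] = *
      have "\<phi> g \<otimes> (\<alpha> g d \<otimes> c) = \<alpha> g d \<otimes> \<phi> g \<otimes> c" using \<phi>c closed g central by (simp add: m_assoc[symmetric])
      also have "\<dots> = lsum R (\<lambda>t. \<alpha> g d \<otimes> (case t of (a, b) \<Rightarrow> \<alpha> g b \<otimes> a) \<otimes> c) ts'"
        unfolding ts'(2)[OF g] using closed g
        by (subst lsum_mult_left; (subst lsum_mult_right)?) (auto dest!: D)
      also have "\<dots> = lsum R (\<lambda>(a, b). \<alpha> g b \<otimes> a) (map (\<lambda>(a, b). (a \<otimes> c, d \<otimes> b)) ts')"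
        unfolding lprod_map
        by (rule lprod_cong) (use closed g mult in \<open>auto simp: m_assoc dest!: D\<close>)
      finally show "\<phi> g \<otimes> (\<alpha> g d \<otimes> c) = lsum R (\<lambda>(a, b). \<alpha> g b \<otimes> a) (map (\<lambda>(a, b). (a \<otimes> c, d \<otimes> b)) ts')" .
    qed
    also have "\<dots> = lsum R (\<lambda>(a, b). \<alpha> g b \<otimes> a) vs'"
      unfolding vs'_def by (rule lsum_concat[symmetric]) (use closed g in \<open>auto dest!: D\<close>)
    finally show ?thesis .
  qed
  have "set vs \<subseteq> carrier R \<times> carrier R" "set vs' \<subseteq> carrier R \<times> carrier R"
    unfolding vs_def vs'_def by (auto dest!: D)
  with * ** show ?thesis unfolding bi_sum_def by blast
qed

text \<open>Interpolation by a product over the points of \<open>T\<close>, each factor being one on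
  \<open>N\<close> and zero at its point. For each h the hypothesis supplies a function g \<mapsto>
  a \<otimes> \<alpha> g b with central values, equal to one on \<open>N\<close>, such that one
  minus its value at h has the central inverse d. Central values are what keeps the product
  representable from both sides.\<close>

lemma bi_sum_delta:
  assumes closed: "\<And>g x. \<lbrakk>g \<in> S; x \<in> carrier R\<rbrakk> \<Longrightarrow> \<alpha> g x \<in> carrier R"
    and mult: "\<And>g x y. \<lbrakk>g \<in> S; x \<in> carrier R; y \<in> carrier R\<rbrakk> \<Longrightarrow> \<alpha> g (x \<otimes> y) = \<alpha> g x \<otimes> \<alpha> g y"
    and one: "\<And>g. g \<in> S \<Longrightarrow> \<alpha> g \<one> = \<one>"
    and N: "N \<subseteq> S" and T: "finite T" "T \<subseteq> S"
    and sep: "\<And>h. h \<in> T \<Longrightarrow> \<exists>a\<in>carrier R. \<exists>b\<in>carrier R. \<exists>d\<in>carrier R.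
      (\<forall>g\<in>S. a \<otimes> \<alpha> g b = \<alpha> g b \<otimes> a \<and> (\<forall>x\<in>carrier R. a \<otimes> \<alpha> g b \<otimes> x = x \<otimes> (a \<otimes> \<alpha> g b))) \<and>
      (\<forall>g\<in>N. a \<otimes> \<alpha> g b = \<one>) \<and> d \<otimes> (\<one> \<ominus> a \<otimes> \<alpha> h b) = \<one> \<and> (\<forall>x\<in>carrier R. d \<otimes> x = x \<otimes> d)"
  shows "\<exists>\<phi>. bi_sum R \<alpha> S \<phi> \<and> (\<forall>g\<in>S. \<phi> g \<in> carrier R \<and> (\<forall>x\<in>carrier R. \<phi> g \<otimes> x = x \<otimes> \<phi> g)) \<and>
    (\<forall>g\<in>N. \<phi> g = \<one>) \<and> (\<forall>g\<in>T. \<phi> g = \<zero>)"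
  using T sep
proof (induction T rule: finite_induct)
  case empty
  have "bi_sum R \<alpha> S (\<lambda>_. \<one>)"
    unfolding bi_sum_def by (intro conjI exI[of _ "[(\<one>, \<one>)]"]) (use one in auto)
  then show ?case by (intro exI[of _ "\<lambda>_. \<one>"]) simp
next
  case (insert h T)
  obtain \<phi> where \<phi>: "bi_sum R \<alpha> S \<phi>" "\<And>g. g \<in> S \<Longrightarrow> \<phi> g \<in> carrier R"
    "\<And>g x. \<lbrakk>g \<in> S; x \<in> carrier R\<rbrakk> \<Longrightarrow> \<phi> g \<otimes> x = x \<otimes> \<phi> g" "\<And>g. g \<in> N \<Longrightarrow> \<phi> g = \<one>" "\<And>g. g \<in> T \<Longrightarrow> \<phi> g = \<zero>"
    using insert.IH[OF _ insert.prems(2)] insert.prems(1) by auto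
  have h: "h \<in> S" using insert by simp
  from insert.prems(2)[OF insertI1] obtain a b d
    where abd [simp]: "a \<in> carrier R" "b \<in> carrier R" "d \<in> carrier R"
    and P: "(\<forall>g\<in>S. a \<otimes> \<alpha> g b = \<alpha> g b \<otimes> a \<and> (\<forall>x\<in>carrier R. a \<otimes> \<alpha> g b \<otimes> x = x \<otimes> (a \<otimes> \<alpha> g b)))"
      "(\<forall>g\<in>N. a \<otimes> \<alpha> g b = \<one>)" "d \<otimes> (\<one> \<ominus> a \<otimes> \<alpha> h b) = \<one>" "\<forall>x\<in>carrier R. d \<otimes> x = x \<otimes> d"
    by (elim bexE conjE)
  have 1: "a \<otimes> \<alpha> g b = \<alpha> g b \<otimes> a" if "g \<in> S" for g
    using conjunct1[OF bspec[OF P(1) that]] .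
  have 2: "a \<otimes> \<alpha> g b \<otimes> x = x \<otimes> (a \<otimes> \<alpha> g b)" if "g \<in> S" "x \<in> carrier R" for g x
    using bspec[OF conjunct2[OF bspec[OF P(1) that(1)]] that(2)] .
  have 3: "a \<otimes> \<alpha> g b = \<one>" if "g \<in> N" for g using P(2) that by simp
  note 4 = P(3)
  have 5: "d \<otimes> x = x \<otimes> d" if "x \<in> carrier R" for x using P(4) that by simp
  define p where "p = a \<otimes> \<alpha> h b"
  \<comment> \<open>The affine rescaling of the separating function: it vanishes at h, and it is one
    wherever the function is one, since d inverts 1 - p. In the lists below the constant term is
    carried by a pair with second leg \<one>, which every \<alpha> g fixes.\<close>
  define \<psi> where "\<psi> g = d \<otimes> (a \<otimes> \<alpha> g b \<ominus> p)" for g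
  have p [simp]: "p \<in> carrier R" and px: "x \<in> carrier R \<Longrightarrow> p \<otimes> x = x \<otimes> p" for x
    using closed h 2 by (auto simp: p_def)
  have \<alpha>b [simp]: "g \<in> S \<Longrightarrow> \<alpha> g b \<in> carrier R" for g using closed by simp
  have \<psi>: "bi_sum R \<alpha> S \<psi>"
    unfolding bi_sum_def
  proof (intro conjI exI ballI)
    fix g assume g [simp]: "g \<in> S"
    show "\<psi> g = lsum R (\<lambda>(a, b). a \<otimes> \<alpha> g b) [(d \<otimes> a, b), (\<ominus> (d \<otimes> p), \<one>)]"
      by (simp add: \<psi>_def one minus_eq r_distr m_assoc r_minus)
    have "d \<otimes> (a \<otimes> \<alpha> g b) = \<alpha> g b \<otimes> (a \<otimes> d)" using 1[OF g] 5[of "a \<otimes> \<alpha> g b"] by (simp add: m_assoc)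
    then show "\<psi> g = lsum R (\<lambda>(a, b). \<alpha> g b \<otimes> a) [(a \<otimes> d, b), (\<ominus> (d \<otimes> p), \<one>)]"
      by (simp add: \<psi>_def one minus_eq r_distr r_minus)
  qed auto
  have \<psi>c: "\<psi> g \<in> carrier R" if "g \<in> S" for g using that by (simp add: \<psi>_def)
  have \<psi>x: "\<psi> g \<otimes> x = x \<otimes> \<psi> g" if [simp]: "g \<in> S" "x \<in> carrier R" for g x
  proof -
    have "(a \<otimes> \<alpha> g b \<ominus> p) \<otimes> x = x \<otimes> (a \<otimes> \<alpha> g b \<ominus> p)"
      using px 2 by (simp add: minus_eq l_distr r_distr l_minus r_minus)
    moreover have "a \<otimes> \<alpha> g b \<ominus> p \<in> carrier R" by simp
    ultimately show ?thesis unfolding \<psi>_def using 5 that(2) abd(3) by (metis m_assoc)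
  qed
  have "bi_sum R \<alpha> S (\<lambda>g. \<phi> g \<otimes> \<psi> g)" by (rule bi_sum_mult[OF closed mult \<phi>(1) \<psi> \<phi>(3)])
  moreover have "\<phi> g \<otimes> \<psi> g \<otimes> x = x \<otimes> (\<phi> g \<otimes> \<psi> g)" if [simp]: "g \<in> S" "x \<in> carrier R" for g x
    using \<phi>(2,3) \<psi>c \<psi>x by (metis m_assoc that)
  moreover have "\<phi> g \<otimes> \<psi> g = \<one>" if "g \<in> N" for g
    using \<phi>(4)[OF that] that N 3[OF that] 4 by (auto simp: \<psi>_def p_def)
  moreover have "\<phi> g \<otimes> \<psi> g = \<zero>" if "g \<in> insert h T" for g
  proof (cases "g = h")
    case True
    have "\<psi> h = \<zero>" using h by (simp add: \<psi>_def p_def minus_eq r_neg)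
    then show ?thesis using True \<phi>(2) h by simp
  next
    case False
    then show ?thesis using that insert.prems \<phi>(5) \<psi>c by auto
  qed
  ultimately show ?case using \<phi>(2) \<psi>c by (intro exI[of _ "\<lambda>g. \<phi> g \<otimes> \<psi> g"]) auto
qed

end

section \<open>Galois theory of a subfield\<close>

text \<open>Sum and product ignore the carrier, but the additive inverse is picked from it, so
  agreement in a subring has to be proved.\<close>

lemma (in ring) a_inv_carrier_update:
  assumes "subring H R" "x \<in> H"
  shows "\<ominus>\<^bsub>R\<lparr>carrier := H\<rparr>\<^esub> x = \<ominus> x"
  using group.m_inv_consistent[OF add.group_axioms subring.axioms(1)[OF assms(1)] assms(2)]
  by (simp add: a_inv_def)

lemma (in ring) a_minus_carrier_update:
  assumes "subring H R" "x \<in> H" "y \<in> H"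
  shows "x \<ominus>\<^bsub>R\<lparr>carrier := H\<rparr>\<^esub> y = x \<ominus> y"
  using a_inv_carrier_update[OF assms(1,3)] by (simp add: a_minus_def)

lemma (in ring) finsum_carrier_update:
  assumes "subring H R" "\<And>i. i \<in> I \<Longrightarrow> f i \<in> H"
  shows "finsum (R\<lparr>carrier := H\<rparr>) f I = finsum R f I"
proof -
  interpret H: ring "R\<lparr>carrier := H\<rparr>" by (rule subring_is_ring[OF assms(1)])
  show ?thesis
    by (rule H.finsum_hom[OF abelian_group_axioms, of "\<lambda>x. x", simplified])
      (use assms subringE(1)[OF assms(1)] in auto)
qed

lemma bi_sumD:
  "bi_sum A \<alpha> S \<phi> \<Longrightarrow> \<exists>ts. set ts \<subseteq> carrier A \<times> carrier A \<and> (\<forall>g\<in>S. \<phi> g = lsum A (\<lambda>(a, b). \<alpha> g b \<otimes>\<^bsub>A\<^esub> a) ts)"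
  by (simp add: bi_sum_def)

text \<open>Only the fixed field of the image of \<theta> is assumed to be \<open>F\<close>.
  Surjectivity of \<theta> onto the Galois group and finiteness of \<open>L\<close> over
  \<open>F\<close> are consequences, so the same locale serves a field read off from a centre and a
  field taken from a triple.\<close>

locale galois_data = field \<Omega> + G: comm_group G
  for \<Omega> (structure) and F and G (structure) and L and \<theta> +
  assumes finite_G: "finite (carrier G)"
    and subfield_F: "subfield F \<Omega>" and subfield_L: "subfield L \<Omega>" and F_L: "F \<subseteq> L"
    and \<theta>_hom: "\<theta> \<in> hom G (Gal_group \<Omega> F L)" and \<theta>_ext: "\<theta> \<in> extensional (carrier G)"
    and fixed: "\<And>x. \<lbrakk>x \<in> L; \<forall>g\<in>carrier G. \<theta> g x = x\<rbrakk> \<Longrightarrow> x \<in> F"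
begin

abbreviation times_\<Omega> (infixl "\<ast>" 70) where "x \<ast> y \<equiv> x \<otimes> y"
abbreviation times_G (infixl "\<bullet>" 70) where "g \<bullet> h \<equiv> g \<otimes>\<^bsub>G\<^esub> h"
abbreviation zero_L ("\<zero>\<^sub>L") where "\<zero>\<^sub>L \<equiv> \<zero>"
abbreviation one_G ("\<one>\<^sub>G") where "\<one>\<^sub>G \<equiv> \<one>\<^bsub>G\<^esub>"
abbreviation inv_G ("inv\<^sub>G _" [81] 80) where "inv\<^sub>G g \<equiv> inv\<^bsub>G\<^esub> g"
abbreviation inv_L ("inv\<^sub>L _" [81] 80) where "inv\<^sub>L x \<equiv> inv x"
abbreviation one_L ("\<one>\<^sub>L") where "\<one>\<^sub>L \<equiv> \<one>"

lemma subring_L: "subring L \<Omega>"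
  using subfieldE(1)[OF subfield_L] .

lemmas L_ring = subringE(2,3,5,6,7)[OF subring_L]
lemma L_carrier: "x \<in> L \<Longrightarrow> x \<in> carrier \<Omega>"
  using subringE(1)[OF subring_L] by auto
lemmas F_ring = subringE(2,3,5,6,7)[OF subfieldE(1)[OF subfield_F]]
lemma F_in_L: "x \<in> F \<Longrightarrow> x \<in> L" using F_L by auto

lemma L_inv: "\<lbrakk>x \<in> L; x \<noteq> \<zero>\<rbrakk> \<Longrightarrow> inv x \<in> L" "\<lbrakk>x \<in> L; x \<noteq> \<zero>\<rbrakk> \<Longrightarrow> inv x \<noteq> \<zero>"
  "\<lbrakk>x \<in> L; x \<noteq> \<zero>\<rbrakk> \<Longrightarrow> x \<ast> inv x = \<one>" "\<lbrakk>x \<in> L; x \<noteq> \<zero>\<rbrakk> \<Longrightarrow> inv x \<ast> x = \<one>"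
  using subfield_m_inv[OF subfield_L, of x] by auto

lemma F_inv: "\<lbrakk>x \<in> F; x \<noteq> \<zero>\<rbrakk> \<Longrightarrow> inv x \<in> F"
  using subfield_m_inv[OF subfield_F, of x] by auto

sublocale L: field "\<Omega>\<lparr>carrier := L\<rparr>"
  using subfield_iff(2)[OF subfield_L] .

lemma \<theta>_mem: "g \<in> carrier G \<Longrightarrow> \<theta> g \<in> carrier (Gal_group \<Omega> F L)"
  using \<theta>_hom by (auto simp: hom_def)

lemma \<theta>_Bij: "g \<in> carrier G \<Longrightarrow> \<theta> g \<in> Bij L"
  using \<theta>_mem by (auto simp: Gal_group_def)

lemma \<theta>_closed: "\<lbrakk>g \<in> carrier G; x \<in> L\<rbrakk> \<Longrightarrow> \<theta> g x \<in> L"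
  using \<theta>_Bij Bij_imp_funcset by blast

lemma \<theta>_ring_hom: "g \<in> carrier G \<Longrightarrow> \<theta> g \<in> ring_hom (\<Omega>\<lparr>carrier := L\<rparr>) (\<Omega>\<lparr>carrier := L\<rparr>)"
  using \<theta>_mem by (auto simp: Gal_group_def)

lemma \<theta>_mult: "\<lbrakk>g \<in> carrier G; x \<in> L; y \<in> L\<rbrakk> \<Longrightarrow> \<theta> g (x \<ast> y) = \<theta> g x \<ast> \<theta> g y"
  using ring_hom_mult[OF \<theta>_ring_hom, of g x y] by simp

lemma \<theta>_add: "\<lbrakk>g \<in> carrier G; x \<in> L; y \<in> L\<rbrakk> \<Longrightarrow> \<theta> g (x \<oplus> y) = \<theta> g x \<oplus> \<theta> g y"
  using ring_hom_add[OF \<theta>_ring_hom, of g x y] by simp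

lemma \<theta>_one: "g \<in> carrier G \<Longrightarrow> \<theta> g \<one> = \<one>"
  using ring_hom_one[OF \<theta>_ring_hom, of g] by simp

lemma \<theta>_zero: "g \<in> carrier G \<Longrightarrow> \<theta> g \<zero> = \<zero>"
  using ring_hom_zero[OF \<theta>_ring_hom L.ring_axioms L.ring_axioms, of g] by simp

lemma \<theta>_F: "\<lbrakk>g \<in> carrier G; x \<in> F\<rbrakk> \<Longrightarrow> \<theta> g x = x"
  using \<theta>_mem by (auto simp: Gal_group_def)

lemma \<theta>_nonzero: "\<lbrakk>g \<in> carrier G; x \<in> L; x \<noteq> \<zero>\<rbrakk> \<Longrightarrow> \<theta> g x \<noteq> \<zero>"
  using \<theta>_mult[of g x "inv x"] L_inv[of x] \<theta>_closed[of g "inv x"] \<theta>_one[of g] L_carrier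
  by (metis l_null one_not_zero)

lemma \<theta>_inv: "\<lbrakk>g \<in> carrier G; x \<in> L; x \<noteq> \<zero>\<rbrakk> \<Longrightarrow> \<theta> g (inv x) = inv (\<theta> g x)"
proof (rule comm_inv_char[symmetric])
  assume *: "g \<in> carrier G" "x \<in> L" "x \<noteq> \<zero>"
  show "\<theta> g x \<in> carrier \<Omega>" "\<theta> g (inv x) \<in> carrier \<Omega>" using * \<theta>_closed L_carrier L_inv by auto
  show "\<theta> g x \<ast> \<theta> g (inv x) = \<one>" using * \<theta>_mult[of g x "inv x"] L_inv \<theta>_one by simp
qed

lemma \<theta>_mult_compose: "\<lbrakk>g \<in> carrier G; h \<in> carrier G\<rbrakk> \<Longrightarrow> \<theta> (g \<bullet> h) = compose L (\<theta> g) (\<theta> h)"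
  using hom_mult[OF \<theta>_hom] \<theta>_Bij by (simp add: Gal_group_def BijGroup_def)

lemma \<theta>_comp: "\<lbrakk>g \<in> carrier G; h \<in> carrier G; x \<in> L\<rbrakk> \<Longrightarrow> \<theta> (g \<bullet> h) x = \<theta> g (\<theta> h x)"
  by (simp add: \<theta>_mult_compose compose_def)

lemma \<theta>_extensional: "g \<in> carrier G \<Longrightarrow> \<theta> g \<in> extensional L"
  using \<theta>_Bij Bij_imp_extensional by blast

lemma \<theta>_inj: "\<lbrakk>g \<in> carrier G; x \<in> L; y \<in> L; \<theta> g x = \<theta> g y\<rbrakk> \<Longrightarrow> x = y"
  using \<theta>_Bij by (auto simp: Bij_def bij_betw_def dest: inj_onD)

lemma \<theta>_id: "x \<in> L \<Longrightarrow> \<theta> \<one>\<^sub>G x = x"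
  using \<theta>_comp[of "\<one>\<^sub>G" "\<one>\<^sub>G" x] \<theta>_inj[of "\<one>\<^sub>G"] \<theta>_closed[of "\<one>\<^sub>G" x] by simp

lemma \<theta>_eqI: "\<lbrakk>g \<in> carrier G; h \<in> carrier G; \<And>x. x \<in> L \<Longrightarrow> \<theta> g x = \<theta> h x\<rbrakk> \<Longrightarrow> \<theta> g = \<theta> h"
  using \<theta>_extensional extensionalityI by blast

lemma \<theta>_inverse: "\<lbrakk>g \<in> carrier G; x \<in> L\<rbrakk> \<Longrightarrow> \<theta> g (\<theta> (inv\<^sub>G g) x) = x"
  "\<lbrakk>g \<in> carrier G; x \<in> L\<rbrakk> \<Longrightarrow> \<theta> (inv\<^sub>G g) (\<theta> g x) = x"
  using \<theta>_comp[of g "inv\<^sub>G g" x] \<theta>_comp[of "inv\<^sub>G g" g x] \<theta>_id by simp_all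

text \<open>Sums run over the distinct automorphisms and not over \<open>G\<close>, because each of
  them occurs once for every element of the kernel of \<theta>.\<close>

definition auts where "auts = \<theta> ` carrier G"

lemma finite_auts: "finite auts"
  using finite_G by (simp add: auts_def)

lemma \<theta>_auts: "g \<in> carrier G \<Longrightarrow> \<theta> g \<in> auts"
  by (simp add: auts_def)

lemma auts_translate: "g \<in> carrier G \<Longrightarrow> bij_betw (compose L (\<theta> g)) auts auts"
proof (rule bij_betwI[where g="compose L (\<theta> (inv\<^sub>G g))"])
  assume g: "g \<in> carrier G"
  show "compose L (\<theta> g) \<in> auts \<rightarrow> auts"
    using g by (auto simp: auts_def \<theta>_mult_compose[symmetric])
  show "compose L (\<theta> (inv\<^sub>G g)) \<in> auts \<rightarrow> auts"
    using g by (auto simp: auts_def \<theta>_mult_compose[symmetric])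
  fix h assume "h \<in> auts"
  then obtain k where k: "k \<in> carrier G" "h = \<theta> k" by (auto simp: auts_def)
  show "compose L (\<theta> (inv\<^sub>G g)) (compose L (\<theta> g) h) = h"
    using g k by (simp add: \<theta>_mult_compose[symmetric] G.m_assoc[symmetric])
  show "compose L (\<theta> g) (compose L (\<theta> (inv\<^sub>G g)) h) = h"
    using g k by (simp add: \<theta>_mult_compose[symmetric] G.m_assoc[symmetric])
qed

text \<open>Delta at the identity automorphism as a tensor over \<open>L\<close>. An automorphism
  moving y is separated from the identity by the function h \<mapsto> inv y \<ast> h y, and
  interpolation over the finite set of automorphisms does the rest.\<close>

lemma dual_basis:
  obtains ts where "set ts \<subseteq> L \<times> L"
    "\<And>g. g \<in> carrier G \<Longrightarrow> lsum \<Omega> (\<lambda>(a, b). \<theta> g b \<ast> a) ts = (if \<theta> \<one>\<^sub>G = \<theta> g then \<one> else \<zero>)"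
proof -
  let ?E = "\<Omega>\<lparr>carrier := L\<rparr>"
  have "\<exists>\<phi>. bi_sum ?E (\<lambda>h. h) auts \<phi> \<and> (\<forall>g\<in>auts. \<phi> g \<in> carrier ?E \<and> (\<forall>x\<in>carrier ?E. \<phi> g \<otimes>\<^bsub>?E\<^esub> x = x \<otimes>\<^bsub>?E\<^esub> \<phi> g)) \<and>
    (\<forall>g\<in>{\<theta> \<one>\<^sub>G}. \<phi> g = \<one>\<^bsub>?E\<^esub>) \<and> (\<forall>g\<in>auts - {\<theta> \<one>\<^sub>G}. \<phi> g = \<zero>\<^bsub>?E\<^esub>)"
  proof (rule L.bi_sum_delta)
    fix h assume "h \<in> auts - {\<theta> \<one>\<^sub>G}"
    then obtain g where g: "g \<in> carrier G" "h = \<theta> g" "\<theta> g \<noteq> \<theta> \<one>\<^sub>G" by (auto simp: auts_def)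
    then obtain y where y: "y \<in> L" "\<theta> g y \<noteq> y" using \<theta>_eqI[of g "\<one>\<^sub>G"] \<theta>_id by auto
    then have y0: "y \<noteq> \<zero>" using \<theta>_zero g by auto
    \<comment> \<open>The value at g of the separating function; it would be one only if \<theta> g
      fixed y.\<close>
    define p where "p = inv y \<ast> \<theta> g y"
    have p: "p \<in> L" "\<one> \<ominus> p \<in> L" using y y0 g \<theta>_closed L_inv L_ring by (auto simp: p_def minus_eq)
    have "\<one> \<ominus> p \<noteq> \<zero>"
    proof
      assume "\<one> \<ominus> p = \<zero>"
      then have "p = \<one>" using p(1) L_carrier by (metis one_closed r_right_minus_eq)
      then have "y \<ast> p = y" using y L_carrier by simp
      then show False using y y0 g \<theta>_closed L_inv L_carrier by (simp add: p_def m_assoc[symmetric])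
    qed
    then have d: "inv (\<one> \<ominus> p) \<in> L" "inv (\<one> \<ominus> p) \<ast> (\<one> \<ominus> p) = \<one>" using L_inv p by auto
    show "\<exists>a\<in>carrier ?E. \<exists>b\<in>carrier ?E. \<exists>d\<in>carrier ?E.
      (\<forall>g\<in>auts. a \<otimes>\<^bsub>?E\<^esub> g b = g b \<otimes>\<^bsub>?E\<^esub> a \<and> (\<forall>x\<in>carrier ?E. a \<otimes>\<^bsub>?E\<^esub> g b \<otimes>\<^bsub>?E\<^esub> x = x \<otimes>\<^bsub>?E\<^esub> (a \<otimes>\<^bsub>?E\<^esub> g b))) \<and>
      (\<forall>g\<in>{\<theta> \<one>\<^sub>G}. a \<otimes>\<^bsub>?E\<^esub> g b = \<one>\<^bsub>?E\<^esub>) \<and> d \<otimes>\<^bsub>?E\<^esub> (\<one>\<^bsub>?E\<^esub> \<ominus>\<^bsub>?E\<^esub> a \<otimes>\<^bsub>?E\<^esub> h b) = \<one>\<^bsub>?E\<^esub> \<and> (\<forall>x\<in>carrier ?E. d \<otimes>\<^bsub>?E\<^esub> x = x \<otimes>\<^bsub>?E\<^esub> d)"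
      by (intro bexI[of _ "inv y"] bexI[of _ y] bexI[of _ "inv (\<one> \<ominus> p)"])
        (use y y0 L_inv d L_carrier p g \<theta>_id a_minus_carrier_update[OF subring_L _ p(1)] L_ring m_comm \<theta>_closed in
          \<open>auto simp: p_def[symmetric] auts_def\<close>)
  qed (use finite_auts \<theta>_closed \<theta>_mult \<theta>_one in \<open>auto simp: auts_def\<close>)
  then obtain \<phi> where \<phi>: "bi_sum ?E (\<lambda>h. h) auts \<phi>" "\<phi> (\<theta> \<one>\<^sub>G) = \<one>" "\<And>g. g \<in> auts - {\<theta> \<one>\<^sub>G} \<Longrightarrow> \<phi> g = \<zero>"
    by auto
  obtain ts where ts: "set ts \<subseteq> L \<times> L" "\<And>g. g \<in> auts \<Longrightarrow> \<phi> g = lsum \<Omega> (\<lambda>(a, b). g b \<ast> a) ts"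
    using bi_sumD[OF \<phi>(1)] unfolding lsum_carrier_update by auto
  show ?thesis
  proof (rule that[OF ts(1)])
    fix g assume "g \<in> carrier G"
    then show "lsum \<Omega> (\<lambda>(a, b). \<theta> g b \<ast> a) ts = (if \<theta> \<one>\<^sub>G = \<theta> g then \<one> else \<zero>)"
      using ts(2)[of "\<theta> g", OF \<theta>_auts] \<phi>(2) \<phi>(3)[of "\<theta> g"] by (auto simp: auts_def)
  qed
qed

definition trace where "trace x = (\<Oplus>h\<in>auts. h x)"

lemma auts_closed: "\<lbrakk>h \<in> auts; x \<in> L\<rbrakk> \<Longrightarrow> h x \<in> L"
  using \<theta>_closed by (auto simp: auts_def)

lemma trace_L: "x \<in> L \<Longrightarrow> trace x = finsum (\<Omega>\<lparr>carrier := L\<rparr>) (\<lambda>h. h x) auts"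
  unfolding trace_def by (rule finsum_carrier_update[symmetric, OF subring_L]) (simp add: auts_closed)

lemma \<theta>_finsum:
  assumes "g \<in> carrier G" "\<And>i. i \<in> I \<Longrightarrow> f i \<in> L"
  shows "\<theta> g (finsum \<Omega> f I) = (\<Oplus>i\<in>I. \<theta> g (f i))"
proof -
  have "\<theta> g (finsum (\<Omega>\<lparr>carrier := L\<rparr>) f I) = finsum (\<Omega>\<lparr>carrier := L\<rparr>) (\<lambda>i. \<theta> g (f i)) I"
    by (rule L.finsum_hom[OF L.abelian_group_axioms]) (use assms \<theta>_closed \<theta>_add in auto)
  then show ?thesis
    using finsum_carrier_update[OF subring_L, of I f] finsum_carrier_update[OF subring_L, of I "\<lambda>i. \<theta> g (f i)"]
      assms \<theta>_closed by auto
qed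

lemma finsum_L: "(\<And>i. i \<in> I \<Longrightarrow> f i \<in> L) \<Longrightarrow> finsum \<Omega> f I \<in> L"
  using L.finsum_closed[of f I] finsum_carrier_update[OF subring_L, of I f] by (simp add: Pi_def)

lemma trace_F:
  assumes x: "x \<in> L"
  shows "trace x \<in> F"
proof (rule fixed)
  show "trace x \<in> L" unfolding trace_def using x auts_closed by (intro finsum_L) auto
  show "\<forall>g\<in>carrier G. \<theta> g (trace x) = trace x"
  proof
    fix g assume g: "g \<in> carrier G"
    have "\<theta> g (trace x) = (\<Oplus>h\<in>auts. \<theta> g (h x))"
      unfolding trace_def by (rule \<theta>_finsum) (use g x auts_closed in auto)
    also have "\<dots> = (\<Oplus>h\<in>auts. compose L (\<theta> g) h x)" using x by (simp add: compose_def)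
    also have "\<dots> = (\<Oplus>h\<in>compose L (\<theta> g) ` auts. h x)"
      by (rule finsum_reindex[symmetric])
        (use auts_translate[OF g] x auts_closed L_carrier in \<open>auto simp: bij_betw_def\<close>)
    also have "\<dots> = trace x" using auts_translate[OF g] by (simp add: trace_def bij_betw_def)
    finally show "\<theta> g (trace x) = trace x" .
  qed
qed

lemma trace_expand:
  obtains ts where "set ts \<subseteq> L \<times> L"
    "\<And>g. g \<in> carrier G \<Longrightarrow> lsum \<Omega> (\<lambda>(a, b). \<theta> g b \<ast> a) ts = (if \<theta> \<one>\<^sub>G = \<theta> g then \<one> else \<zero>)"
    "\<And>z. z \<in> L \<Longrightarrow> z = lsum \<Omega> (\<lambda>(a, b). trace (z \<ast> b) \<ast> a) ts"
proof -
  obtain ts where ts: "set ts \<subseteq> L \<times> L"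
    "\<And>g. g \<in> carrier G \<Longrightarrow> lsum \<Omega> (\<lambda>(a, b). \<theta> g b \<ast> a) ts = (if \<theta> \<one>\<^sub>G = \<theta> g then \<one> else \<zero>)"
    using dual_basis by blast
  have "z = lsum \<Omega> (\<lambda>(a, b). trace (z \<ast> b) \<ast> a) ts" if z: "z \<in> L" for z
  proof -
    have "z = lsum (\<Omega>\<lparr>carrier := L\<rparr>) (\<lambda>(a, b). finsum (\<Omega>\<lparr>carrier := L\<rparr>) (\<lambda>h. h (z \<otimes>\<^bsub>\<Omega>\<lparr>carrier := L\<rparr>\<^esub> b)) auts \<otimes>\<^bsub>\<Omega>\<lparr>carrier := L\<rparr>\<^esub> a) ts"
    proof (rule L.trace_expansion[of auts "\<theta> \<one>\<^sub>G" "\<lambda>h. h"])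
      show "lsum (\<Omega>\<lparr>carrier := L\<rparr>) (\<lambda>(a, b). h b \<otimes>\<^bsub>\<Omega>\<lparr>carrier := L\<rparr>\<^esub> a) ts =
        (if \<theta> \<one>\<^sub>G = h then \<one>\<^bsub>\<Omega>\<lparr>carrier := L\<rparr>\<^esub> else \<zero>\<^bsub>\<Omega>\<lparr>carrier := L\<rparr>\<^esub>)" if "h \<in> auts" for h
        unfolding lsum_carrier_update using ts(2) that by (auto simp: auts_def)
    qed (use finite_auts \<theta>_closed \<theta>_mult \<theta>_id ts(1) z in \<open>auto simp: auts_def\<close>)
    also have "\<dots> = lsum \<Omega> (\<lambda>(a, b). trace (z \<ast> b) \<ast> a) ts"
      unfolding lsum_carrier_update by (rule lprod_cong) (use ts(1) z trace_L L_ring in auto)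
    finally show ?thesis .
  qed
  with ts that show ?thesis by blast
qed

text \<open>The trace expansion exhibits a finite spanning list: the traces lie in \<open>F\<close>,
  so the first legs of the dual tensor span \<open>L\<close>.\<close>

lemma finite_dimension_L: "finite_dimension F L"
proof -
  obtain ts where ts: "set ts \<subseteq> L \<times> L" "\<And>z. z \<in> L \<Longrightarrow> z = lsum \<Omega> (\<lambda>(a, b). trace (z \<ast> b) \<ast> a) ts"
    by (rule trace_expand) auto
  let ?U = "map fst ts"
  have U: "set ?U \<subseteq> carrier \<Omega>" using ts(1) L_carrier by auto
  have "L \<subseteq> Span F ?U"
  proof
    fix z assume z: "z \<in> L"
    have *: "lsum \<Omega> (\<lambda>(a, b). trace (z \<ast> b) \<ast> a) ss \<in> Span F ?U" if "set ss \<subseteq> set ts" for ss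
      using that
    proof (induction ss)
      case (Cons s ss)
      obtain a b where s: "s = (a, b)" by force
      have "a \<in> Span F ?U" using Span_base_incl[OF subfield_F U] Cons.prems s by force
      moreover have "trace (z \<ast> b) \<in> F" using trace_F z L_ring Cons.prems ts(1) s by auto
      ultimately show ?case
        using Cons s Span_smult_closed[OF subfield_F U] Span_subgroup_props(3)[OF subfield_F U] by auto
    qed (use Span_subgroup_props[OF subfield_F U] in auto)
    then show "z \<in> Span F ?U" using ts(2)[OF z] by (metis subset_refl)
  qed
  moreover have "subalgebra F L \<Omega>"
    using subring.axioms(1)[OF subring_L] L_ring F_in_L by (auto simp: subalgebra_def subalgebra_axioms_def)
  ultimately show ?thesis
    using subalbegra_incl_imp_finite_dimension[OF subfield_F Span_finite_dimension[OF subfield_F U]] by blast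
qed

text \<open>The trace expansion makes \<open>\<phi>\<close> a combination of the automorphisms \<open>\<theta> g\<close>, so independence
  of characters forces it to be one of them.\<close>

lemma embedding_eq_aut:
  assumes \<phi>: "\<phi> \<in> ring_hom (\<Omega>\<lparr>carrier := L\<rparr>) \<Omega>" and \<phi>F: "\<And>x. x \<in> F \<Longrightarrow> \<phi> x = x"
  obtains g where "g \<in> carrier G" "\<And>x. x \<in> L \<Longrightarrow> \<phi> x = \<theta> g x"
proof (rule ccontr)
  note main = that
  assume "\<not> thesis"
  then have ne: "\<exists>x\<in>L. \<phi> x \<noteq> \<theta> g x" if "g \<in> carrier G" for g using main[of g] that by blast
  have \<phi>c: "\<phi> x \<in> carrier \<Omega>" if "x \<in> L" for x using ring_hom_closed[OF \<phi>] that by simp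
  have \<phi>m: "\<phi> (x \<ast> y) = \<phi> x \<ast> \<phi> y" "\<phi> (x \<oplus> y) = \<phi> x \<oplus> \<phi> y" if "x \<in> L" "y \<in> L" for x y
    using ring_hom_mult[OF \<phi>] ring_hom_add[OF \<phi>] that by simp_all
  obtain ts where ts: "set ts \<subseteq> L \<times> L" "\<And>z. z \<in> L \<Longrightarrow> z = lsum \<Omega> (\<lambda>(a, b). trace (z \<ast> b) \<ast> a) ts"
    by (rule trace_expand) auto
  have D: "a \<in> L \<and> b \<in> L" if "(a, b) \<in> set ts" for a b using that ts(1) by auto
  \<comment> \<open>These coefficients come from applying \<phi> to the trace expansion and
    exchanging the sum over automorphisms with the sum over the tensor; the traces lie in
    \<open>F\<close> and are left alone by \<phi>.\<close>
  define c where "c h = lsum \<Omega> (\<lambda>(a, b). h b \<ast> \<phi> a) ts" for h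
  have c: "c h \<in> carrier \<Omega>" if "h \<in> auts" for h
    unfolding c_def by (rule lsum_closed) (use that auts_closed L_carrier \<phi>c in \<open>auto dest!: D\<close>)
  have aL: "\<lbrakk>h \<in> auts; x \<in> L\<rbrakk> \<Longrightarrow> h x \<in> carrier \<Omega>" for h x using auts_closed L_carrier by blast
  have am: "\<lbrakk>h \<in> auts; x \<in> L; y \<in> L\<rbrakk> \<Longrightarrow> h (x \<ast> y) = h x \<ast> h y" for h x y
    using \<theta>_mult by (auto simp: auts_def)
  have expand: "\<phi> z = (\<Oplus>h\<in>auts. c h \<ast> h z)" if z: "z \<in> L" for z
  proof -
    have "\<phi> z = \<phi> (lsum (\<Omega>\<lparr>carrier := L\<rparr>) (\<lambda>(a, b). trace (z \<ast> b) \<ast> a) ts)"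
      unfolding lsum_carrier_update using ts(2)[OF z] by simp
    also have "\<dots> = lsum \<Omega> (\<lambda>t. \<phi> (case t of (a, b) \<Rightarrow> trace (z \<ast> b) \<ast> a)) ts"
      by (rule L.lsum_hom[OF abelian_group_axioms])
        (use \<phi>c \<phi>m z L_ring trace_F F_in_L in \<open>auto dest!: D\<close>)
    also have "\<dots> = lsum \<Omega> (\<lambda>t. \<Oplus>h\<in>auts. (case t of (a, b) \<Rightarrow> h b \<ast> \<phi> a) \<ast> h z) ts"
    proof (rule lprod_cong, clarify)
      fix a b assume "(a, b) \<in> set ts"
      then have ab: "a \<in> L" "b \<in> L" by (auto dest!: D)
      then have t: "trace (z \<ast> b) \<in> F" using trace_F z L_ring by blast
      have "\<phi> (trace (z \<ast> b) \<ast> a) = (\<Oplus>h\<in>auts. h (z \<ast> b)) \<ast> \<phi> a"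
        using \<phi>m t \<phi>F ab F_in_L by (simp add: trace_def)
      also have "\<dots> = (\<Oplus>h\<in>auts. h (z \<ast> b) \<ast> \<phi> a)"
        by (rule finsum_ldistr) (use finite_auts aL L_ring z ab \<phi>c in auto)
      also have "\<dots> = (\<Oplus>h\<in>auts. h b \<ast> \<phi> a \<ast> h z)"
      proof (rule finsum_cong')
        fix h assume "h \<in> auts"
        then have "h (z \<ast> b) = h z \<ast> h b" "h z \<in> carrier \<Omega>" "h b \<in> carrier \<Omega>"
          using am aL z ab by auto
        then show "h (z \<ast> b) \<ast> \<phi> a = h b \<ast> \<phi> a \<ast> h z"
          using \<phi>c ab by (simp add: m_ac)
      qed (use aL z ab \<phi>c in auto)
      finally show "\<phi> (trace (z \<ast> b) \<ast> a) = (\<Oplus>h\<in>auts. h b \<ast> \<phi> a \<ast> h z)" .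
    qed
    also have "\<dots> = (\<Oplus>h\<in>auts. lsum \<Omega> (\<lambda>t. (case t of (a, b) \<Rightarrow> h b \<ast> \<phi> a) \<ast> h z) ts)"
      by (rule finsum_lsum[symmetric]) (use finite_auts aL z \<phi>c in \<open>auto dest!: D\<close>)
    also have "\<dots> = (\<Oplus>h\<in>auts. c h \<ast> h z)"
    proof (rule finsum_cong')
      fix h assume "h \<in> auts"
      then show "lsum \<Omega> (\<lambda>t. (case t of (a, b) \<Rightarrow> h b \<ast> \<phi> a) \<ast> h z) ts = c h \<ast> h z"
        unfolding c_def by (intro lsum_mult_right[symmetric]) (use aL z \<phi>c in \<open>auto dest!: D\<close>)
    qed (use c aL z in auto)
    finally show ?thesis .
  qed
  \<comment> \<open>\<open>None\<close> stands for \<phi>, with coefficient minus one, and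
    \<open>Some h\<close> for the automorphism h, so that the expansion of \<phi> becomes a linear
    relation among distinct multiplicative maps.\<close>
  define \<chi> where "\<chi> i = (case i of None \<Rightarrow> \<phi> | Some h \<Rightarrow> h)" for i
  define d where "d i = (case i of None \<Rightarrow> \<ominus> \<one> | Some h \<Rightarrow> c h)" for i
  have "d None = \<zero>"
  proof (rule dedekind_independence[where I="insert None (Some ` auts)" and S=L and \<chi>=\<chi> and Z="carrier \<Omega>"
        and m="\<lambda>x y. x \<ast> y" and e="\<one>" and c=d])
    show "\<exists>g\<in>L. \<chi> i g \<noteq> \<chi> i' g" if "i \<in> insert None (Some ` auts)" "i' \<in> insert None (Some ` auts)" "i \<noteq> i'" for i i'
    proof -
      have 1: "\<exists>x\<in>L. \<phi> x \<noteq> h x" if "h \<in> auts" for h using that ne by (auto simp: auts_def)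
      have 2: "\<exists>x\<in>L. h x \<noteq> h' x" if "h \<in> auts" "h' \<in> auts" "h \<noteq> h'" for h h'
        using that \<theta>_eqI unfolding auts_def by blast
      show ?thesis using that 1 2 by (fastforce simp: \<chi>_def)
    qed
    show "(\<Oplus>i\<in>insert None (Some ` auts). d i \<ast> \<chi> i z) = \<zero>" if z: "z \<in> L" for z
    proof -
      have "(\<Oplus>i\<in>Some ` auts. d i \<ast> \<chi> i z) = (\<Oplus>h\<in>auts. c h \<ast> h z)"
        by (subst finsum_reindex) (use c aL z in \<open>auto simp: d_def \<chi>_def\<close>)
      then have "(\<Oplus>i\<in>insert None (Some ` auts). d i \<ast> \<chi> i z) = d None \<ast> \<chi> None z \<oplus> \<phi> z"
        unfolding expand[OF z] using finite_auts c aL \<phi>c z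
        by (subst finsum_insert) (auto simp: d_def \<chi>_def)
      also have "\<dots> = \<zero>" using \<phi>c[OF z] by (simp add: d_def \<chi>_def l_minus l_neg)
      finally show ?thesis .
    qed
    show "x = \<zero>" if "y \<in> carrier \<Omega>" "z \<in> carrier \<Omega>" "y \<noteq> z" "x \<in> carrier \<Omega>" "x \<ast> (y \<ominus> z) = \<zero>" for x y z
      using that by (metis integral minus_closed r_right_minus_eq)
  qed (use finite_auts \<phi>c \<phi>m am aL c L_ring ring_hom_one[OF \<phi>] \<theta>_one m_comm in \<open>auto simp: \<chi>_def d_def auts_def\<close>)
  then have "\<ominus> \<one> = \<zero>" by (simp add: d_def)
  then have "\<one> = \<zero>" using minus_minus[OF one_closed] by simp
  then show False by simp
qed

text \<open>Artin's theorem: an automorphism of \<open>L\<close> over \<open>F\<close> is in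
  particular an embedding into \<Omega>, hence agrees with some \<theta> g.\<close>

lemma \<theta>_epi: "\<theta> \<in> epi G (Gal_group \<Omega> F L)"
proof -
  have "s \<in> \<theta> ` carrier G" if s: "s \<in> carrier (Gal_group \<Omega> F L)" for s
  proof -
    have s': "s \<in> Bij L" "s \<in> ring_hom (\<Omega>\<lparr>carrier := L\<rparr>) (\<Omega>\<lparr>carrier := L\<rparr>)" "\<And>x. x \<in> F \<Longrightarrow> s x = x"
      using s by (auto simp: Gal_group_def)
    have "s \<in> ring_hom (\<Omega>\<lparr>carrier := L\<rparr>) \<Omega>"
      using s'(2) L_carrier by (auto simp: ring_hom_def)
    then obtain g where g: "g \<in> carrier G" "\<And>x. x \<in> L \<Longrightarrow> s x = \<theta> g x"
      using embedding_eq_aut[of s] s'(3) by blast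
    have "s = \<theta> g"
      using g \<theta>_extensional s'(1) Bij_imp_extensional extensionalityI by blast
    with g(1) show ?thesis by blast
  qed
  then show ?thesis using \<theta>_hom \<theta>_mem by (auto simp: epi_def)
qed

lemma finite_Galois: "finite_Galois \<Omega> F L"
proof -
  have "x \<in> F" if "x \<in> L" "\<forall>s\<in>carrier (Gal_group \<Omega> F L). s x = x" for x
    using fixed[OF that(1)] that(2) \<theta>_mem by blast
  then show ?thesis
    using subfield_L F_L finite_dimension_L by (auto simp: finite_Galois_def Gal_group_def)
qed

text \<open>The cocycle lives on \<open>G\<close>, but being trivial on the elements that act
  trivially it descends to the finite group of automorphisms, where the resolvent argument
  applies.\<close>

lemma hilbert90:
  assumes c: "\<And>g. g \<in> carrier G \<Longrightarrow> c g \<in> L - {\<zero>}"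
    and cocycle: "\<And>g h. \<lbrakk>g \<in> carrier G; h \<in> carrier G\<rbrakk> \<Longrightarrow> c (g \<bullet> h) = c g \<ast> \<theta> g (c h)"
    and kernel: "\<And>g. \<lbrakk>g \<in> carrier G; \<theta> g = \<theta> \<one>\<^sub>G\<rbrakk> \<Longrightarrow> c g = \<one>"
  obtains b where "b \<in> L - {\<zero>}" "\<And>g. g \<in> carrier G \<Longrightarrow> c g = \<theta> g b \<ast> inv b"
proof -
  \<comment> \<open>The descended cocycle, evaluated at an arbitrary preimage; two preimages differ
    by an element acting trivially, on which c is one.\<close>
  define c' where "c' h = c (SOME g. g \<in> carrier G \<and> \<theta> g = h)" for h
  have c': "c' (\<theta> g) = c g" if g: "g \<in> carrier G" for g
  proof -
    define g' where "g' = (SOME g'. g' \<in> carrier G \<and> \<theta> g' = \<theta> g)"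
    have g': "g' \<in> carrier G" "\<theta> g' = \<theta> g"
      using someI[of "\<lambda>g'. g' \<in> carrier G \<and> \<theta> g' = \<theta> g" g] g by (auto simp: g'_def)
    have "\<theta> (inv\<^sub>G g \<bullet> g') = \<theta> \<one>\<^sub>G"
      using g g' \<theta>_mult_compose[of "inv\<^sub>G g" g'] \<theta>_mult_compose[of "inv\<^sub>G g" g] by simp
    then have "c (inv\<^sub>G g \<bullet> g') = \<one>" using kernel g g' by simp
    moreover have "g' = g \<bullet> (inv\<^sub>G g \<bullet> g')" using g g' by (simp add: G.m_assoc[symmetric])
    ultimately have "c g' = c g \<ast> \<theta> g \<one>" using cocycle[of g "inv\<^sub>G g \<bullet> g'"] g g' by simp
    then show ?thesis using g c[OF g] \<theta>_one L_carrier by (simp add: c'_def g'_def)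
  qed
  have c'L: "c' h \<in> L" "c' h \<noteq> \<zero>" if "h \<in> auts" for h using that c c' by (auto simp: auts_def)
  \<comment> \<open>The resolvent. It cannot vanish identically, by independence of the
    automorphisms, and it satisfies c g \<ast> \<theta> g (s a) = s a, so the element sought is the
    inverse of a nonzero value.\<close>
  define s where "s a = (\<Oplus>h\<in>auts. c' h \<ast> h a)" for a
  have sL: "s a \<in> L" if "a \<in> L" for a
    unfolding s_def by (rule finsum_L) (use that c'L L_ring auts_closed in auto)
  have "\<exists>a\<in>L. s a \<noteq> \<zero>"
  proof (rule ccontr)
    assume *: "\<not> (\<exists>a\<in>L. s a \<noteq> \<zero>)"
    have "c' (\<theta> \<one>\<^sub>G) = \<zero>"
    proof (rule dedekind_independence[where I=auts and S=L and \<chi>="\<lambda>h. h" and Z="carrier \<Omega>"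
        and m="\<lambda>x y. x \<ast> y" and e="\<one>" and c=c'])
      show "\<exists>x\<in>L. h x \<noteq> h' x" if "h \<in> auts" "h' \<in> auts" "h \<noteq> h'" for h h'
        using that \<theta>_eqI unfolding auts_def by blast
      show "x = \<zero>" if "y \<in> carrier \<Omega>" "z \<in> carrier \<Omega>" "y \<noteq> z" "x \<in> carrier \<Omega>" "x \<ast> (y \<ominus> z) = \<zero>" for x y z
        using that by (metis integral minus_closed r_right_minus_eq)
      show "(\<Oplus>i\<in>auts. c' i \<ast> i g) = \<zero>" if "g \<in> L" for g using * that by (auto simp: s_def)
    qed (use finite_auts c'L L_carrier L_ring \<theta>_closed \<theta>_mult \<theta>_one m_comm in \<open>auto simp: auts_def\<close>)
    then show False using c'L \<theta>_auts by auto
  qed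
  then obtain a where a: "a \<in> L" "s a \<noteq> \<zero>" by auto
  define b where "b = inv (s a)"
  have b: "b \<in> L" "b \<noteq> \<zero>" "inv b = s a"
    using L_inv[OF sL[OF a(1)] a(2)] L_carrier sL[OF a(1)] a(2) by (auto simp: b_def field_Units)
  have "c g = \<theta> g b \<ast> inv b" if g: "g \<in> carrier G" for g
  proof -
    have cg: "c g \<in> L" "c g \<in> carrier \<Omega>" using c[OF g] L_carrier by auto
    have "c g \<ast> \<theta> g (s a) = c g \<ast> (\<Oplus>h\<in>auts. \<theta> g (c' h \<ast> h a))"
      unfolding s_def using g a c'L L_ring auts_closed by (subst \<theta>_finsum) auto
    also have "\<dots> = (\<Oplus>h\<in>auts. c g \<ast> \<theta> g (c' h \<ast> h a))"
      by (rule finsum_rdistr) (use finite_auts cg g a c'L L_ring auts_closed \<theta>_closed L_carrier in auto)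
    also have "\<dots> = (\<Oplus>h\<in>auts. c' (compose L (\<theta> g) h) \<ast> compose L (\<theta> g) h a)"
    proof (rule finsum_cong')
      fix h assume h: "h \<in> auts"
      then obtain k where k: "k \<in> carrier G" "h = \<theta> k" by (auto simp: auts_def)
      have "c' (compose L (\<theta> g) h) = c g \<ast> \<theta> g (c' h)"
        using g k c' cocycle by (simp add: \<theta>_mult_compose[symmetric])
      then show "c g \<ast> \<theta> g (c' h \<ast> h a) = c' (compose L (\<theta> g) h) \<ast> compose L (\<theta> g) h a"
        using g h a c'L auts_closed \<theta>_mult \<theta>_closed cg L_carrier by (simp add: compose_def m_assoc)
    next
      have "compose L (\<theta> g) h \<in> auts" if "h \<in> auts" for h
        using auts_translate[OF g] that by (auto simp: bij_betw_def)
      then show "(\<lambda>h. c' (compose L (\<theta> g) h) \<ast> compose L (\<theta> g) h a) \<in> auts \<rightarrow> carrier \<Omega>"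
        using c'L auts_closed a L_carrier by blast
    qed simp
    also have "\<dots> = (\<Oplus>h\<in>compose L (\<theta> g) ` auts. c' h \<ast> h a)"
      by (rule finsum_reindex[symmetric])
        (use auts_translate[OF g] a c'L auts_closed L_carrier in \<open>auto simp: bij_betw_def\<close>)
    also have "\<dots> = s a" using auts_translate[OF g] by (simp add: s_def bij_betw_def)
    finally have *: "c g \<ast> \<theta> g (s a) = s a" .
    have "\<theta> g (s a) \<in> L" "\<theta> g (s a) \<noteq> \<zero>" using \<theta>_closed \<theta>_nonzero g sL a by auto
    moreover have "\<theta> g b = inv (\<theta> g (s a))" using \<theta>_inv g sL a by (simp add: b_def)
    ultimately have "c g = s a \<ast> \<theta> g b"
      using * cg L_inv L_carrier by (metis m_assoc r_one)
    then show ?thesis using b(3) m_comm \<theta>_closed g b L_carrier sL a by simp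
  qed
  with b that show ?thesis by blast
qed

text \<open>The neutral element of the Galois group is the extensional identity on \<open>L\<close>,
  so lying in the kernel is a pointwise condition.\<close>

lemma mem_ker: "k \<in> carrier (ker_group \<Omega> F G L \<theta>) \<longleftrightarrow> k \<in> carrier G \<and> (\<forall>x\<in>L. \<theta> k x = x)"
proof -
  have "\<theta> k = (\<lambda>x\<in>L. x) \<longleftrightarrow> (\<forall>x\<in>L. \<theta> k x = x)" if "k \<in> carrier G" for k
    using \<theta>_extensional[OF that] by (auto intro: extensionalityI)
  then show ?thesis by (auto simp: ker_group_def kernel_def Gal_group_def BijGroup_def)
qed

end

section \<open>Tensor products and the canonical map\<close>

locale two_modules = M: module R M + N: module R N for R and M and N
begin

abbreviation "FA \<equiv> free_Abelian_group (carrier M \<times> carrier N)"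
abbreviation "T \<equiv> tensor_product R M N"
abbreviation "pure \<equiv> pure_tensor R M N"

lemma relations_closed: "tensor_relations R M N \<subseteq> carrier FA"
proof -
  have dd: "x - y \<in> carrier FA" if "x \<in> carrier FA" "y \<in> carrier FA" for x y
    using that keys_diff[of x y] by auto
  show ?thesis
    unfolding tensor_relations_def
    by (auto simp del: carrier_free_Abelian_group_iff intro!: dd)
qed

lemma kernel_normal: "tensor_kernel R M N \<lhd> FA"
proof -
  interpret FA: comm_group FA by (rule abelian_free_Abelian_group)
  show ?thesis
    unfolding tensor_kernel_def FA.normal_iff_subgroup by (rule FA.generate_is_subgroup[OF relations_closed])
qed

sublocale T: comm_group T
  unfolding tensor_product_def
  by (rule comm_group.abelian_FactGroup[OF abelian_free_Abelian_group normal_imp_subgroup[OF kernel_normal]])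

abbreviation "proj \<equiv> r_coset FA (tensor_kernel R M N)"

lemma proj_hom: "proj \<in> hom FA T"
  unfolding tensor_product_def by (rule normal.r_coset_hom_Mod[OF kernel_normal])

lemma proj_add: "\<lbrakk>x \<in> carrier FA; y \<in> carrier FA\<rbrakk> \<Longrightarrow> proj (x + y) = proj x \<otimes>\<^bsub>T\<^esub> proj y"
  using hom_mult[OF proj_hom, of x y] by simp

lemma proj_relation:
  assumes "x \<in> tensor_relations R M N"
  shows "proj x = \<one>\<^bsub>T\<^esub>"
proof -
  interpret FA: comm_group FA by (rule abelian_free_Abelian_group)
  have "x \<in> tensor_kernel R M N" using assms unfolding tensor_kernel_def by (rule generate.incl)
  moreover then have "x \<in> carrier FA"
    using subgroup.subset[OF normal_imp_subgroup[OF kernel_normal]] by blast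
  ultimately show ?thesis
    using FA.coset_join2[OF _ normal_imp_subgroup[OF kernel_normal]] by (simp add: tensor_product_def)
qed

lemma pure_proj: "pure a b = proj (frag_of (a, b))"
  by (simp add: pure_tensor_def)

lemma pure_closed [simp]: "\<lbrakk>a \<in> carrier M; b \<in> carrier N\<rbrakk> \<Longrightarrow> pure a b \<in> carrier T"
  unfolding pure_proj by (rule hom_in_carrier[OF proj_hom]) simp

text \<open>Turns a generating relation into an identity between classes. The free abelian group is
  written additively and its quotient multiplicatively, hence the mixture of signs.\<close>

lemma proj_eq_mult:
  assumes "w - x - y \<in> tensor_relations R M N" "x \<in> carrier FA" "y \<in> carrier FA"
  shows "proj w = proj x \<otimes>\<^bsub>T\<^esub> proj y"
proof -
  have c: "w - x - y \<in> carrier FA" using assms(1) relations_closed by blast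
  have "proj w = proj ((w - x - y) + (x + y))" by simp
  also have "\<dots> = proj (w - x - y) \<otimes>\<^bsub>T\<^esub> proj (x + y)"
    by (rule proj_add) (use c assms(2,3) keys_add[of x y] in auto)
  also have "\<dots> = proj x \<otimes>\<^bsub>T\<^esub> proj y"
    unfolding proj_relation[OF assms(1)] proj_add[OF assms(2,3)]
    by (rule T.l_one) (use hom_in_carrier[OF proj_hom] assms in auto)
  finally show ?thesis .
qed

lemma proj_eq:
  assumes "w - x \<in> tensor_relations R M N" "x \<in> carrier FA"
  shows "proj w = proj x"
proof -
  have c: "w - x \<in> carrier FA" using assms(1) relations_closed by blast
  have "proj w = proj ((w - x) + x)" by simp
  also have "\<dots> = proj (w - x) \<otimes>\<^bsub>T\<^esub> proj x" by (rule proj_add) (use c assms(2) in auto)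
  also have "\<dots> = proj x"
    unfolding proj_relation[OF assms(1)]
    by (rule T.l_one) (use hom_in_carrier[OF proj_hom] assms in auto)
  finally show ?thesis .
qed

lemma pure_add_left:
  assumes "a \<in> carrier M" "a' \<in> carrier M" "b \<in> carrier N"
  shows "pure (a \<oplus>\<^bsub>M\<^esub> a') b = pure a b \<otimes>\<^bsub>T\<^esub> pure a' b"
  unfolding pure_proj
  by (rule proj_eq_mult) (use assms in \<open>auto simp: tensor_relations_def intro: exI[where P="\<lambda>x. _ x \<and> _ x"]\<close>)

lemma pure_add_right:
  assumes "a \<in> carrier M" "b \<in> carrier N" "b' \<in> carrier N"
  shows "pure a (b \<oplus>\<^bsub>N\<^esub> b') = pure a b \<otimes>\<^bsub>T\<^esub> pure a b'"
  unfolding pure_proj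
  by (rule proj_eq_mult) (use assms in \<open>auto simp: tensor_relations_def\<close>)

lemma pure_smult:
  assumes "r \<in> carrier R" "a \<in> carrier M" "b \<in> carrier N"
  shows "pure (r \<odot>\<^bsub>M\<^esub> a) b = pure a (r \<odot>\<^bsub>N\<^esub> b)"
  unfolding pure_proj
  by (rule proj_eq) (use assms in \<open>auto simp: tensor_relations_def\<close>)

lemma pure_zero_left: "b \<in> carrier N \<Longrightarrow> pure \<zero>\<^bsub>M\<^esub> b = \<one>\<^bsub>T\<^esub>"
  using pure_add_left[of "\<zero>\<^bsub>M\<^esub>" "\<zero>\<^bsub>M\<^esub>" b] T.l_cancel_one' pure_closed[of "\<zero>\<^bsub>M\<^esub>" b] by auto

lemma pure_zero_right: "a \<in> carrier M \<Longrightarrow> pure a \<zero>\<^bsub>N\<^esub> = \<one>\<^bsub>T\<^esub>"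
  using pure_add_right[of a "\<zero>\<^bsub>N\<^esub>" "\<zero>\<^bsub>N\<^esub>"] T.l_cancel_one' pure_closed[of a "\<zero>\<^bsub>N\<^esub>"] by auto

lemma pure_minus:
  assumes "a \<in> carrier M" "b \<in> carrier N"
  shows "inv\<^bsub>T\<^esub> (pure a b) = pure (\<ominus>\<^bsub>M\<^esub> a) b"
  by (rule T.inv_equality)
    (use assms in \<open>simp_all add: pure_add_left[symmetric] pure_zero_left M.M.l_neg\<close>)

lemma pure_lsum_left:
  assumes "b \<in> carrier N" "\<And>t. t \<in> set ts \<Longrightarrow> f t \<in> carrier M"
  shows "pure (lsum M f ts) b = lprod T (\<lambda>t. pure (f t) b) ts"
  using assms(2) by (induction ts) (use assms(1) in \<open>simp_all add: pure_zero_left pure_add_left M.M.lsum_closed\<close>)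

lemma pure_lsum_right:
  assumes "a \<in> carrier M" "\<And>t. t \<in> set ts \<Longrightarrow> f t \<in> carrier N"
  shows "pure a (lsum N f ts) = lprod T (\<lambda>t. pure a (f t)) ts"
  using assms(2) by (induction ts) (use assms(1) in \<open>simp_all add: pure_zero_right pure_add_right N.M.lsum_closed\<close>)

text \<open>Signs are absorbed into the first leg, so an integral combination of generators becomes
  a plain list of pure tensors. Every tensor thereby gets a concrete form on which a homomorphism
  can be evaluated.\<close>

lemma tensor_as_list:
  assumes "x \<in> carrier T"
  obtains ts where "set ts \<subseteq> carrier M \<times> carrier N" "x = lprod T (\<lambda>(a, b). pure a b) ts"
proof -
  let ?P = "\<lambda>x. \<exists>ts. set ts \<subseteq> carrier M \<times> carrier N \<and> proj x = lprod T (\<lambda>(a, b). pure a b) ts"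
  have "?P y" if y: "Poly_Mapping.keys y \<subseteq> carrier M \<times> carrier N" for y
    using y
  proof (rule free_Abelian_group_induct)
    have "proj 0 = \<one>\<^bsub>T\<^esub>"
      using hom_one[OF proj_hom group_free_Abelian_group T.is_group] by simp
    then show "?P 0" by (intro exI[of _ "[]"]) simp
  next
    fix y z :: "'c \<times> 'e \<Rightarrow>\<^sub>0 int"
    assume 2: "Poly_Mapping.keys y \<subseteq> carrier M \<times> carrier N" "Poly_Mapping.keys z \<subseteq> carrier M \<times> carrier N" "?P y" "?P z"
    then obtain ts ss where ts: "set ts \<subseteq> carrier M \<times> carrier N" "proj y = lprod T (\<lambda>(a, b). pure a b) ts"
      and ss: "set ss \<subseteq> carrier M \<times> carrier N" "proj z = lprod T (\<lambda>(a, b). pure a b) ss" by blast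
    let ?ss = "map (\<lambda>(a, b). (\<ominus>\<^bsub>M\<^esub> a, b)) ss"
    have "proj (y - z) = proj y \<otimes>\<^bsub>T\<^esub> proj (- z)"
      using proj_add[of y "- z"] 2(1,2) by simp
    also have "proj (- z) = inv\<^bsub>T\<^esub> (proj z)"
      using group_hom.hom_inv[of FA T proj z] proj_hom 2(2) T.is_group
      by (simp add: group_hom_def group_hom_axioms_def)
    also have "inv\<^bsub>T\<^esub> (proj z) = lprod T (\<lambda>(a, b). pure a b) ?ss"
      unfolding ss(2) using ss(1)
    proof (induction ss)
      case (Cons s ss)
      obtain a b where s: "s = (a, b)" by force
      have "lprod T (\<lambda>(a, b). pure a b) ss \<in> carrier T"
        by (rule T.lprod_closed) (use Cons.prems in auto)
      with Cons s show ?case by (simp add: T.inv_mult pure_minus)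
    qed simp
    also have "proj y \<otimes>\<^bsub>T\<^esub> lprod T (\<lambda>(a, b). pure a b) ?ss = lprod T (\<lambda>(a, b). pure a b) (ts @ ?ss)"
      unfolding ts(2)
      by (rule T.lprod_append[symmetric]) (use ts(1) ss(1) in auto)
    finally show "?P (y - z)"
      by (intro exI[of _ "ts @ ?ss"]) (use ts(1) ss(1) in auto)
  next
    fix a assume 3: "a \<in> carrier M \<times> carrier N"
    obtain b c where a: "a = (b, c)" by force
    with 3 have "pure b c \<in> carrier T" by auto
    then show "?P (frag_of a)" using 3 a by (intro exI[of _ "[a]"]) (auto simp: pure_proj)
  qed
  moreover obtain y where "Poly_Mapping.keys y \<subseteq> carrier M \<times> carrier N" "x = proj y"
    using assms unfolding tensor_product_def carrier_FactGroup by auto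
  ultimately show ?thesis using that by blast
qed

text \<open>The target may be any abelian group. It is used with the group of maps on
  \<open>G\<close>, to build the canonical map, and with the additive group of the algebra, to
  insert an element between the two legs.\<close>

lemma tensor_universal:
  assumes P: "comm_group P"
    and B: "\<And>a b. \<lbrakk>a \<in> carrier M; b \<in> carrier N\<rbrakk> \<Longrightarrow> B a b \<in> carrier P"
    and left: "\<And>a a' b. \<lbrakk>a \<in> carrier M; a' \<in> carrier M; b \<in> carrier N\<rbrakk> \<Longrightarrow> B (a \<oplus>\<^bsub>M\<^esub> a') b = B a b \<otimes>\<^bsub>P\<^esub> B a' b"
    and right: "\<And>a b b'. \<lbrakk>a \<in> carrier M; b \<in> carrier N; b' \<in> carrier N\<rbrakk> \<Longrightarrow> B a (b \<oplus>\<^bsub>N\<^esub> b') = B a b \<otimes>\<^bsub>P\<^esub> B a b'"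
    and balanced: "\<And>r a b. \<lbrakk>r \<in> carrier R; a \<in> carrier M; b \<in> carrier N\<rbrakk> \<Longrightarrow> B (r \<odot>\<^bsub>M\<^esub> a) b = B a (r \<odot>\<^bsub>N\<^esub> b)"
  obtains h where "h \<in> hom T P" "\<And>a b. \<lbrakk>a \<in> carrier M; b \<in> carrier N\<rbrakk> \<Longrightarrow> h (pure a b) = B a b"
proof -
  interpret P: comm_group P by fact
  interpret FA: comm_group FA by (rule abelian_free_Abelian_group)
  obtain k where k: "k \<in> hom FA P" "\<And>x. x \<in> carrier M \<times> carrier N \<Longrightarrow> k (frag_of x) = case_prod B x"
    using P.free_Abelian_group_universal[of "case_prod B" "carrier M \<times> carrier N"] B by (auto simp: image_subset_iff)
  interpret k: group_hom FA P k
    using k(1) by (simp add: group_hom_def group_hom_axioms_def P.is_group)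
  have diff: "k (x - y) = k x \<otimes>\<^bsub>P\<^esub> inv\<^bsub>P\<^esub> (k y)" if "x \<in> carrier FA" "y \<in> carrier FA" for x y
    using k.hom_mult[of x "- y"] k.hom_inv[of y] that by simp
  have frag: "frag_of (a, b) \<in> carrier FA" "k (frag_of (a, b)) = B a b" if "a \<in> carrier M" "b \<in> carrier N" for a b
    using that k(2)[of "(a, b)"] by auto
  have dd: "x - y \<in> carrier FA" if "x \<in> carrier FA" "y \<in> carrier FA" for x y
    using that keys_diff[of x y] by auto
  have cancel: "x \<otimes>\<^bsub>P\<^esub> y \<otimes>\<^bsub>P\<^esub> inv\<^bsub>P\<^esub> x \<otimes>\<^bsub>P\<^esub> inv\<^bsub>P\<^esub> y = \<one>\<^bsub>P\<^esub>" if "x \<in> carrier P" "y \<in> carrier P" for x y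
  proof -
    have "x \<otimes>\<^bsub>P\<^esub> y \<otimes>\<^bsub>P\<^esub> inv\<^bsub>P\<^esub> x = y" using that P.m_comm[of x y] by (simp add: P.m_assoc)
    then show ?thesis using that by simp
  qed
  have "tensor_relations R M N \<subseteq> kernel FA P k"
  proof
    fix x assume x: "x \<in> tensor_relations R M N"
    then have "k x = \<one>\<^bsub>P\<^esub>"
      unfolding tensor_relations_def
      using B by (elim UnE CollectE exE conjE) (simp_all add: diff frag dd left right balanced cancel del: carrier_free_Abelian_group_iff)
    then show "x \<in> kernel FA P k" using x relations_closed by (auto simp: kernel_def simp del: carrier_free_Abelian_group_iff)
  qed
  then have "tensor_kernel R M N \<subseteq> kernel FA P k"
    unfolding tensor_kernel_def by (rule FA.generate_subgroup_incl) (rule k.subgroup_kernel)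
  then obtain h where h: "h \<in> hom T P" "\<And>x. x \<in> carrier FA \<Longrightarrow> h (proj x) = k x"
    using k.FactGroup_universal_kernel[OF kernel_normal] unfolding tensor_product_def by blast
  show ?thesis
    by (rule that[OF h(1)]) (use h(2) frag in \<open>auto simp: pure_proj\<close>)
qed

end

lemma lprod_product_group:
  "lprod (product_group I (\<lambda>_. P)) f ts = (\<lambda>i\<in>I. lprod P (\<lambda>t. f t i) ts)"
  by (induction ts) (auto simp: restrict_def)

section \<open>Group actions on algebras and a criterion for Galois extensions\<close>

locale action_algebra = C: assoc_algebra R C + R: field R + G: comm_group G
  for R and C (structure) and G and \<sigma> +
  assumes finite_G: "finite (carrier G)" and \<sigma>_hom: "\<sigma> \<in> hom G (alg_aut_group R C)"
begin

lemma \<sigma>_mem: "g \<in> carrier G \<Longrightarrow> \<sigma> g \<in> Bij (carrier C) \<and> \<sigma> g \<in> ring_hom C C \<and> linear_on R C C (\<sigma> g)"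
  using \<sigma>_hom by (auto simp: hom_def alg_aut_group_def)

lemma \<sigma>_closed: "\<lbrakk>g \<in> carrier G; x \<in> carrier C\<rbrakk> \<Longrightarrow> \<sigma> g x \<in> carrier C"
  using \<sigma>_mem ring_hom_closed by metis

lemma \<sigma>_mult: "\<lbrakk>g \<in> carrier G; x \<in> carrier C; y \<in> carrier C\<rbrakk> \<Longrightarrow> \<sigma> g (x \<otimes> y) = \<sigma> g x \<otimes> \<sigma> g y"
  using \<sigma>_mem ring_hom_mult by metis

lemma \<sigma>_add: "\<lbrakk>g \<in> carrier G; x \<in> carrier C; y \<in> carrier C\<rbrakk> \<Longrightarrow> \<sigma> g (x \<oplus> y) = \<sigma> g x \<oplus> \<sigma> g y"
  using \<sigma>_mem ring_hom_add by metis

lemma \<sigma>_one: "g \<in> carrier G \<Longrightarrow> \<sigma> g \<one> = \<one>"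
  using \<sigma>_mem ring_hom_one by metis

lemma \<sigma>_zero: "g \<in> carrier G \<Longrightarrow> \<sigma> g \<zero> = \<zero>"
  using \<sigma>_mem ring_hom_zero C.ring_axioms by metis

lemma \<sigma>_smult: "\<lbrakk>g \<in> carrier G; r \<in> carrier R; x \<in> carrier C\<rbrakk> \<Longrightarrow> \<sigma> g (r \<odot>\<^bsub>C\<^esub> x) = r \<odot>\<^bsub>C\<^esub> \<sigma> g x"
  using \<sigma>_mem by (auto simp: linear_on_def)

lemma \<sigma>_mult_compose: "\<lbrakk>g \<in> carrier G; h \<in> carrier G\<rbrakk> \<Longrightarrow> \<sigma> (g \<otimes>\<^bsub>G\<^esub> h) = compose (carrier C) (\<sigma> g) (\<sigma> h)"
  using hom_mult[OF \<sigma>_hom] \<sigma>_mem by (simp add: alg_aut_group_def BijGroup_def)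

lemma \<sigma>_comp: "\<lbrakk>g \<in> carrier G; h \<in> carrier G; x \<in> carrier C\<rbrakk> \<Longrightarrow> \<sigma> (g \<otimes>\<^bsub>G\<^esub> h) x = \<sigma> g (\<sigma> h x)"
  by (simp add: \<sigma>_mult_compose compose_def)

lemma \<sigma>_inj: "\<lbrakk>g \<in> carrier G; x \<in> carrier C; y \<in> carrier C; \<sigma> g x = \<sigma> g y\<rbrakk> \<Longrightarrow> x = y"
  using \<sigma>_mem[of g] by (auto simp: Bij_def bij_betw_def dest: inj_onD)

lemma \<sigma>_id: "x \<in> carrier C \<Longrightarrow> \<sigma> \<one>\<^bsub>G\<^esub> x = x"
  using \<sigma>_comp[of "\<one>\<^bsub>G\<^esub>" "\<one>\<^bsub>G\<^esub>" x] \<sigma>_inj[of "\<one>\<^bsub>G\<^esub>"] \<sigma>_closed[of "\<one>\<^bsub>G\<^esub>" x] by simp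

lemma \<sigma>_eqI: "\<lbrakk>g \<in> carrier G; h \<in> carrier G; \<And>x. x \<in> carrier C \<Longrightarrow> \<sigma> g x = \<sigma> h x\<rbrakk> \<Longrightarrow> \<sigma> g = \<sigma> h"
  using \<sigma>_mem Bij_imp_extensional extensionalityI by metis

lemma \<sigma>_inverse: "\<lbrakk>g \<in> carrier G; x \<in> carrier C\<rbrakk> \<Longrightarrow> \<sigma> g (\<sigma> (inv\<^bsub>G\<^esub> g) x) = x"
  "\<lbrakk>g \<in> carrier G; x \<in> carrier C\<rbrakk> \<Longrightarrow> \<sigma> (inv\<^bsub>G\<^esub> g) (\<sigma> g x) = x"
  using \<sigma>_comp[of g "inv\<^bsub>G\<^esub> g" x] \<sigma>_comp[of "inv\<^bsub>G\<^esub> g" g x] \<sigma>_id by simp_all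

lemma \<sigma>_commute: "\<lbrakk>g \<in> carrier G; h \<in> carrier G; x \<in> carrier C\<rbrakk> \<Longrightarrow> \<sigma> g (\<sigma> h x) = \<sigma> h (\<sigma> g x)"
  using \<sigma>_comp G.m_comm by metis

lemma scalar_mult: "\<lbrakk>r \<in> carrier R; x \<in> carrier C\<rbrakk> \<Longrightarrow> (r \<odot>\<^bsub>C\<^esub> \<one>) \<otimes> x = r \<odot>\<^bsub>C\<^esub> x"
  "\<lbrakk>r \<in> carrier R; x \<in> carrier C\<rbrakk> \<Longrightarrow> x \<otimes> (r \<odot>\<^bsub>C\<^esub> \<one>) = r \<odot>\<^bsub>C\<^esub> x"
  using C.smult_mult_left[of r \<one> x] C.smult_mult_right[of r x \<one>] by simp_all

lemma scalar_hom: "(\<lambda>r. r \<odot>\<^bsub>C\<^esub> \<one>) \<in> ring_hom R C"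
  by (rule ring_hom_memI) (simp_all add: C.smult_assoc1 C.smult_l_distr scalar_mult(1))

lemma scalars_subfield: "\<one> \<noteq> \<zero> \<Longrightarrow> subfield (scalars R C) C"
proof -
  interpret h: ring_hom_ring R C "\<lambda>r. r \<odot>\<^bsub>C\<^esub> \<one>"
    by (rule ring_hom_ringI2[OF C.R.ring_axioms C.ring_axioms scalar_hom])
  assume "\<one> \<noteq> \<zero>"
  then show ?thesis
    using h.img_is_subfield[OF R.carrier_is_subfield] by (simp add: scalars_def)
qed

sublocale CC: two_modules R C C
  by (simp add: two_modules_def C.module_axioms)

definition trace where "trace x = (\<Oplus>g\<in>carrier G. \<sigma> g x)"

lemma trace_fixed:
  assumes x: "x \<in> carrier C" and g: "g \<in> carrier G"
  shows "\<sigma> g (trace x) = trace x"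
proof -
  have "\<sigma> g (trace x) = (\<Oplus>h\<in>carrier G. \<sigma> g (\<sigma> h x))"
    unfolding trace_def
    by (rule C.finsum_hom[OF C.abelian_group_axioms]) (use g x \<sigma>_closed \<sigma>_add in auto)
  also have "\<dots> = (\<Oplus>h\<in>carrier G. \<sigma> (g \<otimes>\<^bsub>G\<^esub> h) x)"
    by (rule C.finsum_cong') (use g x \<sigma>_closed \<sigma>_comp in auto)
  also have "\<dots> = (\<Oplus>h\<in>(\<lambda>h. g \<otimes>\<^bsub>G\<^esub> h) ` carrier G. \<sigma> h x)"
    by (rule C.finsum_reindex[symmetric]) (use g x \<sigma>_closed in \<open>auto simp: inj_on_def\<close>)
  also have "(\<lambda>h. g \<otimes>\<^bsub>G\<^esub> h) ` carrier G = carrier G"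
    by (rule G.surj_const_mult[OF g])
  finally show ?thesis by (simp add: trace_def)
qed

lemma trace_closed: "x \<in> carrier C \<Longrightarrow> trace x \<in> carrier C"
  unfolding trace_def using \<sigma>_closed by (intro C.finsum_closed) auto

text \<open>The two lists representing delta have different tasks. The one with a on the left yields
  faithfulness and surjectivity of the canonical map; the one with a on the right is a dual basis
  and yields finite dimension and injectivity. Invariants are scalars, and this is what lets traces
  pass from one leg of a tensor to the other.\<close>

lemma Galois_extension_intro:
  assumes one_ne: "\<one> \<noteq> \<zero>"
    and fixed: "\<And>x. \<lbrakk>x \<in> carrier C; \<forall>g\<in>carrier G. \<sigma> g x = x\<rbrakk> \<Longrightarrow> x \<in> scalars R C"
    and delta: "bi_sum C \<sigma> (carrier G) (\<lambda>g. if \<one>\<^bsub>G\<^esub> = g then \<one> else \<zero>)"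
  shows "Galois_extension R G C \<sigma>"
proof -
  obtain ts ts' where ts: "set ts \<subseteq> carrier C \<times> carrier C"
      "\<And>g. g \<in> carrier G \<Longrightarrow> lsum C (\<lambda>(a, b). a \<otimes> \<sigma> g b) ts = (if \<one>\<^bsub>G\<^esub> = g then \<one> else \<zero>)"
    and ts': "set ts' \<subseteq> carrier C \<times> carrier C"
      "\<And>g. g \<in> carrier G \<Longrightarrow> lsum C (\<lambda>(a, b). \<sigma> g b \<otimes> a) ts' = (if \<one>\<^bsub>G\<^esub> = g then \<one> else \<zero>)"
    using delta unfolding bi_sum_def by metis
  have D: "(a, b) \<in> set ts \<Longrightarrow> a \<in> carrier C \<and> b \<in> carrier C"
    "(a, b) \<in> set ts' \<Longrightarrow> a \<in> carrier C \<and> b \<in> carrier C" for a b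
    using ts(1) ts'(1) by auto
  have fix_eq: "{x \<in> carrier C. \<forall>g\<in>carrier G. \<sigma> g x = x} = scalars R C"
  proof
    show "scalars R C \<subseteq> {x \<in> carrier C. \<forall>g\<in>carrier G. \<sigma> g x = x}"
      by (auto simp: scalars_def \<sigma>_smult \<sigma>_one)
  qed (use fixed in auto)
  have trace_scalar: "\<exists>r\<in>carrier R. trace x = r \<odot>\<^bsub>C\<^esub> \<one>" if "x \<in> carrier C" for x
    using fixed[of "trace x"] trace_closed trace_fixed that by (auto simp: scalars_def)
  have expand: "z = lsum C (\<lambda>(a, b). trace (z \<otimes> b) \<otimes> a) ts'" if z: "z \<in> carrier C" for z
    unfolding trace_def
    by (rule C.trace_expansion[of _ "\<one>\<^bsub>G\<^esub>" \<sigma>])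
      (use finite_G \<sigma>_closed \<sigma>_mult \<sigma>_id ts' z in auto)
  \<comment> \<open>If \<sigma> g = \<sigma> h, then delta takes the same value at the identity and
    at g times the inverse of h.\<close>
  have inj: "inj_on \<sigma> (carrier G)"
  proof (rule inj_onI)
    fix g h assume g: "g \<in> carrier G" and h: "h \<in> carrier G" and eq: "\<sigma> g = \<sigma> h"
    have "\<sigma> (g \<otimes>\<^bsub>G\<^esub> inv\<^bsub>G\<^esub> h) b = \<sigma> \<one>\<^bsub>G\<^esub> b" if "b \<in> carrier C" for b
      using \<sigma>_comp[of g "inv\<^bsub>G\<^esub> h" b] \<sigma>_inverse[of h b] \<sigma>_id[of b] g h eq that by simp
    then have "lsum C (\<lambda>(a, b). a \<otimes> \<sigma> (g \<otimes>\<^bsub>G\<^esub> inv\<^bsub>G\<^esub> h) b) ts = lsum C (\<lambda>(a, b). a \<otimes> \<sigma> \<one>\<^bsub>G\<^esub> b) ts"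
      by (intro lprod_cong) (auto dest!: D)
    then have "\<one>\<^bsub>G\<^esub> = g \<otimes>\<^bsub>G\<^esub> inv\<^bsub>G\<^esub> h" using ts(2)[of "g \<otimes>\<^bsub>G\<^esub> inv\<^bsub>G\<^esub> h"] ts(2)[of "\<one>\<^bsub>G\<^esub>"] g h one_ne
      by (metis G.inv_closed G.m_closed G.one_closed)
    then show "g = h" using g h by (metis G.inv_closed G.inv_equality G.inv_inv)
  qed
  \<comment> \<open>The dual basis writes z as a combination of first legs with scalar traces as
    coefficients.\<close>
  have fd: "fd_algebra R C"
  proof -
    let ?K = "scalars R C" and ?U = "map fst ts'"
    have K: "subfield ?K C" by (rule scalars_subfield[OF one_ne])
    have U: "set ?U \<subseteq> carrier C" using ts'(1) by auto
    have "carrier C \<subseteq> C.Span ?K ?U"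
    proof
      fix z assume z: "z \<in> carrier C"
      have "lsum C (\<lambda>(a, b). trace (z \<otimes> b) \<otimes> a) ss \<in> C.Span ?K ?U" if "set ss \<subseteq> set ts'" for ss
        using that
      proof (induction ss)
        case (Cons s ss)
        obtain a b where s: "s = (a, b)" by force
        then have ab: "a \<in> carrier C" "b \<in> carrier C" using Cons.prems D(2)[of a b] by auto
        have "a \<in> C.Span ?K ?U" using C.Span_base_incl[OF K U] Cons.prems s by force
        moreover have "trace (z \<otimes> b) \<in> ?K" using trace_scalar[of "z \<otimes> b"] z ab by (auto simp: scalars_def)
        ultimately show ?case
          using Cons s C.Span_smult_closed[OF K U] C.Span_subgroup_props(3)[OF K U] by auto
      qed (use C.Span_subgroup_props[OF K U] in auto)
      then show "z \<in> C.Span ?K ?U" using expand[OF z] by (metis subset_refl)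
    qed
    then have "C.Span ?K ?U = carrier C" using C.Span_subgroup_props(1)[OF K U] by blast
    then show ?thesis
      using C.Span_finite_dimension[OF K U] C.assoc_algebra_axioms by (simp add: fd_algebra_def)
  qed
  let ?P = "product_group (carrier G) (\<lambda>_. add_monoid C)"
  have P: "comm_group ?P"
    by (rule group.group_comm_groupI)
      (auto intro!: product_group C.add.is_group restrict_ext simp: C.a_comm PiE_def Pi_def)
  have "\<exists>\<kappa>. \<kappa> \<in> hom CC.T ?P \<and> (\<forall>a\<in>carrier C. \<forall>b\<in>carrier C. \<kappa> (CC.pure a b) = (\<lambda>g\<in>carrier G. a \<otimes> \<sigma> g b))"
  proof -
    obtain \<kappa> where "\<kappa> \<in> hom CC.T ?P" "\<And>a b. \<lbrakk>a \<in> carrier C; b \<in> carrier C\<rbrakk> \<Longrightarrow> \<kappa> (CC.pure a b) = (\<lambda>g\<in>carrier G. a \<otimes> \<sigma> g b)"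
    proof (rule CC.tensor_universal[OF P, of "\<lambda>a b. \<lambda>g\<in>carrier G. a \<otimes> \<sigma> g b"])
      fix r a b assume "r \<in> carrier R" "a \<in> carrier C" "b \<in> carrier C"
      then show "(\<lambda>g\<in>carrier G. (r \<odot>\<^bsub>C\<^esub> a) \<otimes> \<sigma> g b) = (\<lambda>g\<in>carrier G. a \<otimes> \<sigma> g (r \<odot>\<^bsub>C\<^esub> b))"
        by (intro restrict_ext) (simp add: \<sigma>_smult \<sigma>_closed C.smult_mult_left C.smult_mult_right)
    qed (auto simp: \<sigma>_closed \<sigma>_add C.l_distr C.r_distr intro!: restrict_ext)
    then show ?thesis by blast
  qed
  then obtain \<kappa> where \<kappa>: "\<kappa> \<in> hom CC.T ?P"
    "\<And>a b. \<lbrakk>a \<in> carrier C; b \<in> carrier C\<rbrakk> \<Longrightarrow> \<kappa> (CC.pure a b) = (\<lambda>g\<in>carrier G. a \<otimes> \<sigma> g b)" by blast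
  interpret P: comm_group ?P by (rule P)
  interpret \<kappa>: group_hom CC.T ?P \<kappa>
    using \<kappa>(1) P.is_group CC.T.is_group by (simp add: group_hom_def group_hom_axioms_def)
  have \<kappa>_list: "\<kappa> (lprod CC.T (\<lambda>(a, b). CC.pure a b) ss) = (\<lambda>g\<in>carrier G. lsum C (\<lambda>(a, b). a \<otimes> \<sigma> g b) ss)"
    if ss: "set ss \<subseteq> carrier C \<times> carrier C" for ss
  proof -
    have "\<kappa> (lprod CC.T (\<lambda>(a, b). CC.pure a b) ss) = lprod ?P (\<lambda>t. \<kappa> (case t of (a, b) \<Rightarrow> CC.pure a b)) ss"
      by (rule lprod_hom[OF CC.T.is_monoid \<kappa>(1) \<kappa>.hom_one]) (use ss in auto)
    also have "\<dots> = lprod ?P (\<lambda>(a, b). \<lambda>g\<in>carrier G. a \<otimes> \<sigma> g b) ss"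
      by (rule lprod_cong) (use ss \<kappa>(2) in auto)
    also have "\<dots> = (\<lambda>g\<in>carrier G. lsum C (\<lambda>(a, b). a \<otimes> \<sigma> g b) ss)"
      unfolding lprod_product_group
      by (rule restrict_ext, rule lprod_cong) (use ss in auto)
    finally show ?thesis .
  qed
  \<comment> \<open>Expand the second leg v of each term by the dual basis and move the scalar
    traces to the first leg u. The factor in front of each basis element a is then the sum of u
    \<otimes> trace (v \<otimes> b), which regroups into values of \<kappa> x and hence
    vanishes.\<close>
  have "inj_on \<kappa> (carrier CC.T)"
  proof (rule \<kappa>.inj_on_one_iff[THEN iffD2, rule_format])
    fix x assume x: "x \<in> carrier CC.T" and \<kappa>x: "\<kappa> x = \<one>\<^bsub>?P\<^esub>"
    obtain ss where ss: "set ss \<subseteq> carrier C \<times> carrier C" "x = lprod CC.T (\<lambda>(a, b). CC.pure a b) ss"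
      using CC.tensor_as_list[OF x] .
    have E: "(a, b) \<in> set ss \<Longrightarrow> a \<in> carrier C \<and> b \<in> carrier C" for a b using ss(1) by auto
    have zero: "lsum C (\<lambda>(u, v). u \<otimes> \<sigma> g v) ss = \<zero>" if "g \<in> carrier G" for g
    proof -
      have "lsum C (\<lambda>(u, v). u \<otimes> \<sigma> g v) ss = \<kappa> x g" unfolding ss(2) \<kappa>_list[OF ss(1)] using that by simp
      also have "\<dots> = \<one>\<^bsub>?P\<^esub> g" by (simp only: \<kappa>x)
      also have "\<dots> = \<zero>" using that by simp
      finally show ?thesis .
    qed
    have "x = lprod CC.T (\<lambda>s. lprod CC.T (\<lambda>t. case s of (u, v) \<Rightarrow> case t of (a, b) \<Rightarrow> CC.pure (u \<otimes> trace (v \<otimes> b)) a) ts') ss"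
      unfolding ss(2)
    proof (rule lprod_cong, clarify)
      fix u v assume "(u, v) \<in> set ss"
      then have uv: "u \<in> carrier C" "v \<in> carrier C" using E[of u v] by blast+
      have "CC.pure u v = CC.pure u (lsum C (\<lambda>(a, b). trace (v \<otimes> b) \<otimes> a) ts')" by (rule arg_cong[OF expand[OF uv(2)]])
      also have "\<dots> = lprod CC.T (\<lambda>t. CC.pure u (case t of (a, b) \<Rightarrow> trace (v \<otimes> b) \<otimes> a)) ts'"
      proof (rule CC.pure_lsum_right[OF uv(1)])
        fix t assume "t \<in> set ts'"
        then obtain a b where "t = (a, b)" "a \<in> carrier C" "b \<in> carrier C" using ts'(1) by auto
        then show "(case t of (a, b) \<Rightarrow> trace (v \<otimes> b) \<otimes> a) \<in> carrier C" using uv trace_closed by simp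
      qed
      also have "\<dots> = lprod CC.T (\<lambda>(a, b). CC.pure (u \<otimes> trace (v \<otimes> b)) a) ts'"
      proof (rule lprod_cong, clarify)
        fix a b assume "(a, b) \<in> set ts'"
        then have ab: "a \<in> carrier C" "b \<in> carrier C" using D(2)[of a b] by blast+
        obtain r where r: "r \<in> carrier R" "trace (v \<otimes> b) = r \<odot>\<^bsub>C\<^esub> \<one>" using trace_scalar[of "v \<otimes> b"] uv ab by auto
        show "CC.pure u (trace (v \<otimes> b) \<otimes> a) = CC.pure (u \<otimes> trace (v \<otimes> b)) a"
          using CC.pure_smult[of r u a] r uv ab by (simp add: scalar_mult)
      qed
      finally show "CC.pure u v = lprod CC.T (\<lambda>t. case t of (a, b) \<Rightarrow> CC.pure (u \<otimes> trace (v \<otimes> b)) a) ts'" .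
    qed
    also have "\<dots> = lprod CC.T (\<lambda>t. lprod CC.T (\<lambda>s. case s of (u, v) \<Rightarrow> case t of (a, b) \<Rightarrow> CC.pure (u \<otimes> trace (v \<otimes> b)) a) ss) ts'"
    proof (rule CC.T.lprod_swap)
      fix s t assume "s \<in> set ss" "t \<in> set ts'"
      then have "s \<in> carrier C \<times> carrier C" "t \<in> carrier C \<times> carrier C" using ss(1) ts'(1) by blast+
      then show "(case s of (u, v) \<Rightarrow> case t of (a, b) \<Rightarrow> CC.pure (u \<otimes> trace (v \<otimes> b)) a) \<in> carrier CC.T"
        using trace_closed by (elim SigmaE) simp
    qed
    also have "\<dots> = \<one>\<^bsub>CC.T\<^esub>"
    proof (rule CC.T.lprod_one, clarify)
      fix a b assume "(a, b) \<in> set ts'"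
      then have ab: "a \<in> carrier C" "b \<in> carrier C" using D(2)[of a b] by blast+
      have "lprod CC.T (\<lambda>s. case s of (u, v) \<Rightarrow> CC.pure (u \<otimes> trace (v \<otimes> b)) a) ss
          = CC.pure (lsum C (\<lambda>(u, v). u \<otimes> trace (v \<otimes> b)) ss) a"
      proof (subst CC.pure_lsum_left[OF ab(1)])
        fix s assume "s \<in> set ss"
        then obtain u v where "s = (u, v)" "u \<in> carrier C" "v \<in> carrier C" using ss(1) by auto
        then show "(case s of (u, v) \<Rightarrow> u \<otimes> trace (v \<otimes> b)) \<in> carrier C" using ab trace_closed by simp
      qed (rule lprod_cong, simp split: prod.split)
      also have "lsum C (\<lambda>(u, v). u \<otimes> trace (v \<otimes> b)) ss
          = lsum C (\<lambda>s. \<Oplus>g\<in>carrier G. (case s of (u, v) \<Rightarrow> u \<otimes> \<sigma> g v) \<otimes> \<sigma> g b) ss"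
      proof (rule lprod_cong, clarify)
        fix u v assume "(u, v) \<in> set ss"
        then have uv: "u \<in> carrier C" "v \<in> carrier C" using E[of u v] by blast+
        have "u \<otimes> trace (v \<otimes> b) = (\<Oplus>g\<in>carrier G. u \<otimes> \<sigma> g (v \<otimes> b))"
          unfolding trace_def by (rule C.finsum_rdistr) (use finite_G uv ab \<sigma>_closed in auto)
        also have "\<dots> = (\<Oplus>g\<in>carrier G. u \<otimes> \<sigma> g v \<otimes> \<sigma> g b)"
          by (rule C.finsum_cong') (use uv ab \<sigma>_closed \<sigma>_mult in \<open>auto simp: C.m_assoc\<close>)
        finally show "u \<otimes> trace (v \<otimes> b) = (\<Oplus>g\<in>carrier G. u \<otimes> \<sigma> g v \<otimes> \<sigma> g b)" .
      qed
      also have "\<dots> = (\<Oplus>g\<in>carrier G. lsum C (\<lambda>s. (case s of (u, v) \<Rightarrow> u \<otimes> \<sigma> g v) \<otimes> \<sigma> g b) ss)"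
        by (rule C.finsum_lsum[symmetric]) (use finite_G ab \<sigma>_closed in \<open>auto dest!: E\<close>)
      also have "\<dots> = \<zero>"
      proof (rule C.add.finprod_one_eqI[folded finsum_def, simplified])
        fix g assume g: "g \<in> carrier G"
        have "lsum C (\<lambda>s. (case s of (u, v) \<Rightarrow> u \<otimes> \<sigma> g v) \<otimes> \<sigma> g b) ss = lsum C (\<lambda>(u, v). u \<otimes> \<sigma> g v) ss \<otimes> \<sigma> g b"
          by (rule C.lsum_mult_right[symmetric]) (use g ab \<sigma>_closed in \<open>auto dest!: E\<close>)
        then show "lsum C (\<lambda>s. (case s of (u, v) \<Rightarrow> u \<otimes> \<sigma> g v) \<otimes> \<sigma> g b) ss = \<zero>"
          using zero[OF g] g ab \<sigma>_closed by simp
      qed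
      finally show "lprod CC.T (\<lambda>s. case s of (u, v) \<Rightarrow> CC.pure (u \<otimes> trace (v \<otimes> b)) a) ss = \<one>\<^bsub>CC.T\<^esub>"
        using ab by (simp add: CC.pure_zero_left)
    qed
    finally show "x = \<one>\<^bsub>CC.T\<^esub>" .
  qed
  moreover have "\<kappa> ` carrier CC.T = carrier ?P"
  proof
    show "carrier ?P \<subseteq> \<kappa> ` carrier CC.T"
    proof
      fix \<phi> assume \<phi>: "\<phi> \<in> carrier ?P"
      then have \<phi>c: "g \<in> carrier G \<Longrightarrow> \<phi> g \<in> carrier C" for g by auto
      obtain gs where gs: "distinct gs" "set gs = carrier G" using finite_distinct_list[OF finite_G] by auto
      \<comment> \<open>A function is the sum over h of its value at h times delta at h, and delta
        at h is delta at the identity with \<sigma> of the inverse of h applied to the second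
        legs.\<close>
      let ?us = "concat (map (\<lambda>h. map (\<lambda>(a, b). (\<phi> h \<otimes> a, \<sigma> (inv\<^bsub>G\<^esub> h) b)) ts) gs)"
      have us: "set ?us \<subseteq> carrier C \<times> carrier C"
        using gs(2) \<phi>c \<sigma>_closed by (auto dest!: D)
      have eq: "\<kappa> (lprod CC.T (\<lambda>(a, b). CC.pure a b) ?us) = \<phi>"
      proof
        fix g
        show "\<kappa> (lprod CC.T (\<lambda>(a, b). CC.pure a b) ?us) g = \<phi> g"
        proof (cases "g \<in> carrier G")
          case g: True
          have "lsum C (\<lambda>(a, b). a \<otimes> \<sigma> g b) ?us
              = lsum C (\<lambda>h. lsum C (\<lambda>(a, b). a \<otimes> \<sigma> g b) (map (\<lambda>(a, b). (\<phi> h \<otimes> a, \<sigma> (inv\<^bsub>G\<^esub> h) b)) ts)) gs"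
            by (rule C.lsum_concat) (use gs(2) g \<phi>c \<sigma>_closed in \<open>auto dest!: D\<close>)
          also have "\<dots> = lsum C (\<lambda>h. if h = g then \<phi> g else \<zero>) gs"
          proof (rule lprod_cong)
            fix h assume "h \<in> set gs"
            then have h: "h \<in> carrier G" using gs by simp
            have "lsum C (\<lambda>(a, b). a \<otimes> \<sigma> g b) (map (\<lambda>(a, b). (\<phi> h \<otimes> a, \<sigma> (inv\<^bsub>G\<^esub> h) b)) ts)
                = lsum C (\<lambda>t. \<phi> h \<otimes> (case t of (a, b) \<Rightarrow> a \<otimes> \<sigma> (g \<otimes>\<^bsub>G\<^esub> inv\<^bsub>G\<^esub> h) b)) ts"
              unfolding lprod_map
              by (rule lprod_cong) (use g h \<phi>c \<sigma>_closed \<sigma>_comp in \<open>auto dest!: D simp: C.m_assoc\<close>)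
            also have "\<dots> = \<phi> h \<otimes> lsum C (\<lambda>(a, b). a \<otimes> \<sigma> (g \<otimes>\<^bsub>G\<^esub> inv\<^bsub>G\<^esub> h) b) ts"
              by (rule C.lsum_mult_left[symmetric]) (use g h \<phi>c \<sigma>_closed in \<open>auto dest!: D\<close>)
            also have "\<dots> = \<phi> h \<otimes> (if \<one>\<^bsub>G\<^esub> = g \<otimes>\<^bsub>G\<^esub> inv\<^bsub>G\<^esub> h then \<one> else \<zero>)"
              using ts(2) g h by simp
            also have "\<one>\<^bsub>G\<^esub> = g \<otimes>\<^bsub>G\<^esub> inv\<^bsub>G\<^esub> h \<longleftrightarrow> h = g"
              using g h by (metis G.inv_closed G.inv_equality G.inv_inv G.r_inv)
            finally show "lsum C (\<lambda>(a, b). a \<otimes> \<sigma> g b) (map (\<lambda>(a, b). (\<phi> h \<otimes> a, \<sigma> (inv\<^bsub>G\<^esub> h) b)) ts)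
                = (if h = g then \<phi> g else \<zero>)" using \<phi>c h g by simp
          qed
          also have "\<dots> = \<phi> g"
          proof -
            have "lsum C (\<lambda>h. if h = g then \<phi> g else \<zero>) hs = (if g \<in> set hs then \<phi> g else \<zero>)" if "distinct hs" for hs
              using that \<phi>c[OF g] by (induction hs) auto
            then show ?thesis using gs g by simp
          qed
          finally show ?thesis using \<kappa>_list[OF us] g by simp
        next
          case False
          then have "\<phi> g = undefined" using \<phi> by auto
          then show ?thesis using \<kappa>_list[OF us] False by simp
        qed
      qed
      have mem: "lprod CC.T (\<lambda>(a, b). CC.pure a b) ?us \<in> carrier CC.T"
      proof (rule CC.T.lprod_closed)
        fix t assume "t \<in> set ?us"
        then have "t \<in> carrier C \<times> carrier C" using us by blast
        then show "(case t of (a, b) \<Rightarrow> CC.pure a b) \<in> carrier CC.T" by (elim SigmaE) simp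
      qed
      show "\<phi> \<in> \<kappa> ` carrier CC.T" using imageI[OF mem, of \<kappa>] unfolding eq .
    qed
  qed (use \<kappa>.hom_closed in auto)
  ultimately have "\<kappa> \<in> iso CC.T ?P" using \<kappa>(1) by (simp add: iso_def bij_betw_def)
  then show ?thesis
    unfolding Galois_extension_def using fd \<sigma>_hom inj fix_eq \<kappa>(2) by blast
qed

end

section \<open>The grading of a simple Galois extension\<close>

locale simple_Galois = action_algebra +
  assumes galois: "Galois_extension R G C \<sigma>" and simple: "simple_ring C"
begin

lemma one_not_zero: "\<one> \<noteq> \<zero>"
proof
  assume "\<one> = \<zero>"
  then have "carrier C = {\<zero>}" by (rule C.one_zeroD)
  then show False using simple by (simp add: simple_ring_def)
qed

lemma fixed_scalar: "\<lbrakk>x \<in> carrier C; \<forall>g\<in>carrier G. \<sigma> g x = x\<rbrakk> \<Longrightarrow> \<exists>r\<in>carrier R. x = r \<odot>\<^bsub>C\<^esub> \<one>"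
  using galois unfolding Galois_extension_def scalars_def by blast

lemma \<sigma>_faithful: "\<lbrakk>g \<in> carrier G; h \<in> carrier G; \<And>x. x \<in> carrier C \<Longrightarrow> \<sigma> g x = \<sigma> h x\<rbrakk> \<Longrightarrow> g = h"
proof -
  assume *: "g \<in> carrier G" "h \<in> carrier G" "\<And>x. x \<in> carrier C \<Longrightarrow> \<sigma> g x = \<sigma> h x"
  have "inj_on \<sigma> (carrier G)" using galois by (simp add: Galois_extension_def)
  then show "g = h" using \<sigma>_eqI[OF *] *(1,2) by (rule inj_onD)
qed

text \<open>The definition prescribes the map on pure tensors; since it is a homomorphism, this
  determines it on the lists that represent arbitrary tensors.\<close>

lemma canonical_map:
  obtains \<kappa> where "\<kappa> \<in> iso CC.T (product_group (carrier G) (\<lambda>_. add_monoid C))"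
    "\<And>ts. set ts \<subseteq> carrier C \<times> carrier C \<Longrightarrow>
      \<kappa> (lprod CC.T (\<lambda>(a, b). CC.pure a b) ts) = (\<lambda>g\<in>carrier G. lsum C (\<lambda>(a, b). a \<otimes> \<sigma> g b) ts)"
proof -
  let ?P = "product_group (carrier G) (\<lambda>_. add_monoid C)"
  obtain \<kappa> where \<kappa>: "\<kappa> \<in> iso CC.T ?P" "\<And>a b. \<lbrakk>a \<in> carrier C; b \<in> carrier C\<rbrakk> \<Longrightarrow> \<kappa> (CC.pure a b) = (\<lambda>g\<in>carrier G. a \<otimes> \<sigma> g b)"
    using galois unfolding Galois_extension_def by blast
  have P: "group ?P" by (rule product_group) (rule C.add.is_group)
  have "\<kappa> (lprod CC.T (\<lambda>(a, b). CC.pure a b) ss) = (\<lambda>g\<in>carrier G. lsum C (\<lambda>(a, b). a \<otimes> \<sigma> g b) ss)"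
    if ss: "set ss \<subseteq> carrier C \<times> carrier C" for ss
  proof -
    have hom: "\<kappa> \<in> hom CC.T ?P" using \<kappa>(1) by (simp add: iso_def)
    have "\<kappa> (lprod CC.T (\<lambda>(a, b). CC.pure a b) ss) = lprod ?P (\<lambda>t. \<kappa> (case t of (a, b) \<Rightarrow> CC.pure a b)) ss"
      by (rule lprod_hom[OF CC.T.is_monoid hom hom_one[OF hom CC.T.is_group P]]) (use ss in auto)
    also have "\<dots> = lprod ?P (\<lambda>(a, b). \<lambda>g\<in>carrier G. a \<otimes> \<sigma> g b) ss"
      by (rule lprod_cong) (use ss \<kappa>(2) in auto)
    also have "\<dots> = (\<lambda>g\<in>carrier G. lsum C (\<lambda>(a, b). a \<otimes> \<sigma> g b) ss)"
      unfolding lprod_product_group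
      by (rule restrict_ext, rule lprod_cong) (use ss in auto)
    finally show ?thesis .
  qed
  with \<kappa>(1) that show ?thesis by blast
qed

lemma Galois_surj:
  assumes "\<And>g. g \<in> carrier G \<Longrightarrow> \<phi> g \<in> carrier C"
  obtains ts where "set ts \<subseteq> carrier C \<times> carrier C"
    "\<And>g. g \<in> carrier G \<Longrightarrow> lsum C (\<lambda>(a, b). a \<otimes> \<sigma> g b) ts = \<phi> g"
proof -
  obtain \<kappa> where \<kappa>: "\<kappa> \<in> iso CC.T (product_group (carrier G) (\<lambda>_. add_monoid C))"
    "\<And>ts. set ts \<subseteq> carrier C \<times> carrier C \<Longrightarrow>
      \<kappa> (lprod CC.T (\<lambda>(a, b). CC.pure a b) ts) = (\<lambda>g\<in>carrier G. lsum C (\<lambda>(a, b). a \<otimes> \<sigma> g b) ts)"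
    using canonical_map by blast
  have "restrict \<phi> (carrier G) \<in> \<kappa> ` carrier CC.T"
    using \<kappa>(1) assms by (auto simp: iso_def bij_betw_def)
  then obtain x where x: "x \<in> carrier CC.T" "\<kappa> x = restrict \<phi> (carrier G)" by auto
  obtain ts where ts: "set ts \<subseteq> carrier C \<times> carrier C" "x = lprod CC.T (\<lambda>(a, b). CC.pure a b) ts"
    using CC.tensor_as_list[OF x(1)] .
  show ?thesis
  proof (rule that[OF ts(1)])
    fix g assume g: "g \<in> carrier G"
    have "(\<lambda>g\<in>carrier G. lsum C (\<lambda>(a, b). a \<otimes> \<sigma> g b) ts) = restrict \<phi> (carrier G)"
      using x(2) unfolding ts(2) \<kappa>(2)[OF ts(1)] .
    from fun_cong[OF this, of g] show "lsum C (\<lambda>(a, b). a \<otimes> \<sigma> g b) ts = \<phi> g"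
      using g by simp
  qed
qed

text \<open>Injectivity of the canonical map makes such a tensor zero. The additive map sending the
  tensor of a and b to a \<otimes> c \<otimes> b is well defined over the scalars, so it must kill
  the tensor.\<close>

lemma Galois_balanced_vanish:
  assumes ts: "set ts \<subseteq> carrier C \<times> carrier C"
      "\<And>g. g \<in> carrier G \<Longrightarrow> lsum C (\<lambda>(a, b). a \<otimes> \<sigma> g b) ts = \<zero>"
    and c: "c \<in> carrier C"
  shows "lsum C (\<lambda>(a, b). a \<otimes> c \<otimes> b) ts = \<zero>"
proof -
  obtain \<kappa> where \<kappa>: "\<kappa> \<in> iso CC.T (product_group (carrier G) (\<lambda>_. add_monoid C))"
    "\<And>ts. set ts \<subseteq> carrier C \<times> carrier C \<Longrightarrow>
      \<kappa> (lprod CC.T (\<lambda>(a, b). CC.pure a b) ts) = (\<lambda>g\<in>carrier G. lsum C (\<lambda>(a, b). a \<otimes> \<sigma> g b) ts)"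
    using canonical_map by blast
  let ?x = "lprod CC.T (\<lambda>(a, b). CC.pure a b) ts"
  have tc: "(case t of (a, b) \<Rightarrow> CC.pure a b) \<in> carrier CC.T" if "t \<in> set ts" for t
    using that ts(1) by auto
  have x: "?x \<in> carrier CC.T" by (rule CC.T.lprod_closed) (rule tc)
  have "\<kappa> ?x = \<kappa> (lprod CC.T (\<lambda>(a, b). CC.pure a b) [])"
    unfolding \<kappa>(2)[OF ts(1)] by (subst \<kappa>(2)) (auto simp: ts(2))
  then have x1: "?x = \<one>\<^bsub>CC.T\<^esub>"
    using inj_onD[of \<kappa> "carrier CC.T" ?x "\<one>\<^bsub>CC.T\<^esub>"] \<kappa>(1) x CC.T.one_closed by (simp add: iso_def bij_betw_def)
  obtain h where h: "h \<in> hom CC.T (add_monoid C)" "\<And>a b. \<lbrakk>a \<in> carrier C; b \<in> carrier C\<rbrakk> \<Longrightarrow> h (CC.pure a b) = a \<otimes> c \<otimes> b"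
  proof (rule CC.tensor_universal[of "add_monoid C" "\<lambda>a b. a \<otimes> c \<otimes> b"])
    show "comm_group (add_monoid C)" by (rule C.a_comm_group)
  qed (use c in \<open>auto simp: C.l_distr C.r_distr C.smult_mult_left C.smult_mult_right\<close>)
  have h1: "h \<one>\<^bsub>CC.T\<^esub> = \<zero>" using hom_one[OF h(1) CC.T.is_group C.add.is_group] by simp
  have "h ?x = lsum C (\<lambda>t. h (case t of (a, b) \<Rightarrow> CC.pure a b)) ts"
    by (rule lprod_hom[OF CC.T.is_monoid h(1)]) (use h1 tc in auto)
  also have "\<dots> = lsum C (\<lambda>(a, b). a \<otimes> c \<otimes> b) ts"
    by (rule lprod_cong) (use ts(1) h(2) in auto)
  finally show ?thesis using h1 unfolding x1 by simp
qed

text \<open>A preimage of delta at the identity, fixed once as a list; applying \<sigma> of the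
  inverse of h to the second legs moves the delta to h.\<close>

definition dual where
  "dual = (SOME ts. set ts \<subseteq> carrier C \<times> carrier C \<and>
    (\<forall>g\<in>carrier G. lsum C (\<lambda>(a, b). a \<otimes> \<sigma> g b) ts = (if g = \<one>\<^bsub>G\<^esub> then \<one> else \<zero>)))"

lemma dual: "set dual \<subseteq> carrier C \<times> carrier C"
  "g \<in> carrier G \<Longrightarrow> lsum C (\<lambda>(a, b). a \<otimes> \<sigma> g b) dual = (if g = \<one>\<^bsub>G\<^esub> then \<one> else \<zero>)"
proof -
  have "\<exists>ts. set ts \<subseteq> carrier C \<times> carrier C \<and>
    (\<forall>g\<in>carrier G. lsum C (\<lambda>(a, b). a \<otimes> \<sigma> g b) ts = (if g = \<one>\<^bsub>G\<^esub> then \<one> else \<zero>))"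
    using Galois_surj[of "\<lambda>g. if g = \<one>\<^bsub>G\<^esub> then \<one> else \<zero>"] by (metis C.one_closed C.zero_closed)
  from someI_ex[OF this] show "set dual \<subseteq> carrier C \<times> carrier C"
    "g \<in> carrier G \<Longrightarrow> lsum C (\<lambda>(a, b). a \<otimes> \<sigma> g b) dual = (if g = \<one>\<^bsub>G\<^esub> then \<one> else \<zero>)"
    unfolding dual_def by blast+
qed

lemma dualD: "(a, b) \<in> set dual \<Longrightarrow> a \<in> carrier C \<and> b \<in> carrier C"
  using dual(1) by auto

text \<open>Evaluating the component of \<open>1 \<otimes> 1\<close> at \<open>h\<close> with \<open>c\<close> inserted in the middle projects onto
  the component of degree \<open>h\<close>.\<close>

definition proj where "proj h c = lsum C (\<lambda>(a, b). a \<otimes> c \<otimes> \<sigma> (inv\<^bsub>G\<^esub> h) b) dual"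

lemma proj_closed: "\<lbrakk>h \<in> carrier G; c \<in> carrier C\<rbrakk> \<Longrightarrow> proj h c \<in> carrier C"
  unfolding proj_def by (rule C.lsum_closed) (use \<sigma>_closed in \<open>auto dest!: dualD\<close>)

lemma dual_shift:
  assumes "g \<in> carrier G" "h \<in> carrier G"
  shows "lsum C (\<lambda>(a, b). a \<otimes> \<sigma> g (\<sigma> (inv\<^bsub>G\<^esub> h) b)) dual = (if h = g then \<one> else \<zero>)"
proof -
  have "lsum C (\<lambda>(a, b). a \<otimes> \<sigma> g (\<sigma> (inv\<^bsub>G\<^esub> h) b)) dual = lsum C (\<lambda>(a, b). a \<otimes> \<sigma> (g \<otimes>\<^bsub>G\<^esub> inv\<^bsub>G\<^esub> h) b) dual"
    by (rule lprod_cong) (use assms \<sigma>_comp in \<open>auto dest!: dualD\<close>)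
  also have "\<dots> = (if g \<otimes>\<^bsub>G\<^esub> inv\<^bsub>G\<^esub> h = \<one>\<^bsub>G\<^esub> then \<one> else \<zero>)" using dual(2) assms by simp
  also have "g \<otimes>\<^bsub>G\<^esub> inv\<^bsub>G\<^esub> h = \<one>\<^bsub>G\<^esub> \<longleftrightarrow> h = g"
    using assms by (metis G.inv_closed G.inv_equality G.inv_inv G.r_inv)
  finally show ?thesis .
qed

lemma homogeneousD: "a \<in> homogeneous C \<sigma> h \<Longrightarrow> a \<in> carrier C"
  "\<lbrakk>a \<in> homogeneous C \<sigma> h; b \<in> carrier C\<rbrakk> \<Longrightarrow> a \<otimes> b = \<sigma> h b \<otimes> a"
  by (auto simp: homogeneous_def)

text \<open>In delta at h, multiplying the first leg by \<sigma> h x from the left and multiplying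
  the second leg by x from the right have the same canonical image: both functions are concentrated
  at h and take the value \<sigma> h x there. The difference therefore dies when c is inserted in
  the middle.\<close>

lemma proj_homogeneous:
  assumes h: "h \<in> carrier G" and c: "c \<in> carrier C"
  shows "proj h c \<in> homogeneous C \<sigma> h"
proof -
  have "proj h c \<otimes> x = \<sigma> h x \<otimes> proj h c" if x: "x \<in> carrier C" for x
  proof -
    let ?us = "map (\<lambda>(a, b). (\<sigma> h x \<otimes> a, \<sigma> (inv\<^bsub>G\<^esub> h) b)) dual"
    let ?vs = "map (\<lambda>(a, b). (\<ominus> a, \<sigma> (inv\<^bsub>G\<^esub> h) b \<otimes> x)) dual"
    have us: "set (?us @ ?vs) \<subseteq> carrier C \<times> carrier C"
      using h x \<sigma>_closed by (auto dest!: dualD)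
    \<comment> \<open>Stated for a multiplicative f and a middle factor y because it is needed
      twice: with \<sigma> g and y = 1 to evaluate the canonical map, and with the identity map and
      y = c for the conclusion.\<close>
    have U: "lsum C (\<lambda>(a, b). a \<otimes> y \<otimes> f b) (?us @ ?vs) =
        \<sigma> h x \<otimes> lsum C (\<lambda>(a, b). a \<otimes> y \<otimes> f (\<sigma> (inv\<^bsub>G\<^esub> h) b)) dual \<ominus>
        lsum C (\<lambda>(a, b). a \<otimes> y \<otimes> f (\<sigma> (inv\<^bsub>G\<^esub> h) b)) dual \<otimes> f x"
      if f: "\<And>b. b \<in> carrier C \<Longrightarrow> f b \<in> carrier C" "\<And>b b'. \<lbrakk>b \<in> carrier C; b' \<in> carrier C\<rbrakk> \<Longrightarrow> f (b \<otimes> b') = f b \<otimes> f b'"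
        and y: "y \<in> carrier C" for f y
    proof -
      let ?F = "\<lambda>(a, b). a \<otimes> y \<otimes> f (\<sigma> (inv\<^bsub>G\<^esub> h) b)"
      have Fc: "t \<in> set dual \<Longrightarrow> ?F t \<in> carrier C" for t
        using dual(1) f(1) y h \<sigma>_closed by (cases t) auto
      have "lsum C (\<lambda>(a, b). a \<otimes> y \<otimes> f b) (?us @ ?vs) =
          lsum C (\<lambda>(a, b). a \<otimes> y \<otimes> f b) ?us \<oplus> lsum C (\<lambda>(a, b). a \<otimes> y \<otimes> f b) ?vs"
        by (rule C.lsum_append) (use us f y in auto)
      also have "lsum C (\<lambda>(a, b). a \<otimes> y \<otimes> f b) ?us = lsum C (\<lambda>t. \<sigma> h x \<otimes> ?F t) dual"
        unfolding lprod_map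
        by (rule lprod_cong) (use f y h x \<sigma>_closed in \<open>auto dest!: dualD simp: C.m_assoc\<close>)
      also have "\<dots> = \<sigma> h x \<otimes> lsum C ?F dual"
        by (rule C.lsum_mult_left[symmetric]) (use Fc h x \<sigma>_closed in auto)
      also have "lsum C (\<lambda>(a, b). a \<otimes> y \<otimes> f b) ?vs = lsum C (\<lambda>t. ?F t \<otimes> \<ominus> f x) dual"
        unfolding lprod_map
        by (rule lprod_cong) (use f y h x \<sigma>_closed in \<open>auto dest!: dualD simp: C.m_assoc C.l_minus C.r_minus\<close>)
      also have "\<dots> = lsum C ?F dual \<otimes> \<ominus> f x"
        by (rule C.lsum_mult_right[symmetric]) (use Fc x f in auto)
      finally show ?thesis
        using C.lsum_closed[of dual ?F, OF Fc] f x by (simp add: C.minus_eq C.r_minus)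
    qed
    have "lsum C (\<lambda>(a, b). a \<otimes> \<sigma> g b) (?us @ ?vs) = \<zero>" if g: "g \<in> carrier G" for g
    proof -
      have "lsum C (\<lambda>(a, b). a \<otimes> \<sigma> g b) (?us @ ?vs) = lsum C (\<lambda>(a, b). a \<otimes> \<one> \<otimes> \<sigma> g b) (?us @ ?vs)"
        by (rule lprod_cong) (use us in auto)
      also have "\<dots> = \<sigma> h x \<otimes> lsum C (\<lambda>(a, b). a \<otimes> \<one> \<otimes> \<sigma> g (\<sigma> (inv\<^bsub>G\<^esub> h) b)) dual \<ominus>
          lsum C (\<lambda>(a, b). a \<otimes> \<one> \<otimes> \<sigma> g (\<sigma> (inv\<^bsub>G\<^esub> h) b)) dual \<otimes> \<sigma> g x"
        by (rule U) (use g \<sigma>_closed \<sigma>_mult in auto)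
      also have "lsum C (\<lambda>(a, b). a \<otimes> \<one> \<otimes> \<sigma> g (\<sigma> (inv\<^bsub>G\<^esub> h) b)) dual = (if h = g then \<one> else \<zero>)"
        unfolding dual_shift[OF g h, symmetric] by (rule lprod_cong) (auto dest!: dualD)
      finally show ?thesis using h x \<sigma>_closed g by (auto simp: C.r_right_minus_eq)
    qed
    then have "lsum C (\<lambda>(a, b). a \<otimes> c \<otimes> b) (?us @ ?vs) = \<zero>"
      using Galois_balanced_vanish[OF us _ c] by blast
    moreover have "lsum C (\<lambda>(a, b). a \<otimes> c \<otimes> b) (?us @ ?vs) = \<sigma> h x \<otimes> proj h c \<ominus> proj h c \<otimes> x"
      unfolding proj_def by (rule U) (use c in auto)
    ultimately show ?thesis
      using h x \<sigma>_closed proj_closed[OF h c] by (simp add: C.r_right_minus_eq)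
  qed
  then show ?thesis using proj_closed[OF h c] by (simp add: homogeneous_def)
qed

lemma trace_central: "\<lbrakk>b \<in> carrier C; c \<in> carrier C\<rbrakk> \<Longrightarrow> c \<otimes> trace b = trace b \<otimes> c"
  using fixed_scalar[of "trace b"] trace_closed trace_fixed scalar_mult by metis

text \<open>Summing over h turns the second legs into traces, which are central, so c can be moved
  past them to the far right. What remains in front of it is delta summed over the group, which is
  one.\<close>

lemma proj_sum:
  assumes c: "c \<in> carrier C"
  shows "(\<Oplus>h\<in>carrier G. proj h c) = c"
proof -
  have "(\<Oplus>h\<in>carrier G. proj h c) = lsum C (\<lambda>t. \<Oplus>h\<in>carrier G. (case t of (a, b) \<Rightarrow> a \<otimes> c \<otimes> \<sigma> (inv\<^bsub>G\<^esub> h) b)) dual"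
    unfolding proj_def by (rule C.finsum_lsum) (use finite_G c \<sigma>_closed in \<open>auto dest!: dualD\<close>)
  also have "\<dots> = lsum C (\<lambda>t. \<Oplus>h\<in>carrier G. (case t of (a, b) \<Rightarrow> a \<otimes> \<sigma> h b) \<otimes> c) dual"
  proof (rule lprod_cong, clarify)
    fix a b assume "(a, b) \<in> set dual"
    then have ab: "a \<in> carrier C" "b \<in> carrier C" using dualD by blast+
    have inv: "(\<lambda>h. inv\<^bsub>G\<^esub> h) ` carrier G = carrier G"
    proof
      show "carrier G \<subseteq> (\<lambda>h. inv\<^bsub>G\<^esub> h) ` carrier G"
        by (metis G.inv_closed G.inv_inv image_eqI subsetI)
    qed auto
    have "(\<Oplus>h\<in>carrier G. a \<otimes> c \<otimes> \<sigma> (inv\<^bsub>G\<^esub> h) b) = (\<Oplus>h\<in>(\<lambda>h. inv\<^bsub>G\<^esub> h) ` carrier G. a \<otimes> c \<otimes> \<sigma> h b)"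
      by (rule C.finsum_reindex[symmetric]) (use ab c \<sigma>_closed in \<open>auto intro: inj_onI G.inv_inj[THEN inj_onD]\<close>)
    also have "\<dots> = a \<otimes> c \<otimes> trace b"
      unfolding inv trace_def by (rule C.finsum_rdistr[symmetric]) (use finite_G ab c \<sigma>_closed in auto)
    also have "\<dots> = a \<otimes> trace b \<otimes> c" using trace_central[of b c] trace_closed ab c by (simp add: C.m_assoc)
    also have "a \<otimes> trace b = (\<Oplus>h\<in>carrier G. a \<otimes> \<sigma> h b)"
      unfolding trace_def by (rule C.finsum_rdistr) (use finite_G ab c \<sigma>_closed in auto)
    also have "\<dots> \<otimes> c = (\<Oplus>h\<in>carrier G. a \<otimes> \<sigma> h b \<otimes> c)"
      by (rule C.finsum_ldistr) (use finite_G ab c \<sigma>_closed in auto)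
    finally show "(\<Oplus>h\<in>carrier G. a \<otimes> c \<otimes> \<sigma> (inv\<^bsub>G\<^esub> h) b) = (\<Oplus>h\<in>carrier G. a \<otimes> \<sigma> h b \<otimes> c)" .
  qed
  also have "\<dots> = (\<Oplus>h\<in>carrier G. lsum C (\<lambda>t. (case t of (a, b) \<Rightarrow> a \<otimes> \<sigma> h b) \<otimes> c) dual)"
    by (rule C.finsum_lsum[symmetric]) (use finite_G c \<sigma>_closed in \<open>auto dest!: dualD\<close>)
  also have "\<dots> = (\<Oplus>h\<in>carrier G. if \<one>\<^bsub>G\<^esub> = h then c else \<zero>)"
  proof (rule C.finsum_cong')
    fix h assume h: "h \<in> carrier G"
    have "lsum C (\<lambda>t. (case t of (a, b) \<Rightarrow> a \<otimes> \<sigma> h b) \<otimes> c) dual = lsum C (\<lambda>(a, b). a \<otimes> \<sigma> h b) dual \<otimes> c"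
      by (rule C.lsum_mult_right[symmetric]) (use h c \<sigma>_closed in \<open>auto dest!: dualD\<close>)
    then show "lsum C (\<lambda>t. (case t of (a, b) \<Rightarrow> a \<otimes> \<sigma> h b) \<otimes> c) dual = (if \<one>\<^bsub>G\<^esub> = h then c else \<zero>)"
      using dual(2)[OF h] c by auto
  qed (use c in auto)
  also have "\<dots> = c"
    using C.add.finprod_singleton[of "\<one>\<^bsub>G\<^esub>" "carrier G" "\<lambda>_. c"] finite_G c by (simp add: finsum_def)
  finally show ?thesis .
qed

lemma homogeneous_zero: "h \<in> carrier G \<Longrightarrow> \<zero> \<in> homogeneous C \<sigma> h"
  using \<sigma>_closed by (simp add: homogeneous_def)

lemma homogeneous_mult:
  assumes "g \<in> carrier G" "h \<in> carrier G" "a \<in> homogeneous C \<sigma> g" "b \<in> homogeneous C \<sigma> h"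
  shows "a \<otimes> b \<in> homogeneous C \<sigma> (g \<otimes>\<^bsub>G\<^esub> h)"
proof -
  have c: "a \<in> carrier C" "b \<in> carrier C" using assms homogeneousD by blast+
  have "a \<otimes> b \<otimes> x = \<sigma> (g \<otimes>\<^bsub>G\<^esub> h) x \<otimes> (a \<otimes> b)" if x: "x \<in> carrier C" for x
  proof -
    have "a \<otimes> b \<otimes> x = a \<otimes> \<sigma> h x \<otimes> b"
      using c x homogeneousD(2)[OF assms(4) x] assms \<sigma>_closed by (simp add: C.m_assoc)
    also have "\<dots> = \<sigma> g (\<sigma> h x) \<otimes> a \<otimes> b"
      using homogeneousD(2)[OF assms(3), of "\<sigma> h x"] x \<sigma>_closed assms by simp
    finally show ?thesis using assms c x \<sigma>_closed \<sigma>_comp by (simp add: C.m_assoc)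
  qed
  then show ?thesis using c by (simp add: homogeneous_def)
qed

lemma homogeneous_\<sigma>:
  assumes "g \<in> carrier G" "h \<in> carrier G" "a \<in> homogeneous C \<sigma> h"
  shows "\<sigma> g a \<in> homogeneous C \<sigma> h"
proof -
  have a: "a \<in> carrier C" using assms homogeneousD by blast
  have "\<sigma> g a \<otimes> x = \<sigma> h x \<otimes> \<sigma> g a" if x: "x \<in> carrier C" for x
  proof -
    let ?y = "\<sigma> (inv\<^bsub>G\<^esub> g) x"
    have y: "?y \<in> carrier C" "\<sigma> g ?y = x" using x assms \<sigma>_closed \<sigma>_inverse by auto
    have "\<sigma> g a \<otimes> x = \<sigma> g (a \<otimes> ?y)" using \<sigma>_mult y a assms by simp
    also have "\<dots> = \<sigma> g (\<sigma> h ?y) \<otimes> \<sigma> g a" using homogeneousD(2)[OF assms(3) y(1)] \<sigma>_mult \<sigma>_closed a y assms by simp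
    also have "\<sigma> g (\<sigma> h ?y) = \<sigma> h x" using \<sigma>_commute[of g h ?y] y assms by simp
    finally show ?thesis .
  qed
  then show ?thesis using a assms \<sigma>_closed by (simp add: homogeneous_def)
qed

lemma homogeneous_one: "homogeneous C \<sigma> \<one>\<^bsub>G\<^esub> = ring_center C"
  using \<sigma>_id by (auto simp: homogeneous_def ring_center_def)

text \<open>By homogeneity, x can be moved from the right of a to its left as \<sigma> h x, so the
  left ideal generated by a is two-sided and simplicity provides a left inverse. Its preimage under
  \<sigma> h is a right inverse.\<close>

lemma homogeneous_unit:
  assumes h: "h \<in> carrier G" and a: "a \<in> homogeneous C \<sigma> h" "a \<noteq> \<zero>"
  shows "a \<in> Units C"
proof -
  have ac: "a \<in> carrier C" using a homogeneousD by blast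
  let ?I = "(\<lambda>x. x \<otimes> a) ` carrier C"
  have "ideal ?I C"
  proof (rule idealI[OF C.ring_axioms])
    show "subgroup ?I (add_monoid C)"
    proof (rule C.add.subgroupI)
      fix x assume "x \<in> ?I"
      then obtain y where y: "y \<in> carrier C" "x = y \<otimes> a" by auto
      have "\<ominus> x = (\<ominus> y) \<otimes> a" using y ac C.l_minus by simp
      then show "\<ominus> x \<in> ?I" using y(1) by blast
      fix x' assume "x' \<in> ?I"
      then obtain y' where y': "y' \<in> carrier C" "x' = y' \<otimes> a" by auto
      have "x \<oplus> x' = (y \<oplus> y') \<otimes> a" using y y' ac C.l_distr by simp
      then show "x \<oplus> x' \<in> ?I" using y(1) y'(1) by blast
    qed (use ac in auto)
    fix x b assume "x \<in> ?I" and b: "b \<in> carrier C"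
    then obtain y where y: "y \<in> carrier C" "x = y \<otimes> a" by auto
    have "b \<otimes> x = (b \<otimes> y) \<otimes> a" using y b ac by (simp add: C.m_assoc)
    then show "b \<otimes> x \<in> ?I" using y(1) b by blast
    have "x \<otimes> b = (y \<otimes> \<sigma> h b) \<otimes> a"
      using y b ac homogeneousD(2)[OF a(1) b] \<sigma>_closed h by (simp add: C.m_assoc)
    then show "x \<otimes> b \<in> ?I" using y(1) b \<sigma>_closed h by blast
  qed
  moreover have "a \<in> ?I" using ac by (metis C.l_one C.one_closed image_eqI)
  ultimately have "?I = carrier C" using simple a(2) unfolding simple_ring_def by blast
  then obtain x where x: "x \<in> carrier C" "x \<otimes> a = \<one>" by (metis C.one_closed image_iff)
  let ?y = "\<sigma> (inv\<^bsub>G\<^esub> h) x"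
  have y: "?y \<in> carrier C" "a \<otimes> ?y = \<one>"
    using homogeneousD(2)[OF a(1), of ?y] x h \<sigma>_closed \<sigma>_inverse by auto
  have "x = ?y" using x y ac by (metis C.l_one C.m_assoc C.r_one)
  then show ?thesis using x y ac by (auto simp: Units_def)
qed

text \<open>Moving x to the right of the second legs applies \<sigma> t to them and leaves the
  shifted delta evaluated at t. This is what makes the sum of the components direct.\<close>

lemma proj_of_homogeneous:
  assumes "h \<in> carrier G" "t \<in> carrier G" "x \<in> homogeneous C \<sigma> t"
  shows "proj h x = (if h = t then x else \<zero>)"
proof -
  have x: "x \<in> carrier C" using assms homogeneousD by blast
  have "proj h x = lsum C (\<lambda>u. (case u of (a, b) \<Rightarrow> a \<otimes> \<sigma> t (\<sigma> (inv\<^bsub>G\<^esub> h) b)) \<otimes> x) dual"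
    unfolding proj_def
  proof (rule lprod_cong, clarify)
    fix a b assume "(a, b) \<in> set dual"
    then have ab: "a \<in> carrier C" "b \<in> carrier C" using dualD by blast+
    show "a \<otimes> x \<otimes> \<sigma> (inv\<^bsub>G\<^esub> h) b = a \<otimes> \<sigma> t (\<sigma> (inv\<^bsub>G\<^esub> h) b) \<otimes> x"
      using ab x assms \<sigma>_closed homogeneousD(2)[OF assms(3), of "\<sigma> (inv\<^bsub>G\<^esub> h) b"] by (simp add: C.m_assoc)
  qed
  also have "\<dots> = lsum C (\<lambda>(a, b). a \<otimes> \<sigma> t (\<sigma> (inv\<^bsub>G\<^esub> h) b)) dual \<otimes> x"
    by (rule C.lsum_mult_right[symmetric]) (use x assms \<sigma>_closed in \<open>auto dest!: dualD\<close>)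
  finally show ?thesis using dual_shift[OF assms(2,1)] x by auto
qed

definition support where "support = {h \<in> carrier G. \<exists>a\<in>homogeneous C \<sigma> h. a \<noteq> \<zero>}"

definition gen where "gen h = (SOME a. a \<in> homogeneous C \<sigma> h \<and> a \<noteq> \<zero>)"

lemma gen: "h \<in> support \<Longrightarrow> gen h \<in> homogeneous C \<sigma> h" "h \<in> support \<Longrightarrow> gen h \<noteq> \<zero>"
  "h \<in> support \<Longrightarrow> gen h \<in> carrier C" "h \<in> support \<Longrightarrow> gen h \<in> Units C"
proof -
  assume h: "h \<in> support"
  then have "\<exists>a. a \<in> homogeneous C \<sigma> h \<and> a \<noteq> \<zero>" by (auto simp: support_def)
  from someI_ex[OF this] show *: "gen h \<in> homogeneous C \<sigma> h" "gen h \<noteq> \<zero>" unfolding gen_def by auto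
  then show "gen h \<in> carrier C" "gen h \<in> Units C" using homogeneousD homogeneous_unit h by (auto simp: support_def)
qed

lemma supportD: "h \<in> support \<Longrightarrow> h \<in> carrier G" by (simp add: support_def)

lemma center_closed: "z \<in> ring_center C \<Longrightarrow> z \<in> carrier C"
  and center_comm: "\<lbrakk>z \<in> ring_center C; x \<in> carrier C\<rbrakk> \<Longrightarrow> z \<otimes> x = x \<otimes> z"
  by (auto simp: ring_center_def)

lemma unit_cancel: "\<lbrakk>x \<in> Units C; a \<in> carrier C; b \<in> carrier C; a \<otimes> x = b \<otimes> x\<rbrakk> \<Longrightarrow> a = b"
  by (metis C.Units_inv_closed C.Units_r_inv C.Units_closed C.m_assoc C.r_one)

text \<open>An element of degree h and \<open>gen h\<close> twist by the same automorphism, so their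
  quotient commutes with everything: a component in the support is free of rank one over the
  centre.\<close>

lemma homogeneous_quotient:
  assumes h: "h \<in> support" and a: "a \<in> homogeneous C \<sigma> h"
  shows "a \<otimes> inv gen h \<in> ring_center C" "a = (a \<otimes> inv gen h) \<otimes> gen h"
proof -
  have ac: "a \<in> carrier C" using a homogeneousD by blast
  have hG: "h \<in> carrier G" using h supportD by blast
  note Xu = gen(4)[OF h] gen(3)[OF h]
  have i: "inv gen h \<in> carrier C" using Xu by simp
  show e: "a = (a \<otimes> inv gen h) \<otimes> gen h" using ac Xu i by (simp add: C.m_assoc)
  have "(a \<otimes> inv gen h) \<otimes> b = b \<otimes> (a \<otimes> inv gen h)" if b: "b \<in> carrier C" for b
  proof -
    let ?y = "\<sigma> (inv\<^bsub>G\<^esub> h) b"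
    have y: "?y \<in> carrier C" "\<sigma> h ?y = b" using b hG \<sigma>_closed \<sigma>_inverse by auto
    have "inv gen h \<otimes> b \<otimes> gen h = inv gen h \<otimes> (gen h \<otimes> ?y)"
      using homogeneousD(2)[OF gen(1)[OF h] y(1)] y b Xu i by (simp add: C.m_assoc)
    then have "inv gen h \<otimes> b \<otimes> gen h = ?y" using Xu i y by (simp add: C.m_assoc[symmetric])
    then have *: "inv gen h \<otimes> b = ?y \<otimes> inv gen h"
      using Xu i y b by (metis C.Units_r_inv C.m_assoc C.m_closed C.r_one)
    have "(a \<otimes> inv gen h) \<otimes> b = a \<otimes> ?y \<otimes> inv gen h" using ac i b y by (simp add: C.m_assoc *)
    also have "\<dots> = b \<otimes> a \<otimes> inv gen h" using homogeneousD(2)[OF a y(1)] y by simp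
    finally show ?thesis using ac i b by (simp add: C.m_assoc)
  qed
  then show "a \<otimes> inv gen h \<in> ring_center C" using ac i by (simp add: ring_center_def)
qed

lemma center_subring: "subring (ring_center C) C"
proof (rule C.subringI)
  show "ring_center C \<subseteq> carrier C" "\<one> \<in> ring_center C" by (auto simp: ring_center_def)
  fix h k assume h: "h \<in> ring_center C" 
  then show "\<ominus> h \<in> ring_center C" by (auto simp: ring_center_def C.l_minus C.r_minus)
  assume k: "k \<in> ring_center C"
  then show "h \<oplus> k \<in> ring_center C" using h by (auto simp: ring_center_def C.l_distr C.r_distr)
  show "h \<otimes> k \<in> ring_center C"
  proof -
    have "h \<otimes> k \<otimes> a = a \<otimes> (h \<otimes> k)" if a: "a \<in> carrier C" for a
    proof -
      have c: "h \<in> carrier C" "k \<in> carrier C" using h k center_closed by auto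
      have "h \<otimes> k \<otimes> a = h \<otimes> a \<otimes> k" using center_comm[OF k a] c a by (simp add: C.m_assoc)
      also have "\<dots> = a \<otimes> h \<otimes> k" using center_comm[OF h a] by simp
      finally show ?thesis using c a by (simp add: C.m_assoc)
    qed
    moreover have "h \<otimes> k \<in> carrier C" using h k center_closed by simp
    ultimately show ?thesis unfolding ring_center_def by blast
  qed
qed

lemma center_unit: "\<lbrakk>z \<in> ring_center C; z \<noteq> \<zero>\<rbrakk> \<Longrightarrow> z \<in> Units C"
  using homogeneous_unit[of "\<one>\<^bsub>G\<^esub>" z] homogeneous_one by simp

lemma center_inv: "\<lbrakk>z \<in> ring_center C; z \<noteq> \<zero>\<rbrakk> \<Longrightarrow> inv z \<in> ring_center C"
proof -
  assume z: "z \<in> ring_center C" "z \<noteq> \<zero>"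
  note u = center_unit[OF z] center_closed[OF z(1)]
  have "inv z \<otimes> x = x \<otimes> inv z" if "x \<in> carrier C" for x
  proof (rule unit_cancel[OF u(1)])
    show "inv z \<otimes> x \<otimes> z = x \<otimes> inv z \<otimes> z"
    proof -
      have "inv z \<otimes> x \<otimes> z = inv z \<otimes> (z \<otimes> x)" using center_comm[OF z(1) that] u that by (simp add: C.m_assoc)
      also have "\<dots> = x" using u that by (simp add: C.m_assoc[symmetric])
      also have "x = x \<otimes> inv z \<otimes> z" using u that by (simp add: C.m_assoc)
      finally show ?thesis .
    qed
  qed (use u that in auto)
  then show ?thesis using u by (simp add: ring_center_def)
qed

lemma center_subfield: "subfield (ring_center C) C"
proof (rule C.subfieldI)
  show "subcring (ring_center C) C"
    by (rule C.subcringI[OF center_subring]) (use center_closed center_comm in blast)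
  show "Units (C\<lparr>carrier := ring_center C\<rparr>) = ring_center C - {\<zero>}"
  proof
    show "Units (C\<lparr>carrier := ring_center C\<rparr>) \<subseteq> ring_center C - {\<zero>}"
      using one_not_zero center_closed by (auto simp: Units_def)
    show "ring_center C - {\<zero>} \<subseteq> Units (C\<lparr>carrier := ring_center C\<rparr>)"
    proof
      fix z assume "z \<in> ring_center C - {\<zero>}"
      then have z: "z \<in> ring_center C" "z \<noteq> \<zero>" by auto
      show "z \<in> Units (C\<lparr>carrier := ring_center C\<rparr>)"
        using center_inv[OF z] center_unit[OF z] z(1) by (auto simp: Units_def[of "C\<lparr>carrier := ring_center C\<rparr>"] intro!: bexI[of _ "inv z"])
    qed
  qed
qed

lemma \<sigma>_center: "\<lbrakk>g \<in> carrier G; z \<in> ring_center C\<rbrakk> \<Longrightarrow> \<sigma> g z \<in> ring_center C"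
  using homogeneous_\<sigma>[of g "\<one>\<^bsub>G\<^esub>" z] homogeneous_one by simp

section \<open>The inertia subgroup and the characters attached to the support\<close>

definition inertia where "inertia = {k \<in> carrier G. \<forall>z\<in>ring_center C. \<sigma> k z = z}"

text \<open>The central factor by which \<sigma> g scales \<open>gen s\<close>. For g in the inertia
  subgroup it is multiplicative in g; for g in the support it is the commutator of
  \<open>gen g\<close> and \<open>gen s\<close>, because \<open>gen g\<close> induces \<sigma>
  g.\<close>

definition mu where "mu g s = \<sigma> g (gen s) \<otimes> inv gen s"

lemma mu: 
  assumes "g \<in> carrier G" "s \<in> support"
  shows "mu g s \<in> ring_center C" "\<sigma> g (gen s) = mu g s \<otimes> gen s" "mu g s \<noteq> \<zero>" "mu g s \<in> carrier C"
proof -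
  have *: "\<sigma> g (gen s) \<in> homogeneous C \<sigma> s"
    by (rule homogeneous_\<sigma>) (use assms gen supportD in auto)
  show m: "mu g s \<in> ring_center C" "\<sigma> g (gen s) = mu g s \<otimes> gen s"
    using homogeneous_quotient[OF assms(2) *] by (auto simp: mu_def)
  then show "mu g s \<in> carrier C" using center_closed by blast
  show "mu g s \<noteq> \<zero>"
  proof
    assume "mu g s = \<zero>"
    then have "\<sigma> g (gen s) = \<sigma> g \<zero>" using m gen assms \<sigma>_zero by simp
    then show False using \<sigma>_inj[of g "gen s" \<zero>] gen assms by auto
  qed
qed

text \<open>A central z commutes with \<open>gen s\<close>, but moving it past \<open>gen s\<close>
  also applies \<sigma> s; cancelling the unit \<open>gen s\<close> gives \<sigma> s z = z.\<close>

lemma support_inertia: "support \<subseteq> inertia"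
proof
  fix s assume s: "s \<in> support"
  have "\<sigma> s z = z" if z: "z \<in> ring_center C" for z
  proof (rule unit_cancel[OF gen(4)[OF s]])
    show "\<sigma> s z \<otimes> gen s = z \<otimes> gen s"
      using homogeneousD(2)[OF gen(1)[OF s], of z] center_comm[OF z gen(3)[OF s]] center_closed[OF z] by simp
  qed (use z center_closed \<sigma>_closed supportD s in auto)
  then show "s \<in> inertia" using s supportD by (simp add: inertia_def)
qed

lemma one_support: "\<one>\<^bsub>G\<^esub> \<in> support"
  using homogeneous_one one_not_zero C.one_closed by (auto simp: support_def ring_center_def)

lemma support_mult:
  assumes "s \<in> support" "t \<in> support"
  shows "s \<otimes>\<^bsub>G\<^esub> t \<in> support"
proof -
  have "gen s \<otimes> gen t \<in> Units C" using gen assms by simp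
  then have "gen s \<otimes> gen t \<noteq> \<zero>"
    using one_not_zero C.Units_l_inv[of \<zero>] C.Units_inv_closed[of \<zero>] by auto
  then show ?thesis
    using homogeneous_mult[OF supportD[OF assms(1)] supportD[OF assms(2)] gen(1)[OF assms(1)] gen(1)[OF assms(2)]]
      supportD assms by (auto simp: support_def)
qed

lemma proj_support: "\<lbrakk>h \<in> carrier G; h \<notin> support; c \<in> carrier C\<rbrakk> \<Longrightarrow> proj h c = \<zero>"
  using proj_homogeneous by (auto simp: support_def)

lemma finite_support: "finite support"
  using finite_G by (simp add: support_def)

lemma support_expand:
  assumes c: "c \<in> carrier C"
  shows "c = (\<Oplus>s\<in>support. proj s c)"
proof -
  have "(\<Oplus>s\<in>support. proj s c) = (\<Oplus>h\<in>carrier G. proj h c)"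
    by (rule C.add.finprod_mono_neutral_cong_left[folded finsum_def])
      (use finite_G proj_support proj_closed c supportD in auto)
  then show ?thesis using proj_sum[OF c] by simp
qed

text \<open>Elements of the inertia subgroup act linearly over the centre, so on each component they
  are determined by the image of its generator; faithfulness of the action concludes.\<close>

lemma \<sigma>_agree:
  assumes "g \<in> inertia" "h \<in> inertia" "\<And>s. s \<in> support \<Longrightarrow> \<sigma> g (gen s) = \<sigma> h (gen s)"
  shows "g = h"
proof (rule \<sigma>_faithful)
  show gh: "g \<in> carrier G" "h \<in> carrier G" using assms by (auto simp: inertia_def)
  fix c assume c: "c \<in> carrier C"
  have \<sigma>s: "\<sigma> k c = (\<Oplus>s\<in>support. \<sigma> k (proj s c))" if "k \<in> carrier G" for k
    by (subst support_expand[OF c], rule C.finsum_hom[OF C.abelian_group_axioms])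
      (use that \<sigma>_closed \<sigma>_add proj_closed c supportD in auto)
  have "\<sigma> g (proj s c) = \<sigma> h (proj s c)" if s: "s \<in> support" for s
  proof -
    have p: "proj s c \<in> homogeneous C \<sigma> s" using proj_homogeneous supportD s c by blast
    note q = homogeneous_quotient[OF s p]
    have "\<sigma> k (proj s c) = (proj s c \<otimes> inv gen s) \<otimes> \<sigma> k (gen s)" if "k \<in> inertia" for k
      using q \<sigma>_mult[of k "proj s c \<otimes> inv gen s" "gen s"] that center_closed gen(3)[OF s] by (simp add: inertia_def)
    then show ?thesis using assms s by simp
  qed
  then show "\<sigma> g c = \<sigma> h c"
    unfolding \<sigma>s[OF gh(1)] \<sigma>s[OF gh(2)]
    by (intro C.finsum_cong') (use proj_closed c supportD \<sigma>_closed gh in auto)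
qed

text \<open>Both factors are commutators: exchanging \<open>gen s\<close> and \<open>gen t\<close>
  twice returns the original product.\<close>

lemma mu_swap:
  assumes "s \<in> support" "t \<in> support"
  shows "mu s t \<otimes> mu t s = \<one>"
proof -
  note Xs = gen(3,4)[OF assms(1)] gen(3,4)[OF assms(2)]
  note sG = supportD[OF assms(1)] supportD[OF assms(2)]
  note m = mu[OF sG(1) assms(2)] mu[OF sG(2) assms(1)]
  have 1: "gen s \<otimes> gen t = mu s t \<otimes> (gen t \<otimes> gen s)"
    using homogeneousD(2)[OF gen(1)[OF assms(1)] Xs(3)] m Xs by (simp add: C.m_assoc)
  have 2: "gen t \<otimes> gen s = mu t s \<otimes> (gen s \<otimes> gen t)"
    using homogeneousD(2)[OF gen(1)[OF assms(2)] Xs(1)] m Xs by (simp add: C.m_assoc)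
  have "\<one> \<otimes> (gen s \<otimes> gen t) = (mu s t \<otimes> mu t s) \<otimes> (gen s \<otimes> gen t)"
    using 1 2 m Xs by (simp add: C.m_assoc)
  then show ?thesis
    using unit_cancel[of "gen s \<otimes> gen t" "mu s t \<otimes> mu t s" \<one>] Xs m by simp
qed

text \<open>The central element \<open>mu h s\<close> is not moved by \<sigma> g when g lies in the
  inertia subgroup; for other g the rule would be that of a cocycle.\<close>

lemma mu_mult:
  assumes "g \<in> inertia" "h \<in> carrier G" "s \<in> support"
  shows "mu (g \<otimes>\<^bsub>G\<^esub> h) s = mu g s \<otimes> mu h s"
proof (rule unit_cancel[OF gen(4)[OF assms(3)]])
  have g: "g \<in> carrier G" "\<And>z. z \<in> ring_center C \<Longrightarrow> \<sigma> g z = z" using assms by (auto simp: inertia_def)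
  note m = mu[OF g(1) assms(3)] mu[OF assms(2,3)]
  have "mu (g \<otimes>\<^bsub>G\<^esub> h) s \<otimes> gen s = \<sigma> g (\<sigma> h (gen s))"
    using mu[of "g \<otimes>\<^bsub>G\<^esub> h" s] g assms gen \<sigma>_comp by simp
  also have "\<dots> = mu h s \<otimes> (mu g s \<otimes> gen s)"
    using m g assms gen \<sigma>_mult by simp
  also have "\<dots> = mu g s \<otimes> mu h s \<otimes> gen s"
    using m gen(3)[OF assms(3)] center_comm[OF m(1), of "mu h s"] by (simp add: C.m_assoc[symmetric])
  finally show "mu (g \<otimes>\<^bsub>G\<^esub> h) s \<otimes> gen s = mu g s \<otimes> mu h s \<otimes> gen s" .
qed (use assms mu in \<open>auto simp: inertia_def\<close>)

lemma mu_one: "s \<in> support \<Longrightarrow> mu \<one>\<^bsub>G\<^esub> s = \<one>"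
  using gen \<sigma>_id by (simp add: mu_def)

text \<open>Antisymmetry turns equality of the characters g \<mapsto> mu g s and g \<mapsto> mu g t
  into equality of \<sigma> s and \<sigma> t on all generators.\<close>

lemma mu_inj:
  assumes s: "s \<in> support" "t \<in> support" and eq: "\<And>g. g \<in> support \<Longrightarrow> mu g s = mu g t"
  shows "s = t"
proof (rule \<sigma>_agree)
  fix g assume g: "g \<in> support"
  have c: "mu s g \<in> carrier C" "mu t g \<in> carrier C" "mu g s \<in> carrier C"
    using mu supportD s g by blast+
  have "mu s g = mu t g"
    using mu_swap[OF s(1) g] mu_swap[OF s(2) g] mu_swap[OF g s(1)] mu_swap[OF g s(2)] eq[OF g] c
    by (intro C.inv_unique[of "mu s g" "mu g s" "mu t g"]) simp_all
  then show "\<sigma> s (gen g) = \<sigma> t (gen g)" using mu(2) supportD s g by simp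
qed (use s support_inertia in auto)

lemma mu_independent:
  assumes c: "\<And>s. s \<in> support \<Longrightarrow> c s \<in> carrier C"
    and rel: "\<And>g. g \<in> support \<Longrightarrow> (\<Oplus>s\<in>support. c s \<otimes> mu g s) = \<zero>"
    and s: "s \<in> support"
  shows "c s = \<zero>"
proof (rule C.dedekind_independence[where I=support and S=support and \<chi>="\<lambda>s g. mu g s" and Z="ring_center C"
      and m="\<lambda>g h. g \<otimes>\<^bsub>G\<^esub> h" and e="\<one>\<^bsub>G\<^esub>" and c=c and i=s])
  fix x y c assume xy: "x \<in> ring_center C" "y \<in> ring_center C" "x \<noteq> y" "c \<in> carrier C" "c \<otimes> (x \<ominus> y) = \<zero>"
  have "x \<ominus> y \<in> ring_center C" using xy subringE(5,7)[OF center_subring] by (simp add: C.minus_eq)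
  moreover have "x \<ominus> y \<noteq> \<zero>" using xy center_closed by (metis C.r_right_minus_eq)
  ultimately show "c = \<zero>" using unit_cancel[OF center_unit, of "x \<ominus> y" c \<zero>] xy center_closed by simp
next
  show "\<exists>g\<in>support. mu g s \<noteq> mu g t" if "s \<in> support" "t \<in> support" "s \<noteq> t" for s t
    using mu_inj that by blast
next
  show "mu (g \<otimes>\<^bsub>G\<^esub> h) s = mu g s \<otimes> mu h s" if "s \<in> support" "g \<in> support" "h \<in> support" for s g h
    using mu_mult support_inertia supportD that by blast
next
  show "x \<otimes> y = y \<otimes> x" if "x \<in> ring_center C" "y \<in> ring_center C" for x y
    using center_comm center_closed that by blast
qed (use finite_support mu(1) supportD support_mult one_support mu_one assms center_closed in auto)

text \<open>On the inertia subgroup \<sigma> g multiplies the component of degree s by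
  \<open>mu g s\<close>, so canonical images restricted to it stay in the span of the characters
  coming from the support. This limits what surjectivity can reach.\<close>

lemma inertia_expand:
  assumes ts: "set ts \<subseteq> carrier C \<times> carrier C" and g: "g \<in> inertia"
  shows "lsum C (\<lambda>(a, b). a \<otimes> \<sigma> g b) ts = (\<Oplus>s\<in>support. lsum C (\<lambda>(a, b). a \<otimes> proj s b) ts \<otimes> mu g s)"
proof -
  have D: "(a, b) \<in> set ts \<Longrightarrow> a \<in> carrier C \<and> b \<in> carrier C" for a b using ts by auto
  have gG: "g \<in> carrier G" using g by (simp add: inertia_def)
  have m: "s \<in> support \<Longrightarrow> mu g s \<in> carrier C" for s using mu gG by blast
  have pc: "\<lbrakk>s \<in> support; b \<in> carrier C\<rbrakk> \<Longrightarrow> proj s b \<in> carrier C" for s b using proj_closed supportD by blast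
  have "lsum C (\<lambda>(a, b). a \<otimes> \<sigma> g b) ts
      = lsum C (\<lambda>t. \<Oplus>s\<in>support. (case t of (a, b) \<Rightarrow> a \<otimes> proj s b) \<otimes> mu g s) ts"
  proof (rule lprod_cong, clarify)
    fix a b assume "(a, b) \<in> set ts"
    then have ab: "a \<in> carrier C" "b \<in> carrier C" using D by blast+
    have "\<sigma> g b = (\<Oplus>s\<in>support. \<sigma> g (proj s b))"
      by (subst support_expand[OF ab(2)], rule C.finsum_hom[OF C.abelian_group_axioms])
        (use gG \<sigma>_closed \<sigma>_add pc ab in auto)
    also have "\<dots> = (\<Oplus>s\<in>support. proj s b \<otimes> mu g s)"
    proof (rule C.finsum_cong')
      fix s assume s: "s \<in> support"
      have p: "proj s b \<in> homogeneous C \<sigma> s" using proj_homogeneous supportD s ab by blast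
      note q = homogeneous_quotient[OF s p]
      let ?z = "proj s b \<otimes> inv gen s"
      have "\<sigma> g (proj s b) = ?z \<otimes> \<sigma> g (gen s)"
        using q \<sigma>_mult[of g ?z "gen s"] g center_closed gen(3)[OF s] by (simp add: inertia_def)
      also have "\<dots> = ?z \<otimes> (mu g s \<otimes> gen s)" using mu gG s by simp
      also have "mu g s \<otimes> gen s = gen s \<otimes> mu g s" using center_comm mu(1) gG s gen(3) by blast
      also have "?z \<otimes> (gen s \<otimes> mu g s) = proj s b \<otimes> mu g s"
        using center_closed[OF q(1)] gen(3)[OF s] m[OF s] q(2)[symmetric] by (simp add: C.m_assoc[symmetric])
      finally show "\<sigma> g (proj s b) = proj s b \<otimes> mu g s" .
    qed (use pc ab m in auto)
    finally have "a \<otimes> \<sigma> g b = (\<Oplus>s\<in>support. a \<otimes> (proj s b \<otimes> mu g s))"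
      using C.finsum_rdistr[OF finite_support ab(1), of "\<lambda>s. proj s b \<otimes> mu g s"] pc ab m by (simp add: Pi_def)
    also have "\<dots> = (\<Oplus>s\<in>support. a \<otimes> proj s b \<otimes> mu g s)"
      by (rule C.finsum_cong') (use pc ab m in \<open>auto simp: C.m_assoc\<close>)
    finally show "a \<otimes> \<sigma> g b = (\<Oplus>s\<in>support. a \<otimes> proj s b \<otimes> mu g s)" .
  qed
  also have "\<dots> = (\<Oplus>s\<in>support. lsum C (\<lambda>t. (case t of (a, b) \<Rightarrow> a \<otimes> proj s b) \<otimes> mu g s) ts)"
    by (rule C.finsum_lsum[symmetric]) (use finite_support pc m in \<open>auto dest!: D\<close>)
  also have "\<dots> = (\<Oplus>s\<in>support. lsum C (\<lambda>(a, b). a \<otimes> proj s b) ts \<otimes> mu g s)"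
  proof (rule C.finsum_cong')
    fix s assume s: "s \<in> support"
    show "lsum C (\<lambda>t. (case t of (a, b) \<Rightarrow> a \<otimes> proj s b) \<otimes> mu g s) ts = lsum C (\<lambda>(a, b). a \<otimes> proj s b) ts \<otimes> mu g s"
      by (rule C.lsum_mult_right[symmetric]) (use s pc m in \<open>auto dest!: D\<close>)
  next
    have "lsum C (\<lambda>(a, b). a \<otimes> proj s b) ts \<otimes> mu g s \<in> carrier C" if "s \<in> support" for s
      by (rule C.m_closed[OF C.lsum_closed]) (use that pc m in \<open>auto dest!: D\<close>)
    then show "(\<lambda>s. lsum C (\<lambda>(a, b). a \<otimes> proj s b) ts \<otimes> mu g s) \<in> support \<rightarrow> carrier C"
      by blast
  qed auto
  finally show ?thesis .
qed

text \<open>For k in the inertia subgroup but outside the support, a tensor with canonical image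
  delta at k would give a combination of these characters that vanishes on the whole support.
  Independence over the support kills its coefficients, so it vanishes at k too, where it should be
  one.\<close>

theorem support_eq_inertia: "support = inertia"
proof (rule ccontr)
  assume "support \<noteq> inertia"
  then obtain k where k: "k \<in> inertia" "k \<notin> support" using support_inertia by auto
  obtain ts where ts: "set ts \<subseteq> carrier C \<times> carrier C"
    "\<And>g. g \<in> carrier G \<Longrightarrow> lsum C (\<lambda>(a, b). a \<otimes> \<sigma> g b) ts = (if g = k then \<one> else \<zero>)"
    by (rule Galois_surj[of "\<lambda>g. if g = k then \<one> else \<zero>"]) simp_all
  define c where "c s = lsum C (\<lambda>(a, b). a \<otimes> proj s b) ts" for s
  have c: "c s \<in> carrier C" if "s \<in> support" for s
    unfolding c_def by (rule C.lsum_closed) (use that ts(1) proj_closed supportD in \<open>auto dest!: subsetD[OF ts(1)]\<close>)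
  have *: "(\<Oplus>s\<in>support. c s \<otimes> mu g s) = (if g = k then \<one> else \<zero>)" if "g \<in> inertia" for g
    using inertia_expand[OF ts(1) that] ts(2)[of g] that by (simp add: c_def inertia_def)
  have "c s = \<zero>" if "s \<in> support" for s
    by (rule mu_independent[OF c _ that]) (use * k support_inertia in auto)
  then have "(\<Oplus>s\<in>support. c s \<otimes> mu k s) = \<zero>"
    using mu(4) k(1) by (intro C.add.finprod_one_eqI[folded finsum_def, simplified]) (simp add: inertia_def)
  then show False using *[OF k(1)] one_not_zero by simp
qed

end

section \<open>Embedding a finite extension into an algebraically closed field\<close>

lemma (in algebraically_closed) has_root:
  assumes "p \<in> carrier (poly_ring L)" "degree p \<ge> 1"
  obtains w where "w \<in> carrier L" "eval p w = \<zero>"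
proof -
  have "size (roots p) = degree p" using roots_over_carrier[OF assms(1)] by (simp add: splitted_def)
  then have "roots p \<noteq> {#}" using assms(2) by auto
  then obtain w where "w \<in># roots p" by blast
  then have "is_root p w" using roots_mem_iff_is_root[OF assms(1)] by simp
  then show ?thesis using that by (auto simp: is_root_def)
qed

text \<open>Moving coefficients by h respects sums and products up to \<open>normalize\<close>,
  which drops leading zeros and does not change the value at w.\<close>

lemma (in ring_hom_ring) eval_map_hom:
  assumes w: "w \<in> carrier S" and S: "cring S"
  shows "(\<lambda>p. S.eval (map h p) w) \<in> ring_hom (poly_ring R) S"
proof (rule ring_hom_memI)
  have set: "set p \<subseteq> carrier R" if "p \<in> carrier (poly_ring R)" for p
    using that by (auto simp: univ_poly_carrier[symmetric] polynomial_def)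
  have mset: "set (map h p) \<subseteq> carrier S" if "set p \<subseteq> carrier R" for p using that by auto
  show "S.eval (map h p) w \<in> carrier S" if "p \<in> carrier (poly_ring R)" for p
    using S.eval_in_carrier[OF mset[OF set[OF that]] w] .
  show "S.eval (map h (p \<otimes>\<^bsub>poly_ring R\<^esub> q)) w = S.eval (map h p) w \<otimes>\<^bsub>S\<^esub> S.eval (map h q) w"
    if "p \<in> carrier (poly_ring R)" "q \<in> carrier (poly_ring R)" for p q
  proof -
    note pq = set[OF that(1)] set[OF that(2)]
    have "S.eval (map h (p \<otimes>\<^bsub>poly_ring R\<^esub> q)) w = S.eval (S.normalize (map h (R.poly_mult p q))) w"
      using S.eval_normalize[OF mset[OF R.poly_mult_in_carrier[OF pq]] w] by (simp add: univ_poly_mult)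
    also have "\<dots> = S.eval (map h p) w \<otimes>\<^bsub>S\<^esub> S.eval (map h q) w"
      unfolding poly_mult_hom'[OF pq] using cring.eval_poly_mult[OF S mset[OF pq(1)] mset[OF pq(2)] w] .
    finally show ?thesis .
  qed
  show "S.eval (map h (p \<oplus>\<^bsub>poly_ring R\<^esub> q)) w = S.eval (map h p) w \<oplus>\<^bsub>S\<^esub> S.eval (map h q) w"
    if "p \<in> carrier (poly_ring R)" "q \<in> carrier (poly_ring R)" for p q
  proof -
    note pq = set[OF that(1)] set[OF that(2)]
    have "S.eval (map h (p \<oplus>\<^bsub>poly_ring R\<^esub> q)) w = S.eval (S.normalize (map h (R.poly_add p q))) w"
      using S.eval_normalize[OF mset[OF R.poly_add_in_carrier[OF pq]] w] by (simp add: univ_poly_add)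
    also have "\<dots> = S.eval (map h p) w \<oplus>\<^bsub>S\<^esub> S.eval (map h q) w"
      unfolding poly_add_hom'[OF pq] using S.eval_poly_add[OF mset[OF pq(1)] mset[OF pq(2)] w] .
    finally show ?thesis .
  qed
  show "S.eval (map h \<one>\<^bsub>poly_ring R\<^esub>) w = \<one>\<^bsub>S\<^esub>"
    using w by (simp add: univ_poly_one)
qed

text \<open>The homomorphism theorem in elementary form: \<psi> is computed on some preimage under
  f, and the condition on kernels makes the choice irrelevant.\<close>

lemma ring_hom_factor:
  assumes P: "ring P" and B: "ring B" and C: "ring C"
    and f: "f \<in> ring_hom P B" and k: "k \<in> ring_hom P C"
    and ker: "\<And>p. \<lbrakk>p \<in> carrier P; f p = \<zero>\<^bsub>B\<^esub>\<rbrakk> \<Longrightarrow> k p = \<zero>\<^bsub>C\<^esub>"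
  obtains \<psi> where "\<And>p. p \<in> carrier P \<Longrightarrow> \<psi> (f p) = k p" "\<psi> \<in> ring_hom (B\<lparr>carrier := f ` carrier P\<rparr>) C"
proof -
  interpret f: ring_hom_ring P B f by (rule ring_hom_ringI2[OF P B f])
  interpret k: ring_hom_ring P C k by (rule ring_hom_ringI2[OF P C k])
  define \<psi> where "\<psi> b = k (SOME p. p \<in> carrier P \<and> f p = b)" for b
  have \<psi>: "\<psi> (f p) = k p" if p: "p \<in> carrier P" for p
  proof -
    define q where "q = (SOME q. q \<in> carrier P \<and> f q = f p)"
    have q: "q \<in> carrier P" "f q = f p"
      using someI[of "\<lambda>q. q \<in> carrier P \<and> f q = f p" p] p by (auto simp: q_def)
    have "f (q \<ominus>\<^bsub>P\<^esub> p) = \<zero>\<^bsub>B\<^esub>" using p q by (simp add: f.R.minus_eq f.S.r_neg)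
    then have "k (q \<ominus>\<^bsub>P\<^esub> p) = \<zero>\<^bsub>C\<^esub>" using ker p q by simp
    then have "k q \<ominus>\<^bsub>C\<^esub> k p = \<zero>\<^bsub>C\<^esub>" using p q by (simp add: f.R.minus_eq k.S.minus_eq)
    then show ?thesis using p q by (simp add: \<psi>_def q_def[symmetric] k.S.r_right_minus_eq)
  qed
  have "\<psi> \<in> ring_hom (B\<lparr>carrier := f ` carrier P\<rparr>) C"
  proof (rule ring_hom_memI)
    fix x assume "x \<in> carrier (B\<lparr>carrier := f ` carrier P\<rparr>)"
    then obtain p where p: "p \<in> carrier P" "x = f p" by auto
    then show "\<psi> x \<in> carrier C" using \<psi> by simp
    fix y assume "y \<in> carrier (B\<lparr>carrier := f ` carrier P\<rparr>)"
    then obtain q where q: "q \<in> carrier P" "y = f q" by auto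
    show "\<psi> (x \<otimes>\<^bsub>B\<lparr>carrier := f ` carrier P\<rparr>\<^esub> y) = \<psi> x \<otimes>\<^bsub>C\<^esub> \<psi> y"
      using p q \<psi>[of "p \<otimes>\<^bsub>P\<^esub> q"] by (simp add: \<psi>)
    show "\<psi> (x \<oplus>\<^bsub>B\<lparr>carrier := f ` carrier P\<rparr>\<^esub> y) = \<psi> x \<oplus>\<^bsub>C\<^esub> \<psi> y"
      using p q \<psi>[of "p \<oplus>\<^bsub>P\<^esub> q"] by (simp add: \<psi>)
  next
    show "\<psi> \<one>\<^bsub>B\<lparr>carrier := f ` carrier P\<rparr>\<^esub> = \<one>\<^bsub>C\<^esub>" using \<psi>[of "\<one>\<^bsub>P\<^esub>"] by simp
  qed
  with \<psi> that show ?thesis by blast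
qed

text \<open>The new element z is sent to a root w of its minimal polynomial with coefficients moved
  by h. This is consistent because the polynomials vanishing at z are multiples of the minimal one,
  so their transported versions vanish at w.\<close>

lemma extend_embedding:
  assumes E: "field E" and A: "subfield A E" and z: "z \<in> carrier E" and alg: "(ring.algebraic E over A) z"
    and \<Omega>: "algebraically_closed \<Omega>" and h: "h \<in> ring_hom (E\<lparr>carrier := A\<rparr>) \<Omega>"
  obtains B \<psi> where "subfield B E" "A \<subseteq> B" "z \<in> B" "\<psi> \<in> ring_hom (E\<lparr>carrier := B\<rparr>) \<Omega>" "\<And>x. x \<in> A \<Longrightarrow> \<psi> x = h x"
proof -
  interpret E: field E by fact
  interpret \<Omega>: algebraically_closed \<Omega> by fact
  have subr: "subring A E" using subfieldE(1)[OF A] .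
  interpret A: field "E\<lparr>carrier := A\<rparr>" using E.subfield_iff(2)[OF A] .
  interpret h: ring_hom_ring "E\<lparr>carrier := A\<rparr>" \<Omega> h
    by (rule ring_hom_ringI2[OF A.ring_axioms \<Omega>.ring_axioms h])
  let ?P = "A[X]\<^bsub>E\<^esub>" and ?m = "E.Irr A z"
  interpret P: ring ?P by (rule E.univ_poly_is_ring[OF subr])
  have P_eq: "poly_ring (E\<lparr>carrier := A\<rparr>) = ?P" using E.univ_poly_consistent[OF subr] by simp
  have m: "?m \<in> carrier ?P" "degree ?m \<ge> 1"
    using E.IrrE(1)[OF A z alg] E.pirreducible_degree[OF A E.IrrE(1,2)[OF A z alg]] by auto
  have "map h ?m \<in> carrier (poly_ring \<Omega>)"
    using polynomial_hom[OF h A.field_axioms \<Omega>.field_axioms] m(1) P_eq by simp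
  then obtain w where w: "w \<in> carrier \<Omega>" "\<Omega>.eval (map h ?m) w = \<zero>\<^bsub>\<Omega>\<^esub>"
    using \<Omega>.has_root[of "map h ?m"] m(2) by auto
  define \<Phi> where "\<Phi> p = \<Omega>.eval (map h p) w" for p
  have \<Phi>: "\<Phi> \<in> ring_hom ?P \<Omega>"
    using h.eval_map_hom[OF w(1) \<Omega>.is_cring] unfolding P_eq \<Phi>_def .
  have ev: "(\<lambda>p. E.eval p z) \<in> ring_hom ?P E"
    by (rule E.eval_is_hom[OF subr z])
  have ker: "\<Phi> p = \<zero>\<^bsub>\<Omega>\<^esub>" if p: "p \<in> carrier ?P" "E.eval p z = \<zero>\<^bsub>E\<^esub>" for p
  proof -
    have "p \<in> PIdl\<^bsub>?P\<^esub> ?m"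
      using E.Irr_generates_ker[OF A z alg] p unfolding a_kernel_def' by auto
    then obtain r where r: "r \<in> carrier ?P" "p = r \<otimes>\<^bsub>?P\<^esub> ?m" by (auto simp: cgenideal_def)
    then have "\<Phi> p = \<Phi> r \<otimes>\<^bsub>\<Omega>\<^esub> \<Phi> ?m" using ring_hom_mult[OF \<Phi> r(1) m(1)] by simp
    then show ?thesis using w ring_hom_closed[OF \<Phi> r(1)] by (simp add: \<Phi>_def)
  qed
  obtain \<psi> where \<psi>: "\<And>p. p \<in> carrier ?P \<Longrightarrow> \<psi> (E.eval p z) = \<Phi> p"
    "\<psi> \<in> ring_hom (E\<lparr>carrier := (\<lambda>p. E.eval p z) ` carrier ?P\<rparr>) \<Omega>"
    using ring_hom_factor[OF P.ring_axioms E.ring_axioms \<Omega>.ring_axioms ev \<Phi> ker] by blast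
  have B: "E.simple_extension A z = (\<lambda>p. E.eval p z) ` carrier ?P"
    by (rule E.simple_extension_as_eval_img) (use subringE(1)[OF subr] z in auto)
  show ?thesis
  proof (rule that[of "E.simple_extension A z" \<psi>])
    show "subfield (E.simple_extension A z) E" using E.simple_extension_is_subfield[OF A z] alg by simp
    show "A \<subseteq> E.simple_extension A z" by (rule E.simple_extension_incl) (use subringE(1)[OF subr] z in auto)
    show "z \<in> E.simple_extension A z" by (rule E.simple_extension_mem) (use subr z in auto)
    show "\<psi> \<in> ring_hom (E\<lparr>carrier := E.simple_extension A z\<rparr>) \<Omega>" unfolding B by (rule \<psi>(2))
    fix x assume x: "x \<in> A"
    show "\<psi> x = h x"
    \<comment> \<open>A nonzero constant is the polynomial \<open>[x]\<close>, but zero is the empty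
      list.\<close>
    proof (cases "x = \<zero>\<^bsub>E\<^esub>")
      case True
      have "\<psi> (E.eval [] z) = \<Phi> []" by (rule \<psi>(1)) (simp add: univ_poly_zero_closed)
      then show ?thesis using True h.hom_zero by (simp add: \<Phi>_def)
    next
      case False
      have "[x] \<in> carrier ?P" using x False by (simp add: univ_poly_carrier[symmetric] polynomial_def)
      then have "\<psi> (E.eval [x] z) = \<Phi> [x]" by (rule \<psi>(1))
      moreover have "E.eval [x] z = x" using x subringE(1)[OF subr] z by auto
      moreover have "\<Phi> [x] = h x" using h.hom_closed[of x] x w by (simp add: \<Phi>_def)
      ultimately show ?thesis by simp
    qed
  qed
qed

text \<open>A finite spanning list is adjoined element by element, each being algebraic over the
  subfield reached so far. A subfield containing \<open>A\<close> and the list contains its span,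
  hence everything.\<close>

lemma embedding_exists:
  assumes E: "field E" and A: "subfield A E" and fd: "ring.finite_dimension E A (carrier E)"
    and \<Omega>: "algebraically_closed \<Omega>" and h: "h \<in> ring_hom (E\<lparr>carrier := A\<rparr>) \<Omega>"
  obtains \<psi> where "\<psi> \<in> ring_hom E \<Omega>" "\<And>x. x \<in> A \<Longrightarrow> \<psi> x = h x"
proof -
  interpret E: field E by fact
  obtain n where "E.dimension n A (carrier E)" using fd by (auto simp: E.finite_dimension_def)
  then obtain Us where Us: "set Us \<subseteq> carrier E" "E.Span A Us = carrier E"
    using E.exists_base[OF A] E.independent_in_carrier by metis
  have "\<exists>B \<psi>. subfield B E \<and> A \<subseteq> B \<and> set vs \<subseteq> B \<and> \<psi> \<in> ring_hom (E\<lparr>carrier := B\<rparr>) \<Omega> \<and> (\<forall>x\<in>A. \<psi> x = h x)"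
    if "set vs \<subseteq> carrier E" for vs
    using that
  proof (induction vs)
    case Nil
    then show ?case using A h by auto
  next
    case (Cons v vs)
    then obtain B \<psi> where B: "subfield B E" "A \<subseteq> B" "set vs \<subseteq> B" "\<psi> \<in> ring_hom (E\<lparr>carrier := B\<rparr>) \<Omega>" "\<forall>x\<in>A. \<psi> x = h x"
      by auto
    have "(E.algebraic over A) v"
      by (rule E.finite_dimension_imp_algebraic[OF A E.carrier_is_subring fd]) (use Cons.prems in auto)
    then have alg: "(E.algebraic over B) v" by (rule E.algebraic_mono[OF B(2)])
    obtain B' \<psi>' where "subfield B' E" "B \<subseteq> B'" "v \<in> B'" "\<psi>' \<in> ring_hom (E\<lparr>carrier := B'\<rparr>) \<Omega>" "\<And>x. x \<in> B \<Longrightarrow> \<psi>' x = \<psi> x"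
      using extend_embedding[OF E B(1) _ alg \<Omega> B(4)] Cons.prems by auto
    then show ?case using B by (intro exI[of _ B'] exI[of _ \<psi>']) auto
  qed
  from this[OF Us(1)] obtain B \<psi> where B: "subfield B E" "A \<subseteq> B" "set Us \<subseteq> B"
    "\<psi> \<in> ring_hom (E\<lparr>carrier := B\<rparr>) \<Omega>" "\<forall>x\<in>A. \<psi> x = h x" by auto
  have "E.Span A Us \<subseteq> B"
    by (rule E.subalgebra_Span_incl[OF A _ B(3)])
      (use subring.axioms(1)[OF subfieldE(1)[OF B(1)]] B(2) subringE(6)[OF subfieldE(1)[OF B(1)]] in
        \<open>auto simp: subalgebra_def subalgebra_axioms_def\<close>)
  then have "B = carrier E" using Us(2) subfieldE(3)[OF B(1)] by auto
  with B that show ?thesis by auto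
qed

section \<open>Crossed products\<close>

lemma (in monoid) unit_of_products:
  assumes "a \<in> carrier G" "b \<in> carrier G" "a \<otimes> b \<in> Units G" "b \<otimes> a \<in> Units G"
  shows "a \<in> Units G"
proof -
  define l where "l = inv (b \<otimes> a) \<otimes> b"
  define r where "r = b \<otimes> inv (a \<otimes> b)"
  have c: "l \<in> carrier G" "r \<in> carrier G" using assms by (simp_all add: l_def r_def)
  have e: "l \<otimes> a = \<one>" "a \<otimes> r = \<one>"
    using assms by (simp_all add: l_def r_def m_assoc) (simp add: m_assoc[symmetric])
  then have "l = r" using inv_unique[of l a r] assms c by simp
  with e c assms show ?thesis by (auto simp: Units_def)
qed

context galois_data
begin

abbreviation "K \<equiv> carrier (ker_group \<Omega> F G L \<theta>)"

lemma K_carrier: "k \<in> K \<Longrightarrow> k \<in> carrier G"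
  and K_\<theta>: "\<lbrakk>k \<in> K; x \<in> L\<rbrakk> \<Longrightarrow> \<theta> k x = x"
  by (simp_all add: mem_ker)

lemma K_one: "\<one>\<^sub>G \<in> K"
  by (simp add: mem_ker \<theta>_id)

lemma K_mult: "\<lbrakk>k \<in> K; l \<in> K\<rbrakk> \<Longrightarrow> k \<bullet> l \<in> K"
  by (simp add: mem_ker \<theta>_comp)

lemma K_inv: "k \<in> K \<Longrightarrow> inv\<^sub>G k \<in> K"
  using \<theta>_inverse(2) by (auto simp: mem_ker) metis

lemma finite_K: "finite K"
  using finite_G K_carrier by (meson finite_subset subsetI)

lemma K_translate: "k \<in> K \<Longrightarrow> (\<lambda>x. k \<bullet> x) ` K = K"
proof
  assume k: "k \<in> K"
  show "K \<subseteq> (\<lambda>x. k \<bullet> x) ` K"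
  proof
    fix x assume x: "x \<in> K"
    have "x = k \<bullet> (inv\<^sub>G k \<bullet> x)" using k x K_carrier by (simp add: G.m_assoc[symmetric])
    then show "x \<in> (\<lambda>x. k \<bullet> x) ` K" using k x K_inv K_mult by blast
  qed
qed (use K_mult in auto)

lemma K_inj: "k \<in> K \<Longrightarrow> inj_on (\<lambda>x. k \<bullet> x) K"
  using K_carrier by (auto intro!: inj_onI)

end

text \<open>The common ground of both directions: every simple Galois extension gives such data, and
  so does the algebra built from a triple. Associativity and the action belong to \<open>C\<close>,
  so the cocycle identities for \<tau> and f are read off from \<open>C\<close> by comparing
  coordinates. The generators are arbitrary; in particular u at the identity may differ from the
  unit.\<close>

locale crossed_data = D: galois_data \<Omega> F G L \<theta> + A: action_algebra "\<Omega>\<lparr>carrier := F\<rparr>" C G \<sigma>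
  for \<Omega> and F and G and L and \<theta> and C (structure) and \<sigma> +
  fixes \<iota> u \<tau> f
  assumes \<iota>_hom: "\<iota> \<in> ring_hom (\<Omega>\<lparr>carrier := L\<rparr>) C"
    and \<iota>_F: "\<And>r. r \<in> F \<Longrightarrow> \<iota> r = r \<odot>\<^bsub>C\<^esub> \<one>"
    and u_closed: "\<And>k. k \<in> D.K \<Longrightarrow> u k \<in> carrier C"
    and u_\<iota>: "\<And>k x. \<lbrakk>k \<in> D.K; x \<in> L\<rbrakk> \<Longrightarrow> u k \<otimes> \<iota> x = \<iota> x \<otimes> u k"
    and u_mult: "\<And>k l. \<lbrakk>k \<in> D.K; l \<in> D.K\<rbrakk> \<Longrightarrow> u k \<otimes> u l = \<iota> (\<tau> (k, l)) \<otimes> u (k \<bullet> l)"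
    and \<tau>_closed: "\<And>k l. \<lbrakk>k \<in> D.K; l \<in> D.K\<rbrakk> \<Longrightarrow> \<tau> (k, l) \<in> L - {\<zero>\<^sub>L}"
    and \<tau>_ext: "\<tau> \<in> extensional (D.K \<times> D.K)"
    and \<sigma>_\<iota>: "\<And>g x. \<lbrakk>g \<in> carrier G; x \<in> L\<rbrakk> \<Longrightarrow> \<sigma> g (\<iota> x) = \<iota> (\<theta> g x)"
    and f_closed: "\<And>k g. \<lbrakk>k \<in> D.K; g \<in> carrier G\<rbrakk> \<Longrightarrow> f k g \<in> L - {\<zero>\<^sub>L}"
    and \<sigma>_u: "\<And>k g. \<lbrakk>k \<in> D.K; g \<in> carrier G\<rbrakk> \<Longrightarrow> \<sigma> g (u k) = \<iota> (f k g) \<otimes> u k"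
    and f_\<tau>: "\<And>k l. \<lbrakk>k \<in> D.K; l \<in> D.K\<rbrakk> \<Longrightarrow> f k l \<ast> \<tau> (k, l) = \<tau> (l, k)"
    and nondeg: "\<And>l. \<lbrakk>l \<in> D.K; \<forall>k\<in>D.K. f k l = \<one>\<^sub>L\<rbrakk> \<Longrightarrow> l = \<one>\<^sub>G"
    and span: "\<And>c. c \<in> carrier C \<Longrightarrow> \<exists>z. (\<forall>k\<in>D.K. z k \<in> L) \<and> c = (\<Oplus>k\<in>D.K. \<iota> (z k) \<otimes> u k)"
    and indep: "\<And>z k. \<lbrakk>\<And>k. k \<in> D.K \<Longrightarrow> z k \<in> L; (\<Oplus>k\<in>D.K. \<iota> (z k) \<otimes> u k) = \<zero>; k \<in> D.K\<rbrakk> \<Longrightarrow> z k = \<zero>\<^sub>L"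
begin

lemma \<iota>_closed: "x \<in> L \<Longrightarrow> \<iota> x \<in> carrier C"
  using ring_hom_closed[OF \<iota>_hom] by simp

lemma \<iota>_mult: "\<lbrakk>x \<in> L; y \<in> L\<rbrakk> \<Longrightarrow> \<iota> (x \<ast> y) = \<iota> x \<otimes> \<iota> y"
  using ring_hom_mult[OF \<iota>_hom] by simp

lemma \<iota>_add: "\<lbrakk>x \<in> L; y \<in> L\<rbrakk> \<Longrightarrow> \<iota> (x \<oplus>\<^bsub>\<Omega>\<^esub> y) = \<iota> x \<oplus> \<iota> y"
  using ring_hom_add[OF \<iota>_hom] by simp

lemma \<iota>_one: "\<iota> \<one>\<^sub>L = \<one>"
  using ring_hom_one[OF \<iota>_hom] by simp

lemma \<iota>_zero: "\<iota> \<zero>\<^sub>L = \<zero>"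
  using ring_hom_zero[OF \<iota>_hom D.L.ring_axioms A.C.ring_axioms] by simp

lemmas Lc = D.L_carrier
lemma L_mult: "\<lbrakk>x \<in> L; y \<in> L\<rbrakk> \<Longrightarrow> x \<ast> y \<in> L" using D.L_ring by blast
lemma L_add: "\<lbrakk>x \<in> L; y \<in> L\<rbrakk> \<Longrightarrow> x \<oplus>\<^bsub>\<Omega>\<^esub> y \<in> L" using D.L_ring by blast
lemma L_minus: "x \<in> L \<Longrightarrow> \<ominus>\<^bsub>\<Omega>\<^esub> x \<in> L" using D.L_ring by blast
lemma L_one: "\<one>\<^sub>L \<in> L" and L_zero: "\<zero>\<^sub>L \<in> L" using D.L_ring by blast+
lemma \<tau>_L: "\<lbrakk>k \<in> D.K; l \<in> D.K\<rbrakk> \<Longrightarrow> \<tau> (k, l) \<in> L" using \<tau>_closed by blast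
lemma f_L: "\<lbrakk>k \<in> D.K; g \<in> carrier G\<rbrakk> \<Longrightarrow> f k g \<in> L" using f_closed by blast

lemma one_not_zero: "\<one> \<noteq> \<zero>"
proof
  assume "\<one> = \<zero>"
  then have C: "carrier C = {\<zero>}" by (rule A.C.one_zeroD)
  have "(\<Oplus>k\<in>D.K. \<iota> \<one>\<^sub>L \<otimes> u k) = \<zero>"
    by (rule A.C.add.finprod_one_eqI[folded finsum_def, simplified]) (use C u_closed \<iota>_closed[OF L_one] in auto)
  then have "\<one>\<^sub>L = \<zero>\<^sub>L" using indep[of "\<lambda>_. \<one>\<^sub>L"] L_one D.K_one by blast
  then show False by simp
qed

lemma \<iota>_unit: "\<lbrakk>x \<in> L; x \<noteq> \<zero>\<^sub>L\<rbrakk> \<Longrightarrow> \<iota> x \<in> Units C" "\<lbrakk>x \<in> L; x \<noteq> \<zero>\<^sub>L\<rbrakk> \<Longrightarrow> inv \<iota> x = \<iota> (inv\<^sub>L x)"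
proof -
  assume x: "x \<in> L" "x \<noteq> \<zero>\<^sub>L"
  note i = D.L_inv[OF x]
  have e: "\<iota> x \<otimes> \<iota> (inv\<^sub>L x) = \<one>" "\<iota> (inv\<^sub>L x) \<otimes> \<iota> x = \<one>"
    using \<iota>_mult[OF x(1) i(1)] \<iota>_mult[OF i(1) x(1)] i \<iota>_one by simp_all
  then show "\<iota> x \<in> Units C" using \<iota>_closed x i by (auto simp: Units_def)
  show "inv \<iota> x = \<iota> (inv\<^sub>L x)"
    by (rule A.C.inv_unique'[symmetric]) (use e \<iota>_closed x i in auto)
qed

lemma \<iota>_inj: "\<lbrakk>x \<in> L; y \<in> L; \<iota> x = \<iota> y\<rbrakk> \<Longrightarrow> x = y"
proof (rule ccontr)
  assume xy: "x \<in> L" "y \<in> L" "\<iota> x = \<iota> y" "x \<noteq> y"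
  have d: "x \<ominus>\<^bsub>\<Omega>\<^esub> y \<in> L" "x \<ominus>\<^bsub>\<Omega>\<^esub> y \<noteq> \<zero>\<^sub>L"
    using xy L_add L_minus Lc by (auto simp: D.minus_eq) (metis D.minus_eq D.r_right_minus_eq)
  have "\<iota> (x \<ominus>\<^bsub>\<Omega>\<^esub> y) \<oplus> \<iota> y = \<iota> x" using \<iota>_add[OF d(1) xy(2)] xy Lc by (simp add: D.minus_eq D.a_assoc D.l_neg)
  then have "\<iota> (x \<ominus>\<^bsub>\<Omega>\<^esub> y) = \<zero>" using xy \<iota>_closed d by simp
  then show False using \<iota>_unit(1)[OF d] one_not_zero A.C.Units_l_inv[of \<zero>] A.C.Units_inv_closed[of \<zero>] by auto
qed

definition \<Phi> where "\<Phi> z = (\<Oplus>k\<in>D.K. \<iota> (z k) \<otimes> u k)"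

lemma \<Phi>_closed: "(\<And>k. k \<in> D.K \<Longrightarrow> z k \<in> L) \<Longrightarrow> \<Phi> z \<in> carrier C"
  unfolding \<Phi>_def by (rule A.C.finsum_closed) (use \<iota>_closed u_closed in auto)

lemma \<Phi>_cong: "(\<And>k. k \<in> D.K \<Longrightarrow> z k \<in> L) \<Longrightarrow> (\<And>k. k \<in> D.K \<Longrightarrow> z k = w k) \<Longrightarrow> \<Phi> z = \<Phi> w"
  unfolding \<Phi>_def by (rule A.C.finsum_cong') (use \<iota>_closed u_closed in auto)

lemma \<Phi>_add:
  assumes "\<And>k. k \<in> D.K \<Longrightarrow> z k \<in> L" "\<And>k. k \<in> D.K \<Longrightarrow> w k \<in> L"
  shows "\<Phi> z \<oplus> \<Phi> w = \<Phi> (\<lambda>k. z k \<oplus>\<^bsub>\<Omega>\<^esub> w k)"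
proof -
  have "\<Phi> (\<lambda>k. z k \<oplus>\<^bsub>\<Omega>\<^esub> w k) = (\<Oplus>k\<in>D.K. \<iota> (z k) \<otimes> u k \<oplus> \<iota> (w k) \<otimes> u k)"
    unfolding \<Phi>_def by (rule A.C.finsum_cong') (use assms \<iota>_closed u_closed \<iota>_add in \<open>auto simp: A.C.l_distr\<close>)
  also have "\<dots> = \<Phi> z \<oplus> \<Phi> w"
    unfolding \<Phi>_def by (rule A.C.finsum_addf) (use assms \<iota>_closed u_closed in auto)
  finally show ?thesis by simp
qed

lemma \<Phi>_scale:
  assumes "\<And>k. k \<in> D.K \<Longrightarrow> z k \<in> L" "x \<in> L"
  shows "\<iota> x \<otimes> \<Phi> z = \<Phi> (\<lambda>k. x \<ast> z k)"
proof -
  have "\<iota> x \<otimes> \<Phi> z = (\<Oplus>k\<in>D.K. \<iota> x \<otimes> (\<iota> (z k) \<otimes> u k))"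
    unfolding \<Phi>_def by (rule A.C.finsum_rdistr) (use D.finite_K assms \<iota>_closed u_closed in auto)
  also have "\<dots> = \<Phi> (\<lambda>k. x \<ast> z k)"
    unfolding \<Phi>_def by (rule A.C.finsum_cong') (use assms \<iota>_closed u_closed \<iota>_mult L_mult in \<open>auto simp: A.C.m_assoc\<close>)
  finally show ?thesis .
qed

lemma \<Phi>_inj:
  assumes z: "\<And>k. k \<in> D.K \<Longrightarrow> z k \<in> L" and w: "\<And>k. k \<in> D.K \<Longrightarrow> w k \<in> L" and eq: "\<Phi> z = \<Phi> w" and k: "k \<in> D.K"
  shows "z k = w k"
proof -
  let ?m = "\<lambda>k. (\<ominus>\<^bsub>\<Omega>\<^esub> \<one>\<^sub>L) \<ast> w k"
  have m: "k \<in> D.K \<Longrightarrow> ?m k \<in> L" for k using w L_mult L_minus L_one by blast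
  have "\<Phi> (\<lambda>k. z k \<oplus>\<^bsub>\<Omega>\<^esub> ?m k) = \<Phi> z \<oplus> \<Phi> ?m" by (rule \<Phi>_add[symmetric]) (use z m in auto)
  also have "\<Phi> ?m = \<Phi> (\<lambda>k. (\<ominus>\<^bsub>\<Omega>\<^esub> \<one>\<^sub>L) \<ast> z k)"
    using \<Phi>_scale[of z "\<ominus>\<^bsub>\<Omega>\<^esub> \<one>\<^sub>L", OF z] \<Phi>_scale[of w "\<ominus>\<^bsub>\<Omega>\<^esub> \<one>\<^sub>L", OF w] eq L_minus L_one by simp
  also have "\<Phi> z \<oplus> \<Phi> (\<lambda>k. (\<ominus>\<^bsub>\<Omega>\<^esub> \<one>\<^sub>L) \<ast> z k) = \<Phi> (\<lambda>k. z k \<oplus>\<^bsub>\<Omega>\<^esub> ((\<ominus>\<^bsub>\<Omega>\<^esub> \<one>\<^sub>L) \<ast> z k))"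
    by (rule \<Phi>_add) (use z L_mult L_minus L_one in auto)
  also have "\<dots> = \<Phi> (\<lambda>k. \<zero>\<^sub>L)"
    by (rule \<Phi>_cong) (use z L_mult L_minus L_add L_one L_zero Lc in \<open>auto simp: D.l_minus D.r_neg\<close>)
  also have "\<dots> = \<zero>"
    unfolding \<Phi>_def by (rule A.C.add.finprod_one_eqI[folded finsum_def, simplified]) (use u_closed \<iota>_zero in auto)
  finally have "z k \<oplus>\<^bsub>\<Omega>\<^esub> ?m k = \<zero>\<^sub>L"
    unfolding \<Phi>_def using indep[of "\<lambda>k. z k \<oplus>\<^bsub>\<Omega>\<^esub> ?m k" k] z m L_add k by blast
  then show ?thesis
    using D.r_right_minus_eq[of "z k" "w k"] z[OF k] w[OF k] Lc by (simp add: D.l_minus D.minus_eq)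
qed

lemma \<Phi>_surj: "c \<in> carrier C \<Longrightarrow> \<exists>z. (\<forall>k\<in>D.K. z k \<in> L) \<and> c = \<Phi> z"
  unfolding \<Phi>_def by (rule span)

lemma \<Phi>_single:
  assumes "k \<in> D.K" "x \<in> L"
  shows "\<Phi> (\<lambda>l. if k = l then x else \<zero>\<^sub>L) = \<iota> x \<otimes> u k"
proof -
  have "\<Phi> (\<lambda>l. if k = l then x else \<zero>\<^sub>L) = (\<Oplus>l\<in>D.K. if k = l then \<iota> x \<otimes> u l else \<zero>)"
    unfolding \<Phi>_def by (rule A.C.finsum_cong') (use assms \<iota>_closed u_closed \<iota>_zero in auto)
  also have "\<dots> = \<iota> x \<otimes> u k"
    using A.C.add.finprod_singleton[of k D.K "\<lambda>l. \<iota> x \<otimes> u l"] assms D.finite_K \<iota>_closed u_closed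
    by (simp add: finsum_def Pi_def)
  finally show ?thesis .
qed

lemma single_eqD:
  assumes "k \<in> D.K" "x \<in> L" "y \<in> L" "\<iota> x \<otimes> u k = \<iota> y \<otimes> u k"
  shows "x = y"
  using \<Phi>_inj[of "\<lambda>l. if k = l then x else \<zero>\<^sub>L" "\<lambda>l. if k = l then y else \<zero>\<^sub>L" k] \<Phi>_single assms L_zero
  by auto

text \<open>Both bracketings of u x u y u z, compared in the coordinate of the product.\<close>

lemma \<tau>_cocycle:
  assumes [simp]: "x \<in> D.K" "y \<in> D.K" "z \<in> D.K"
  shows "\<tau> (x, y) \<ast> \<tau> (x \<bullet> y, z) = \<tau> (x, y \<bullet> z) \<ast> \<tau> (y, z)"
proof (rule single_eqD)
  note [simp] = D.K_mult \<tau>_L \<iota>_closed u_closed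
  have "\<iota> (\<tau> (x, y) \<ast> \<tau> (x \<bullet> y, z)) \<otimes> u (x \<bullet> y \<bullet> z) = (u x \<otimes> u y) \<otimes> u z"
  proof -
    have "\<iota> (\<tau> (x, y) \<ast> \<tau> (x \<bullet> y, z)) \<otimes> u (x \<bullet> y \<bullet> z)
        = \<iota> (\<tau> (x, y)) \<otimes> (u (x \<bullet> y) \<otimes> u z)"
      by (simp add: \<iota>_mult u_mult A.C.m_assoc)
    also have "\<dots> = (u x \<otimes> u y) \<otimes> u z"
      by (subst u_mult[of x y]) (simp_all add: A.C.m_assoc)
    finally show ?thesis .
  qed
  also have "\<dots> = u x \<otimes> (\<iota> (\<tau> (y, z)) \<otimes> u (y \<bullet> z))" by (simp add: A.C.m_assoc u_mult[of y z])
  also have "\<dots> = \<iota> (\<tau> (y, z)) \<otimes> (u x \<otimes> u (y \<bullet> z))" by (simp add: A.C.m_assoc[symmetric] u_\<iota>)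
  also have "\<dots> = \<iota> (\<tau> (y, z) \<ast> \<tau> (x, y \<bullet> z)) \<otimes> u (x \<bullet> y \<bullet> z)"
    using D.K_carrier by (simp add: \<iota>_mult u_mult A.C.m_assoc D.G.m_assoc)
  also have "\<tau> (y, z) \<ast> \<tau> (x, y \<bullet> z) = \<tau> (x, y \<bullet> z) \<ast> \<tau> (y, z)"
    using Lc by (simp add: D.m_comm)
  finally show "\<iota> (\<tau> (x, y) \<ast> \<tau> (x \<bullet> y, z)) \<otimes> u (x \<bullet> y \<bullet> z)
    = \<iota> (\<tau> (x, y \<bullet> z) \<ast> \<tau> (y, z)) \<otimes> u (x \<bullet> y \<bullet> z)" .
qed (use assms D.K_mult \<tau>_L L_mult in auto)

text \<open>Apply \<sigma> of a product to u k at once and in two stages.\<close>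

lemma f_cocycle:
  assumes [simp]: "k \<in> D.K" "g \<in> carrier G" "h \<in> carrier G"
  shows "f k (g \<bullet> h) = f k g \<ast> \<theta> g (f k h)"
proof (rule single_eqD)
  note [simp] = f_L \<iota>_closed u_closed D.\<theta>_closed
  have "\<iota> (f k (g \<bullet> h)) \<otimes> u k = \<sigma> g (\<iota> (f k h) \<otimes> u k)"
    using A.\<sigma>_comp[of g h "u k"] by (simp add: \<sigma>_u[symmetric])
  also have "\<dots> = \<iota> (\<theta> g (f k h)) \<otimes> (\<iota> (f k g) \<otimes> u k)"
    by (simp add: A.\<sigma>_mult \<sigma>_\<iota> \<sigma>_u)
  also have "\<dots> = \<iota> (\<theta> g (f k h) \<ast> f k g) \<otimes> u k" by (simp add: A.C.m_assoc \<iota>_mult)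
  also have "\<theta> g (f k h) \<ast> f k g = f k g \<ast> \<theta> g (f k h)" using Lc by (simp add: D.m_comm)
  finally show "\<iota> (f k (g \<bullet> h)) \<otimes> u k = \<iota> (f k g \<ast> \<theta> g (f k h)) \<otimes> u k" .
qed (use assms f_L D.\<theta>_closed L_mult in auto)

text \<open>Apply \<sigma> g to u x u y, factor by factor and through the single coordinate of the
  product.\<close>

lemma f_coboundary:
  assumes [simp]: "x \<in> D.K" "y \<in> D.K" "g \<in> carrier G"
  shows "f x g \<ast> f y g \<ast> \<tau> (x, y) = \<theta> g (\<tau> (x, y)) \<ast> f (x \<bullet> y) g"
proof (rule single_eqD)
  note [simp] = f_L \<iota>_closed u_closed D.\<theta>_closed \<tau>_L D.K_mult L_mult
  have "\<iota> (f x g \<ast> f y g \<ast> \<tau> (x, y)) \<otimes> u (x \<bullet> y) = \<iota> (f x g) \<otimes> (\<iota> (f y g) \<otimes> (u x \<otimes> u y))"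
    by (simp add: \<iota>_mult u_mult A.C.m_assoc)
  also have "\<dots> = (\<iota> (f x g) \<otimes> u x) \<otimes> (\<iota> (f y g) \<otimes> u y)"
  proof -
    have "u x \<otimes> (\<iota> (f y g) \<otimes> u y) = \<iota> (f y g) \<otimes> (u x \<otimes> u y)"
      by (simp add: A.C.m_assoc[symmetric] u_\<iota>)
    then show ?thesis by (simp add: A.C.m_assoc)
  qed
  also have "\<dots> = \<sigma> g (u x \<otimes> u y)" by (simp add: A.\<sigma>_mult \<sigma>_u)
  also have "\<dots> = \<iota> (\<theta> g (\<tau> (x, y)) \<ast> f (x \<bullet> y) g) \<otimes> u (x \<bullet> y)"
    by (simp add: u_mult A.\<sigma>_mult \<sigma>_u \<sigma>_\<iota> \<iota>_mult A.C.m_assoc)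
  finally show "\<iota> (f x g \<ast> f y g \<ast> \<tau> (x, y)) \<otimes> u (x \<bullet> y)
    = \<iota> (\<theta> g (\<tau> (x, y)) \<ast> f (x \<bullet> y) g) \<otimes> u (x \<bullet> y)" .
qed (use assms f_L D.\<theta>_closed L_mult \<tau>_L D.K_mult in auto)

lemma f_one: "k \<in> D.K \<Longrightarrow> f k \<one>\<^sub>G = \<one>\<^sub>L"
  by (rule single_eqD[of k]) (use \<sigma>_u[of k "\<one>\<^sub>G"] A.\<sigma>_id u_closed \<iota>_one L_one f_L in auto)

lemma f_K_mult: "\<lbrakk>k \<in> D.K; x \<in> D.K; g \<in> carrier G\<rbrakk> \<Longrightarrow> f k (x \<bullet> g) = f k x \<ast> f k g"
  using f_cocycle[of k x g] D.K_carrier D.K_\<theta> f_L by simp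

text \<open>Commutativity of \<open>G\<close> enters here. Expanding f k at g x and at x g by the
  cocycle rule, with x acting trivially on \<open>L\<close>, leaves \<theta> g (f k x) = f k x for
  every g.\<close>

lemma f_K_F:
  assumes k: "k \<in> D.K" and x: "x \<in> D.K"
  shows "f k x \<in> F"
proof (rule D.fixed)
  show "f k x \<in> L" using f_L k x D.K_carrier by blast
  show "\<forall>g\<in>carrier G. \<theta> g (f k x) = f k x"
  proof
    fix g assume g: "g \<in> carrier G"
    have "f k (g \<bullet> x) = f k (x \<bullet> g)" using g x D.K_carrier D.G.m_comm by simp
    then have "f k g \<ast> \<theta> g (f k x) = f k g \<ast> f k x"
      using f_cocycle[of k g x] f_K_mult[of k x g] k x g D.K_carrier f_L Lc D.m_comm by simp
    moreover have "f k g \<in> carrier \<Omega> - {\<zero>\<^sub>L}" using f_closed[OF k g] Lc by auto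
    moreover have "\<theta> g (f k x) \<in> carrier \<Omega>" "f k x \<in> carrier \<Omega>"
      using D.\<theta>_closed g f_L k x D.K_carrier Lc by auto
    ultimately show "\<theta> g (f k x) = f k x" using D.m_lcancel by auto
  qed
qed

text \<open>This is the coboundary relation at an element of \<open>K\<close>: there \<theta> is
  trivial and the factor \<tau> (x, y) cancels.\<close>

lemma f_bichar:
  assumes "x \<in> D.K" "y \<in> D.K" "k \<in> D.K"
  shows "f (x \<bullet> y) k = f x k \<ast> f y k"
proof -
  have c: "f x k \<ast> f y k \<in> carrier \<Omega>" "f (x \<bullet> y) k \<in> carrier \<Omega>" "\<tau> (x, y) \<in> carrier \<Omega> - {\<zero>\<^sub>L}"
    using assms f_L D.K_carrier D.K_mult Lc \<tau>_closed by auto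
  have "\<tau> (x, y) \<ast> (f x k \<ast> f y k) = \<tau> (x, y) \<ast> f (x \<bullet> y) k"
    using f_coboundary[of x y k] assms D.K_carrier D.K_\<theta> \<tau>_L c D.m_comm by auto
  then show ?thesis using D.m_lcancel c by auto
qed

lemma f_alternating: "k \<in> D.K \<Longrightarrow> f k k = \<one>\<^sub>L"
  using f_\<tau>[of k k] \<tau>_closed[of k k] f_L[of k k] D.K_carrier Lc
  by (metis D.m_rcancel D.one_closed D.l_one DiffD1 DiffD2 singletonI)

lemma f_swap:
  assumes "x \<in> D.K" "y \<in> D.K"
  shows "f x y \<ast> f y x = \<one>\<^sub>L"
proof -
  have c: "f x y \<in> carrier \<Omega>" "f y x \<in> carrier \<Omega>" "\<tau> (x, y) \<in> carrier \<Omega>" "\<tau> (x, y) \<noteq> \<zero>\<^sub>L"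
    using assms f_L D.K_carrier Lc \<tau>_closed by auto
  have "f y x \<ast> (f x y \<ast> \<tau> (x, y)) = \<tau> (x, y)"
    unfolding f_\<tau>[OF assms] f_\<tau>[OF assms(2,1)] ..
  then have "(f x y \<ast> f y x) \<ast> \<tau> (x, y) = \<one>\<^sub>L \<ast> \<tau> (x, y)"
    using c by (simp add: D.m_assoc D.m_comm D.m_lcomm)
  then show ?thesis using c D.m_rcancel by (metis D.m_closed D.one_closed)
qed

text \<open>The cocycle is not normalized, so the position of the unit has to be found. Multiplying
  the expansion of the unit by the generator at the identity and comparing coordinates shows that
  the unit has no coordinate elsewhere, which makes that generator a multiple of the unit.\<close>

lemma one_\<Phi>: "u \<one>\<^sub>G = \<iota> (\<tau> (\<one>\<^sub>G, \<one>\<^sub>G))"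
proof -
  note [simp] = D.K_one D.K_mult \<tau>_L u_closed \<iota>_closed L_mult
  let ?t = "\<tau> (\<one>\<^sub>G, \<one>\<^sub>G)"
  obtain z where z: "\<And>k. k \<in> D.K \<Longrightarrow> z k \<in> L" "\<one> = \<Phi> z" using \<Phi>_surj[of \<one>] by blast
  have "\<Phi> z \<otimes> u \<one>\<^sub>G = (\<Oplus>k\<in>D.K. \<iota> (z k) \<otimes> u k \<otimes> u \<one>\<^sub>G)"
    unfolding \<Phi>_def by (rule A.C.finsum_ldistr) (use D.finite_K z in auto)
  also have "\<dots> = \<Phi> (\<lambda>k. z k \<ast> \<tau> (k, \<one>\<^sub>G))"
    unfolding \<Phi>_def by (rule A.C.finsum_cong') (use z D.K_carrier in \<open>auto simp: A.C.m_assoc u_mult \<iota>_mult\<close>)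
  finally have *: "\<Phi> (\<lambda>k. z k \<ast> \<tau> (k, \<one>\<^sub>G)) = \<iota> \<one>\<^sub>L \<otimes> u \<one>\<^sub>G" using z(2) \<iota>_one by simp
  have **: "z k \<ast> \<tau> (k, \<one>\<^sub>G) = (if \<one>\<^sub>G = k then \<one>\<^sub>L else \<zero>\<^sub>L)" if k: "k \<in> D.K" for k
    by (rule \<Phi>_inj[OF _ _ _ k]) (use z * \<Phi>_single[of "\<one>\<^sub>G" "\<one>\<^sub>L"] L_one L_zero in auto)
  have "z k = (if \<one>\<^sub>G = k then z \<one>\<^sub>G else \<zero>\<^sub>L)" if k: "k \<in> D.K" for k
    using **[OF k] z(1)[OF k] \<tau>_closed[OF k D.K_one] Lc D.integral_iff[of "z k" "\<tau> (k, \<one>\<^sub>G)"] by (auto split: if_splits)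
  then have "\<Phi> z = \<Phi> (\<lambda>k. if \<one>\<^sub>G = k then z \<one>\<^sub>G else \<zero>\<^sub>L)" using z(1) by (intro \<Phi>_cong) auto
  then have "\<one> = \<iota> (z \<one>\<^sub>G) \<otimes> u \<one>\<^sub>G" using z \<Phi>_single by simp
  then have "\<iota> ?t = \<iota> ?t \<otimes> (\<iota> (z \<one>\<^sub>G) \<otimes> u \<one>\<^sub>G)" by (metis A.C.r_one D.K_one \<iota>_closed \<tau>_L)
  also have "\<dots> = \<iota> (z \<one>\<^sub>G \<ast> ?t) \<otimes> u \<one>\<^sub>G"
    using z(1) Lc by (simp add: A.C.m_assoc[symmetric] \<iota>_mult[symmetric] D.m_comm)
  also have "z \<one>\<^sub>G \<ast> ?t = \<one>\<^sub>L" using **[OF D.K_one] by simp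
  finally show ?thesis by (simp add: \<iota>_one)
qed

lemma u_unit: "k \<in> D.K \<Longrightarrow> u k \<in> Units C"
proof -
  assume k: "k \<in> D.K"
  have *: "u x \<otimes> u (inv\<^sub>G x) \<in> Units C" if x: "x \<in> D.K" for x
  proof -
    have "u x \<otimes> u (inv\<^sub>G x) = \<iota> (\<tau> (x, inv\<^sub>G x)) \<otimes> \<iota> (\<tau> (\<one>\<^sub>G, \<one>\<^sub>G))"
      using u_mult[OF x D.K_inv[OF x]] x D.K_carrier by (simp add: one_\<Phi>[symmetric])
    then show ?thesis using \<iota>_unit(1) \<tau>_closed x D.K_inv D.K_one by auto
  qed
  have "u (inv\<^sub>G k) \<otimes> u k \<in> Units C" using *[OF D.K_inv[OF k]] k D.K_carrier by simp
  with *[OF k] show ?thesis using A.C.unit_of_products u_closed[OF k] u_closed[OF D.K_inv[OF k]] by blast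
qed

end

lemma (in monoid) unit_cancel_right:
  assumes "x \<in> Units G" "a \<in> carrier G" "b \<in> carrier G" "a \<otimes> x = b \<otimes> x"
  shows "a = b"
  using assms by (metis Units_closed Units_inv_closed Units_r_inv m_assoc r_one)

lemma bi_sum_cong:
  assumes "bi_sum A \<alpha> S \<phi>" "\<And>g. g \<in> S \<Longrightarrow> \<phi> g = \<psi> g"
  shows "bi_sum A \<alpha> S \<psi>"
  using assms(1) unfolding bi_sum_def by (simp add: assms(2) cong: ball_cong)

section \<open>Centre, grading, Galois property and simplicity of a crossed product\<close>

context crossed_data
begin

lemma \<iota>_central: "\<lbrakk>x \<in> L; c \<in> carrier C\<rbrakk> \<Longrightarrow> \<iota> x \<otimes> c = c \<otimes> \<iota> x"
proof -
  assume x: "x \<in> L" and c: "c \<in> carrier C"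
  obtain z where z: "\<forall>k\<in>D.K. z k \<in> L" "c = \<Phi> z" using \<Phi>_surj[OF c] by blast
  have "c \<otimes> \<iota> x = (\<Oplus>k\<in>D.K. \<iota> (z k) \<otimes> u k \<otimes> \<iota> x)"
    unfolding z(2) \<Phi>_def by (rule A.C.finsum_ldistr) (use D.finite_K z x \<iota>_closed u_closed in auto)
  also have "\<dots> = \<Phi> (\<lambda>k. x \<ast> z k)"
    unfolding \<Phi>_def
  proof (rule A.C.finsum_cong')
    fix k assume k: "k \<in> D.K"
    have "\<iota> (z k) \<otimes> u k \<otimes> \<iota> x = \<iota> (z k) \<otimes> \<iota> x \<otimes> u k"
      using k z x \<iota>_closed u_closed u_\<iota> by (simp add: A.C.m_assoc)
    also have "\<dots> = \<iota> (x \<ast> z k) \<otimes> u k" using k z x Lc by (simp add: \<iota>_mult[symmetric] D.m_comm)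
    finally show "\<iota> (z k) \<otimes> u k \<otimes> \<iota> x = \<iota> (x \<ast> z k) \<otimes> u k" .
  qed (use z x \<iota>_closed u_closed L_mult in auto)
  also have "\<dots> = \<iota> x \<otimes> c" unfolding z(2) using z x by (intro \<Phi>_scale[symmetric]) auto
  finally show ?thesis by simp
qed

lemma u_swap: "\<lbrakk>k \<in> D.K; l \<in> D.K\<rbrakk> \<Longrightarrow> u l \<otimes> u k = \<iota> (f k l) \<otimes> (u k \<otimes> u l)"
  using D.G.m_comm[of k l] D.K_carrier f_\<tau> f_L \<tau>_L \<iota>_closed u_closed D.K_mult
  by (simp add: u_mult A.C.m_assoc[symmetric] \<iota>_mult[symmetric])

text \<open>It suffices to look at the terms \<iota> (z l) \<otimes> u l: exchanging u k with u l
  costs exactly the factor f l k by which \<sigma> k scales u l, and \<sigma> k fixes \<iota> (z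
  l).\<close>

lemma u_homogeneous: "\<lbrakk>k \<in> D.K; c \<in> carrier C\<rbrakk> \<Longrightarrow> u k \<otimes> c = \<sigma> k c \<otimes> u k"
proof -
  assume k: "k \<in> D.K" and c: "c \<in> carrier C"
  have kG: "k \<in> carrier G" using D.K_carrier k by blast
  obtain z where z: "\<forall>k\<in>D.K. z k \<in> L" "c = \<Phi> z" using \<Phi>_surj[OF c] by blast
  have *: "u k \<otimes> (\<iota> (z l) \<otimes> u l) = \<sigma> k (\<iota> (z l) \<otimes> u l) \<otimes> u k" if l: "l \<in> D.K" for l
  proof -
    have zl: "z l \<in> L" using z l by blast
    note [simp] = zl \<iota>_closed[OF zl] u_closed[OF k] u_closed[OF l] f_L[OF l kG] \<iota>_closed[OF f_L[OF l kG]]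
    have "u k \<otimes> (\<iota> (z l) \<otimes> u l) = \<iota> (z l) \<otimes> (u k \<otimes> u l)"
      using k l by (simp add: A.C.m_assoc[symmetric] u_\<iota>)
    also have "\<dots> = \<iota> (z l) \<otimes> (\<iota> (f l k) \<otimes> u l) \<otimes> u k"
      using u_swap[OF l k] by (simp add: A.C.m_assoc)
    also have "\<iota> (z l) \<otimes> (\<iota> (f l k) \<otimes> u l) = \<sigma> k (\<iota> (z l) \<otimes> u l)"
      using k l kG D.K_\<theta> by (simp add: A.\<sigma>_mult \<sigma>_\<iota> \<sigma>_u)
    finally show ?thesis .
  qed
  have "u k \<otimes> c = (\<Oplus>l\<in>D.K. u k \<otimes> (\<iota> (z l) \<otimes> u l))"
    unfolding z(2) \<Phi>_def by (rule A.C.finsum_rdistr) (use D.finite_K z k \<iota>_closed u_closed in auto)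
  also have "\<dots> = (\<Oplus>l\<in>D.K. \<sigma> k (\<iota> (z l) \<otimes> u l) \<otimes> u k)"
    by (rule A.C.finsum_cong') (use * z k kG \<iota>_closed u_closed A.\<sigma>_closed in auto)
  also have "\<dots> = (\<Oplus>l\<in>D.K. \<sigma> k (\<iota> (z l) \<otimes> u l)) \<otimes> u k"
    by (rule A.C.finsum_ldistr[symmetric]) (use D.finite_K z k kG \<iota>_closed u_closed A.\<sigma>_closed in auto)
  also have "(\<Oplus>l\<in>D.K. \<sigma> k (\<iota> (z l) \<otimes> u l)) = \<sigma> k c"
    unfolding z(2) \<Phi>_def
    by (rule A.C.finsum_hom[OF A.C.abelian_group_axioms, symmetric])
      (use z kG \<iota>_closed u_closed A.\<sigma>_closed A.\<sigma>_add in auto)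
  finally show ?thesis .
qed

lemma \<Phi>_\<sigma>:
  assumes z: "\<And>k. k \<in> D.K \<Longrightarrow> z k \<in> L" and g: "g \<in> carrier G"
  shows "\<sigma> g (\<Phi> z) = \<Phi> (\<lambda>k. \<theta> g (z k) \<ast> f k g)"
proof -
  have "\<sigma> g (\<Phi> z) = (\<Oplus>k\<in>D.K. \<sigma> g (\<iota> (z k) \<otimes> u k))"
    unfolding \<Phi>_def
    by (rule A.C.finsum_hom[OF A.C.abelian_group_axioms]) (use z g \<iota>_closed u_closed A.\<sigma>_closed A.\<sigma>_add in auto)
  also have "\<dots> = \<Phi> (\<lambda>k. \<theta> g (z k) \<ast> f k g)"
    unfolding \<Phi>_def
    by (rule A.C.finsum_cong')
      (use z g \<iota>_closed u_closed A.\<sigma>_mult \<sigma>_\<iota> \<sigma>_u D.\<theta>_closed f_L L_mult in \<open>auto simp: A.C.m_assoc \<iota>_mult\<close>)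
  finally show ?thesis .
qed

lemma finsum_\<iota>:
  assumes "\<And>i. i \<in> I \<Longrightarrow> x i \<in> L"
  shows "\<iota> (finsum \<Omega> x I) = (\<Oplus>i\<in>I. \<iota> (x i))"
proof -
  have "\<iota> (finsum (\<Omega>\<lparr>carrier := L\<rparr>) x I) = (\<Oplus>i\<in>I. \<iota> (x i))"
    by (rule D.L.finsum_hom[OF A.C.abelian_group_axioms]) (use assms \<iota>_closed \<iota>_add in auto)
  then show ?thesis using D.finsum_carrier_update[OF D.subring_L, of I x, OF assms] by simp
qed

text \<open>The product in coordinates depends on \<tau> alone, which is why crossed products with
  equal cocycles can be matched coordinatewise.\<close>

lemma \<Phi>_mult:
  assumes z: "\<And>k. k \<in> D.K \<Longrightarrow> z k \<in> L" and w: "\<And>k. k \<in> D.K \<Longrightarrow> w k \<in> L"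
  shows "\<Phi> z \<otimes> \<Phi> w = \<Phi> (\<lambda>k. \<Oplus>\<^bsub>\<Omega>\<^esub>x\<in>D.K. z x \<ast> w (inv\<^sub>G x \<bullet> k) \<ast> \<tau> (x, inv\<^sub>G x \<bullet> k))"
proof -
  define p where "p x k = z x \<ast> w (inv\<^sub>G x \<bullet> k) \<ast> \<tau> (x, inv\<^sub>G x \<bullet> k)" for x k
  have p: "p x k \<in> L" if "x \<in> D.K" "k \<in> D.K" for x k
    using that z w \<tau>_L D.K_inv D.K_mult L_mult by (simp add: p_def)
  have "\<Phi> z \<otimes> \<Phi> w = (\<Oplus>x\<in>D.K. \<iota> (z x) \<otimes> u x \<otimes> \<Phi> w)"
    unfolding \<Phi>_def[of z] by (rule A.C.finsum_ldistr) (use D.finite_K z \<iota>_closed u_closed \<Phi>_closed[OF w] in auto)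
  also have "\<dots> = (\<Oplus>x\<in>D.K. \<Oplus>k\<in>D.K. \<iota> (p x k) \<otimes> u k)"
  proof (rule A.C.finsum_cong')
    fix x assume x: "x \<in> D.K"
    have "\<iota> (z x) \<otimes> u x \<otimes> \<Phi> w = (\<Oplus>y\<in>D.K. \<iota> (z x) \<otimes> u x \<otimes> (\<iota> (w y) \<otimes> u y))"
      unfolding \<Phi>_def by (rule A.C.finsum_rdistr) (use D.finite_K z w x \<iota>_closed u_closed in auto)
    also have "\<dots> = (\<Oplus>y\<in>D.K. \<iota> (p x (x \<bullet> y)) \<otimes> u (x \<bullet> y))"
    proof (rule A.C.finsum_cong')
      fix y assume y: "y \<in> D.K"
      note [simp] = x y z[OF x] w[OF y] \<iota>_closed[OF z[OF x]] \<iota>_closed[OF w[OF y]] u_closed[OF x] u_closed[OF y]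
        \<tau>_L[OF x y] \<iota>_closed[OF \<tau>_L[OF x y]] u_closed[OF D.K_mult[OF x y]]
      have e: "inv\<^sub>G x \<bullet> (x \<bullet> y) = y" using D.K_carrier by (simp add: D.G.m_assoc[symmetric])
      have "\<iota> (z x) \<otimes> u x \<otimes> (\<iota> (w y) \<otimes> u y) = \<iota> (z x) \<otimes> (\<iota> (w y) \<otimes> (u x \<otimes> u y))"
      proof -
        have "u x \<otimes> (\<iota> (w y) \<otimes> u y) = \<iota> (w y) \<otimes> (u x \<otimes> u y)" by (simp add: A.C.m_assoc[symmetric] u_\<iota>)
        then show ?thesis by (simp add: A.C.m_assoc)
      qed
      also have "\<dots> = \<iota> (p x (x \<bullet> y)) \<otimes> u (x \<bullet> y)"
        unfolding p_def e by (simp add: u_mult \<iota>_mult L_mult A.C.m_assoc)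
      finally show "\<iota> (z x) \<otimes> u x \<otimes> (\<iota> (w y) \<otimes> u y) = \<iota> (p x (x \<bullet> y)) \<otimes> u (x \<bullet> y)" .
    qed (use x p D.K_mult \<iota>_closed u_closed in auto)
    also have "\<dots> = (\<Oplus>k\<in>(\<lambda>y. x \<bullet> y) ` D.K. \<iota> (p x k) \<otimes> u k)"
      by (rule A.C.finsum_reindex[symmetric])
        (use x p D.K_inj D.K_translate \<iota>_closed u_closed in auto)
    finally show "\<iota> (z x) \<otimes> u x \<otimes> \<Phi> w = (\<Oplus>k\<in>D.K. \<iota> (p x k) \<otimes> u k)"
      using D.K_translate[OF x] by simp
  qed (use p \<iota>_closed u_closed in auto)
  also have "\<dots> = (\<Oplus>k\<in>D.K. \<Oplus>x\<in>D.K. \<iota> (p x k) \<otimes> u k)"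
    by (rule A.C.finsum_swap) (use D.finite_K p \<iota>_closed u_closed in auto)
  also have "\<dots> = \<Phi> (\<lambda>k. \<Oplus>\<^bsub>\<Omega>\<^esub>x\<in>D.K. p x k)"
    unfolding \<Phi>_def
  proof (rule A.C.finsum_cong')
    fix k assume k: "k \<in> D.K"
    have "(\<Oplus>x\<in>D.K. \<iota> (p x k) \<otimes> u k) = (\<Oplus>x\<in>D.K. \<iota> (p x k)) \<otimes> u k"
      by (rule A.C.finsum_ldistr[symmetric]) (use D.finite_K p k \<iota>_closed u_closed in auto)
    then show "(\<Oplus>x\<in>D.K. \<iota> (p x k) \<otimes> u k) = \<iota> (\<Oplus>\<^bsub>\<Omega>\<^esub>x\<in>D.K. p x k) \<otimes> u k"
      using finsum_\<iota>[of D.K "\<lambda>x. p x k"] p k by simp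
  next
    have "(\<Oplus>\<^bsub>\<Omega>\<^esub>x\<in>D.K. p x k) \<in> L" if "k \<in> D.K" for k
      by (rule D.finsum_L) (use p that in auto)
    then show "(\<lambda>k. \<iota> (\<Oplus>\<^bsub>\<Omega>\<^esub>x\<in>D.K. p x k) \<otimes> u k) \<in> D.K \<rightarrow> carrier C"
      using \<iota>_closed u_closed by blast
  qed simp
  finally show ?thesis by (simp add: p_def)
qed

lemma coordinate_zero:
  assumes z: "\<And>k. k \<in> D.K \<Longrightarrow> z k \<in> L" and c: "\<And>k. k \<in> D.K \<Longrightarrow> c k \<in> L"
    and eq: "\<Phi> z = \<Phi> (\<lambda>k. c k \<ast> z k)" and k: "k \<in> D.K" "c k \<noteq> \<one>\<^sub>L"
  shows "z k = \<zero>\<^sub>L"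
proof (rule ccontr)
  assume n: "z k \<noteq> \<zero>\<^sub>L"
  have "z k = c k \<ast> z k" by (rule \<Phi>_inj[OF z _ eq k(1)]) (use z c L_mult in auto)
  then have "\<one>\<^sub>L \<ast> z k = c k \<ast> z k" using z k Lc by simp
  then show False using n z[OF k(1)] c[OF k(1)] Lc k(2) D.m_rcancel[of "z k" "\<one>\<^sub>L" "c k"] by auto
qed

text \<open>Nondegeneracy applied to the quotient of k and l, which pairs trivially with every
  t.\<close>

lemma f_distinct:
  assumes "k \<in> D.K" "l \<in> D.K" "\<And>t. t \<in> D.K \<Longrightarrow> f t k = f t l"
  shows "k = l"
proof -
  have "f t (inv\<^sub>G l \<bullet> k) = \<one>\<^sub>L" if t: "t \<in> D.K" for t
    using f_K_mult[OF t D.K_inv[OF assms(2)], of k] f_K_mult[OF t D.K_inv[OF assms(2)], of l] f_one[OF t]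
      assms D.K_carrier t by simp
  then have "inv\<^sub>G l \<bullet> k = \<one>\<^sub>G" by (intro nondeg ballI D.K_mult D.K_inv assms(1,2))
  then have "l \<bullet> (inv\<^sub>G l \<bullet> k) = l" using assms D.K_carrier by simp
  then show ?thesis using assms D.K_carrier by (simp add: D.G.m_assoc[symmetric])
qed

text \<open>Commuting an element a of degree k past u t in two ways gives a = \<iota> (f t k)
  \<otimes> \<sigma> t a. In a coordinate l where a does not vanish this reads f t k f l t = 1,
  hence f t k = f t l for all t, and nondegeneracy forces l = k.\<close>

lemma homogeneous_eq:
  assumes k: "k \<in> D.K"
  shows "homogeneous C \<sigma> k = (\<lambda>x. \<iota> x \<otimes> u k) ` L"
proof
  have kG: "k \<in> carrier G" using D.K_carrier k by blast
  show "(\<lambda>x. \<iota> x \<otimes> u k) ` L \<subseteq> homogeneous C \<sigma> k"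
  proof clarify
    fix x assume x: "x \<in> L"
    have "\<iota> x \<otimes> u k \<otimes> c = \<sigma> k c \<otimes> (\<iota> x \<otimes> u k)" if c: "c \<in> carrier C" for c
    proof -
      note [simp] = \<iota>_closed[OF x] u_closed[OF k] c A.\<sigma>_closed[OF kG c]
      have "\<iota> x \<otimes> u k \<otimes> c = \<iota> x \<otimes> \<sigma> k c \<otimes> u k" using u_homogeneous[OF k c] by (simp add: A.C.m_assoc)
      also have "\<dots> = \<sigma> k c \<otimes> \<iota> x \<otimes> u k" using \<iota>_central[OF x, of "\<sigma> k c"] by simp
      finally show ?thesis by (simp add: A.C.m_assoc)
    qed
    then show "\<iota> x \<otimes> u k \<in> homogeneous C \<sigma> k" using x k \<iota>_closed u_closed by (simp add: homogeneous_def)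
  qed
  show "homogeneous C \<sigma> k \<subseteq> (\<lambda>x. \<iota> x \<otimes> u k) ` L"
  proof
    fix a assume a: "a \<in> homogeneous C \<sigma> k"
    then have ac: "a \<in> carrier C" "\<And>b. b \<in> carrier C \<Longrightarrow> a \<otimes> b = \<sigma> k b \<otimes> a" by (auto simp: homogeneous_def)
    obtain z where z: "\<And>k. k \<in> D.K \<Longrightarrow> z k \<in> L" "a = \<Phi> z" using \<Phi>_surj[OF ac(1)] by blast
    have zero: "z l = \<zero>\<^sub>L" if l: "l \<in> D.K" "l \<noteq> k" for l
    proof (rule ccontr)
      assume n: "z l \<noteq> \<zero>\<^sub>L"
      have "f t k = f t l" if t: "t \<in> D.K" for t
      proof -
        have tG: "t \<in> carrier G" using t D.K_carrier by blast
        note [simp] = f_L[OF t kG] \<iota>_closed[OF f_L[OF t kG]] u_closed[OF t] ac(1) A.\<sigma>_closed[OF tG ac(1)]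
        have "a \<otimes> u t = \<iota> (f t k) \<otimes> (u t \<otimes> a)" using ac(2)[of "u t"] \<sigma>_u[OF t kG] by (simp add: A.C.m_assoc)
        also have "\<dots> = \<iota> (f t k) \<otimes> \<sigma> t a \<otimes> u t" using u_homogeneous[OF t ac(1)] by (simp add: A.C.m_assoc)
        finally have fin: "a \<otimes> u t = \<iota> (f t k) \<otimes> \<sigma> t a \<otimes> u t" .
        have "a = \<iota> (f t k) \<otimes> \<sigma> t a"
          by (rule A.C.unit_cancel_right[OF u_unit[OF t] _ _ fin]) simp_all
        also have "\<sigma> t a = \<Phi> (\<lambda>l. f l t \<ast> z l)"
          unfolding z(2)
          by (rule trans[OF \<Phi>_\<sigma> \<Phi>_cong]) (use z(1) D.\<theta>_closed tG f_L L_mult D.K_\<theta>[OF t] Lc D.m_comm in auto)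
        also have "\<iota> (f t k) \<otimes> \<Phi> (\<lambda>l. f l t \<ast> z l) = \<Phi> (\<lambda>l. f t k \<ast> (f l t \<ast> z l))"
          by (rule \<Phi>_scale) (use z f_L tG L_mult in auto)
        also have "\<dots> = \<Phi> (\<lambda>l. (f t k \<ast> f l t) \<ast> z l)"
          by (rule \<Phi>_cong) (use z(1) f_L tG kG t L_mult Lc in \<open>auto simp: D.m_assoc\<close>)
        finally have eq: "\<Phi> z = \<Phi> (\<lambda>l. (f t k \<ast> f l t) \<ast> z l)" using z(2) by simp
        have "f t k \<ast> f l t = \<one>\<^sub>L"
        proof (rule ccontr)
          assume "f t k \<ast> f l t \<noteq> \<one>\<^sub>L"
          then have "z l = \<zero>\<^sub>L"
            by (intro coordinate_zero[OF z(1) _ eq l(1)]) (use f_L tG L_mult in auto)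
          with n show False ..
        qed
        moreover have "f l t \<ast> f t l = \<one>\<^sub>L" by (rule f_swap[OF l(1) t])
        ultimately show "f t k = f t l"
          using D.inv_unique[of "f t k" "f l t" "f t l"] f_L t l D.K_carrier kG tG Lc by simp
      qed
      then show False using f_distinct[OF k l(1)] l(2) by simp
    qed
    have "a = \<Phi> (\<lambda>l. if k = l then z k else \<zero>\<^sub>L)"
      unfolding z(2) by (rule \<Phi>_cong) (use z zero in auto)
    then show "a \<in> (\<lambda>x. \<iota> x \<otimes> u k) ` L" using \<Phi>_single[OF k z(1)[OF k]] z(1)[OF k] by auto
  qed
qed

text \<open>The centre is the component of degree one, whose generator is itself the image of a
  nonzero element of \<open>L\<close>.\<close>

lemma center_eq: "ring_center C = \<iota> ` L"
proof -
  have "ring_center C = homogeneous C \<sigma> \<one>\<^sub>G"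
    using A.\<sigma>_id by (auto simp: homogeneous_def ring_center_def)
  also have "\<dots> = (\<lambda>x. \<iota> x \<otimes> \<iota> (\<tau> (\<one>\<^sub>G, \<one>\<^sub>G))) ` L" unfolding homogeneous_eq[OF D.K_one] one_\<Phi> ..
  also have "\<dots> = (\<lambda>x. \<iota> (x \<ast> \<tau> (\<one>\<^sub>G, \<one>\<^sub>G))) ` L" using \<tau>_L D.K_one by (simp add: \<iota>_mult)
  also have "\<dots> = \<iota> ` L"
  proof
    show "\<iota> ` L \<subseteq> (\<lambda>x. \<iota> (x \<ast> \<tau> (\<one>\<^sub>G, \<one>\<^sub>G))) ` L"
    proof clarify
      fix y assume y: "y \<in> L"
      let ?t = "\<tau> (\<one>\<^sub>G, \<one>\<^sub>G)"
      have t: "?t \<in> L" "?t \<noteq> \<zero>\<^sub>L" using \<tau>_closed D.K_one by auto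
      have "y = (y \<ast> inv\<^sub>L ?t) \<ast> ?t" using y t D.L_inv Lc by (simp add: D.m_assoc)
      then show "\<iota> y \<in> (\<lambda>x. \<iota> (x \<ast> ?t)) ` L" using y t D.L_inv L_mult
        by (intro image_eqI[of _ _ "y \<ast> inv\<^sub>L ?t"]) simp_all
    qed
  qed (use \<tau>_L D.K_one L_mult in auto)
  finally show ?thesis .
qed

text \<open>The separating functions are the quotients of \<sigma> g x by x, for x = u k or x in the
  image of \<open>L\<close>. Their values lie in the image of \<open>L\<close>, hence are central
  and do not depend on the side from which x is divided out, as the interpolation requires.\<close>

lemma delta: "bi_sum C \<sigma> (carrier G) (\<lambda>g. if \<one>\<^sub>G = g then \<one> else \<zero>)"
proof -
  have sep: "\<exists>a\<in>carrier C. \<exists>b\<in>carrier C. \<exists>p. (\<forall>g\<in>carrier G. p g \<in> L \<and> a \<otimes> \<sigma> g b = \<iota> (p g) \<and> \<sigma> g b \<otimes> a = \<iota> (p g)) \<and>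
      p \<one>\<^sub>G = \<one>\<^sub>L \<and> p h \<noteq> \<one>\<^sub>L" if h: "h \<in> carrier G" "h \<noteq> \<one>\<^sub>G" for h
  proof (cases "h \<in> D.K")
    case True
    then obtain k where k: "k \<in> D.K" "f k h \<noteq> \<one>\<^sub>L" using nondeg h by blast
    note uk = u_unit[OF k(1)] u_closed[OF k(1)]
    have e: "inv (u k) \<otimes> \<sigma> g (u k) = \<iota> (f k g)" "\<sigma> g (u k) \<otimes> inv (u k) = \<iota> (f k g)" if g: "g \<in> carrier G" for g
      using uk k g \<iota>_closed[OF f_L] by (simp_all add: \<sigma>_u u_\<iota>[OF k(1) f_L, symmetric] A.C.m_assoc[symmetric] f_L)
        (simp_all add: A.C.m_assoc u_\<iota>[OF k(1) f_L] f_L)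
    show ?thesis
      by (rule bexI[of _ "inv (u k)"], rule bexI[of _ "u k"], rule exI[of _ "f k"])
        (use e uk k f_one f_L in auto)
  next
    case False
    then obtain y where y: "y \<in> L" "\<theta> h y \<noteq> y" using h by (auto simp: D.mem_ker)
    have y0: "y \<noteq> \<zero>\<^sub>L" using y D.\<theta>_zero h by auto
    note i = D.L_inv[OF y(1) y0]
    have "inv\<^sub>L y \<ast> \<theta> h y \<noteq> \<one>\<^sub>L"
    proof
      assume "inv\<^sub>L y \<ast> \<theta> h y = \<one>\<^sub>L"
      then have "y \<ast> (inv\<^sub>L y \<ast> \<theta> h y) = y" using y Lc by simp
      then show False using y i h D.\<theta>_closed Lc by (simp add: D.m_assoc[symmetric])
    qed
    moreover have "\<iota> (inv\<^sub>L y) \<otimes> \<sigma> g (\<iota> y) = \<iota> (inv\<^sub>L y \<ast> \<theta> g y)"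
      "\<sigma> g (\<iota> y) \<otimes> \<iota> (inv\<^sub>L y) = \<iota> (inv\<^sub>L y \<ast> \<theta> g y)" if "g \<in> carrier G" for g
      using that y i D.\<theta>_closed Lc by (simp_all add: \<sigma>_\<iota> \<iota>_mult[symmetric] D.m_comm)
    ultimately show ?thesis
      by (intro bexI[of _ "\<iota> (inv\<^sub>L y)"] bexI[of _ "\<iota> y"] exI[of _ "\<lambda>g. inv\<^sub>L y \<ast> \<theta> g y"])
        (use y i \<iota>_closed D.\<theta>_closed L_mult D.\<theta>_id in auto)
  qed
  have "\<exists>\<phi>. bi_sum C \<sigma> (carrier G) \<phi> \<and> (\<forall>g\<in>carrier G. \<phi> g \<in> carrier C \<and> (\<forall>x\<in>carrier C. \<phi> g \<otimes> x = x \<otimes> \<phi> g)) \<and>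
    (\<forall>g\<in>{\<one>\<^sub>G}. \<phi> g = \<one>) \<and> (\<forall>g\<in>carrier G - {\<one>\<^sub>G}. \<phi> g = \<zero>)"
  proof (rule A.C.bi_sum_delta)
    fix h assume "h \<in> carrier G - {\<one>\<^sub>G}"
    then obtain a b p where abp: "a \<in> carrier C" "b \<in> carrier C"
      "\<And>g. g \<in> carrier G \<Longrightarrow> p g \<in> L" "\<And>g. g \<in> carrier G \<Longrightarrow> a \<otimes> \<sigma> g b = \<iota> (p g)"
      "\<And>g. g \<in> carrier G \<Longrightarrow> \<sigma> g b \<otimes> a = \<iota> (p g)" "p \<one>\<^sub>G = \<one>\<^sub>L" "p h \<noteq> \<one>\<^sub>L" "h \<in> carrier G"
      using sep[of h] by auto
    \<comment> \<open>One minus the value at h is a nonzero element of \<open>L\<close>, so its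
      inverse provides the central element d.\<close>
    define q where "q = \<one>\<^sub>L \<ominus>\<^bsub>\<Omega>\<^esub> p h"
    have q: "q \<in> L" "q \<noteq> \<zero>\<^sub>L"
      using abp L_one L_add L_minus Lc D.r_right_minus_eq[of "\<one>\<^sub>L" "p h"] by (auto simp: q_def D.minus_eq)
    have "\<iota> q \<oplus> \<iota> (p h) = \<one>"
      using abp q Lc by (simp add: \<iota>_add[symmetric] q_def D.minus_eq D.a_assoc D.l_neg \<iota>_one)
    then have "\<one> \<ominus> \<iota> (p h) = (\<iota> q \<oplus> \<iota> (p h)) \<ominus> \<iota> (p h)" by simp
    also have "\<dots> = \<iota> q"
      using \<iota>_closed[OF q(1)] \<iota>_closed[OF abp(3)[OF abp(8)]] by (simp add: A.C.minus_eq A.C.a_assoc A.C.r_neg)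
    finally have \<iota>q: "\<one> \<ominus> \<iota> (p h) = \<iota> q" .
    note i = D.L_inv[OF q]
    show "\<exists>a\<in>carrier C. \<exists>b\<in>carrier C. \<exists>d\<in>carrier C.
      (\<forall>g\<in>carrier G. a \<otimes> \<sigma> g b = \<sigma> g b \<otimes> a \<and> (\<forall>x\<in>carrier C. a \<otimes> \<sigma> g b \<otimes> x = x \<otimes> (a \<otimes> \<sigma> g b))) \<and>
      (\<forall>g\<in>{\<one>\<^sub>G}. a \<otimes> \<sigma> g b = \<one>) \<and> d \<otimes> (\<one> \<ominus> a \<otimes> \<sigma> h b) = \<one> \<and> (\<forall>x\<in>carrier C. d \<otimes> x = x \<otimes> d)"
    proof (rule bexI[OF _ abp(1)], rule bexI[OF _ abp(2)], rule bexI[of _ "\<iota> (inv\<^sub>L q)"], intro conjI ballI)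
      fix g assume g: "g \<in> carrier G"
      show "a \<otimes> \<sigma> g b = \<sigma> g b \<otimes> a" using abp(4,5)[OF g] by simp
      fix x assume "x \<in> carrier C"
      then show "a \<otimes> \<sigma> g b \<otimes> x = x \<otimes> (a \<otimes> \<sigma> g b)"
        unfolding abp(4)[OF g] by (rule \<iota>_central[OF abp(3)[OF g]])
    next
      fix g assume "g \<in> {\<one>\<^sub>G}"
      then show "a \<otimes> \<sigma> g b = \<one>" using abp(4)[of g] abp(6) \<iota>_one by simp
    next
      show "\<iota> (inv\<^sub>L q) \<otimes> (\<one> \<ominus> a \<otimes> \<sigma> h b) = \<one>"
        unfolding abp(4)[OF abp(8)] \<iota>q using \<iota>_mult[OF i(1) q(1)] i \<iota>_one by simp
    next
      fix x assume "x \<in> carrier C"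
      then show "\<iota> (inv\<^sub>L q) \<otimes> x = x \<otimes> \<iota> (inv\<^sub>L q)"
        by (rule \<iota>_central[OF i(1)])
    qed (rule \<iota>_closed[OF i(1)])
  qed (use D.finite_G A.\<sigma>_closed A.\<sigma>_mult A.\<sigma>_one in auto)
  then obtain \<phi> where \<phi>: "bi_sum C \<sigma> (carrier G) \<phi>" "\<phi> \<one>\<^sub>G = \<one>" "\<And>g. g \<in> carrier G - {\<one>\<^sub>G} \<Longrightarrow> \<phi> g = \<zero>" by auto
  show ?thesis by (rule bi_sum_cong[OF \<phi>(1)]) (use \<phi>(2,3) in auto)
qed

text \<open>Invariance under \<open>K\<close> alone kills the coordinates away from the identity, by
  nondegeneracy. What remains is the image of an element of \<open>L\<close> fixed by all \<theta>
  g, hence of an element of \<open>F\<close>.\<close>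

lemma fixed_scalars:
  assumes x: "x \<in> carrier C" and fix_x: "\<forall>g\<in>carrier G. \<sigma> g x = x"
  shows "x \<in> scalars (\<Omega>\<lparr>carrier := F\<rparr>) C"
proof -
  obtain z where z: "\<And>k. k \<in> D.K \<Longrightarrow> z k \<in> L" "x = \<Phi> z" using \<Phi>_surj[OF x] by blast
  have zero: "z k = \<zero>\<^sub>L" if k: "k \<in> D.K" "k \<noteq> \<one>\<^sub>G" for k
  proof -
    obtain l where l: "l \<in> D.K" "f l k \<noteq> \<one>\<^sub>L" using nondeg k by blast
    then have lG: "l \<in> carrier G" using D.K_carrier by blast
    have fkl: "f k l \<noteq> \<one>\<^sub>L"
      using f_swap[OF k(1) l(1)] l(2) f_L[OF l(1)] D.K_carrier k Lc by auto
    have "\<Phi> z = \<sigma> l (\<Phi> z)" using fix_x lG z(2) by simp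
    also have "\<dots> = \<Phi> (\<lambda>k. f k l \<ast> z k)"
      by (rule trans[OF \<Phi>_\<sigma> \<Phi>_cong]) (use z(1) D.\<theta>_closed lG f_L L_mult D.K_\<theta>[OF l(1)] Lc D.m_comm in auto)
    finally have eq: "\<Phi> z = \<Phi> (\<lambda>k. f k l \<ast> z k)" .
    show ?thesis
      by (rule coordinate_zero[where z=z and c="\<lambda>k. f k l" and k=k]) (use z(1) f_L lG eq k(1) fkl in auto)
  qed
  have "x = \<Phi> (\<lambda>k. if \<one>\<^sub>G = k then z \<one>\<^sub>G else \<zero>\<^sub>L)"
    unfolding z(2) by (rule \<Phi>_cong) (use z zero in auto)
  then have "x = \<iota> (z \<one>\<^sub>G) \<otimes> u \<one>\<^sub>G" using \<Phi>_single[OF D.K_one z(1)[OF D.K_one]] by simp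
  then have xy: "x = \<iota> (z \<one>\<^sub>G \<ast> \<tau> (\<one>\<^sub>G, \<one>\<^sub>G))" (is "x = \<iota> ?y")
    using one_\<Phi> z(1) D.K_one \<tau>_L by (simp add: \<iota>_mult)
  have y: "?y \<in> L" using z(1) D.K_one \<tau>_L L_mult by simp
  have "?y \<in> F"
  proof (rule D.fixed[OF y], rule ballI)
    fix g assume g: "g \<in> carrier G"
    have "\<iota> (\<theta> g ?y) = \<iota> ?y" using fix_x g xy y \<sigma>_\<iota> by metis
    then show "\<theta> g ?y = ?y" using \<iota>_inj D.\<theta>_closed g y by blast
  qed
  then show ?thesis using xy \<iota>_F by (auto simp: scalars_def)
qed

lemma Galois: "Galois_extension (\<Omega>\<lparr>carrier := F\<rparr>) G C \<sigma>"
  by (rule A.Galois_extension_intro[OF one_not_zero fixed_scalars delta])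

text \<open>The delta tensor acts as a coordinate filter: inserting c between its legs, with a shift
  by k, keeps only the term of degree k, and the result stays in the ideal. A nonzero coordinate
  thus becomes a unit inside the ideal.\<close>

lemma simple: "simple_ring C"
proof -
  have "I = carrier C" if I: "ideal I C" and ne: "I \<noteq> {\<zero>}" for I
  proof -
    interpret I: ideal I C by (rule I)
    obtain c where c: "c \<in> I" "c \<noteq> \<zero>" using ne I.zero_closed by auto
    then have cC: "c \<in> carrier C" using I.a_subset by auto
    obtain z where z: "\<And>k. k \<in> D.K \<Longrightarrow> z k \<in> L" "c = \<Phi> z" using \<Phi>_surj[OF cC] by blast
    have "\<exists>k\<in>D.K. z k \<noteq> \<zero>\<^sub>L"
    proof (rule ccontr)
      assume *: "\<not> (\<exists>k\<in>D.K. z k \<noteq> \<zero>\<^sub>L)"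
      have "\<Phi> z = \<zero>"
        unfolding \<Phi>_def by (rule A.C.add.finprod_one_eqI[folded finsum_def, simplified]) (use * u_closed \<iota>_zero in auto)
      then show False using c z by simp
    qed
    then obtain k where k: "k \<in> D.K" "z k \<noteq> \<zero>\<^sub>L" by blast
    have kG: "k \<in> carrier G" using k D.K_carrier by blast
    obtain ts where ts: "set ts \<subseteq> carrier C \<times> carrier C"
      "\<And>g. g \<in> carrier G \<Longrightarrow> lsum C (\<lambda>(a, b). a \<otimes> \<sigma> g b) ts = (if \<one>\<^sub>G = g then \<one> else \<zero>)"
      using delta unfolding bi_sum_def by metis
    have T: "(a, b) \<in> set ts \<Longrightarrow> a \<in> carrier C \<and> b \<in> carrier C" for a b using ts(1) by auto
    let ?i = "inv\<^sub>G k"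
    \<comment> \<open>Moving the second leg past u l applies \<sigma> l to it, so the l-th term of c
      contributes delta evaluated at l times the inverse of k.\<close>
    let ?S = "lsum C (\<lambda>(a, b). a \<otimes> c \<otimes> \<sigma> ?i b) ts"
    have "?S = lsum C (\<lambda>t. \<Oplus>l\<in>D.K. (case t of (a, b) \<Rightarrow> \<iota> (z l) \<otimes> (a \<otimes> \<sigma> (l \<bullet> ?i) b) \<otimes> u l)) ts"
    proof (rule lprod_cong, clarify)
      fix a b assume "(a, b) \<in> set ts"
      then have ab: "a \<in> carrier C" "b \<in> carrier C" using T by blast+
      have "a \<otimes> c = (\<Oplus>l\<in>D.K. a \<otimes> (\<iota> (z l) \<otimes> u l))"
        unfolding z(2) \<Phi>_def by (rule A.C.finsum_rdistr) (use D.finite_K ab z \<iota>_closed u_closed in auto)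
      then have "a \<otimes> c \<otimes> \<sigma> ?i b = (\<Oplus>l\<in>D.K. a \<otimes> (\<iota> (z l) \<otimes> u l)) \<otimes> \<sigma> ?i b" by simp
      also have "\<dots> = (\<Oplus>l\<in>D.K. a \<otimes> (\<iota> (z l) \<otimes> u l) \<otimes> \<sigma> ?i b)"
        by (rule A.C.finsum_ldistr) (use D.finite_K ab z \<iota>_closed u_closed A.\<sigma>_closed kG in auto)
      also have "\<dots> = (\<Oplus>l\<in>D.K. \<iota> (z l) \<otimes> (a \<otimes> \<sigma> (l \<bullet> ?i) b) \<otimes> u l)"
      proof (rule A.C.finsum_cong')
        fix l assume l: "l \<in> D.K"
        have lG: "l \<in> carrier G" using l D.K_carrier by blast
        note [simp] = ab \<iota>_closed[OF z(1)[OF l]] u_closed[OF l] A.\<sigma>_closed lG kG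
        have "a \<otimes> (\<iota> (z l) \<otimes> u l) \<otimes> \<sigma> ?i b = (a \<otimes> \<iota> (z l)) \<otimes> (u l \<otimes> \<sigma> ?i b)" by (simp add: A.C.m_assoc)
        also have "\<dots> = (\<iota> (z l) \<otimes> a) \<otimes> (\<sigma> l (\<sigma> ?i b) \<otimes> u l)"
          using \<iota>_central[OF z(1)[OF l], of a] u_homogeneous[OF l, of "\<sigma> ?i b"] by simp
        finally show "a \<otimes> (\<iota> (z l) \<otimes> u l) \<otimes> \<sigma> ?i b = \<iota> (z l) \<otimes> (a \<otimes> \<sigma> (l \<bullet> ?i) b) \<otimes> u l"
          by (simp add: A.C.m_assoc A.\<sigma>_comp)
      qed (use ab z \<iota>_closed u_closed A.\<sigma>_closed kG D.K_carrier in auto)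
      finally show "a \<otimes> c \<otimes> \<sigma> ?i b = (\<Oplus>l\<in>D.K. \<iota> (z l) \<otimes> (a \<otimes> \<sigma> (l \<bullet> ?i) b) \<otimes> u l)" .
    qed
    also have "\<dots> = (\<Oplus>l\<in>D.K. lsum C (\<lambda>t. (case t of (a, b) \<Rightarrow> \<iota> (z l) \<otimes> (a \<otimes> \<sigma> (l \<bullet> ?i) b) \<otimes> u l)) ts)"
      by (rule A.C.finsum_lsum[symmetric])
        (use D.finite_K z \<iota>_closed u_closed A.\<sigma>_closed kG D.K_carrier in \<open>auto dest!: T\<close>)
    also have "\<dots> = (\<Oplus>l\<in>D.K. if k = l then \<iota> (z l) \<otimes> u l else \<zero>)"
    proof (rule A.C.finsum_cong')
      fix l assume l: "l \<in> D.K"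
      have lG: "l \<in> carrier G" using l D.K_carrier by blast
      let ?f = "\<lambda>(a, b). a \<otimes> \<sigma> (l \<bullet> ?i) b"
      have fc: "t \<in> set ts \<Longrightarrow> ?f t \<in> carrier C" for t
        using ts(1) A.\<sigma>_closed lG kG by (cases t) auto
      have "lsum C (\<lambda>t. (case t of (a, b) \<Rightarrow> \<iota> (z l) \<otimes> (a \<otimes> \<sigma> (l \<bullet> ?i) b) \<otimes> u l)) ts
          = lsum C (\<lambda>t. \<iota> (z l) \<otimes> ?f t \<otimes> u l) ts"
        by (rule lprod_cong) auto
      also have "\<dots> = lsum C (\<lambda>t. \<iota> (z l) \<otimes> ?f t) ts \<otimes> u l"
        by (rule A.C.lsum_mult_right[symmetric]) (use fc z l \<iota>_closed u_closed in auto)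
      also have "lsum C (\<lambda>t. \<iota> (z l) \<otimes> ?f t) ts = \<iota> (z l) \<otimes> lsum C ?f ts"
        by (rule A.C.lsum_mult_left[symmetric]) (use fc z l \<iota>_closed in auto)
      also have "lsum C ?f ts = (if \<one>\<^sub>G = l \<bullet> ?i then \<one> else \<zero>)" using ts(2) lG kG by simp
      also have "\<one>\<^sub>G = l \<bullet> ?i \<longleftrightarrow> k = l"
        using lG kG by (metis D.G.inv_closed D.G.inv_equality D.G.inv_inv D.G.r_inv)
      finally show "lsum C (\<lambda>t. (case t of (a, b) \<Rightarrow> \<iota> (z l) \<otimes> (a \<otimes> \<sigma> (l \<bullet> ?i) b) \<otimes> u l)) ts
          = (if k = l then \<iota> (z l) \<otimes> u l else \<zero>)"
        using z l \<iota>_closed u_closed by auto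
    qed (use z \<iota>_closed u_closed in auto)
    also have "\<dots> = \<iota> (z k) \<otimes> u k"
      using A.C.add.finprod_singleton[of k D.K "\<lambda>l. \<iota> (z l) \<otimes> u l"] k D.finite_K z \<iota>_closed u_closed
      by (simp add: finsum_def Pi_def)
    finally have S: "?S = \<iota> (z k) \<otimes> u k" .
    have "lsum C (\<lambda>(a, b). a \<otimes> c \<otimes> \<sigma> ?i b) ss \<in> I" if "set ss \<subseteq> set ts" for ss
      using that
    proof (induction ss)
      case Nil
      then show ?case using I.zero_closed by simp
    next
      case (Cons s ss)
      obtain a b where s: "s = (a, b)" by force
      then have ab: "a \<in> carrier C" "b \<in> carrier C" using Cons.prems T by auto
      have "a \<otimes> c \<otimes> \<sigma> ?i b \<in> I"
        by (rule I.I_r_closed[OF I.I_l_closed]) (use c ab A.\<sigma>_closed kG in auto)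
      then show ?case using Cons s by (auto intro: I.a_closed)
    qed
    then have "\<iota> (z k) \<otimes> u k \<in> I" using S by (metis subset_refl)
    moreover have "\<iota> (z k) \<otimes> u k \<in> Units C" using \<iota>_unit(1) u_unit z k by simp
    ultimately have "\<one> \<in> I" by (metis A.C.Units_inv_closed A.C.Units_l_inv I.I_l_closed)
    then show ?thesis by (rule I.one_imp_carrier)
  qed
  moreover have "carrier C \<noteq> {\<zero>}" using one_not_zero by auto
  ultimately show ?thesis unfolding simple_ring_def by blast
qed

end

section \<open>From a simple Galois extension to a crossed product\<close>

lemma (in ring) finite_dimension_carrier_update:
  assumes Z: "subring Z R" and K: "subfield K R" "K \<subseteq> Z" and fd: "finite_dimension K Z"
  shows "ring.finite_dimension (R\<lparr>carrier := Z\<rparr>) K Z" "subfield K (R\<lparr>carrier := Z\<rparr>)"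
proof -
  interpret Z: ring "R\<lparr>carrier := Z\<rparr>" by (rule subring_is_ring[OF Z])
  show KZ: "subfield K (R\<lparr>carrier := Z\<rparr>)"
    by (rule Z.subfield_iff(1)) (use subfield_iff(2)[OF K(1)] K(2) in simp_all)
  obtain n where n: "dimension n K Z" using fd by (auto simp: finite_dimension_def)
  obtain Us where Us: "set Us \<subseteq> carrier R" "Span K Us = Z" using exists_base[OF K(1) n] by blast
  have "set Us \<subseteq> Z" using Span_base_incl[OF K(1) Us(1)] Us(2) by simp
  then show "Z.finite_dimension K Z"
    using Z.Span_finite_dimension[OF KZ, of Us] Span_consistent[OF Z] Us(2) by simp
qed

context simple_Galois
begin

lemma proj_add: "\<lbrakk>h \<in> carrier G; c \<in> carrier C; d \<in> carrier C\<rbrakk> \<Longrightarrow> proj h (c \<oplus> d) = proj h c \<oplus> proj h d"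
proof -
  assume h: "h \<in> carrier G" and c: "c \<in> carrier C" "d \<in> carrier C"
  have "proj h (c \<oplus> d) = lsum C (\<lambda>t. (case t of (a, b) \<Rightarrow> a \<otimes> c \<otimes> \<sigma> (inv\<^bsub>G\<^esub> h) b) \<oplus> (case t of (a, b) \<Rightarrow> a \<otimes> d \<otimes> \<sigma> (inv\<^bsub>G\<^esub> h) b)) dual"
    unfolding proj_def by (rule lprod_cong) (use h c \<sigma>_closed in \<open>auto dest!: dualD simp: C.l_distr C.r_distr\<close>)
  also have "\<dots> = proj h c \<oplus> proj h d"
    unfolding proj_def by (rule C.lsum_add) (use h c \<sigma>_closed in \<open>auto dest!: dualD\<close>)
  finally show ?thesis .
qed

lemma scalars_center: "scalars R C \<subseteq> ring_center C"
  by (auto simp: scalars_def ring_center_def scalar_mult)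

lemma homogeneous_center_mult:
  "\<lbrakk>z \<in> ring_center C; k \<in> carrier G; a \<in> homogeneous C \<sigma> k\<rbrakk> \<Longrightarrow> z \<otimes> a \<in> homogeneous C \<sigma> k"
  using homogeneous_mult[of "\<one>\<^bsub>G\<^esub>" k z a] homogeneous_one by simp

lemma center_finite_dimension: "C.finite_dimension (scalars R C) (ring_center C)"
proof (rule C.subalbegra_incl_imp_finite_dimension[OF scalars_subfield[OF one_not_zero]])
  show "C.finite_dimension (scalars R C) (carrier C)"
    using galois by (simp add: Galois_extension_def fd_algebra_def)
  show "subalgebra (scalars R C) (ring_center C) C"
    using subring.axioms(1)[OF center_subring] subringE(6)[OF center_subring] scalars_center
    by (auto simp: subalgebra_def subalgebra_axioms_def)
qed (use center_closed in auto)

end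

text \<open>The centre is finite over the scalars, so it embeds into \<Omega> over \<open>F\<close>;
  \<open>L\<close> is the image and \<iota> the inverse of the embedding. The generators are
  arbitrary nonzero homogeneous elements, so f is not yet adapted to any choice of
  extensions.\<close>

theorem simple_Galois_crossed_data:
  fixes \<Omega> :: "('a, 'm) ring_scheme" and C :: "('a, 'c, 'k) module_scheme" (structure)
  assumes closure: "algebraic_closure \<Omega> F" and S: "simple_Galois (\<Omega>\<lparr>carrier := F\<rparr>) C G \<sigma>"
  obtains L \<theta> \<iota> u \<tau> f where "crossed_data \<Omega> F G L \<theta> C \<sigma> \<iota> u \<tau> f"
proof -
  interpret \<Omega>: algebraic_closure \<Omega> F by fact
  interpret S: simple_Galois "\<Omega>\<lparr>carrier := F\<rparr>" C G \<sigma> by fact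
  have F: "subfield F \<Omega>" ..
  let ?Z = "ring_center C" and ?S = "scalars (\<Omega>\<lparr>carrier := F\<rparr>) C"
  let ?E = "C\<lparr>carrier := ?Z\<rparr>" and ?h = "\<lambda>r. r \<odot>\<^bsub>C\<^esub> \<one>"
  interpret E: field ?E by (rule S.C.subfield_iff(2)[OF S.center_subfield])
  note fd = S.C.finite_dimension_carrier_update[OF S.center_subring S.scalars_subfield[OF S.one_not_zero]
      S.scalars_center S.center_finite_dimension]
  interpret h: ring_hom_ring "\<Omega>\<lparr>carrier := F\<rparr>" C ?h
    by (rule ring_hom_ringI2[OF S.C.R.ring_axioms S.C.ring_axioms S.scalar_hom])
  have h_inj: "inj_on ?h F" and h_img: "?h ` F = ?S"
    using h.img_is_subfield(1)[OF S.R.carrier_is_subfield S.one_not_zero] by (auto simp: scalars_def)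
  have h_iso: "?h \<in> ring_iso (\<Omega>\<lparr>carrier := F\<rparr>) (?E\<lparr>carrier := ?S\<rparr>)"
    using ring_hom_memE[OF S.scalar_hom] h_inj h_img
    by (intro ring_iso_memI) (auto simp: bij_betw_def)
  \<comment> \<open>The embedding of the centre is started on the scalars by the inverse of r
    \<mapsto> r \<odot> 1, so that it is compatible with \<open>F\<close>.\<close>
  have h_inv: "inv_into F ?h \<in> ring_hom (?E\<lparr>carrier := ?S\<rparr>) \<Omega>"
    using ring_iso_memE[OF ring_iso_set_sym[OF S.C.R.ring_axioms h_iso]] subfieldE(3)[OF F]
    by (intro ring_hom_memI) auto
  obtain \<psi> where \<psi>: "\<psi> \<in> ring_hom ?E \<Omega>" "\<And>x. x \<in> ?S \<Longrightarrow> \<psi> x = inv_into F ?h x"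
    by (rule embedding_exists[OF E.field_axioms fd(2) _ \<Omega>.algebraically_closed_axioms h_inv]) (use fd(1) in auto)
  interpret \<psi>: ring_hom_ring ?E \<Omega> \<psi> by (rule ring_hom_ringI2[OF E.ring_axioms \<Omega>.ring_axioms \<psi>(1)])
  define L where "L = \<psi> ` ?Z"
  have \<psi>_inj: "inj_on \<psi> ?Z" and L: "subfield L \<Omega>"
    using \<psi>.img_is_subfield[OF E.carrier_is_subfield] by (auto simp: L_def)
  have \<psi>c: "z \<in> ?Z \<Longrightarrow> \<psi> z \<in> L" for z by (simp add: L_def)
  have \<psi>_mult: "\<lbrakk>x \<in> ?Z; y \<in> ?Z\<rbrakk> \<Longrightarrow> \<psi> (x \<otimes> y) = \<psi> x \<otimes>\<^bsub>\<Omega>\<^esub> \<psi> y" for x y using \<psi>.hom_mult by simp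
  have \<psi>_add: "\<lbrakk>x \<in> ?Z; y \<in> ?Z\<rbrakk> \<Longrightarrow> \<psi> (x \<oplus> y) = \<psi> x \<oplus>\<^bsub>\<Omega>\<^esub> \<psi> y" for x y using \<psi>.hom_add by simp
  have \<psi>_one: "\<psi> \<one> = \<one>\<^bsub>\<Omega>\<^esub>" and \<psi>_zero: "\<psi> \<zero> = \<zero>\<^bsub>\<Omega>\<^esub>" using \<psi>.hom_one \<psi>.hom_zero by simp_all
  have Z_ring: "\<one> \<in> ?Z" "\<zero> \<in> ?Z" "\<And>x y. \<lbrakk>x \<in> ?Z; y \<in> ?Z\<rbrakk> \<Longrightarrow> x \<otimes> y \<in> ?Z" "\<And>x y. \<lbrakk>x \<in> ?Z; y \<in> ?Z\<rbrakk> \<Longrightarrow> x \<oplus> y \<in> ?Z"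
    using subringE[OF S.center_subring] by auto
  define \<iota> where "\<iota> = inv_into ?Z \<psi>"
  have \<iota>: "\<iota> x \<in> ?Z" "\<psi> (\<iota> x) = x" if "x \<in> L" for x
    using that by (auto simp: \<iota>_def L_def f_inv_into_f inv_into_into)
  have \<iota>\<psi>: "\<iota> (\<psi> z) = z" if "z \<in> ?Z" for z
    using \<psi>_inj that by (simp add: \<iota>_def)
  have \<psi>_eqD: "\<lbrakk>\<psi> x = \<psi> y; x \<in> ?Z; y \<in> ?Z\<rbrakk> \<Longrightarrow> x = y" for x y using \<psi>_inj by (simp add: inj_on_def)
  have L_ring: "\<lbrakk>x \<in> L; y \<in> L\<rbrakk> \<Longrightarrow> x \<otimes>\<^bsub>\<Omega>\<^esub> y \<in> L" "\<lbrakk>x \<in> L; y \<in> L\<rbrakk> \<Longrightarrow> x \<oplus>\<^bsub>\<Omega>\<^esub> y \<in> L" "\<one>\<^bsub>\<Omega>\<^esub> \<in> L" for x y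
    using subringE[OF subfieldE(1)[OF L]] by auto
  have \<iota>_mult: "\<iota> (x \<otimes>\<^bsub>\<Omega>\<^esub> y) = \<iota> x \<otimes> \<iota> y" if "x \<in> L" "y \<in> L" for x y
    using that \<psi>_mult \<iota> L_ring Z_ring by (intro \<psi>_eqD) simp_all
  have \<iota>_add: "\<iota> (x \<oplus>\<^bsub>\<Omega>\<^esub> y) = \<iota> x \<oplus> \<iota> y" if "x \<in> L" "y \<in> L" for x y
    using that \<psi>_add \<iota> L_ring Z_ring by (intro \<psi>_eqD) simp_all
  have \<iota>_one: "\<iota> \<one>\<^bsub>\<Omega>\<^esub> = \<one>" using \<iota>\<psi>[OF Z_ring(1)] \<psi>_one by simp
  have \<psi>F: "\<psi> (r \<odot>\<^bsub>C\<^esub> \<one>) = r" if "r \<in> F" for r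
  proof -
    have "?h r \<in> ?S" using that h_img by blast
    then show ?thesis using \<psi>(2)[of "?h r"] inv_into_f_f[OF h_inj that] by simp
  qed
  have hZ: "r \<in> F \<Longrightarrow> ?h r \<in> ?Z" for r using S.scalars_center h_img by blast
  have FL: "F \<subseteq> L"
  proof
    fix r assume "r \<in> F"
    then show "r \<in> L" using \<psi>F hZ \<psi>c by metis
  qed
  have \<iota>F: "\<iota> r = r \<odot>\<^bsub>C\<^esub> \<one>" if "r \<in> F" for r
    using \<iota>\<psi>[OF hZ[OF that]] \<psi>F[OF that] by simp
  \<comment> \<open>The action on the centre carried over to \<open>L\<close>, made extensional both
    on \<open>G\<close> and on \<open>L\<close>.\<close>
  define \<theta> where "\<theta> = (\<lambda>g\<in>carrier G. \<lambda>x\<in>L. \<psi> (\<sigma> g (\<iota> x)))"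
  have \<sigma>Z: "\<sigma> g (\<iota> x) \<in> ?Z" if "g \<in> carrier G" "x \<in> L" for g x using S.\<sigma>_center \<iota> that by blast
  have \<theta>: "\<theta> g x = \<psi> (\<sigma> g (\<iota> x))" "\<theta> g x \<in> L" "\<iota> (\<theta> g x) = \<sigma> g (\<iota> x)" if "g \<in> carrier G" "x \<in> L" for g x
    using that \<sigma>Z \<psi>c \<iota>\<psi> by (simp_all add: \<theta>_def)
  have \<iota>c: "x \<in> L \<Longrightarrow> \<iota> x \<in> carrier C" for x using \<iota> S.center_closed by blast
  have \<theta>_comp: "\<theta> (g \<otimes>\<^bsub>G\<^esub> h) x = \<theta> g (\<theta> h x)" if "g \<in> carrier G" "h \<in> carrier G" "x \<in> L" for g h x
    using that \<theta> \<iota>c S.\<sigma>_comp by simp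
  have \<theta>_id: "\<theta> \<one>\<^bsub>G\<^esub> x = x" if "x \<in> L" for x using \<theta>(1)[of "\<one>\<^bsub>G\<^esub>" x] that \<iota> \<iota>c S.\<sigma>_id by simp
  have bij: "\<theta> g \<in> Bij L" if g: "g \<in> carrier G" for g
  proof -
    have "bij_betw (\<theta> g) L L"
      by (rule bij_betwI[where g="\<theta> (inv\<^bsub>G\<^esub> g)"])
        (use g \<theta>(2) \<theta>_comp[of "inv\<^bsub>G\<^esub> g" g] \<theta>_comp[of g "inv\<^bsub>G\<^esub> g"] \<theta>_id in auto)
    then show ?thesis using g by (simp add: Bij_def \<theta>_def)
  qed
  have mem: "\<theta> g \<in> carrier (Gal_group \<Omega> F L)" if g: "g \<in> carrier G" for g
  proof -
    have "\<theta> g \<in> ring_hom (\<Omega>\<lparr>carrier := L\<rparr>) (\<Omega>\<lparr>carrier := L\<rparr>)"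
      by (rule ring_hom_memI)
        (use g \<theta> L_ring \<sigma>Z \<iota>c \<iota>_mult \<iota>_add \<iota>_one S.\<sigma>_mult S.\<sigma>_add S.\<sigma>_one \<psi>_mult \<psi>_add \<psi>_one in auto)
    moreover have "\<theta> g x = x" if x: "x \<in> F" for x
    proof -
      have "\<theta> g x = \<psi> (\<sigma> g (x \<odot>\<^bsub>C\<^esub> \<one>))" using \<theta>(1)[OF g] x FL \<iota>F by auto
      also have "\<dots> = \<psi> (x \<odot>\<^bsub>C\<^esub> \<one>)" using S.\<sigma>_smult[OF g] S.\<sigma>_one[OF g] x by simp
      finally show ?thesis using \<psi>F x by simp
    qed
    ultimately show ?thesis using bij[OF g] by (simp add: Gal_group_def)
  qed
  have hom: "\<theta> \<in> hom G (Gal_group \<Omega> F L)"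
  proof (rule homI)
    fix g h assume gh: "g \<in> carrier G" "h \<in> carrier G"
    have "\<theta> (g \<otimes>\<^bsub>G\<^esub> h) = compose L (\<theta> g) (\<theta> h)"
    proof
      fix x show "\<theta> (g \<otimes>\<^bsub>G\<^esub> h) x = compose L (\<theta> g) (\<theta> h) x"
        using gh \<theta>_comp by (cases "x \<in> L") (simp_all add: compose_def \<theta>_def[of] extensional_def)
    qed
    then show "\<theta> (g \<otimes>\<^bsub>G\<^esub> h) = \<theta> g \<otimes>\<^bsub>Gal_group \<Omega> F L\<^esub> \<theta> h"
      using gh bij by (simp add: Gal_group_def BijGroup_def)
  qed (rule mem)
  interpret D: galois_data \<Omega> F G L \<theta>
  proof (intro galois_data.intro galois_data_axioms.intro)
    show "\<theta> \<in> extensional (carrier G)" by (simp add: \<theta>_def)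
    fix x assume x: "x \<in> L" "\<forall>g\<in>carrier G. \<theta> g x = x"
    have "\<forall>g\<in>carrier G. \<sigma> g (\<iota> x) = \<iota> x" using x \<theta>(3) by metis
    then obtain r where r: "r \<in> F" "\<iota> x = r \<odot>\<^bsub>C\<^esub> \<one>" using S.fixed_scalar[OF \<iota>c[OF x(1)]] by auto
    then show "x \<in> F" using \<iota>(2)[OF x(1)] \<psi>F by metis
  qed (rule \<Omega>.field_axioms S.G.comm_group_axioms S.finite_G F L FL hom)+
  \<comment> \<open>Acting trivially on \<open>L\<close> means acting trivially on the centre.
    Equality of the inertia subgroup with the support then provides a generator for every element of
    the kernel.\<close>
  have K: "D.K = S.support"
    unfolding S.support_eq_inertia
  proof
    show "D.K \<subseteq> S.inertia"
    proof
      fix k assume "k \<in> D.K"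
      then have k: "k \<in> carrier G" "\<forall>x\<in>L. \<theta> k x = x" by (simp_all add: D.mem_ker)
      have "\<sigma> k z = z" if z: "z \<in> ?Z" for z using \<theta>(3)[OF k(1) \<psi>c[OF z]] \<iota>\<psi>[OF z] k(2) \<psi>c[OF z] by simp
      then show "k \<in> S.inertia" using k by (simp add: S.inertia_def)
    qed
    show "S.inertia \<subseteq> D.K"
      using \<theta>(1) \<iota> by (auto simp: S.inertia_def D.mem_ker)
  qed
  let ?u = S.gen
  define \<tau> where "\<tau> = (\<lambda>(x, y)\<in>S.support \<times> S.support. \<psi> (?u x \<otimes> ?u y \<otimes> inv ?u (x \<otimes>\<^bsub>G\<^esub> y)))"
  define f where "f k g = \<psi> (S.mu g k)" for k g
  have nz: "\<psi> z \<in> L - {\<zero>\<^bsub>\<Omega>\<^esub>}" if "z \<in> ?Z" "z \<noteq> \<zero>" for z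
    using that \<psi>c \<psi>_eqD[of z \<zero>] Z_ring \<psi>_zero by auto
  have sG: "k \<in> S.support \<Longrightarrow> k \<in> carrier G" for k by (rule S.supportD)
  have Tm: "?u x \<otimes> ?u y \<otimes> inv ?u (x \<otimes>\<^bsub>G\<^esub> y) \<in> ?Z"
    "?u x \<otimes> ?u y = (?u x \<otimes> ?u y \<otimes> inv ?u (x \<otimes>\<^bsub>G\<^esub> y)) \<otimes> ?u (x \<otimes>\<^bsub>G\<^esub> y)"
    "?u x \<otimes> ?u y \<otimes> inv ?u (x \<otimes>\<^bsub>G\<^esub> y) \<noteq> \<zero>" if xy: "x \<in> S.support" "y \<in> S.support" for x y
  proof -
    have h: "?u x \<otimes> ?u y \<in> homogeneous C \<sigma> (x \<otimes>\<^bsub>G\<^esub> y)"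
      by (rule S.homogeneous_mult) (use xy sG S.gen in auto)
    note q = S.homogeneous_quotient[OF S.support_mult[OF xy] h]
    show "?u x \<otimes> ?u y \<otimes> inv ?u (x \<otimes>\<^bsub>G\<^esub> y) \<in> ?Z" by (rule q(1))
    show e: "?u x \<otimes> ?u y = (?u x \<otimes> ?u y \<otimes> inv ?u (x \<otimes>\<^bsub>G\<^esub> y)) \<otimes> ?u (x \<otimes>\<^bsub>G\<^esub> y)" by (rule q(2))
    have "?u x \<otimes> ?u y \<in> Units C" using S.gen xy by simp
    then have ne: "?u x \<otimes> ?u y \<noteq> \<zero>"
      using S.one_not_zero S.C.Units_l_inv[of \<zero>] S.C.Units_inv_closed[of \<zero>] by auto
    show "?u x \<otimes> ?u y \<otimes> inv ?u (x \<otimes>\<^bsub>G\<^esub> y) \<noteq> \<zero>"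
    proof
      assume "?u x \<otimes> ?u y \<otimes> inv ?u (x \<otimes>\<^bsub>G\<^esub> y) = \<zero>"
      then have "?u x \<otimes> ?u y = \<zero>" using e S.gen(3)[OF S.support_mult[OF xy]] by simp
      with ne show False ..
    qed
  qed
  have \<tau>_val: "\<tau> (x, y) = \<psi> (?u x \<otimes> ?u y \<otimes> inv ?u (x \<otimes>\<^bsub>G\<^esub> y))" if "x \<in> S.support" "y \<in> S.support" for x y
    using that by (simp add: \<tau>_def)
  have "crossed_data \<Omega> F G L \<theta> C \<sigma> \<iota> ?u \<tau> f"
  proof (intro crossed_data.intro crossed_data_axioms.intro)
    show "galois_data \<Omega> F G L \<theta>" "action_algebra (\<Omega>\<lparr>carrier := F\<rparr>) C G \<sigma>"
      by (rule D.galois_data_axioms S.action_algebra_axioms)+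
    show "\<iota> \<in> ring_hom (\<Omega>\<lparr>carrier := L\<rparr>) C"
      by (rule ring_hom_memI) (use \<iota>c \<iota>_mult \<iota>_add \<iota>_one in auto)
    show "\<iota> r = r \<odot>\<^bsub>C\<^esub> \<one>" if "r \<in> F" for r by (rule \<iota>F[OF that])
    show "?u k \<in> carrier C" if "k \<in> D.K" for k using S.gen(3) that K by simp
    show "?u k \<otimes> \<iota> x = \<iota> x \<otimes> ?u k" if "k \<in> D.K" "x \<in> L" for k x
      using S.center_comm[OF \<iota>(1)[OF that(2)]] S.gen(3) that(1) K by simp
    show "?u k \<otimes> ?u l = \<iota> (\<tau> (k, l)) \<otimes> ?u (k \<otimes>\<^bsub>G\<^esub> l)" if "k \<in> D.K" "l \<in> D.K" for k l
      using Tm[of k l] that K \<iota>\<psi> \<tau>_val by simp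
    show "\<tau> (k, l) \<in> L - {\<zero>\<^bsub>\<Omega>\<^esub>}" if "k \<in> D.K" "l \<in> D.K" for k l
      using Tm[of k l] that K nz \<tau>_val by simp
    show "\<tau> \<in> extensional (D.K \<times> D.K)" by (simp add: \<tau>_def K)
    show "\<sigma> g (\<iota> x) = \<iota> (\<theta> g x)" if "g \<in> carrier G" "x \<in> L" for g x using \<theta>(3)[OF that] by simp
    show "f k g \<in> L - {\<zero>\<^bsub>\<Omega>\<^esub>}" if "k \<in> D.K" "g \<in> carrier G" for k g
      unfolding f_def using S.mu[OF that(2), of k] that K by (intro nz) auto
    show fu: "\<sigma> g (?u k) = \<iota> (f k g) \<otimes> ?u k" if "k \<in> D.K" "g \<in> carrier G" for k g
      unfolding f_def using S.mu[OF that(2), of k] that K \<iota>\<psi> by simp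
    \<comment> \<open>The factor \<open>mu l k\<close> is the commutator of the two generators, and
      commutativity of \<open>G\<close> lets both products be divided by the same generator.\<close>
    show "f k l \<otimes>\<^bsub>\<Omega>\<^esub> \<tau> (k, l) = \<tau> (l, k)" if "k \<in> D.K" "l \<in> D.K" for k l
    proof -
      have kl: "k \<in> S.support" "l \<in> S.support" using that K by auto
      note m = S.mu[OF sG[OF kl(2)] kl(1)]
      note uc = S.gen(3)[OF kl(1)] S.gen(3)[OF kl(2)] S.gen(4)[OF S.support_mult[OF kl]] m(4)
      have "?u l \<otimes> ?u k = S.mu l k \<otimes> (?u k \<otimes> ?u l)"
        using S.homogeneousD(2)[OF S.gen(1)[OF kl(2)] uc(1)] m(2) uc by (simp add: S.C.m_assoc)
      moreover have "l \<otimes>\<^bsub>G\<^esub> k = k \<otimes>\<^bsub>G\<^esub> l" using S.G.m_comm kl sG by blast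
      ultimately have "?u l \<otimes> ?u k \<otimes> inv ?u (l \<otimes>\<^bsub>G\<^esub> k) = S.mu l k \<otimes> (?u k \<otimes> ?u l \<otimes> inv ?u (k \<otimes>\<^bsub>G\<^esub> l))"
        using uc by (simp add: S.C.m_assoc)
      then show ?thesis using \<tau>_val kl \<psi>_mult[OF m(1) Tm(1)[OF kl]] by (simp add: f_def)
    qed
    \<comment> \<open>A trivial pairing means that l fixes every generator, as the identity does;
      both act trivially on the centre, so they agree.\<close>
    show "l = \<one>\<^bsub>G\<^esub>" if l: "l \<in> D.K" "\<forall>k\<in>D.K. f k l = \<one>\<^bsub>\<Omega>\<^esub>" for l
    proof (rule S.\<sigma>_agree)
      show "l \<in> S.inertia" "\<one>\<^bsub>G\<^esub> \<in> S.inertia" using l(1) K S.support_eq_inertia S.one_support by auto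
      fix s assume s: "s \<in> S.support"
      have "\<sigma> l (?u s) = ?u s" using fu[of s l] l s K sG \<iota>_one S.gen(3)[OF s] by simp
      then show "\<sigma> l (?u s) = \<sigma> \<one>\<^bsub>G\<^esub> (?u s)" using S.\<sigma>_id S.gen(3)[OF s] by simp
    qed
    show "\<exists>z. (\<forall>k\<in>D.K. z k \<in> L) \<and> c = (\<Oplus>k\<in>D.K. \<iota> (z k) \<otimes> ?u k)" if c: "c \<in> carrier C" for c
    proof (intro exI conjI ballI)
      let ?q = "\<lambda>s. S.proj s c \<otimes> inv ?u s"
      have q: "?q s \<in> ?Z" "S.proj s c = ?q s \<otimes> ?u s" if s: "s \<in> S.support" for s
        using S.homogeneous_quotient[OF s S.proj_homogeneous[OF sG[OF s] c]] by auto
      show "\<psi> (?q k) \<in> L" if "k \<in> D.K" for k using q \<psi>c that K by simp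
      have "c = (\<Oplus>s\<in>S.support. S.proj s c)" by (rule S.support_expand[OF c])
      also have "\<dots> = (\<Oplus>k\<in>D.K. \<iota> (\<psi> (?q k)) \<otimes> ?u k)"
        unfolding K by (rule S.C.finsum_cong') (use q \<iota>\<psi> S.gen(3) S.center_closed in auto)
      finally show "c = (\<Oplus>k\<in>D.K. \<iota> (\<psi> (?q k)) \<otimes> ?u k)" .
    qed
    \<comment> \<open>Projecting the relation to degree k isolates the single term with the
      generator at k.\<close>
    show "z k = \<zero>\<^bsub>\<Omega>\<^esub>"
      if z: "\<And>k. k \<in> D.K \<Longrightarrow> z k \<in> L" and sum: "(\<Oplus>k\<in>D.K. \<iota> (z k) \<otimes> ?u k) = \<zero>" and k: "k \<in> D.K" for z k
    proof -
      have kS: "k \<in> S.support" and kG: "k \<in> carrier G" using k K sG by auto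
      have t: "\<iota> (z l) \<otimes> ?u l \<in> homogeneous C \<sigma> l" if "l \<in> D.K" for l
        by (rule S.homogeneous_center_mult[OF \<iota>(1)[OF z[OF that]]]) (use that K sG S.gen(1) in auto)
      then have tc: "\<iota> (z l) \<otimes> ?u l \<in> carrier C" if "l \<in> D.K" for l
        using S.homogeneousD(1) that by blast
      have "S.proj k \<zero> = (\<Oplus>l\<in>D.K. S.proj k (\<iota> (z l) \<otimes> ?u l))"
        unfolding sum[symmetric]
        by (rule S.C.finsum_hom[OF S.C.abelian_group_axioms]) (use kG S.proj_closed S.proj_add tc in auto)
      also have "\<dots> = (\<Oplus>l\<in>D.K. if k = l then \<iota> (z l) \<otimes> ?u l else \<zero>)"
        by (rule S.C.finsum_cong') (use t tc S.proj_of_homogeneous[OF kG] K sG in auto)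
      also have "\<dots> = \<iota> (z k) \<otimes> ?u k"
        using S.C.add.finprod_singleton[of k D.K "\<lambda>l. \<iota> (z l) \<otimes> ?u l"] k D.finite_K tc
        by (simp add: finsum_def Pi_def)
      finally have e1: "S.proj k \<zero> = \<iota> (z k) \<otimes> ?u k" .
      have e2: "S.proj k \<zero> = \<zero>"
        using S.proj_of_homogeneous[OF kG kG S.homogeneous_zero[OF kG]] by simp
      have "\<iota> (z k) \<otimes> ?u k = \<zero> \<otimes> ?u k"
        unfolding e1[symmetric] e2 using S.gen(3)[OF kS] by (rule S.C.l_null[symmetric])
      then have "\<iota> (z k) = \<zero>"
        by (rule S.unit_cancel[OF S.gen(4)[OF kS] \<iota>c[OF z[OF k]] S.C.zero_closed])
      then show ?thesis using \<iota>(2)[OF z[OF k]] \<psi>_zero by simp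
    qed
  qed
  then show ?thesis by (rule that)
qed

text \<open>Passes from the unit group of a subfield, in which the classifying data are stated, to
  the ambient ring, in which the calculations take place.\<close>

lemma (in ring) mult_group_subfield:
  assumes L: "subfield L R"
  shows "carrier (mult_group R L) = L - {\<zero>}" "x \<otimes>\<^bsub>mult_group R L\<^esub> y = x \<otimes> y" "\<one>\<^bsub>mult_group R L\<^esub> = \<one>"
    "x \<in> L - {\<zero>} \<Longrightarrow> inv\<^bsub>mult_group R L\<^esub> x = inv x" "comm_group (mult_group R L)"
proof -
  interpret L: field "R\<lparr>carrier := L\<rparr>" by (rule subfield_iff(2)[OF L])
  show c: "carrier (mult_group R L) = L - {\<zero>}"
    using L.field_Units by (simp add: mult_group_def units_of_def)
  show m: "x \<otimes>\<^bsub>mult_group R L\<^esub> y = x \<otimes> y" "\<one>\<^bsub>mult_group R L\<^esub> = \<one>" for x y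
    by (simp_all add: mult_group_def units_of_def)
  show g: "comm_group (mult_group R L)"
    unfolding mult_group_def by (rule L.units_comm_group)
  assume x: "x \<in> L - {\<zero>}"
  interpret M: comm_group "mult_group R L" by (rule g)
  show "inv\<^bsub>mult_group R L\<^esub> x = inv x"
    using subfield_m_inv[OF L x] x by (intro M.inv_equality) (simp_all add: c m)
qed

section \<open>Change of generators, transport along isomorphisms, characters of the kernel\<close>

context crossed_data
begin

text \<open>Multiplying u k by \<iota> (l k) changes f k by the coboundary of l k, and \<tau> by the
  coboundary of l. The values of f on \<open>K\<close> do not change because \<open>K\<close> acts
  trivially on \<open>L\<close>, so the bicharacter and its nondegeneracy survive.\<close>

lemma rescale:
  assumes l: "\<And>k. k \<in> D.K \<Longrightarrow> l k \<in> L - {\<zero>\<^sub>L}"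
    and f': "\<And>k g. \<lbrakk>k \<in> D.K; g \<in> carrier G\<rbrakk> \<Longrightarrow> f' k g = \<theta> g (l k) \<ast> inv\<^sub>L (l k) \<ast> f k g"
    and \<tau>': "\<And>x y. \<lbrakk>x \<in> D.K; y \<in> D.K\<rbrakk> \<Longrightarrow> \<tau>' (x, y) = l x \<ast> l y \<ast> inv\<^sub>L (l (x \<bullet> y)) \<ast> \<tau> (x, y)"
    and ext: "\<tau>' \<in> extensional (D.K \<times> D.K)"
  shows "crossed_data \<Omega> F G L \<theta> C \<sigma> \<iota> (\<lambda>k. \<iota> (l k) \<otimes> u k) \<tau>' f'"
proof -
  have lL: "l k \<in> L" "l k \<noteq> \<zero>\<^sub>L" if "k \<in> D.K" for k using l[OF that] by auto
  have li: "inv\<^sub>L (l k) \<in> L" "inv\<^sub>L (l k) \<noteq> \<zero>\<^sub>L" "inv\<^sub>L (l k) \<ast> l k = \<one>\<^sub>L" "l k \<ast> inv\<^sub>L (l k) = \<one>\<^sub>L"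
    if "k \<in> D.K" for k using D.L_inv[OF lL[OF that]] by auto
  have lin: "inv\<^sub>L (l k) \<in> L - {\<zero>\<^sub>L}" if "k \<in> D.K" for k using li[OF that] by simp
  have \<theta>l: "\<theta> g (l k) \<in> L - {\<zero>\<^sub>L}" if "g \<in> carrier G" "k \<in> D.K" for g k
    using D.\<theta>_closed[OF that(1) lL(1)] D.\<theta>_nonzero[OF that(1) lL] that(2) by simp
  have nz: "x \<ast> y \<in> L - {\<zero>\<^sub>L}" if "x \<in> L - {\<zero>\<^sub>L}" "y \<in> L - {\<zero>\<^sub>L}" for x y
    using that L_mult Lc D.integral_iff by auto
  have fK: "f' k x = f k x" if "k \<in> D.K" "x \<in> D.K" for k x
    using f'[OF that(1) D.K_carrier[OF that(2)]] D.K_\<theta>[OF that(2) lL(1)[OF that(1)]] li[OF that(1)]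
      f_L[OF that(1) D.K_carrier[OF that(2)]] Lc by simp
  show ?thesis
  proof (intro crossed_data.intro crossed_data_axioms.intro)
    show "galois_data \<Omega> F G L \<theta>" "action_algebra (\<Omega>\<lparr>carrier := F\<rparr>) C G \<sigma>"
      by (rule D.galois_data_axioms A.action_algebra_axioms)+
    show "\<iota> (l k) \<otimes> u k \<in> carrier C" if "k \<in> D.K" for k using lL u_closed \<iota>_closed that by simp
    show "\<iota> (l k) \<otimes> u k \<otimes> \<iota> x = \<iota> x \<otimes> (\<iota> (l k) \<otimes> u k)" if "k \<in> D.K" "x \<in> L" for k x
      using \<iota>_central[OF that(2), of "\<iota> (l k) \<otimes> u k"] lL u_closed \<iota>_closed that by simp
    show "\<iota> (l x) \<otimes> u x \<otimes> (\<iota> (l y) \<otimes> u y) = \<iota> (\<tau>' (x, y)) \<otimes> (\<iota> (l (x \<bullet> y)) \<otimes> u (x \<bullet> y))"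
      if "x \<in> D.K" "y \<in> D.K" for x y
    proof -
      note [simp] = that D.K_mult lL u_closed \<iota>_closed \<tau>_L L_mult li
      have e: "\<tau>' (x, y) \<ast> l (x \<bullet> y) = l x \<ast> l y \<ast> \<tau> (x, y)"
      proof -
        have c: "l x \<in> carrier \<Omega>" "l y \<in> carrier \<Omega>" "l (x \<bullet> y) \<in> carrier \<Omega>" "\<tau> (x, y) \<in> carrier \<Omega>"
          "inv\<^sub>L (l (x \<bullet> y)) \<in> carrier \<Omega>" by (simp_all add: Lc)
        have "\<tau>' (x, y) \<ast> l (x \<bullet> y)
          = l x \<ast> l y \<ast> \<tau> (x, y) \<ast> (inv\<^sub>L (l (x \<bullet> y)) \<ast> l (x \<bullet> y))"
          unfolding \<tau>'[OF that] using c by (simp only: D.m_ac D.m_closed)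
        then show ?thesis using c by simp
      qed
      have "\<iota> (l x) \<otimes> u x \<otimes> (\<iota> (l y) \<otimes> u y) = \<iota> (l x) \<otimes> (\<iota> (l y) \<otimes> (u x \<otimes> u y))"
      proof -
        have "u x \<otimes> (\<iota> (l y) \<otimes> u y) = \<iota> (l y) \<otimes> (u x \<otimes> u y)" by (simp add: A.C.m_assoc[symmetric] u_\<iota>)
        then show ?thesis by (simp add: A.C.m_assoc)
      qed
      also have "\<dots> = \<iota> (l x \<ast> l y \<ast> \<tau> (x, y)) \<otimes> u (x \<bullet> y)"
        by (simp add: u_mult \<iota>_mult A.C.m_assoc)
      also have "\<dots> = \<iota> (\<tau>' (x, y)) \<otimes> (\<iota> (l (x \<bullet> y)) \<otimes> u (x \<bullet> y))"
        unfolding e[symmetric] by (simp add: \<iota>_mult A.C.m_assoc \<tau>')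
      finally show ?thesis .
    qed
    show "\<tau>' (k, m) \<in> L - {\<zero>\<^sub>L}" if "k \<in> D.K" "m \<in> D.K" for k m
      unfolding \<tau>'[OF that]
      by (intro nz l lin \<tau>_closed that D.K_mult)
    show "f' k g \<in> L - {\<zero>\<^sub>L}" if "k \<in> D.K" "g \<in> carrier G" for k g
      unfolding f'[OF that]
      by (intro nz lin \<theta>l f_closed that)
    show "\<sigma> g (\<iota> (l k) \<otimes> u k) = \<iota> (f' k g) \<otimes> (\<iota> (l k) \<otimes> u k)" if kg: "k \<in> D.K" "g \<in> carrier G" for k g
    proof -
      note [simp] = kg lL u_closed \<iota>_closed f_L L_mult li D.\<theta>_closed
      have e: "f' k g \<ast> l k = \<theta> g (l k) \<ast> f k g"
      proof -
        have c: "l k \<in> carrier \<Omega>" "inv\<^sub>L (l k) \<in> carrier \<Omega>" "f k g \<in> carrier \<Omega>" "\<theta> g (l k) \<in> carrier \<Omega>"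
          by (simp_all add: Lc)
        have "f' k g \<ast> l k = \<theta> g (l k) \<ast> f k g \<ast> (inv\<^sub>L (l k) \<ast> l k)"
          unfolding f'[OF kg] using c by (simp only: D.m_ac D.m_closed)
        then show ?thesis using c by simp
      qed
      have "\<sigma> g (\<iota> (l k) \<otimes> u k) = \<iota> (\<theta> g (l k) \<ast> f k g) \<otimes> u k"
        by (simp add: A.\<sigma>_mult \<sigma>_\<iota> \<sigma>_u \<iota>_mult A.C.m_assoc)
      then show ?thesis unfolding e[symmetric] by (simp add: \<iota>_mult A.C.m_assoc f')
    qed
    show "f' k m \<ast> \<tau>' (k, m) = \<tau>' (m, k)" if km: "k \<in> D.K" "m \<in> D.K" for k m
    proof -
      have c: "l k \<in> carrier \<Omega>" "l m \<in> carrier \<Omega>" "\<tau> (k, m) \<in> carrier \<Omega>" "f k m \<in> carrier \<Omega>"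
        "inv\<^sub>L (l (k \<bullet> m)) \<in> carrier \<Omega>"
        using km lL li(1)[OF D.K_mult[OF km]] \<tau>_L f_L D.K_carrier Lc by auto
      have mk: "m \<bullet> k = k \<bullet> m" using km D.K_carrier D.G.m_comm by blast
      show ?thesis
        unfolding fK[OF km] \<tau>'[OF km] \<tau>'[OF km(2,1)] f_\<tau>[OF km, symmetric] mk
        using c by (simp only: D.m_ac D.m_closed)
    qed
    show "m = \<one>\<^sub>G" if "m \<in> D.K" "\<forall>k\<in>D.K. f' k m = \<one>\<^sub>L" for m
      using nondeg[OF that(1)] that fK by simp
    show "\<exists>z. (\<forall>k\<in>D.K. z k \<in> L) \<and> c = (\<Oplus>k\<in>D.K. \<iota> (z k) \<otimes> (\<iota> (l k) \<otimes> u k))" if c: "c \<in> carrier C" for c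
    proof -
      obtain z where z: "\<And>k. k \<in> D.K \<Longrightarrow> z k \<in> L" "c = \<Phi> z" using \<Phi>_surj[OF c] by blast
      have "c = (\<Oplus>k\<in>D.K. \<iota> (z k \<ast> inv\<^sub>L (l k)) \<otimes> (\<iota> (l k) \<otimes> u k))"
        unfolding z(2) \<Phi>_def
      proof (rule A.C.finsum_cong')
        fix k assume k: "k \<in> D.K"
        have "z k = z k \<ast> inv\<^sub>L (l k) \<ast> l k" using z(1)[OF k] li[OF k] lL[OF k] Lc by (simp add: D.m_assoc)
        then have "\<iota> (z k) \<otimes> u k = \<iota> (z k \<ast> inv\<^sub>L (l k) \<ast> l k) \<otimes> u k" by simp
        also have "\<dots> = \<iota> (z k \<ast> inv\<^sub>L (l k)) \<otimes> (\<iota> (l k) \<otimes> u k)"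
          using k z lL li L_mult \<iota>_closed u_closed by (simp add: \<iota>_mult A.C.m_assoc)
        finally show "\<iota> (z k) \<otimes> u k = \<iota> (z k \<ast> inv\<^sub>L (l k)) \<otimes> (\<iota> (l k) \<otimes> u k)" .
      qed (use z lL li L_mult \<iota>_closed u_closed in auto)
      then show ?thesis using z li L_mult by (intro exI[of _ "\<lambda>k. z k \<ast> inv\<^sub>L (l k)"]) auto
    qed
    show "z k = \<zero>\<^sub>L"
      if z: "\<And>k. k \<in> D.K \<Longrightarrow> z k \<in> L" and sum: "(\<Oplus>k\<in>D.K. \<iota> (z k) \<otimes> (\<iota> (l k) \<otimes> u k)) = \<zero>" and k: "k \<in> D.K" for z k
    proof -
      have "(\<Oplus>k\<in>D.K. \<iota> (z k \<ast> l k) \<otimes> u k) = (\<Oplus>k\<in>D.K. \<iota> (z k) \<otimes> (\<iota> (l k) \<otimes> u k))"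
        by (rule A.C.finsum_cong') (use z lL \<iota>_closed u_closed in \<open>auto simp: \<iota>_mult A.C.m_assoc\<close>)
      then have "z k \<ast> l k = \<zero>\<^sub>L"
        using indep[of "\<lambda>k. z k \<ast> l k" k] z lL L_mult sum k by auto
      then show ?thesis using z[OF k] lL[OF k] Lc D.integral_iff by auto
    qed
  qed (use \<iota>_hom \<iota>_F \<sigma>_\<iota> ext in auto)
qed

text \<open>An isomorphism moves only the embedding and the generators; \<open>L\<close>, \<theta>,
  \<tau> and f stay the same. This gives both the invariance under isomorphism and the passage to a
  copy on another type.\<close>

lemma transport:
  assumes B: "action_algebra (\<Omega>\<lparr>carrier := F\<rparr>) B G \<rho>"
    and \<phi>: "\<phi> \<in> ring_iso C B" and lin: "linear_on (\<Omega>\<lparr>carrier := F\<rparr>) C B \<phi>"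
    and equi: "\<And>g x. \<lbrakk>g \<in> carrier G; x \<in> carrier C\<rbrakk> \<Longrightarrow> \<phi> (\<sigma> g x) = \<rho> g (\<phi> x)"
  shows "crossed_data \<Omega> F G L \<theta> B \<rho> (\<lambda>x. \<phi> (\<iota> x)) (\<lambda>k. \<phi> (u k)) \<tau> f"
proof -
  interpret B: action_algebra "\<Omega>\<lparr>carrier := F\<rparr>" B G \<rho> by (rule B)
  note \<phi>E = ring_iso_memE[OF \<phi>]
  have \<phi>_inj: "\<lbrakk>x \<in> carrier C; y \<in> carrier C; \<phi> x = \<phi> y\<rbrakk> \<Longrightarrow> x = y" for x y
    using \<phi>E(5) by (auto simp: bij_betw_def dest: inj_onD)
  have \<phi>_zero: "\<phi> \<zero> = \<zero>\<^bsub>B\<^esub>"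
    by (rule A.C.additive_zero[OF B.C.abelian_group_axioms]) (use \<phi>E in auto)
  have \<Phi>\<phi>: "\<phi> (\<Phi> z) = (\<Oplus>\<^bsub>B\<^esub>k\<in>D.K. \<phi> (\<iota> (z k)) \<otimes>\<^bsub>B\<^esub> \<phi> (u k))" if z: "\<And>k. k \<in> D.K \<Longrightarrow> z k \<in> L" for z
  proof -
    have "\<phi> (\<Phi> z) = (\<Oplus>\<^bsub>B\<^esub>k\<in>D.K. \<phi> (\<iota> (z k) \<otimes> u k))"
      unfolding \<Phi>_def
      by (rule A.C.finsum_hom[OF B.C.abelian_group_axioms]) (use \<phi>E z \<iota>_closed u_closed in auto)
    also have "\<dots> = (\<Oplus>\<^bsub>B\<^esub>k\<in>D.K. \<phi> (\<iota> (z k)) \<otimes>\<^bsub>B\<^esub> \<phi> (u k))"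
      by (rule B.C.finsum_cong') (use \<phi>E z \<iota>_closed u_closed in auto)
    finally show ?thesis .
  qed
  show ?thesis
  proof (intro crossed_data.intro crossed_data_axioms.intro)
    show "galois_data \<Omega> F G L \<theta>" "action_algebra (\<Omega>\<lparr>carrier := F\<rparr>) B G \<rho>" by (rule D.galois_data_axioms B)+
    show "(\<lambda>x. \<phi> (\<iota> x)) \<in> ring_hom (\<Omega>\<lparr>carrier := L\<rparr>) B"
      by (rule ring_hom_memI) (use \<phi>E \<iota>_closed \<iota>_mult \<iota>_add \<iota>_one in auto)
    show "\<phi> (\<iota> r) = r \<odot>\<^bsub>B\<^esub> \<one>\<^bsub>B\<^esub>" if "r \<in> F" for r
      using lin that \<iota>_F[OF that] \<phi>E(4) by (simp add: linear_on_def)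
    show "\<phi> (u k) \<otimes>\<^bsub>B\<^esub> \<phi> (\<iota> x) = \<phi> (\<iota> x) \<otimes>\<^bsub>B\<^esub> \<phi> (u k)" if "k \<in> D.K" "x \<in> L" for k x
      using \<phi>E(2) u_closed \<iota>_closed u_\<iota> that by metis
    show "\<phi> (u k) \<otimes>\<^bsub>B\<^esub> \<phi> (u l) = \<phi> (\<iota> (\<tau> (k, l))) \<otimes>\<^bsub>B\<^esub> \<phi> (u (k \<bullet> l))" if "k \<in> D.K" "l \<in> D.K" for k l
      using \<phi>E(2)[OF u_closed u_closed, OF that] \<phi>E(2)[OF \<iota>_closed[OF \<tau>_L[OF that]] u_closed[OF D.K_mult[OF that]]]
        u_mult[OF that] by simp
    show "\<rho> g (\<phi> (\<iota> x)) = \<phi> (\<iota> (\<theta> g x))" if "g \<in> carrier G" "x \<in> L" for g x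
      using equi[OF that(1) \<iota>_closed[OF that(2)]] \<sigma>_\<iota>[OF that] by simp
    show "\<rho> g (\<phi> (u k)) = \<phi> (\<iota> (f k g)) \<otimes>\<^bsub>B\<^esub> \<phi> (u k)" if "k \<in> D.K" "g \<in> carrier G" for k g
      using equi[OF that(2) u_closed[OF that(1)]] \<sigma>_u[OF that] \<phi>E(2)[OF \<iota>_closed[OF f_L[OF that]] u_closed[OF that(1)]] by simp
    show "\<exists>z. (\<forall>k\<in>D.K. z k \<in> L) \<and> c = (\<Oplus>\<^bsub>B\<^esub>k\<in>D.K. \<phi> (\<iota> (z k)) \<otimes>\<^bsub>B\<^esub> \<phi> (u k))" if c: "c \<in> carrier B" for c
    proof -
      obtain x where x: "x \<in> carrier C" "c = \<phi> x" using c \<phi>E(5) by (auto simp: bij_betw_def)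
      obtain z where z: "\<And>k. k \<in> D.K \<Longrightarrow> z k \<in> L" "x = \<Phi> z" using \<Phi>_surj[OF x(1)] by blast
      show ?thesis
        by (intro exI[of _ z] conjI ballI z(1)) (simp_all add: x(2) z(2) \<Phi>\<phi>[OF z(1)])
    qed
    show "z k = \<zero>\<^sub>L"
      if z: "\<And>k. k \<in> D.K \<Longrightarrow> z k \<in> L" and sum: "(\<Oplus>\<^bsub>B\<^esub>k\<in>D.K. \<phi> (\<iota> (z k)) \<otimes>\<^bsub>B\<^esub> \<phi> (u k)) = \<zero>\<^bsub>B\<^esub>" and k: "k \<in> D.K" for z k
    proof -
      have "\<phi> (\<Phi> z) = \<phi> \<zero>" using trans[OF \<Phi>\<phi>[of z, OF z] sum] \<phi>_zero by simp
      moreover have "\<Phi> z \<in> carrier C" by (rule \<Phi>_closed) (rule z)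
      ultimately have "\<Phi> z = \<zero>" using \<phi>_inj A.C.zero_closed by blast
      then show ?thesis by (intro indep[of z k]) (use z k in \<open>simp_all add: \<Phi>_def\<close>)
    qed
  qed (use \<phi>E(1) u_closed \<tau>_closed \<tau>_ext f_closed f_\<tau> nondeg in auto)
qed

text \<open>Take the delta tensor on \<open>K\<close> and split its second legs into coordinates:
  \<sigma> x scales the coordinate k by f k x, so the remaining factors collect into the
  coefficients \<open>E k\<close>.\<close>

lemma K_interpolation:
  obtains E where "\<And>k. k \<in> D.K \<Longrightarrow> E k \<in> carrier C"
    "\<And>x. x \<in> D.K \<Longrightarrow> (\<Oplus>k\<in>D.K. E k \<otimes> \<iota> (f k x)) = (if \<one>\<^sub>G = x then \<one> else \<zero>)"
proof -
  obtain ts where ts: "set ts \<subseteq> carrier C \<times> carrier C"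
    "\<And>g. g \<in> carrier G \<Longrightarrow> lsum C (\<lambda>(a, b). a \<otimes> \<sigma> g b) ts = (if \<one>\<^sub>G = g then \<one> else \<zero>)"
    using delta unfolding bi_sum_def by metis
  have T: "(a, b) \<in> set ts \<Longrightarrow> a \<in> carrier C \<and> b \<in> carrier C" for a b using ts(1) by auto
  define q where "q b = (SOME z. (\<forall>k\<in>D.K. z k \<in> L) \<and> b = \<Phi> z)" for b
  have q: "\<And>k. k \<in> D.K \<Longrightarrow> q b k \<in> L" "b = \<Phi> (q b)" if "b \<in> carrier C" for b
    using someI_ex[OF \<Phi>_surj[OF that]] unfolding q_def by auto
  define p where "p k b = \<iota> (q b k) \<otimes> u k" for k b
  have p: "p k b \<in> carrier C" if "k \<in> D.K" "b \<in> carrier C" for k b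
    using q that \<iota>_closed u_closed by (simp add: p_def)
  have fc: "\<iota> (f k x) \<in> carrier C" if "k \<in> D.K" "x \<in> D.K" for k x using that f_L D.K_carrier \<iota>_closed by blast
  define E where "E k = lsum C (\<lambda>(a, b). a \<otimes> p k b) ts" for k
  have E: "E k \<in> carrier C" if "k \<in> D.K" for k
    unfolding E_def by (rule A.C.lsum_closed) (use that p in \<open>auto dest!: T\<close>)
  have "(\<Oplus>k\<in>D.K. E k \<otimes> \<iota> (f k x)) = (if \<one>\<^sub>G = x then \<one> else \<zero>)" if x: "x \<in> D.K" for x
  proof -
    have xG: "x \<in> carrier G" using x D.K_carrier by blast
    have "lsum C (\<lambda>(a, b). a \<otimes> \<sigma> x b) ts = lsum C (\<lambda>t. \<Oplus>k\<in>D.K. (case t of (a, b) \<Rightarrow> a \<otimes> p k b) \<otimes> \<iota> (f k x)) ts"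
    proof (rule lprod_cong, clarify)
      fix a b assume "(a, b) \<in> set ts"
      then have ab: "a \<in> carrier C" "b \<in> carrier C" using T by blast+
      have "\<sigma> x b = \<Phi> (\<lambda>k. \<theta> x (q b k) \<ast> f k x)" using \<Phi>_\<sigma>[of "q b" x] q[OF ab(2)] xG by simp
      also have "\<dots> = (\<Oplus>k\<in>D.K. p k b \<otimes> \<iota> (f k x))"
        unfolding \<Phi>_def
      proof (rule A.C.finsum_cong')
        fix k assume k: "k \<in> D.K"
        note qk = q(1)[OF ab(2) k] and fk = f_L[OF k xG]
        have "\<iota> (\<theta> x (q b k) \<ast> f k x) \<otimes> u k = \<iota> (q b k) \<otimes> (\<iota> (f k x) \<otimes> u k)"
          using D.K_\<theta>[OF x qk] qk fk \<iota>_closed u_closed[OF k] by (simp add: \<iota>_mult A.C.m_assoc)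
        also have "\<iota> (f k x) \<otimes> u k = u k \<otimes> \<iota> (f k x)" by (rule \<iota>_central[OF fk u_closed[OF k]])
        finally show "\<iota> (\<theta> x (q b k) \<ast> f k x) \<otimes> u k = p k b \<otimes> \<iota> (f k x)"
          using qk fk \<iota>_closed u_closed[OF k] by (simp add: p_def A.C.m_assoc)
      qed (use p ab fc x in auto)
      finally have "a \<otimes> \<sigma> x b = (\<Oplus>k\<in>D.K. a \<otimes> (p k b \<otimes> \<iota> (f k x)))"
        using A.C.finsum_rdistr[OF D.finite_K ab(1), of "\<lambda>k. p k b \<otimes> \<iota> (f k x)"] p ab fc x by (simp add: Pi_def)
      also have "\<dots> = (\<Oplus>k\<in>D.K. a \<otimes> p k b \<otimes> \<iota> (f k x))"
        by (rule A.C.finsum_cong') (use p ab fc x in \<open>auto simp: A.C.m_assoc\<close>)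
      finally show "a \<otimes> \<sigma> x b = (\<Oplus>k\<in>D.K. a \<otimes> p k b \<otimes> \<iota> (f k x))" .
    qed
    also have "\<dots> = (\<Oplus>k\<in>D.K. lsum C (\<lambda>t. (case t of (a, b) \<Rightarrow> a \<otimes> p k b) \<otimes> \<iota> (f k x)) ts)"
      by (rule A.C.finsum_lsum[symmetric]) (use D.finite_K p fc x in \<open>auto dest!: T\<close>)
    also have "\<dots> = (\<Oplus>k\<in>D.K. E k \<otimes> \<iota> (f k x))"
    proof (rule A.C.finsum_cong')
      fix k assume k: "k \<in> D.K"
      show "lsum C (\<lambda>t. (case t of (a, b) \<Rightarrow> a \<otimes> p k b) \<otimes> \<iota> (f k x)) ts = E k \<otimes> \<iota> (f k x)"
        unfolding E_def by (rule A.C.lsum_mult_right[symmetric]) (use k p fc x in \<open>auto dest!: T\<close>)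
    qed (use E fc x in auto)
    finally show ?thesis using ts(2)[OF xG] by simp
  qed
  with E that show ?thesis by blast
qed

text \<open>Translates of the interpolation write any function on \<open>K\<close> as a combination
  of the f k with coefficients in \<open>C\<close>. For \<chi> itself this is a linear dependence
  between characters, which independence excludes unless \<chi> is one of the f k.\<close>

lemma character_eq_f:
  assumes \<chi>: "\<And>x. x \<in> D.K \<Longrightarrow> \<chi> x \<in> F" "\<And>x y. \<lbrakk>x \<in> D.K; y \<in> D.K\<rbrakk> \<Longrightarrow> \<chi> (x \<bullet> y) = \<chi> x \<ast> \<chi> y"
    and one: "\<chi> \<one>\<^sub>G = \<one>\<^sub>L"
  obtains k where "k \<in> D.K" "\<And>x. x \<in> D.K \<Longrightarrow> \<chi> x = f k x"
proof (rule ccontr)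
  note main = that
  assume "\<not> thesis"
  then have ne: "\<exists>x\<in>D.K. \<chi> x \<noteq> f k x" if "k \<in> D.K" for k using main that by blast
  obtain E where E: "\<And>k. k \<in> D.K \<Longrightarrow> E k \<in> carrier C"
    "\<And>x. x \<in> D.K \<Longrightarrow> (\<Oplus>k\<in>D.K. E k \<otimes> \<iota> (f k x)) = (if \<one>\<^sub>G = x then \<one> else \<zero>)"
    by (rule K_interpolation) blast
  have \<chi>L: "x \<in> D.K \<Longrightarrow> \<chi> x \<in> L" for x using \<chi> D.F_in_L by blast
  have fKL: "\<lbrakk>k \<in> D.K; x \<in> D.K\<rbrakk> \<Longrightarrow> f k x \<in> L" for k x using f_L D.K_carrier by blast
  \<comment> \<open>The value \<chi> x multiplies delta at x, which is the interpolation translated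
    by the inverse of x; multiplicativity of f k puts the translation into the coefficient.\<close>
  define d where "d k = (\<Oplus>x\<in>D.K. \<iota> (\<chi> x) \<otimes> (E k \<otimes> \<iota> (f k (inv\<^sub>G x))))" for k
  have tc: "\<iota> (\<chi> x) \<otimes> (E k \<otimes> \<iota> (f k (inv\<^sub>G x))) \<in> carrier C" if "x \<in> D.K" "k \<in> D.K" for x k
    using that E \<chi>L fKL D.K_inv \<iota>_closed by simp
  have d: "d k \<in> carrier C" if "k \<in> D.K" for k
    unfolding d_def using that tc by (intro A.C.finsum_closed) auto
  have expand: "\<iota> (\<chi> y) = (\<Oplus>k\<in>D.K. d k \<otimes> \<iota> (f k y))" if y: "y \<in> D.K" for y
  proof -
    have "(\<Oplus>k\<in>D.K. d k \<otimes> \<iota> (f k y)) = (\<Oplus>k\<in>D.K. \<Oplus>x\<in>D.K. \<iota> (\<chi> x) \<otimes> (E k \<otimes> \<iota> (f k (inv\<^sub>G x \<bullet> y))))"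
    proof (rule A.C.finsum_cong')
      fix k assume k: "k \<in> D.K"
      have "d k \<otimes> \<iota> (f k y) = (\<Oplus>x\<in>D.K. \<iota> (\<chi> x) \<otimes> (E k \<otimes> \<iota> (f k (inv\<^sub>G x))) \<otimes> \<iota> (f k y))"
        unfolding d_def by (rule A.C.finsum_ldistr) (use D.finite_K tc k y fKL \<iota>_closed in auto)
      also have "\<dots> = (\<Oplus>x\<in>D.K. \<iota> (\<chi> x) \<otimes> (E k \<otimes> \<iota> (f k (inv\<^sub>G x \<bullet> y))))"
      proof (rule A.C.finsum_cong')
        fix x assume x: "x \<in> D.K"
        have "f k (inv\<^sub>G x \<bullet> y) = f k (inv\<^sub>G x) \<ast> f k y"
          by (rule f_K_mult) (use k x y D.K_inv D.K_carrier in auto)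
        then show "\<iota> (\<chi> x) \<otimes> (E k \<otimes> \<iota> (f k (inv\<^sub>G x))) \<otimes> \<iota> (f k y) = \<iota> (\<chi> x) \<otimes> (E k \<otimes> \<iota> (f k (inv\<^sub>G x \<bullet> y)))"
          using k x y E \<chi>L fKL D.K_inv \<iota>_closed by (simp add: A.C.m_assoc \<iota>_mult)
      qed (use k y E \<chi>L fKL D.K_inv D.K_mult \<iota>_closed in auto)
      finally show "d k \<otimes> \<iota> (f k y) = (\<Oplus>x\<in>D.K. \<iota> (\<chi> x) \<otimes> (E k \<otimes> \<iota> (f k (inv\<^sub>G x \<bullet> y))))" .
    qed (use y E \<chi>L fKL D.K_inv D.K_mult \<iota>_closed in \<open>auto intro!: A.C.finsum_closed\<close>)
    also have "\<dots> = (\<Oplus>x\<in>D.K. \<Oplus>k\<in>D.K. \<iota> (\<chi> x) \<otimes> (E k \<otimes> \<iota> (f k (inv\<^sub>G x \<bullet> y))))"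
      by (rule A.C.finsum_swap) (use D.finite_K y E \<chi>L fKL D.K_inv D.K_mult \<iota>_closed in auto)
    also have "\<dots> = (\<Oplus>x\<in>D.K. if y = x then \<iota> (\<chi> x) else \<zero>)"
    proof (rule A.C.finsum_cong')
      fix x assume x: "x \<in> D.K"
      let ?z = "inv\<^sub>G x \<bullet> y"
      have z: "?z \<in> D.K" using x y D.K_inv D.K_mult by blast
      have "(\<Oplus>k\<in>D.K. \<iota> (\<chi> x) \<otimes> (E k \<otimes> \<iota> (f k ?z))) = \<iota> (\<chi> x) \<otimes> (\<Oplus>k\<in>D.K. E k \<otimes> \<iota> (f k ?z))"
        by (rule A.C.finsum_rdistr[symmetric]) (use D.finite_K x z E \<chi>L fKL \<iota>_closed in auto)
      also have "\<dots> = \<iota> (\<chi> x) \<otimes> (if \<one>\<^sub>G = ?z then \<one> else \<zero>)" using E(2)[OF z] by simp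
      also have "\<one>\<^sub>G = ?z \<longleftrightarrow> y = x"
        using x y D.K_carrier by (metis D.G.inv_closed D.G.inv_equality D.G.inv_inv D.G.l_inv D.G.m_comm)
      finally show "(\<Oplus>k\<in>D.K. \<iota> (\<chi> x) \<otimes> (E k \<otimes> \<iota> (f k ?z))) = (if y = x then \<iota> (\<chi> x) else \<zero>)"
        using \<chi>L x \<iota>_closed by auto
    qed (use \<chi>L \<iota>_closed in auto)
    also have "\<dots> = \<iota> (\<chi> y)"
      using A.C.add.finprod_singleton[of y D.K "\<lambda>x. \<iota> (\<chi> x)"] y D.finite_K \<chi>L \<iota>_closed
      by (simp add: finsum_def Pi_def)
    finally show ?thesis by simp
  qed
  \<comment> \<open>\<open>None\<close> stands for \<chi>, with coefficient minus one, and
    \<open>Some k\<close> for f k.\<close>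
  define \<zeta> where "\<zeta> i x = (case i of None \<Rightarrow> \<iota> (\<chi> x) | Some k \<Rightarrow> \<iota> (f k x))" for i x
  define c where "c i = (case i of None \<Rightarrow> \<ominus> \<one> | Some k \<Rightarrow> d k)" for i
  have "c None = \<zero>"
  proof (rule A.C.dedekind_independence[where I="insert None (Some ` D.K)" and S=D.K and \<chi>=\<zeta> and Z="\<iota> ` L"
        and m="\<lambda>x y. x \<bullet> y" and e="\<one>\<^sub>G" and c=c and i=None])
    show "\<exists>g\<in>D.K. \<zeta> i g \<noteq> \<zeta> i' g" if ii: "i \<in> insert None (Some ` D.K)" "i' \<in> insert None (Some ` D.K)" "i \<noteq> i'" for i i'
    proof -
      have d1: "\<exists>x\<in>D.K. \<iota> (\<chi> x) \<noteq> \<iota> (f k x)" if "k \<in> D.K" for k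
        using ne[OF that] \<iota>_inj \<chi>L fKL that by blast
      have d2: "\<exists>x\<in>D.K. \<iota> (f k x) \<noteq> \<iota> (f l x)" if kl: "k \<in> D.K" "l \<in> D.K" "k \<noteq> l" for k l
      proof (rule ccontr)
        assume "\<not> (\<exists>x\<in>D.K. \<iota> (f k x) \<noteq> \<iota> (f l x))"
        then have e: "f k x = f l x" if "x \<in> D.K" for x using that \<iota>_inj fKL kl by blast
        \<comment> \<open>Antisymmetry moves the equality to the other argument, where nondegeneracy
          can be used.\<close>
        have "f x k = f x l" if x: "x \<in> D.K" for x
          using f_swap[OF x kl(1)] f_swap[OF x kl(2)] e[OF x] fKL kl x Lc D.m_comm
          by (intro D.inv_unique[of "f x k" "f k x" "f x l"]) auto
        then show False using f_distinct[OF kl(1,2)] kl(3) by simp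
      qed
      consider k where "i = None" "i' = Some k" "k \<in> D.K" | k where "i' = None" "i = Some k" "k \<in> D.K"
        | k l where "i = Some k" "i' = Some l" "k \<in> D.K" "l \<in> D.K" "k \<noteq> l"
        using ii by (cases i; cases i') auto
      then show ?thesis
      proof cases
        case 1
        then show ?thesis using d1[of k] by (simp add: \<zeta>_def)
      next
        case 2
        then show ?thesis using d1[of k] by (metis \<zeta>_def option.simps(4,5))
      next
        case 3
        then show ?thesis using d2 by (simp add: \<zeta>_def)
      qed
    qed
    show "(\<Oplus>i\<in>insert None (Some ` D.K). c i \<otimes> \<zeta> i y) = \<zero>" if y: "y \<in> D.K" for y
    proof -
      have "(\<Oplus>i\<in>Some ` D.K. c i \<otimes> \<zeta> i y) = (\<Oplus>k\<in>D.K. d k \<otimes> \<iota> (f k y))"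
        by (subst A.C.finsum_reindex) (use d fKL y \<iota>_closed in \<open>auto simp: c_def \<zeta>_def\<close>)
      then have "(\<Oplus>i\<in>insert None (Some ` D.K). c i \<otimes> \<zeta> i y) = c None \<otimes> \<zeta> None y \<oplus> \<iota> (\<chi> y)"
        unfolding expand[OF y] using D.finite_K d fKL \<chi>L y \<iota>_closed
        by (subst A.C.finsum_insert) (auto simp: c_def \<zeta>_def)
      also have "\<dots> = \<zero>" using \<iota>_closed[OF \<chi>L[OF y]] by (simp add: c_def \<zeta>_def A.C.l_minus A.C.l_neg)
      finally show ?thesis .
    qed
    show "c = \<zero>" if xyc: "x \<in> \<iota> ` L" "y \<in> \<iota> ` L" "x \<noteq> y" "c \<in> carrier C" "c \<otimes> (x \<ominus> y) = \<zero>" for x y c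
    proof -
      obtain a b where ab: "a \<in> L" "b \<in> L" "x = \<iota> a" "y = \<iota> b" using xyc by blast
      have n: "a \<ominus>\<^bsub>\<Omega>\<^esub> b \<in> L" "a \<ominus>\<^bsub>\<Omega>\<^esub> b \<noteq> \<zero>\<^sub>L"
        using ab xyc(3) L_add L_minus Lc D.r_right_minus_eq[of a b] by (auto simp: D.minus_eq)
      have "\<iota> (a \<ominus>\<^bsub>\<Omega>\<^esub> b) \<oplus> \<iota> b = \<iota> a" using \<iota>_add[OF n(1) ab(2)] ab Lc by (simp add: D.minus_eq D.a_assoc D.l_neg)
      then have "x \<ominus> y = (\<iota> (a \<ominus>\<^bsub>\<Omega>\<^esub> b) \<oplus> \<iota> b) \<ominus> \<iota> b" using ab by simp
      also have "\<dots> = \<iota> (a \<ominus>\<^bsub>\<Omega>\<^esub> b)"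
        using \<iota>_closed[OF n(1)] \<iota>_closed[OF ab(2)] by (simp add: A.C.minus_eq A.C.a_assoc A.C.r_neg)
      finally have "x \<ominus> y \<in> Units C" using \<iota>_unit(1)[OF n] by simp
      then show ?thesis
        by (rule A.C.unit_cancel_right[OF _ xyc(4) A.C.zero_closed]) (use xyc(5) A.C.Units_closed[OF \<open>x \<ominus> y \<in> Units C\<close>] in simp_all)
    qed
    show "\<zeta> i (g \<bullet> h) = \<zeta> i g \<otimes> \<zeta> i h" if "i \<in> insert None (Some ` D.K)" "g \<in> D.K" "h \<in> D.K" for i g h
      using that \<chi>(2) f_K_mult D.K_carrier \<chi>L fKL by (auto simp: \<zeta>_def \<iota>_mult)
    show "x \<otimes> y = y \<otimes> x" if "x \<in> \<iota> ` L" "y \<in> \<iota> ` L" for x y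
      using that \<iota>_central \<iota>_closed by blast
    show "\<zeta> i g \<in> \<iota> ` L" if "i \<in> insert None (Some ` D.K)" "g \<in> D.K" for i g
      using that \<chi>L fKL by (auto simp: \<zeta>_def)
    show "\<zeta> i \<one>\<^sub>G = \<one>" if "i \<in> insert None (Some ` D.K)" for i
      using that one f_one \<iota>_one by (auto simp: \<zeta>_def)
    show "c i \<in> carrier C" if "i \<in> insert None (Some ` D.K)" for i
      using that d by (auto simp: c_def)
  qed (use D.finite_K \<iota>_closed D.K_mult D.K_one in auto)
  then have "\<ominus> \<one> = \<zero>" by (simp add: c_def)
  then have "\<one> = \<zero>" using A.C.minus_minus[OF A.C.one_closed] by simp
  then show False using one_not_zero by simp
qed

end

section \<open>The invariants\<close>

context galois_data
begin

abbreviation "KG \<equiv> ker_group \<Omega> F G L \<theta>"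
abbreviation "UL \<equiv> mult_group \<Omega> L"
abbreviation "UF \<equiv> mult_group \<Omega> F"

lemma KG_simps [simp]: "x \<otimes>\<^bsub>KG\<^esub> y = x \<bullet> y" "\<one>\<^bsub>KG\<^esub> = \<one>\<^sub>G"
  by (simp_all add: ker_group_def)

lemmas UL = mult_group_subfield[OF subfield_L]
lemmas UF = mult_group_subfield[OF subfield_F]

text \<open>The product of t with the coboundary of c, written inside \<Omega>. Values of c in
  \<open>L\<close> describe a change of generators, values in \<open>F\<close> a change of
  representative within a class.\<close>

definition twist where
  "twist c t = (\<lambda>(x, y)\<in>K \<times> K. c x \<ast> c y \<ast> inv (c (x \<bullet> y)) \<ast> t (x, y))"

text \<open>The coset is formed with the product of the cocycle group and the inverses of the unit
  group of \<open>F\<close>; expressing it through \<open>twist\<close> brings all calculations back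
  to \<Omega>.\<close>

lemma coset_twist: "coset_B2 \<Omega> F KG L t = {twist c t | c. c \<in> K \<rightarrow> F - {\<zero>}}"
proof -
  let ?b = "\<lambda>c. \<lambda>(x, y)\<in>K \<times> K. c x \<otimes>\<^bsub>UF\<^esub> c y \<otimes>\<^bsub>UF\<^esub> inv\<^bsub>UF\<^esub> c (x \<otimes>\<^bsub>KG\<^esub> y)"
  let ?Z = "cocycle_group2 KG UL"
  have tw: "?b c \<otimes>\<^bsub>?Z\<^esub> t = twist c t" if "c \<in> K \<rightarrow> F - {\<zero>}" for c
  proof -
    have "?b c \<otimes>\<^bsub>?Z\<^esub> t = (\<lambda>p\<in>K \<times> K. ?b c p \<otimes>\<^bsub>UL\<^esub> t p)" by (simp add: cocycle_group2_def)
    also have "\<dots> = twist c t"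
      unfolding twist_def
    proof (rule restrict_ext, clarify)
      fix x y assume xy: "x \<in> K" "y \<in> K"
      have "c (x \<bullet> y) \<in> F - {\<zero>}" using that K_mult[OF xy] by blast
      then show "?b c (x, y) \<otimes>\<^bsub>UL\<^esub> t (x, y)
        = c x \<ast> c y \<ast> inv (c (x \<bullet> y)) \<ast> t (x, y)"
        using xy UF(4) by (simp add: UL UF(2))
    qed
    finally show ?thesis .
  qed
  have "coset_B2 \<Omega> F KG L t = (\<lambda>h. h \<otimes>\<^bsub>?Z\<^esub> t) ` ?b ` (K \<rightarrow> F - {\<zero>})"
    unfolding coset_B2_def r_coset_def coboundaries2_def UF(1) by blast
  also have "\<dots> = (\<lambda>c. ?b c \<otimes>\<^bsub>?Z\<^esub> t) ` (K \<rightarrow> F - {\<zero>})" by (rule image_image)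
  also have "\<dots> = (\<lambda>c. twist c t) ` (K \<rightarrow> F - {\<zero>})" by (rule image_cong[OF refl tw])
  finally show ?thesis by blast
qed

lemma twist_twist:
  assumes "c \<in> K \<rightarrow> L - {\<zero>}" "d \<in> K \<rightarrow> L - {\<zero>}" "\<And>x y. \<lbrakk>x \<in> K; y \<in> K\<rbrakk> \<Longrightarrow> t (x, y) \<in> carrier \<Omega>"
  shows "twist d (twist c t) = twist (\<lambda>k. d k \<ast> c k) t"
  unfolding twist_def
proof (rule restrict_ext, clarify)
  fix x y assume x: "x \<in> K" and y: "y \<in> K"
  have cc: "c k \<in> L" "c k \<noteq> \<zero>" "d k \<in> L" "d k \<noteq> \<zero>" "inv (c k) \<in> carrier \<Omega>" "inv (d k) \<in> carrier \<Omega>"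
    "c k \<in> carrier \<Omega>" "d k \<in> carrier \<Omega>" if "k \<in> K" for k
  proof -
    show *: "c k \<in> L" "c k \<noteq> \<zero>" "d k \<in> L" "d k \<noteq> \<zero>" using assms that by auto
    then show "inv (c k) \<in> carrier \<Omega>" "inv (d k) \<in> carrier \<Omega>" "c k \<in> carrier \<Omega>" "d k \<in> carrier \<Omega>"
      using L_inv(1) L_carrier by auto
  qed
  let ?z = "x \<bullet> y"
  note X = cc[OF x] and Y = cc[OF y] and Z = cc[OF K_mult[OF x y]] and T = assms(3)[OF x y]
  have i: "inv (d ?z \<ast> c ?z) = inv (d ?z) \<ast> inv (c ?z)"
  proof (rule comm_inv_char)
    have "d ?z \<ast> c ?z \<ast> (inv (d ?z) \<ast> inv (c ?z))
      = (d ?z \<ast> inv (d ?z)) \<ast> (c ?z \<ast> inv (c ?z))"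
      using Z by (simp only: m_ac m_closed)
    then show "d ?z \<ast> c ?z \<ast> (inv (d ?z) \<ast> inv (c ?z)) = \<one>"
      using L_inv(3)[OF Z(1,2)] L_inv(3)[OF Z(3,4)] by simp
  qed (use Z in auto)
  show "d x \<ast> d y \<ast> inv (d ?z) \<otimes>
      (\<lambda>(x, y)\<in>K \<times> K. c x \<ast> c y \<ast> inv (c (x \<bullet> y)) \<ast> t (x, y)) (x, y)
    = d x \<ast> c x \<ast> (d y \<ast> c y) \<ast> inv (d ?z \<ast> c ?z) \<ast> t (x, y)"
    unfolding i using X Y Z T x y by (simp add: m_ac)
qed

lemma twist_one:
  assumes "t \<in> extensional (K \<times> K)" "\<And>x y. \<lbrakk>x \<in> K; y \<in> K\<rbrakk> \<Longrightarrow> t (x, y) \<in> carrier \<Omega>" "\<And>k. k \<in> K \<Longrightarrow> c k = \<one>"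
  shows "twist c t = t"
  by (rule extensionalityI[of _ "K \<times> K"]) (use assms K_mult in \<open>auto simp: twist_def\<close>)

text \<open>One inclusion holds because successive twists multiply; the other is the same inclusion
  for the inverse of c.\<close>

lemma coset_eqI:
  assumes c: "c \<in> K \<rightarrow> F - {\<zero>}" and t: "\<And>x y. \<lbrakk>x \<in> K; y \<in> K\<rbrakk> \<Longrightarrow> t (x, y) \<in> carrier \<Omega>" "t \<in> extensional (K \<times> K)"
  shows "coset_B2 \<Omega> F KG L (twist c t) = coset_B2 \<Omega> F KG L t"
proof -
  have FL: "c \<in> K \<rightarrow> F - {\<zero>} \<Longrightarrow> c \<in> K \<rightarrow> L - {\<zero>}" for c using F_L by blast
  have sub: "coset_B2 \<Omega> F KG L (twist c t) \<subseteq> coset_B2 \<Omega> F KG L t"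
    if c: "c \<in> K \<rightarrow> F - {\<zero>}" and t: "\<And>x y. \<lbrakk>x \<in> K; y \<in> K\<rbrakk> \<Longrightarrow> t (x, y) \<in> carrier \<Omega>" for c t
  proof
    fix s assume "s \<in> coset_B2 \<Omega> F KG L (twist c t)"
    then obtain d where d: "d \<in> K \<rightarrow> F - {\<zero>}" "s = twist d (twist c t)" unfolding coset_twist by blast
    have "s = twist (\<lambda>k. d k \<ast> c k) t"
      unfolding d(2) by (rule twist_twist[OF FL[OF c] FL[OF d(1)]]) (rule t)
    moreover have "(\<lambda>k. d k \<ast> c k) \<in> K \<rightarrow> F - {\<zero>}"
    proof
      fix k assume "k \<in> K"
      then have "c k \<in> F" "c k \<noteq> \<zero>" "d k \<in> F" "d k \<noteq> \<zero>" using c d(1) by auto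
      then show "d k \<ast> c k \<in> F - {\<zero>}" using F_ring F_in_L L_carrier integral_iff by auto
    qed
    ultimately show "s \<in> coset_B2 \<Omega> F KG L t" unfolding coset_twist by blast
  qed
  define c' where "c' k = inv (c k)" for k
  have ck: "c k \<in> F" "c k \<noteq> \<zero>" "c k \<in> L" if "k \<in> K" for k using c that F_L by auto
  have c': "c' \<in> K \<rightarrow> F - {\<zero>}"
    using ck F_inv L_inv(2) by (auto simp: c'_def)
  have "twist c' (twist c t) = t"
  proof -
    have "twist c' (twist c t) = twist (\<lambda>k. c' k \<ast> c k) t"
      by (rule twist_twist[OF FL[OF c] FL[OF c']]) (rule t(1))
    also have "\<dots> = t"
      by (rule twist_one[OF t(2)]) (use t(1) ck L_inv(4) in \<open>auto simp: c'_def\<close>)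
    finally show ?thesis .
  qed
  moreover have "coset_B2 \<Omega> F KG L (twist c' (twist c t)) \<subseteq> coset_B2 \<Omega> F KG L (twist c t)"
  proof (rule sub[OF c'])
    fix x y assume xy: "x \<in> K" "y \<in> K"
    then show "twist c t (x, y) \<in> carrier \<Omega>"
      using ck K_mult L_inv(1) L_carrier t(1) by (auto simp: twist_def)
  qed
  moreover have "coset_B2 \<Omega> F KG L (twist c t) \<subseteq> coset_B2 \<Omega> F KG L t"
    by (rule sub[OF c]) (rule t(1))
  ultimately show ?thesis by simp
qed

text \<open>With c = 1 one sees that s lies in its own coset, hence in the coset of t.\<close>

lemma coset_eqD:
  assumes eq: "coset_B2 \<Omega> F KG L t = coset_B2 \<Omega> F KG L s"
    and s: "\<And>x y. \<lbrakk>x \<in> K; y \<in> K\<rbrakk> \<Longrightarrow> s (x, y) \<in> carrier \<Omega>" "s \<in> extensional (K \<times> K)"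
  obtains c where "c \<in> K \<rightarrow> F - {\<zero>}" "s = twist c t"
proof -
  have "s = twist (\<lambda>_. \<one>) s" by (rule twist_one[symmetric]) (use s in auto)
  moreover have "(\<lambda>_. \<one>) \<in> K \<rightarrow> F - {\<zero>}" using F_ring by auto
  ultimately have "s \<in> coset_B2 \<Omega> F KG L s" unfolding coset_twist by blast
  then have "s \<in> coset_B2 \<Omega> F KG L t" unfolding eq .
  then obtain c where "c \<in> K \<rightarrow> F - {\<zero>}" "s = twist c t" unfolding coset_twist by blast
  then show ?thesis by (rule that)
qed

text \<open>Each member of \<open>Xi\<close> is the chosen extension of some character, and its
  restriction to \<open>K\<close> returns that character; so prescribed values on \<open>K\<close>
  leave exactly one candidate.\<close>

lemma Xi_ext_eq:
  assumes choice: "extension_choice \<Omega> F G e" and Z: "(L, \<theta>) \<in> Z_set \<Omega> F G"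
    and k: "k \<in> K" and \<chi>: "(\<lambda>x\<in>K. \<beta> x k) \<in> characters KG UF"
  shows "Xi_ext \<Omega> F G e L \<theta> \<beta> k = e L \<theta> (\<lambda>x\<in>K. \<beta> x k)"
proof -
  have E: "restrict (e L \<theta> \<psi>) K = \<psi>" if "\<psi> \<in> characters KG UF" for \<psi>
    using choice Z that unfolding extension_choice_def Let_def by fastforce
  show ?thesis
    unfolding Xi_ext_def
  proof (rule the_equality)
    have "e L \<theta> (\<lambda>x\<in>K. \<beta> x k) x = \<beta> x k" if "x \<in> K" for x
      using fun_cong[OF E[OF \<chi>], of x] that by simp
    then show "e L \<theta> (\<lambda>x\<in>K. \<beta> x k) \<in> Xi \<Omega> F G e L \<theta> \<and> (\<forall>x\<in>K. e L \<theta> (\<lambda>x\<in>K. \<beta> x k) x = \<beta> x k)"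
      using \<chi> by (simp add: Xi_def)
    fix f assume f: "f \<in> Xi \<Omega> F G e L \<theta> \<and> (\<forall>x\<in>K. f x = \<beta> x k)"
    then obtain \<psi> where \<psi>: "\<psi> \<in> characters KG UF" "f = e L \<theta> \<psi>" by (auto simp: Xi_def)
    have "\<psi> = (\<lambda>x\<in>K. \<beta> x k)"
      using E[OF \<psi>(1)] f \<psi>(2) by (metis (no_types, lifting) restrict_ext)
    then show "f = e L \<theta> (\<lambda>x\<in>K. \<beta> x k)" using \<psi>(2) by simp
  qed
qed

end

section \<open>Admissibility of the field and action, and normalization of the generators\<close>

context crossed_data
begin

lemma f_character: "k \<in> D.K \<Longrightarrow> (\<lambda>x\<in>D.K. f k x) \<in> characters D.KG D.UF"
  using f_K_F f_closed D.K_carrier D.K_mult f_K_mult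
  by (auto simp: characters_def hom_def D.UF)

lemma f_cocycle1: "k \<in> D.K \<Longrightarrow> restrict (f k) (carrier G) \<in> cocycles1 G D.UL \<theta>"
  using f_closed f_cocycle by (auto simp: cocycles1_def D.UL)

text \<open>The bicharacter is f with exchanged arguments. As for extensions, every character of
  \<open>K\<close> is some f k there, and f k is a cocycle on all of \<open>G\<close>.\<close>

lemma Z_mem: "(L, \<theta>) \<in> Z_set \<Omega> F G"
proof -
  have alt: "alternating_bicharacter D.KG D.UF (\<lambda>x y. f y x)"
    using f_K_F f_closed D.K_carrier f_K_mult f_bichar f_alternating
    by (auto simp: alternating_bicharacter_def hom_def D.UF)
  have nd: "nondegenerate D.KG D.UF (\<lambda>x y. f y x)"
    using nondeg by (auto simp: nondegenerate_def D.UF)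
  have ext: "\<exists>h\<in>cocycles1 G D.UL \<theta>. restrict h D.K = \<chi>" if \<chi>: "\<chi> \<in> characters D.KG D.UF" for \<chi>
  proof -
    have 1: "\<chi> x \<in> F - {\<zero>\<^sub>L}" if "x \<in> D.K" for x
      using \<chi> that by (auto simp: characters_def hom_def D.UF)
    have 2: "\<chi> (x \<bullet> y) = \<chi> x \<ast> \<chi> y" if "x \<in> D.K" "y \<in> D.K" for x y
      using \<chi> that by (auto simp: characters_def hom_def D.UF)
    have "\<chi> \<one>\<^sub>G \<ast> \<chi> \<one>\<^sub>G = \<chi> \<one>\<^sub>G \<ast> \<one>\<^sub>L"
      using 2[OF D.K_one D.K_one] 1[OF D.K_one] D.F_in_L Lc by auto
    moreover have "\<chi> \<one>\<^sub>G \<in> carrier \<Omega>" "\<chi> \<one>\<^sub>G \<noteq> \<zero>\<^sub>L" using 1[OF D.K_one] D.F_in_L Lc by auto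
    ultimately have 3: "\<chi> \<one>\<^sub>G = \<one>\<^sub>L" using D.m_lcancel D.one_closed by blast
    obtain k where k: "k \<in> D.K" "\<And>x. x \<in> D.K \<Longrightarrow> \<chi> x = f k x"
      using character_eq_f[of \<chi>] 1 2 3 by blast
    \<comment> \<open>Cocycles are extensional on \<open>G\<close>, so f k is cut down to
      \<open>G\<close> before it is restricted to \<open>K\<close>.\<close>
    have "restrict (restrict (f k) (carrier G)) D.K = \<chi>"
      by (rule extensionalityI[of _ D.K]) (use k \<chi> D.K_carrier in \<open>auto simp: characters_def\<close>)
    then show ?thesis using f_cocycle1[OF k(1)] by blast
  qed
  show ?thesis
    unfolding Z_set_def Let_def using D.finite_Galois D.\<theta>_epi D.\<theta>_ext alt nd ext by auto
qed

text \<open>The chosen extension and f k agree on \<open>K\<close>, so their quotient is a cocycle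
  trivial on \<open>K\<close>. Writing it as the coboundary of l k gives exactly the factor by which
  u k has to be rescaled.\<close>

lemma normalize:
  assumes choice: "extension_choice \<Omega> F G e"
  obtains u' \<tau>' f' where "crossed_data \<Omega> F G L \<theta> C \<sigma> \<iota> u' \<tau>' f'"
    "\<And>k g. \<lbrakk>k \<in> D.K; g \<in> carrier G\<rbrakk> \<Longrightarrow> f' k g = e L \<theta> (\<lambda>x\<in>D.K. f' k x) g"
proof -
  define f' where "f' k = e L \<theta> (\<lambda>x\<in>D.K. f k x)" for k
  have f': "f' k \<in> cocycles1 G D.UL \<theta>" "restrict (f' k) D.K = (\<lambda>x\<in>D.K. f k x)" if "k \<in> D.K" for k
    using choice Z_mem f_character[OF that] unfolding extension_choice_def Let_def f'_def by fastforce+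
  have f'K: "f' k x = f k x" if "k \<in> D.K" "x \<in> D.K" for k x
    using fun_cong[OF f'(2)[OF that(1)], of x] that by simp
  have f'c: "f' k g \<in> L - {\<zero>\<^sub>L}" if "k \<in> D.K" "g \<in> carrier G" for k g
    using f'(1)[OF that(1)] that(2) by (auto simp: cocycles1_def D.UL)
  have f'm: "f' k (g \<bullet> h) = f' k g \<ast> \<theta> g (f' k h)" if "k \<in> D.K" "g \<in> carrier G" "h \<in> carrier G" for k g h
    using f'(1)[OF that(1)] that(2,3) by (auto simp: cocycles1_def D.UL)
  have "\<exists>b. b \<in> L - {\<zero>\<^sub>L} \<and> (\<forall>g\<in>carrier G. f' k g = \<theta> g b \<ast> inv\<^sub>L b \<ast> f k g)" if k: "k \<in> D.K" for k
  proof -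
    let ?c = "\<lambda>g. f' k g \<ast> inv\<^sub>L (f k g)"
    have F: "f k g \<in> L" "f k g \<noteq> \<zero>\<^sub>L" "f k g \<in> carrier \<Omega>" "inv\<^sub>L (f k g) \<in> L" "inv\<^sub>L (f k g) \<in> carrier \<Omega>"
      "inv\<^sub>L (f k g) \<noteq> \<zero>\<^sub>L" "f' k g \<in> L" "f' k g \<in> carrier \<Omega>" "f' k g \<noteq> \<zero>\<^sub>L"
      "f k g \<ast> inv\<^sub>L (f k g) = \<one>\<^sub>L" "inv\<^sub>L (f k g) \<ast> f k g = \<one>\<^sub>L" if "g \<in> carrier G" for g
      using f_closed[OF k that] f'c[OF k that] D.L_inv[of "f k g"] Lc by auto
    obtain b where b: "b \<in> L - {\<zero>\<^sub>L}" "\<And>g. g \<in> carrier G \<Longrightarrow> ?c g = \<theta> g b \<ast> inv\<^sub>L b"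
    proof (rule D.hilbert90[of ?c])
      show "?c g \<in> L - {\<zero>\<^sub>L}" if "g \<in> carrier G" for g
        using F[OF that] L_mult D.integral_iff by auto
      show "?c (g \<bullet> h) = ?c g \<ast> \<theta> g (?c h)" if gh: "g \<in> carrier G" "h \<in> carrier G" for g h
      proof -
        note A = F[OF gh(1)] and B = F[OF gh(2)] and GH = F[OF D.G.m_closed[OF gh]]
        have t: "\<theta> g (f k h) \<in> L" "\<theta> g (f k h) \<noteq> \<zero>\<^sub>L" "\<theta> g (f' k h) \<in> L"
          using D.\<theta>_closed D.\<theta>_nonzero gh B by auto
        note ti = D.L_inv[OF t(1,2)]
        have c: "\<theta> g (f k h) \<in> carrier \<Omega>" "inv\<^sub>L (\<theta> g (f k h)) \<in> carrier \<Omega>" "\<theta> g (f' k h) \<in> carrier \<Omega>" using t ti Lc by auto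
        have "inv\<^sub>L (f k g \<ast> \<theta> g (f k h)) = inv\<^sub>L (f k g) \<ast> inv\<^sub>L (\<theta> g (f k h))"
        proof (rule D.comm_inv_char)
          have "f k g \<ast> \<theta> g (f k h) \<ast> (inv\<^sub>L (f k g) \<ast> inv\<^sub>L (\<theta> g (f k h)))
            = (f k g \<ast> inv\<^sub>L (f k g)) \<ast> (\<theta> g (f k h) \<ast> inv\<^sub>L (\<theta> g (f k h)))"
            using A(3,5) c by (simp only: D.m_ac D.m_closed)
          then show "f k g \<ast> \<theta> g (f k h) \<ast> (inv\<^sub>L (f k g) \<ast> inv\<^sub>L (\<theta> g (f k h))) = \<one>\<^sub>L"
            using A ti by simp
        qed (use A c in auto)
        then have "?c (g \<bullet> h) = f' k g \<ast> \<theta> g (f' k h) \<ast> (inv\<^sub>L (f k g) \<ast> inv\<^sub>L (\<theta> g (f k h)))"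
          using f'm[OF k gh] f_cocycle[OF k gh] by simp
        also have "\<dots> = ?c g \<ast> (\<theta> g (f' k h) \<ast> inv\<^sub>L (\<theta> g (f k h)))"
          using A(5,8) c by (simp only: D.m_ac D.m_closed)
        also have "\<theta> g (f' k h) \<ast> inv\<^sub>L (\<theta> g (f k h)) = \<theta> g (?c h)"
          using D.\<theta>_mult[OF gh(1) B(7,4)] D.\<theta>_inv[OF gh(1) B(1,2)] by simp
        finally show ?thesis .
      qed
      show "?c g = \<one>\<^sub>L" if g: "g \<in> carrier G" "\<theta> g = \<theta> \<one>\<^sub>G" for g
      proof -
        have "g \<in> D.K" using g D.\<theta>_id by (simp add: D.mem_ker)
        then show ?thesis using f'K[OF k] F[OF g(1)] by simp
      qed
    qed blast
    have "f' k g = \<theta> g b \<ast> inv\<^sub>L b \<ast> f k g" if "g \<in> carrier G" for g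
      unfolding b(2)[OF that, symmetric] using F[OF that] by (simp add: D.m_assoc)
    with b(1) show ?thesis by blast
  qed
  then obtain l where l: "\<And>k. k \<in> D.K \<Longrightarrow> l k \<in> L - {\<zero>\<^sub>L}"
    "\<And>k g. \<lbrakk>k \<in> D.K; g \<in> carrier G\<rbrakk> \<Longrightarrow> f' k g = \<theta> g (l k) \<ast> inv\<^sub>L (l k) \<ast> f k g" by metis
  show ?thesis
  proof (rule that)
    show "crossed_data \<Omega> F G L \<theta> C \<sigma> \<iota> (\<lambda>k. \<iota> (l k) \<otimes> u k) (D.twist l \<tau>) f'"
      by (rule rescale[OF l(1) l(2)]) (auto simp: D.twist_def)
    show "f' k g = e L \<theta> (\<lambda>x\<in>D.K. f' k x) g" if "k \<in> D.K" "g \<in> carrier G" for k g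
    proof -
      have "(\<lambda>x\<in>D.K. f' k x) = (\<lambda>x\<in>D.K. f k x)" using f'(2)[OF that(1)] by simp
      then show ?thesis by (simp add: f'_def)
    qed
  qed
qed

end

section \<open>The invariants of a normalized crossed product\<close>

locale normalized_data = crossed_data +
  fixes e
  assumes choice: "extension_choice \<Omega> F G e"
    and normal: "\<And>k g. \<lbrakk>k \<in> D.K; g \<in> carrier G\<rbrakk> \<Longrightarrow> f k g = e L \<theta> (\<lambda>x\<in>D.K. f k x) g"
begin

lemma Xi_ext_f:
  assumes "\<And>x k. \<lbrakk>x \<in> D.K; k \<in> D.K\<rbrakk> \<Longrightarrow> \<beta> x k = f k x" "k \<in> D.K" "g \<in> carrier G"
  shows "Xi_ext \<Omega> F G e L \<theta> \<beta> k g = f k g"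
proof -
  have eq: "(\<lambda>x\<in>D.K. \<beta> x k) = (\<lambda>x\<in>D.K. f k x)" using assms by (intro restrict_ext) auto
  have "Xi_ext \<Omega> F G e L \<theta> \<beta> k = e L \<theta> (\<lambda>x\<in>D.K. \<beta> x k)"
    by (rule D.Xi_ext_eq[OF choice Z_mem assms(2)]) (use eq f_character assms in simp)
  then show ?thesis using normal[OF assms(2,3)] eq by simp
qed

text \<open>The bicharacter attached to \<tau> sends (x, k) to f k x, so the cocycles that the
  definition asks for are the f k themselves, and the required relation is the coboundary relation
  of the action.\<close>

lemma T_mem: "(L, \<theta>, coset_B2 \<Omega> F D.KG L \<tau>) \<in> T_set \<Omega> F G e"
proof -
  let ?\<beta> = "\<lambda>x y. \<tau> (x, y) \<otimes>\<^bsub>D.UL\<^esub> inv\<^bsub>D.UL\<^esub> \<tau> (y, x)"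
  have tc: "\<tau> (x, y) \<in> carrier \<Omega>" "\<tau> (x, y) \<in> L" "\<tau> (x, y) \<noteq> \<zero>\<^sub>L" if "x \<in> D.K" "y \<in> D.K" for x y
    using \<tau>_closed[OF that] Lc by auto
  have \<beta>: "?\<beta> x k = f k x" if "x \<in> D.K" "k \<in> D.K" for x k
  proof -
    have "f k x \<in> carrier \<Omega>" using f_L that D.K_carrier Lc by blast
    then show ?thesis
      using D.UL(4)[OF \<tau>_closed[OF that(2,1)]] D.L_inv[OF tc(2,3)[OF that(2,1)]] tc[OF that(2,1)] Lc
      by (simp add: D.UL f_\<tau>[OF that(2,1), symmetric] D.m_assoc)
  qed
  have fx: "Xi_ext \<Omega> F G e L \<theta> ?\<beta> k g = f k g" if "k \<in> D.K" "g \<in> carrier G" for k g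
    by (rule Xi_ext_f[OF \<beta> that])
  have mem: "\<tau> \<in> carrier (cocycle_group2 D.KG D.UL)"
    using \<tau>_ext \<tau>_closed \<tau>_cocycle by (auto simp: cocycle_group2_def D.UL PiE_def)
  have nd: "nondegenerate D.KG D.UL ?\<beta>"
    using nondeg \<beta> by (auto simp: nondegenerate_def D.UL)
  have rel: "f x g \<otimes>\<^bsub>D.UL\<^esub> f y g = coboundary1 D.UL \<theta> (\<tau> (x, y)) g \<otimes>\<^bsub>D.UL\<^esub> f (x \<bullet> y) g"
    if "x \<in> D.K" "y \<in> D.K" "g \<in> carrier G" for x y g
  proof -
    note t = tc[OF that(1,2)]
    note ti = D.L_inv[OF t(2,3)]
    have c: "f x g \<in> carrier \<Omega>" "f y g \<in> carrier \<Omega>" "f (x \<bullet> y) g \<in> carrier \<Omega>" "\<theta> g (\<tau> (x, y)) \<in> carrier \<Omega>"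
      "inv\<^sub>L (\<tau> (x, y)) \<in> carrier \<Omega>"
      using f_L that D.K_mult D.\<theta>_closed t ti Lc by auto
    have "f x g \<ast> f y g = f x g \<ast> f y g \<ast> \<tau> (x, y) \<ast> inv\<^sub>L (\<tau> (x, y))"
      using c t ti by (simp add: D.m_assoc)
    also have "\<dots> = \<theta> g (\<tau> (x, y)) \<ast> f (x \<bullet> y) g \<ast> inv\<^sub>L (\<tau> (x, y))"
      unfolding f_coboundary[OF that] ..
    also have "\<dots> = \<theta> g (\<tau> (x, y)) \<ast> inv\<^sub>L (\<tau> (x, y)) \<ast> f (x \<bullet> y) g"
      using c by (simp only: D.m_ac D.m_closed)
    finally show ?thesis
      using D.UL(4)[OF \<tau>_closed[OF that(1,2)]] by (simp add: coboundary1_def D.UL)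
  qed
  show ?thesis
    unfolding T_set_def Let_def
  proof (intro CollectI case_prodI conjI bexI[of _ \<tau>] Z_mem refl mem nd ballI)
    fix x y g assume x: "x \<in> D.K" "y \<in> D.K" "g \<in> carrier G"
    then show "Xi_ext \<Omega> F G e L \<theta> ?\<beta> x g \<otimes>\<^bsub>D.UL\<^esub> Xi_ext \<Omega> F G e L \<theta> ?\<beta> y g =
        coboundary1 D.UL \<theta> (\<tau> (x, y)) g \<otimes>\<^bsub>D.UL\<^esub> Xi_ext \<Omega> F G e L \<theta> ?\<beta> (x \<otimes>\<^bsub>D.KG\<^esub> y) g"
      using rel[OF x] D.K_mult[OF x(1,2)] by (simp add: fx)
  qed
qed

lemma center_iso: "\<iota> \<in> center_isos \<Omega> F L C"
  unfolding center_isos_def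
  using \<iota>_mult \<iota>_add \<iota>_one \<iota>_F \<iota>_inj center_eq
  by (auto intro!: ring_iso_memI simp: bij_betw_def inj_on_def)

lemma center_isoD:
  assumes "\<kappa> \<in> center_isos \<Omega> F M C"
  shows "\<And>x. x \<in> M \<Longrightarrow> \<kappa> x \<in> \<iota> ` L" "\<And>x y. \<lbrakk>x \<in> M; y \<in> M\<rbrakk> \<Longrightarrow> \<kappa> (x \<ast> y) = \<kappa> x \<otimes> \<kappa> y"
    "\<And>x y. \<lbrakk>x \<in> M; y \<in> M\<rbrakk> \<Longrightarrow> \<kappa> (x \<oplus>\<^bsub>\<Omega>\<^esub> y) = \<kappa> x \<oplus> \<kappa> y" "\<kappa> \<one>\<^sub>L = \<one>" "bij_betw \<kappa> M (\<iota> ` L)" "\<And>r. r \<in> F \<Longrightarrow> \<kappa> r = \<iota> r"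
  using assms ring_iso_memE[of \<kappa> "\<Omega>\<lparr>carrier := M\<rparr>" "C\<lparr>carrier := ring_center C\<rparr>"] \<iota>_F
  unfolding center_isos_def center_eq by auto

text \<open>Composing \<iota> with the inverse of \<kappa> embeds \<open>L\<close> into \<Omega>
  over \<open>F\<close> with image \<open>M\<close>. Such an embedding agrees with some \<theta> g,
  so its image is \<open>L\<close>.\<close>

lemma center_isos_field:
  assumes M: "subfield M \<Omega>" "F \<subseteq> M" and \<kappa>: "\<kappa> \<in> center_isos \<Omega> F M C"
  shows "M = L"
proof -
  note \<kappa>D = center_isoD[OF \<kappa>]
  define \<psi> where "\<psi> x = inv_into M \<kappa> (\<iota> x)" for x
  have \<psi>: "\<psi> x \<in> M" "\<kappa> (\<psi> x) = \<iota> x" if "x \<in> L" for x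
    using \<kappa>D(5) that by (auto simp: \<psi>_def bij_betw_def inv_into_into f_inv_into_f)
  have \<kappa>_inj: "\<lbrakk>x \<in> M; y \<in> M; \<kappa> x = \<kappa> y\<rbrakk> \<Longrightarrow> x = y" for x y
    using \<kappa>D(5) by (auto simp: bij_betw_def dest: inj_onD)
  have M_ring: "\<lbrakk>x \<in> M; y \<in> M\<rbrakk> \<Longrightarrow> x \<ast> y \<in> M" "\<lbrakk>x \<in> M; y \<in> M\<rbrakk> \<Longrightarrow> x \<oplus>\<^bsub>\<Omega>\<^esub> y \<in> M" "\<one>\<^sub>L \<in> M" "M \<subseteq> carrier \<Omega>" for x y
    using subringE[OF subfieldE(1)[OF M(1)]] by auto
  have hom: "\<psi> \<in> ring_hom (\<Omega>\<lparr>carrier := L\<rparr>) \<Omega>"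
  proof (rule ring_hom_memI)
    show "\<psi> x \<in> carrier \<Omega>" if "x \<in> carrier (\<Omega>\<lparr>carrier := L\<rparr>)" for x using \<psi>(1) that M_ring(4) by auto
    show "\<psi> (x \<otimes>\<^bsub>\<Omega>\<lparr>carrier := L\<rparr>\<^esub> y) = \<psi> x \<ast> \<psi> y"
      if "x \<in> carrier (\<Omega>\<lparr>carrier := L\<rparr>)" "y \<in> carrier (\<Omega>\<lparr>carrier := L\<rparr>)" for x y
      by (rule \<kappa>_inj) (use that \<psi> M_ring \<kappa>D(2) L_mult \<iota>_mult in auto)
    show "\<psi> (x \<oplus>\<^bsub>\<Omega>\<lparr>carrier := L\<rparr>\<^esub> y) = \<psi> x \<oplus>\<^bsub>\<Omega>\<^esub> \<psi> y"
      if "x \<in> carrier (\<Omega>\<lparr>carrier := L\<rparr>)" "y \<in> carrier (\<Omega>\<lparr>carrier := L\<rparr>)" for x y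
      by (rule \<kappa>_inj) (use that \<psi> M_ring \<kappa>D(3) L_add \<iota>_add in auto)
    show "\<psi> \<one>\<^bsub>\<Omega>\<lparr>carrier := L\<rparr>\<^esub> = \<one>\<^sub>L"
      by (rule \<kappa>_inj) (use \<psi> M_ring \<kappa>D(4) L_one \<iota>_one in auto)
  qed
  have "\<psi> r = r" if "r \<in> F" for r
    by (rule \<kappa>_inj) (use that \<psi> \<kappa>D(6) D.F_in_L M in auto)
  then obtain g where g: "g \<in> carrier G" "\<And>x. x \<in> L \<Longrightarrow> \<psi> x = \<theta> g x"
    using D.embedding_eq_aut[OF hom] by blast
  show "M = L"
  proof
    show "M \<subseteq> L"
    proof
      fix y assume y: "y \<in> M"
      then obtain x where x: "x \<in> L" "\<kappa> y = \<iota> x" using \<kappa>D(1) by blast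
      then have "y = \<psi> x" using \<kappa>_inj[OF y \<psi>(1)] \<psi>(2) by simp
      then show "y \<in> L" using g x D.\<theta>_closed by simp
    qed
    show "L \<subseteq> M"
    proof
      fix x assume x: "x \<in> L"
      have "x = \<psi> (\<theta> (inv\<^sub>G g) x)" using g x D.\<theta>_inverse D.\<theta>_closed by simp
      then show "x \<in> M" using \<psi>(1)[OF D.\<theta>_closed[OF D.G.inv_closed[OF g(1)] x]] by simp
    qed
  qed
qed

text \<open>Two isomorphisms onto the centre differ by an automorphism of \<open>L\<close> over
  \<open>F\<close>. That it comes from an element h of \<open>G\<close> is what allows \<sigma> h to
  move the generators along.\<close>

lemma center_isos_twist:
  assumes \<kappa>: "\<kappa> \<in> center_isos \<Omega> F L C"
  obtains h where "h \<in> carrier G" "\<And>x. x \<in> L \<Longrightarrow> \<kappa> x = \<iota> (\<theta> h x)"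
proof -
  note \<kappa>D = center_isoD[OF \<kappa>]
  define \<psi> where "\<psi> x = inv_into L \<iota> (\<kappa> x)" for x
  have \<psi>: "\<psi> x \<in> L" "\<iota> (\<psi> x) = \<kappa> x" if "x \<in> L" for x
    using \<kappa>D(1)[OF that] by (auto simp: \<psi>_def inv_into_into f_inv_into_f)
  have hom: "\<psi> \<in> ring_hom (\<Omega>\<lparr>carrier := L\<rparr>) \<Omega>"
  proof (rule ring_hom_memI)
    show "\<psi> x \<in> carrier \<Omega>" if "x \<in> carrier (\<Omega>\<lparr>carrier := L\<rparr>)" for x using \<psi>(1) that Lc by auto
    show "\<psi> (x \<otimes>\<^bsub>\<Omega>\<lparr>carrier := L\<rparr>\<^esub> y) = \<psi> x \<ast> \<psi> y"
      if "x \<in> carrier (\<Omega>\<lparr>carrier := L\<rparr>)" "y \<in> carrier (\<Omega>\<lparr>carrier := L\<rparr>)" for x y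
      by (rule \<iota>_inj) (use that \<psi> \<kappa>D(2) L_mult \<iota>_mult in auto)
    show "\<psi> (x \<oplus>\<^bsub>\<Omega>\<lparr>carrier := L\<rparr>\<^esub> y) = \<psi> x \<oplus>\<^bsub>\<Omega>\<^esub> \<psi> y"
      if "x \<in> carrier (\<Omega>\<lparr>carrier := L\<rparr>)" "y \<in> carrier (\<Omega>\<lparr>carrier := L\<rparr>)" for x y
      by (rule \<iota>_inj) (use that \<psi> \<kappa>D(3) L_add \<iota>_add in auto)
    show "\<psi> \<one>\<^bsub>\<Omega>\<lparr>carrier := L\<rparr>\<^esub> = \<one>\<^sub>L"
      by (rule \<iota>_inj) (use \<psi> \<kappa>D(4) L_one \<iota>_one in auto)
  qed
  have "\<psi> r = r" if "r \<in> F" for r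
    by (rule \<iota>_inj) (use that \<psi> \<kappa>D(6) D.F_in_L in auto)
  then obtain g where g: "g \<in> carrier G" "\<And>x. x \<in> L \<Longrightarrow> \<psi> x = \<theta> g x"
    using D.embedding_eq_aut[OF hom] by blast
  then have "\<kappa> x = \<iota> (\<theta> g x)" if "x \<in> L" for x using \<psi>(2)[OF that] that by simp
  with g(1) that show ?thesis by blast
qed

lemma Psi_field: "Psi_field \<Omega> F C = L"
  unfolding Psi_field_def
  by (rule the_equality) (use D.subfield_L D.F_L center_iso center_isos_field in blast)+

lemma Psi_action: "Psi_action \<Omega> F G C \<sigma> = \<theta>"
  unfolding Psi_action_def Let_def Psi_field
proof (rule the_equality)
  show "\<theta> \<in> hom G (Gal_group \<Omega> F L) \<and> \<theta> \<in> extensional (carrier G) \<and>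
    (\<exists>\<iota>\<in>center_isos \<Omega> F L C. \<forall>g\<in>carrier G. \<forall>x\<in>L. \<iota> (\<theta> g x) = \<sigma> g (\<iota> x))"
    using D.\<theta>_hom D.\<theta>_ext center_iso \<sigma>_\<iota> by (metis (no_types, lifting))
  fix \<eta> assume \<eta>: "\<eta> \<in> hom G (Gal_group \<Omega> F L) \<and> \<eta> \<in> extensional (carrier G) \<and>
    (\<exists>\<iota>\<in>center_isos \<Omega> F L C. \<forall>g\<in>carrier G. \<forall>x\<in>L. \<iota> (\<eta> g x) = \<sigma> g (\<iota> x))"
  then obtain \<kappa> where \<kappa>: "\<kappa> \<in> center_isos \<Omega> F L C" "\<And>g x. \<lbrakk>g \<in> carrier G; x \<in> L\<rbrakk> \<Longrightarrow> \<kappa> (\<eta> g x) = \<sigma> g (\<kappa> x)" by blast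
  obtain h where h: "h \<in> carrier G" "\<And>x. x \<in> L \<Longrightarrow> \<kappa> x = \<iota> (\<theta> h x)" using center_isos_twist[OF \<kappa>(1)] by blast
  have \<eta>B: "\<eta> g \<in> Bij L" if "g \<in> carrier G" for g
    using \<eta> that by (auto simp: hom_def Gal_group_def)
  have "\<eta> g = \<theta> g" if g: "g \<in> carrier G" for g
  proof (rule extensionalityI[of _ L])
    show "\<eta> g \<in> extensional L" "\<theta> g \<in> extensional L" using \<eta>B[OF g] D.\<theta>_Bij[OF g] Bij_imp_extensional by blast+
    fix x assume x: "x \<in> L"
    have \<eta>x: "\<eta> g x \<in> L" using \<eta>B[OF g] Bij_imp_funcset x by blast
    have "\<iota> (\<theta> h (\<eta> g x)) = \<sigma> g (\<iota> (\<theta> h x))" using \<kappa>(2)[OF g x] h(2)[OF x] h(2)[OF \<eta>x] by simp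
    also have "\<dots> = \<iota> (\<theta> g (\<theta> h x))" using \<sigma>_\<iota> g D.\<theta>_closed h x by simp
    \<comment> \<open>Another isomorphism onto the centre conjugates the action by \<theta> h, which
      has no effect because \<open>G\<close> is abelian.\<close>
    also have "\<theta> g (\<theta> h x) = \<theta> h (\<theta> g x)" using D.\<theta>_comp[OF g h(1) x] D.\<theta>_comp[OF h(1) g x] D.G.m_comm g h by simp
    finally have "\<theta> h (\<eta> g x) = \<theta> h (\<theta> g x)" by (rule \<iota>_inj[rotated 2]) (use D.\<theta>_closed h g x \<eta>x in auto)
    then show "\<eta> g x = \<theta> g x" using D.\<theta>_inj h g x \<eta>x D.\<theta>_closed by blast
  qed
  then show "\<eta> = \<theta>" using extensionalityI[of \<eta> "carrier G" \<theta>] \<eta> D.\<theta>_ext by blast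
qed

lemma u_homogeneous_nonzero: "k \<in> D.K \<Longrightarrow> u k \<in> homogeneous C \<sigma> k - {\<zero>}"
proof -
  assume k: "k \<in> D.K"
  have "u k \<noteq> \<zero>"
    using u_unit[OF k] one_not_zero A.C.Units_l_inv[of \<zero>] A.C.Units_inv_closed[of \<zero>] by auto
  moreover have "u k = \<iota> \<one>\<^sub>L \<otimes> u k" using \<iota>_one u_closed[OF k] by simp
  ultimately show ?thesis unfolding homogeneous_eq[OF k] using L_one by blast
qed

text \<open>Nonzero homogeneous elements are multiples of the generators by central units, which
  cancel in the commutator. The arguments are exchanged because u x u y = \<sigma> x (u y) u x, and
  \<sigma> x scales u y by f y x.\<close>

lemma commutation_bichar_eq:
  assumes x: "x \<in> D.K" and y: "y \<in> D.K"
  shows "commutation_bichar (\<Omega>\<lparr>carrier := F\<rparr>) C \<sigma> x y = f y x"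
proof -
  have key: "c \<otimes> d \<otimes> inv c \<otimes> inv d = \<iota> (f y x)"
    if cd: "c \<in> homogeneous C \<sigma> x - {\<zero>}" "d \<in> homogeneous C \<sigma> y - {\<zero>}" for c d
  proof -
    obtain a where a: "a \<in> L" "c = \<iota> a \<otimes> u x" using cd(1) unfolding homogeneous_eq[OF x] by blast
    obtain b where b: "b \<in> L" "d = \<iota> b \<otimes> u y" using cd(2) unfolding homogeneous_eq[OF y] by blast
    have n: "a \<noteq> \<zero>\<^sub>L" "b \<noteq> \<zero>\<^sub>L" using cd a b \<iota>_zero u_closed x y by auto
    have un: "c \<in> Units C" "d \<in> Units C" using a b n \<iota>_unit(1) u_unit x y by auto
    have cc: "c \<in> carrier C" "d \<in> carrier C" "\<iota> (f y x) \<in> carrier C"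
      using un A.C.Units_closed f_L D.K_carrier x y \<iota>_closed by auto
    note [simp] = a(1) b(1) \<iota>_closed[OF a(1)] \<iota>_closed[OF b(1)] u_closed[OF x] u_closed[OF y] cc(3)
    have "c \<otimes> d = \<iota> a \<otimes> (\<iota> b \<otimes> (u x \<otimes> u y))"
    proof -
      have "u x \<otimes> (\<iota> b \<otimes> u y) = \<iota> b \<otimes> (u x \<otimes> u y)" using x by (simp add: A.C.m_assoc[symmetric] u_\<iota>)
      then show ?thesis unfolding a b by (simp add: A.C.m_assoc)
    qed
    also have "\<dots> = \<iota> (f y x) \<otimes> (\<iota> b \<otimes> (\<iota> a \<otimes> (u y \<otimes> u x)))"
    proof -
      have fL: "f y x \<in> L" using f_L D.K_carrier x y by blast
      have "\<iota> a \<otimes> (\<iota> b \<otimes> (\<iota> (f y x) \<otimes> (u y \<otimes> u x))) = \<iota> (f y x \<ast> (b \<ast> a)) \<otimes> (u y \<otimes> u x)"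
      proof -
        have "a \<ast> (b \<ast> f y x) = f y x \<ast> (b \<ast> a)"
          using Lc[OF a(1)] Lc[OF b(1)] Lc[OF fL] by (simp add: D.m_ac)
        moreover have "\<iota> a \<otimes> (\<iota> b \<otimes> (\<iota> (f y x) \<otimes> (u y \<otimes> u x))) = \<iota> (a \<ast> (b \<ast> f y x)) \<otimes> (u y \<otimes> u x)"
          using fL by (simp add: \<iota>_mult L_mult A.C.m_assoc)
        ultimately show ?thesis by simp
      qed
      then show ?thesis using u_swap[OF y x] fL by (simp add: \<iota>_mult L_mult A.C.m_assoc)
    qed
    also have "\<iota> b \<otimes> (\<iota> a \<otimes> (u y \<otimes> u x)) = d \<otimes> c"
    proof -
      have "u y \<otimes> (\<iota> a \<otimes> u x) = \<iota> a \<otimes> (u y \<otimes> u x)" using y by (simp add: A.C.m_assoc[symmetric] u_\<iota>)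
      then show ?thesis unfolding a b by (simp add: A.C.m_assoc)
    qed
    finally have "c \<otimes> d \<otimes> inv c \<otimes> inv d = \<iota> (f y x) \<otimes> (d \<otimes> c) \<otimes> inv c \<otimes> inv d" by simp
    then show ?thesis using un cc by (simp add: A.C.m_assoc)
  qed
  have F: "f y x \<in> F" by (rule f_K_F[OF y x])
  show ?thesis
    unfolding commutation_bichar_def
  proof (rule the_equality)
    show "f y x \<in> carrier (\<Omega>\<lparr>carrier := F\<rparr>) \<and> (\<forall>c\<in>homogeneous C \<sigma> x - {\<zero>}. \<forall>d\<in>homogeneous C \<sigma> y - {\<zero>}.
      c \<otimes> d \<otimes> inv c \<otimes> inv d = f y x \<odot>\<^bsub>C\<^esub> \<one>)"
      using key F \<iota>_F[OF F] by simp
    fix r assume r: "r \<in> carrier (\<Omega>\<lparr>carrier := F\<rparr>) \<and> (\<forall>c\<in>homogeneous C \<sigma> x - {\<zero>}. \<forall>d\<in>homogeneous C \<sigma> y - {\<zero>}.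
      c \<otimes> d \<otimes> inv c \<otimes> inv d = r \<odot>\<^bsub>C\<^esub> \<one>)"
    then have "\<iota> (f y x) = \<iota> r" using key[OF u_homogeneous_nonzero[OF x] u_homogeneous_nonzero[OF y]] u_homogeneous_nonzero[OF x] u_homogeneous_nonzero[OF y] \<iota>_F by simp
    then show "r = f y x" using \<iota>_inj r F D.F_in_L by auto
  qed
qed

lemma cocycle_of_generators:
  assumes "x \<in> D.K" "y \<in> D.K"
  shows "u x \<otimes> u y \<otimes> inv (u (x \<bullet> y)) = \<iota> (\<tau> (x, y))"
  using u_mult[OF assms] u_unit[OF D.K_mult[OF assms]] u_closed[OF D.K_mult[OF assms]]
    \<iota>_closed[OF \<tau>_L[OF assms]] by (simp add: A.C.m_assoc)

text \<open>Two choices of an isomorphism \<open>\<iota>\<close> differ by some \<open>h \<in> G\<close>, and \<open>\<sigma> h\<close> carries the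
  generators for one choice to generators for the other without changing the cocycle.\<close>

lemma Psi_class: "Psi_class \<Omega> F G e C \<sigma> = coset_B2 \<Omega> F D.KG L \<tau>"
proof -
  let ?\<beta> = "commutation_bichar (\<Omega>\<lparr>carrier := F\<rparr>) C \<sigma>"
  let ?X = "Xi_ext \<Omega> F G e L \<theta> ?\<beta>"
  have X: "?X k g = f k g" if "k \<in> D.K" "g \<in> carrier G" for k g
    by (rule Xi_ext_f[OF _ that]) (rule commutation_bichar_eq)
  have \<tau>_eq: "(\<lambda>(x, y)\<in>D.K \<times> D.K. inv_into L \<iota> (u x \<otimes> u y \<otimes> inv (u (x \<otimes>\<^bsub>D.KG\<^esub> y)))) = \<tau>"
  proof (rule extensionalityI[of _ "D.K \<times> D.K"])
    fix p assume "p \<in> D.K \<times> D.K"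
    then obtain x y where p: "p = (x, y)" "x \<in> D.K" "y \<in> D.K" by blast
    have "inj_on \<iota> L" using \<iota>_inj by (auto intro: inj_onI)
    then show "(\<lambda>(x, y)\<in>D.K \<times> D.K. inv_into L \<iota> (u x \<otimes> u y \<otimes> inv (u (x \<otimes>\<^bsub>D.KG\<^esub> y)))) p = \<tau> p"
      using p cocycle_of_generators[OF p(2,3)] \<tau>_L by simp
  qed (use \<tau>_ext in auto)
  show ?thesis
    unfolding Psi_class_def Let_def Psi_field Psi_action
  proof (rule the_equality)
    show "\<exists>\<iota>\<in>center_isos \<Omega> F L C. \<exists>u. (\<forall>k\<in>D.K. u k \<in> homogeneous C \<sigma> k - {\<zero>} \<and>
        (\<forall>g\<in>carrier G. \<sigma> g (u k) = \<iota> (?X k g) \<otimes> u k)) \<and>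
      coset_B2 \<Omega> F D.KG L \<tau> = coset_B2 \<Omega> F D.KG L (\<lambda>(x, y)\<in>D.K \<times> D.K. inv_into L \<iota> (u x \<otimes> u y \<otimes> inv (u (x \<otimes>\<^bsub>D.KG\<^esub> y))))"
      using u_homogeneous_nonzero \<sigma>_u X \<tau>_eq
      by (intro bexI[OF _ center_iso] exI[of _ u] conjI ballI) auto
  next
    fix \<xi> assume "\<exists>\<iota>\<in>center_isos \<Omega> F L C. \<exists>u. (\<forall>k\<in>D.K. u k \<in> homogeneous C \<sigma> k - {\<zero>} \<and>
        (\<forall>g\<in>carrier G. \<sigma> g (u k) = \<iota> (?X k g) \<otimes> u k)) \<and>
      \<xi> = coset_B2 \<Omega> F D.KG L (\<lambda>(x, y)\<in>D.K \<times> D.K. inv_into L \<iota> (u x \<otimes> u y \<otimes> inv (u (x \<otimes>\<^bsub>D.KG\<^esub> y))))"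
    then obtain \<kappa> v where \<kappa>: "\<kappa> \<in> center_isos \<Omega> F L C"
      and v: "\<And>k. k \<in> D.K \<Longrightarrow> v k \<in> homogeneous C \<sigma> k - {\<zero>}"
        "\<And>k g. \<lbrakk>k \<in> D.K; g \<in> carrier G\<rbrakk> \<Longrightarrow> \<sigma> g (v k) = \<kappa> (?X k g) \<otimes> v k"
      and \<xi>: "\<xi> = coset_B2 \<Omega> F D.KG L (\<lambda>(x, y)\<in>D.K \<times> D.K. inv_into L \<kappa> (v x \<otimes> v y \<otimes> inv (v (x \<otimes>\<^bsub>D.KG\<^esub> y))))"
      by blast
    obtain h where h: "h \<in> carrier G" "\<And>x. x \<in> L \<Longrightarrow> \<kappa> x = \<iota> (\<theta> h x)" using center_isos_twist[OF \<kappa>] by blast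
    have \<kappa>\<sigma>: "\<kappa> x = \<sigma> h (\<iota> x)" if "x \<in> L" for x using h \<sigma>_\<iota> that by simp
    \<comment> \<open>Generators adapted to \<kappa>: as \<kappa> is \<iota> followed by \<sigma> h
      and \<open>G\<close> is abelian, \<sigma> g scales w k by \<kappa> (f k g).\<close>
    define w where "w k = \<sigma> h (u k)" for k
    \<comment> \<open>Having the same degree, v k and w k differ by an element of \<open>L\<close>.
      Every \<sigma> g scales both by the same factor, so this element is invariant and lies in
      \<open>F\<close>.\<close>
    have "\<exists>c. c \<in> F - {\<zero>\<^sub>L} \<and> v k = \<iota> c \<otimes> w k" if k: "k \<in> D.K" for k
    proof -
      obtain a where a: "a \<in> L" "v k = \<iota> a \<otimes> u k" using v(1)[OF k] unfolding homogeneous_eq[OF k] by blast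
      have a0: "a \<noteq> \<zero>\<^sub>L" using a v(1)[OF k] \<iota>_zero u_closed[OF k] by auto
      have fh: "f k h \<in> L" "f k h \<noteq> \<zero>\<^sub>L" using f_closed[OF k h(1)] by auto
      note fi = D.L_inv[OF fh]
      define c where "c = a \<ast> inv\<^sub>L (f k h)"
      have c: "c \<in> L" "c \<noteq> \<zero>\<^sub>L" "c \<ast> f k h = a"
        using a a0 fi fh L_mult Lc D.integral_iff by (auto simp: c_def D.m_assoc)
      have wk: "w k = \<iota> (f k h) \<otimes> u k" using \<sigma>_u[OF k h(1)] by (simp add: w_def)
      have vw: "v k = \<iota> c \<otimes> w k"
        using \<iota>_mult[OF c(1) fh(1)] c(1,3) fh \<iota>_closed u_closed[OF k] by (simp add: wk a(2) A.C.m_assoc)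
      have "c \<in> F"
      proof (rule D.fixed[OF c(1)], rule ballI)
        fix g assume g: "g \<in> carrier G"
        have fg: "f k g \<in> L" using f_L k g by blast
        have wc: "w k \<in> carrier C" using A.\<sigma>_closed h u_closed k by (simp add: w_def)
        have kc: "\<kappa> (f k g) = \<iota> (\<theta> h (f k g))" "\<theta> h (f k g) \<in> L" using h fg D.\<theta>_closed by auto
        have \<sigma>w: "\<sigma> g (w k) = \<kappa> (f k g) \<otimes> w k"
        proof -
          have "\<sigma> g (w k) = \<sigma> h (\<sigma> g (u k))" using A.\<sigma>_commute g h u_closed k by (simp add: w_def)
          also have "\<dots> = \<kappa> (f k g) \<otimes> w k"
            using \<sigma>_u[OF k g] A.\<sigma>_mult[OF h(1) \<iota>_closed[OF fg] u_closed[OF k]] \<kappa>\<sigma>[OF fg] by (simp add: w_def)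
          finally show ?thesis .
        qed
        have "\<iota> (\<theta> g c) \<otimes> (\<kappa> (f k g) \<otimes> w k) = \<sigma> g (v k)"
          unfolding vw using A.\<sigma>_mult[OF g \<iota>_closed[OF c(1)] wc] \<sigma>_\<iota>[OF g c(1)] \<sigma>w by simp
        also have "\<dots> = \<kappa> (f k g) \<otimes> (\<iota> c \<otimes> w k)" using v(2)[OF k g] X[OF k g] vw by simp
        finally have "\<iota> (\<theta> g c) \<otimes> (\<iota> (\<theta> h (f k g)) \<otimes> (\<iota> (f k h) \<otimes> u k)) = \<iota> (\<theta> h (f k g)) \<otimes> (\<iota> c \<otimes> (\<iota> (f k h) \<otimes> u k))"
          unfolding kc(1) wk .
        then have "\<iota> (\<theta> g c \<ast> (\<theta> h (f k g) \<ast> f k h)) \<otimes> u k = \<iota> (c \<ast> (\<theta> h (f k g) \<ast> f k h)) \<otimes> u k"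
        proof -
          assume *: "\<iota> (\<theta> g c) \<otimes> (\<iota> (\<theta> h (f k g)) \<otimes> (\<iota> (f k h) \<otimes> u k)) = \<iota> (\<theta> h (f k g)) \<otimes> (\<iota> c \<otimes> (\<iota> (f k h) \<otimes> u k))"
          have m: "\<iota> (x \<ast> (y \<ast> z)) \<otimes> u k = \<iota> x \<otimes> (\<iota> y \<otimes> (\<iota> z \<otimes> u k))" if "x \<in> L" "y \<in> L" "z \<in> L" for x y z
            using that L_mult \<iota>_closed u_closed[OF k] by (simp add: \<iota>_mult A.C.m_assoc)
          have "c \<ast> (\<theta> h (f k g) \<ast> f k h) = \<theta> h (f k g) \<ast> (c \<ast> f k h)"
            using c(1) kc(2) fh(1) Lc by (simp add: D.m_lcomm)
          then show ?thesis using * m[OF D.\<theta>_closed[OF g c(1)] kc(2) fh(1)] m[OF kc(2) c(1) fh(1)] by simp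
        qed
        then have "\<theta> g c \<ast> (\<theta> h (f k g) \<ast> f k h) = c \<ast> (\<theta> h (f k g) \<ast> f k h)"
          by (rule single_eqD[OF k, rotated 2]) (use D.\<theta>_closed g c kc fh L_mult in auto)
        moreover have "\<theta> h (f k g) \<ast> f k h \<noteq> \<zero>\<^sub>L" "\<theta> h (f k g) \<ast> f k h \<in> carrier \<Omega>"
          using kc(2) fh Lc D.integral_iff D.\<theta>_nonzero[OF h(1) fg] f_closed[OF k g] by auto
        ultimately show "\<theta> g c = c" using D.m_rcancel D.\<theta>_closed[OF g c(1)] c(1) Lc by blast
      qed
      with c(2) vw show ?thesis by blast
    qed
    then obtain c where c: "\<And>k. k \<in> D.K \<Longrightarrow> c k \<in> F - {\<zero>\<^sub>L}" "\<And>k. k \<in> D.K \<Longrightarrow> v k = \<iota> (c k) \<otimes> w k" by metis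
    \<comment> \<open>On \<open>F\<close> the isomorphisms \<kappa> and \<iota> agree, so the
      factors c k may be treated as values of either.\<close>
    have cL: "c k \<in> L" "c k \<noteq> \<zero>\<^sub>L" "\<kappa> (c k) = \<iota> (c k)" if "k \<in> D.K" for k
      using c(1)[OF that] D.F_in_L center_isoD(6)[OF \<kappa>] by auto
    have "(\<lambda>(x, y)\<in>D.K \<times> D.K. inv_into L \<kappa> (v x \<otimes> v y \<otimes> inv (v (x \<otimes>\<^bsub>D.KG\<^esub> y)))) = D.twist c \<tau>"
      unfolding D.twist_def
    proof (rule restrict_ext, clarify)
      fix x y assume x: "x \<in> D.K" and y: "y \<in> D.K"
      let ?z = "x \<bullet> y"
      have z: "?z \<in> D.K" by (rule D.K_mult[OF x y])
      have wc: "w k \<in> carrier C" "w k \<in> Units C" if "k \<in> D.K" for k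
      proof -
        show "w k \<in> carrier C" using A.\<sigma>_closed h u_closed that by (simp add: w_def)
        have "w k = \<iota> (f k h) \<otimes> u k" using \<sigma>_u[OF that h(1)] by (simp add: w_def)
        then show "w k \<in> Units C" using \<iota>_unit(1) f_closed[OF that h(1)] u_unit[OF that] by simp
      qed
      let ?t = "c x \<ast> c y \<ast> inv\<^sub>L (c ?z) \<ast> \<tau> (x, y)"
      note ci = D.L_inv[OF cL(1,2)[OF z]]
      have tL: "?t \<in> L" using cL x y ci \<tau>_L L_mult by simp
      have \<kappa>m: "\<kappa> (a \<ast> b) = \<kappa> a \<otimes> \<kappa> b" if "a \<in> L" "b \<in> L" for a b using center_isoD(2)[OF \<kappa>] that by blast
      \<comment> \<open>Applying \<sigma> h to the relation for u x u y: the cocycle of the w k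
        relative to \<kappa> is again \<tau>.\<close>
      have ww: "w x \<otimes> w y = \<kappa> (\<tau> (x, y)) \<otimes> w ?z"
        using A.\<sigma>_mult[OF h(1) u_closed[OF x] u_closed[OF y]] u_mult[OF x y] \<kappa>\<sigma>[OF \<tau>_L[OF x y]]
          A.\<sigma>_mult[OF h(1) \<iota>_closed[OF \<tau>_L[OF x y]] u_closed[OF z]] by (simp add: w_def)
      have \<kappa>c: "\<kappa> a \<in> carrier C" if "a \<in> L" for a using \<kappa>\<sigma>[OF that] A.\<sigma>_closed h \<iota>_closed that by simp
      have \<kappa>_central: "\<kappa> a \<otimes> b = b \<otimes> \<kappa> a" if "a \<in> L" "b \<in> carrier C" for a b
        using h(2)[OF that(1)] \<iota>_central[OF D.\<theta>_closed[OF h(1) that(1)] that(2)] by simp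
      have vk: "v k = \<kappa> (c k) \<otimes> w k" and \<kappa>ck: "\<kappa> (c k) \<in> carrier C" if "k \<in> D.K" for k
        using c(2) cL(3) \<kappa>c[OF cL(1)] that by simp_all
      have "v x \<otimes> v y = \<kappa> (c x) \<otimes> (w x \<otimes> \<kappa> (c y)) \<otimes> w y"
        using \<kappa>ck x y wc(1) by (simp add: vk A.C.m_assoc)
      also have "w x \<otimes> \<kappa> (c y) = \<kappa> (c y) \<otimes> w x" using \<kappa>_central[of "c y" "w x"] cL y wc x by simp
      also have "\<kappa> (c x) \<otimes> (\<kappa> (c y) \<otimes> w x) \<otimes> w y = \<kappa> (c x) \<otimes> \<kappa> (c y) \<otimes> (w x \<otimes> w y)"
        using \<kappa>ck x y wc(1) by (simp add: A.C.m_assoc)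
      also have "\<dots> = \<kappa> (c x \<ast> c y \<ast> \<tau> (x, y)) \<otimes> w ?z"
        unfolding ww using cL(1) x y \<tau>_L L_mult wc(1)[OF z] \<kappa>c by (simp add: \<kappa>m A.C.m_assoc)
      also have "c x \<ast> c y \<ast> \<tau> (x, y) = ?t \<ast> c ?z"
      proof -
        have cc: "c x \<in> carrier \<Omega>" "c y \<in> carrier \<Omega>" "\<tau> (x, y) \<in> carrier \<Omega>" "c ?z \<in> carrier \<Omega>" "inv\<^sub>L (c ?z) \<in> carrier \<Omega>"
          using cL x y z \<tau>_L ci Lc by auto
        have "?t \<ast> c ?z = c x \<ast> c y \<ast> \<tau> (x, y) \<ast> (inv\<^sub>L (c ?z) \<ast> c ?z)"
          using cc by (simp only: D.m_ac D.m_closed)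
        then show ?thesis using cc ci by simp
      qed
      also have "\<kappa> (?t \<ast> c ?z) \<otimes> w ?z = \<kappa> ?t \<otimes> v ?z"
        using \<kappa>m[OF tL cL(1)[OF z]] \<kappa>c[OF tL] \<kappa>ck[OF z] wc(1)[OF z] vk[OF z] by (simp add: A.C.m_assoc)
      finally have "v x \<otimes> v y = \<kappa> ?t \<otimes> v ?z" .
      moreover have "v ?z \<in> Units C" using c(2)[OF z] cL(1,2)[OF z] \<iota>_unit(1) wc(2)[OF z] by simp
      ultimately have "v x \<otimes> v y \<otimes> inv (v ?z) = \<kappa> ?t"
        using \<kappa>c[OF tL] A.C.Units_closed[of "v ?z"] by (simp add: A.C.m_assoc)
      moreover have "inv_into L \<kappa> (\<kappa> ?t) = ?t"
        using center_isoD(5)[OF \<kappa>] tL by (simp add: bij_betw_def)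
      ultimately show "inv_into L \<kappa> (v x \<otimes> v y \<otimes> inv (v (x \<otimes>\<^bsub>D.KG\<^esub> y))) = ?t" by simp
    qed
    then show "\<xi> = coset_B2 \<Omega> F D.KG L \<tau>"
      unfolding \<xi> using D.coset_eqI[of c \<tau>] c(1) \<tau>_L Lc \<tau>_ext by auto
  qed
qed

end

lemma (in normalized_data) Psi_components:
  "(Psi_field \<Omega> F C, Psi_action \<Omega> F G C \<sigma>, Psi_class \<Omega> F G e C \<sigma>) = (L, \<theta>, coset_B2 \<Omega> F D.KG L \<tau>)"
  by (simp add: Psi_field Psi_action Psi_class)

lemma Psi_eq:
  assumes "normalized_data \<Omega> F G L \<theta> C \<sigma> \<iota> u \<tau> f e"
  shows "Psi \<Omega> F G e (C, \<sigma>) = (L, \<theta>, coset_B2 \<Omega> F (ker_group \<Omega> F G L \<theta>) L \<tau>)"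
  using normalized_data.Psi_components[OF assms] by (simp add: Psi_def)

lemma (in abelian_monoid) finsum_single:
  assumes "finite A" "i \<in> A" "f i \<in> carrier G" "\<And>j. \<lbrakk>j \<in> A; j \<noteq> i\<rbrakk> \<Longrightarrow> f j = \<zero>"
  shows "(\<Oplus>j\<in>A. f j) = f i"
proof -
  have "(\<Oplus>j\<in>A. f j) = (\<Oplus>j\<in>A. if i = j then f i else \<zero>)"
    by (rule finsum_cong') (use assms in auto)
  also have "\<dots> = f i"
    using add.finprod_singleton[of i A "\<lambda>_. f i"] assms by (simp add: finsum_def Pi_def)
  finally show ?thesis .
qed

section \<open>Construction of crossed products\<close>

text \<open>What remains of a crossed product once the algebra is taken away. The cocycle and
  coboundary identities, which the algebra would imply, are now the axioms from which it is
  built.\<close>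

locale cocycle_data = galois_data +
  fixes \<tau> f
  assumes \<tau>_closed: "\<And>x y. \<lbrakk>x \<in> K; y \<in> K\<rbrakk> \<Longrightarrow> \<tau> (x, y) \<in> L - {\<zero>}"
    and \<tau>_ext: "\<tau> \<in> extensional (K \<times> K)"
    and \<tau>_cocycle: "\<And>x y z. \<lbrakk>x \<in> K; y \<in> K; z \<in> K\<rbrakk> \<Longrightarrow>
      \<tau> (x, y) \<ast> \<tau> (x \<bullet> y, z) = \<tau> (x, y \<bullet> z) \<ast> \<tau> (y, z)"
    and f_closed: "\<And>k g. \<lbrakk>k \<in> K; g \<in> carrier G\<rbrakk> \<Longrightarrow> f k g \<in> L - {\<zero>}"
    and f_cocycle: "\<And>k g h. \<lbrakk>k \<in> K; g \<in> carrier G; h \<in> carrier G\<rbrakk> \<Longrightarrow> f k (g \<bullet> h) = f k g \<ast> \<theta> g (f k h)"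
    and f_coboundary: "\<And>x y g. \<lbrakk>x \<in> K; y \<in> K; g \<in> carrier G\<rbrakk> \<Longrightarrow>
      f x g \<ast> f y g \<ast> \<tau> (x, y) = \<theta> g (\<tau> (x, y)) \<ast> f (x \<bullet> y) g"
    and f_\<tau>: "\<And>k l. \<lbrakk>k \<in> K; l \<in> K\<rbrakk> \<Longrightarrow> f k l \<ast> \<tau> (k, l) = \<tau> (l, k)"
    and nondeg: "\<And>l. \<lbrakk>l \<in> K; \<forall>k\<in>K. f k l = \<one>\<rbrakk> \<Longrightarrow> l = \<one>\<^sub>G"
begin

text \<open>The twisted group algebra on extensional functions from \<open>K\<close> to
  \<open>L\<close>, so that equality is pointwise on \<open>K\<close>. The product is the
  convolution found for the coordinates of any crossed product, and the unit has the inverse of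
  \<tau> (1, 1) as its coordinate because \<tau> is not normalized.\<close>

definition crossed_algebra :: "('a, 'c \<Rightarrow> 'a) module" where
  "crossed_algebra = \<lparr>carrier = K \<rightarrow>\<^sub>E L,
    monoid.mult = (\<lambda>z w. \<lambda>k\<in>K. \<Oplus>x\<in>K. z x \<ast> w (inv\<^sub>G x \<bullet> k) \<ast> \<tau> (x, inv\<^sub>G x \<bullet> k)),
    monoid.one = (\<lambda>k\<in>K. if \<one>\<^sub>G = k then inv (\<tau> (\<one>\<^sub>G, \<one>\<^sub>G)) else \<zero>),
    ring.zero = (\<lambda>k\<in>K. \<zero>), ring.add = (\<lambda>z w. \<lambda>k\<in>K. z k \<oplus> w k), module.smult = (\<lambda>r z. \<lambda>k\<in>K. r \<ast> z k)\<rparr>"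

definition act where
  "act g = (\<lambda>z\<in>K \<rightarrow>\<^sub>E L. \<lambda>k\<in>K. \<theta> g (z k) \<ast> f k g)"

text \<open>The multiple of the unit by l; the factor compensates for \<tau> (1, 1), by which the
  generator at the identity differs from the unit.\<close>

definition embed where
  "embed l = (\<lambda>k\<in>K. if \<one>\<^sub>G = k then l \<ast> inv (\<tau> (\<one>\<^sub>G, \<one>\<^sub>G)) else \<zero>)"

definition gen where "gen k = (\<lambda>x\<in>K. if k = x then \<one> else \<zero>)"

abbreviation "A \<equiv> crossed_algebra"
abbreviation times_A (infixl "\<star>" 70) where "z \<star> w \<equiv> z \<otimes>\<^bsub>A\<^esub> w"

lemma A_simps [simp]:
  "carrier A = K \<rightarrow>\<^sub>E L" "\<one>\<^bsub>A\<^esub> = (\<lambda>k\<in>K. if \<one>\<^sub>G = k then inv (\<tau> (\<one>\<^sub>G, \<one>\<^sub>G)) else \<zero>)" "\<zero>\<^bsub>A\<^esub> = (\<lambda>k\<in>K. \<zero>)"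
  "z \<oplus>\<^bsub>A\<^esub> w = (\<lambda>k\<in>K. z k \<oplus> w k)" "r \<odot>\<^bsub>A\<^esub> z = (\<lambda>k\<in>K. r \<ast> z k)"
  by (simp_all add: crossed_algebra_def)

lemma A_mult: "z \<star> w = (\<lambda>k\<in>K. \<Oplus>x\<in>K. z x \<ast> w (inv\<^sub>G x \<bullet> k) \<ast> \<tau> (x, inv\<^sub>G x \<bullet> k))"
  by (simp add: crossed_algebra_def)

lemma L_mult: "\<lbrakk>x \<in> L; y \<in> L\<rbrakk> \<Longrightarrow> x \<ast> y \<in> L" and L_add: "\<lbrakk>x \<in> L; y \<in> L\<rbrakk> \<Longrightarrow> x \<oplus> y \<in> L"
  and L_one: "\<one> \<in> L" and L_zero: "\<zero> \<in> L"
  using L_ring by blast+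

lemma \<tau>_L: "\<lbrakk>x \<in> K; y \<in> K\<rbrakk> \<Longrightarrow> \<tau> (x, y) \<in> L" and \<tau>_c: "\<lbrakk>x \<in> K; y \<in> K\<rbrakk> \<Longrightarrow> \<tau> (x, y) \<in> carrier \<Omega>"
  using \<tau>_closed L_carrier by blast+

lemma f_L: "\<lbrakk>k \<in> K; g \<in> carrier G\<rbrakk> \<Longrightarrow> f k g \<in> L" and f_c: "\<lbrakk>k \<in> K; g \<in> carrier G\<rbrakk> \<Longrightarrow> f k g \<in> carrier \<Omega>"
  using f_closed L_carrier by blast+

lemma A_val: "\<lbrakk>z \<in> K \<rightarrow>\<^sub>E L; k \<in> K\<rbrakk> \<Longrightarrow> z k \<in> L" and A_val_c: "\<lbrakk>z \<in> K \<rightarrow>\<^sub>E L; k \<in> K\<rbrakk> \<Longrightarrow> z k \<in> carrier \<Omega>"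
  using L_carrier by blast+

lemma A_eqI: "\<lbrakk>z \<in> K \<rightarrow>\<^sub>E L; w \<in> K \<rightarrow>\<^sub>E L; \<And>k. k \<in> K \<Longrightarrow> z k = w k\<rbrakk> \<Longrightarrow> z = w"
  by (rule PiE_ext)

lemma K_div: "\<lbrakk>x \<in> K; k \<in> K\<rbrakk> \<Longrightarrow> inv\<^sub>G x \<bullet> k \<in> K"
  using K_inv K_mult by blast

lemma K_calc:
  assumes "x \<in> K" "y \<in> K"
  shows "x \<bullet> (inv\<^sub>G x \<bullet> y) = y" "inv\<^sub>G x \<bullet> (x \<bullet> y) = y"
  using assms K_carrier by (simp_all add: G.m_assoc[symmetric])

lemma K_calc2:
  assumes "x \<in> K" "y \<in> K" "k \<in> K"
  shows "inv\<^sub>G x \<bullet> y \<bullet> (inv\<^sub>G y \<bullet> k) = inv\<^sub>G x \<bullet> k"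
    "inv\<^sub>G (inv\<^sub>G x \<bullet> y) \<bullet> (inv\<^sub>G x \<bullet> k) = inv\<^sub>G y \<bullet> k"
proof -
  note c = assms[THEN K_carrier]
  have 1: "inv\<^sub>G u \<bullet> v \<bullet> (inv\<^sub>G v \<bullet> w) = inv\<^sub>G u \<bullet> w" if "u \<in> carrier G" "v \<in> carrier G" "w \<in> carrier G" for u v w
  proof -
    have "v \<bullet> (inv\<^sub>G v \<bullet> w) = w" using that by (simp add: G.m_assoc[symmetric])
    then show ?thesis using that by (simp add: G.m_assoc)
  qed
  show "inv\<^sub>G x \<bullet> y \<bullet> (inv\<^sub>G y \<bullet> k) = inv\<^sub>G x \<bullet> k" using 1 c by simp
  have "inv\<^sub>G (inv\<^sub>G x \<bullet> y) = inv\<^sub>G y \<bullet> x" using c by (simp add: G.inv_mult_group)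
  then show "inv\<^sub>G (inv\<^sub>G x \<bullet> y) \<bullet> (inv\<^sub>G x \<bullet> k) = inv\<^sub>G y \<bullet> k" using 1 c by simp
qed

text \<open>Two arguments of the cocycle identity are set to the identity. Since \<tau> is then
  constant on both axes, a single correction factor suffices for the unit.\<close>

lemma \<tau>_one: "k \<in> K \<Longrightarrow> \<tau> (\<one>\<^sub>G, k) = \<tau> (\<one>\<^sub>G, \<one>\<^sub>G)" "k \<in> K \<Longrightarrow> \<tau> (k, \<one>\<^sub>G) = \<tau> (\<one>\<^sub>G, \<one>\<^sub>G)"
proof -
  assume k: "k \<in> K"
  note c = K_carrier[OF k] and t1 = \<tau>_closed[OF K_one k] and t2 = \<tau>_closed[OF k K_one] and t3 = \<tau>_c[OF K_one K_one]
  have "\<tau> (\<one>\<^sub>G, \<one>\<^sub>G) \<ast> \<tau> (\<one>\<^sub>G, k) = \<tau> (\<one>\<^sub>G, k) \<ast> \<tau> (\<one>\<^sub>G, k)"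
    using \<tau>_cocycle[OF K_one K_one k] c by simp
  then show "\<tau> (\<one>\<^sub>G, k) = \<tau> (\<one>\<^sub>G, \<one>\<^sub>G)" using t1 t3 L_carrier m_rcancel by auto
  have "\<tau> (k, \<one>\<^sub>G) \<ast> \<tau> (k, \<one>\<^sub>G) = \<tau> (k, \<one>\<^sub>G) \<ast> \<tau> (\<one>\<^sub>G, \<one>\<^sub>G)"
    using \<tau>_cocycle[OF k K_one K_one] c by simp
  then show "\<tau> (k, \<one>\<^sub>G) = \<tau> (\<one>\<^sub>G, \<one>\<^sub>G)" using t2 t3 L_carrier m_lcancel by auto
qed

abbreviation "t1 \<equiv> \<tau> (\<one>\<^sub>G, \<one>\<^sub>G)"

lemma t1: "t1 \<in> L" "t1 \<noteq> \<zero>" "inv t1 \<in> L" "t1 \<ast> inv t1 = \<one>" "inv t1 \<ast> t1 = \<one>"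
  "t1 \<in> carrier \<Omega>" "inv t1 \<in> carrier \<Omega>"
  using \<tau>_closed[OF K_one K_one] L_inv[of t1] L_carrier by auto

lemma A_mult_closed: "\<lbrakk>z \<in> K \<rightarrow>\<^sub>E L; w \<in> K \<rightarrow>\<^sub>E L\<rbrakk> \<Longrightarrow> z \<star> w \<in> K \<rightarrow>\<^sub>E L"
  unfolding A_mult by (intro restrict_PiE_iff[THEN iffD2] ballI finsum_L L_mult A_val \<tau>_L K_div)

lemma embed_closed: "l \<in> L \<Longrightarrow> embed l \<in> K \<rightarrow>\<^sub>E L"
  using t1 L_mult L_zero by (auto simp: embed_def)

lemma gen_closed: "gen k \<in> K \<rightarrow>\<^sub>E L"
  using L_one L_zero by (auto simp: gen_def)

lemma embed_mult:
  assumes l: "l \<in> L" and z: "z \<in> K \<rightarrow>\<^sub>E L"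
  shows "embed l \<star> z = (\<lambda>k\<in>K. l \<ast> z k)"
  unfolding A_mult
proof (rule restrict_ext)
  fix k assume k: "k \<in> K"
  have c: "l \<in> carrier \<Omega>" "z k \<in> carrier \<Omega>" using l A_val[OF z k] L_carrier by auto
  let ?s = "\<lambda>x. embed l x \<ast> z (inv\<^sub>G x \<bullet> k) \<ast> \<tau> (x, inv\<^sub>G x \<bullet> k)"
  have s: "?s \<one>\<^sub>G = l \<ast> inv t1 \<ast> z k \<ast> t1"
    using K_one K_carrier[OF k] \<tau>_one(1)[OF k] by (simp add: embed_def)
  also have "\<dots> = l \<ast> z k \<ast> (inv t1 \<ast> t1)"
    using c t1(6,7) by (simp only: m_ac m_closed)
  also have "\<dots> = l \<ast> z k" using c t1 by simp
  finally have s1: "?s \<one>\<^sub>G = l \<ast> z k" .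
  have "(\<Oplus>x\<in>K. ?s x) = ?s \<one>\<^sub>G"
  proof (rule finsum_single[OF finite_K K_one])
    show "?s \<one>\<^sub>G \<in> carrier \<Omega>" unfolding s1 using c by simp
    show "?s x = \<zero>" if "x \<in> K" "x \<noteq> \<one>\<^sub>G" for x
      using that A_val_c[OF z K_div[OF that(1) k]] \<tau>_c[OF that(1) K_div[OF that(1) k]] by (simp add: embed_def)
  qed
  then show "(\<Oplus>x\<in>K. ?s x) = l \<ast> z k" using s1 by simp
qed

lemma mult_embed:
  assumes l: "l \<in> L" and z: "z \<in> K \<rightarrow>\<^sub>E L"
  shows "z \<star> embed l = (\<lambda>k\<in>K. l \<ast> z k)"
  unfolding A_mult
proof (rule restrict_ext)
  fix k assume k: "k \<in> K"
  have c: "l \<in> carrier \<Omega>" "z k \<in> carrier \<Omega>" using l A_val[OF z k] L_carrier by auto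
  let ?s = "\<lambda>x. z x \<ast> embed l (inv\<^sub>G x \<bullet> k) \<ast> \<tau> (x, inv\<^sub>G x \<bullet> k)"
  have "?s k = z k \<ast> (l \<ast> inv t1) \<ast> t1"
    using K_one K_carrier[OF k] \<tau>_one(2)[OF k] by (simp add: embed_def)
  also have "\<dots> = l \<ast> z k \<ast> (inv t1 \<ast> t1)"
    using c t1(6,7) by (simp only: m_ac m_closed)
  also have "\<dots> = l \<ast> z k" using c t1 by simp
  finally have s1: "?s k = l \<ast> z k" .
  have "(\<Oplus>x\<in>K. ?s x) = ?s k"
  proof (rule finsum_single[OF finite_K k])
    show "?s k \<in> carrier \<Omega>" unfolding s1 using c by simp
    show "?s x = \<zero>" if x: "x \<in> K" "x \<noteq> k" for x
    proof -
      have "\<one>\<^sub>G \<noteq> inv\<^sub>G x \<bullet> k"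
        using K_calc(1)[OF x(1) k] G.r_one[OF K_carrier[OF x(1)]] x(2) by metis
      then show ?thesis
        using A_val_c[OF z x(1)] \<tau>_c[OF x(1) K_div[OF x(1) k]] K_div[OF x(1) k] by (simp add: embed_def)
    qed
  qed
  then show "(\<Oplus>x\<in>K. ?s x) = l \<ast> z k" using s1 by simp
qed

lemma gen_mult:
  assumes k: "k \<in> K" and l: "l \<in> K"
  shows "gen k \<star> gen l = embed (\<tau> (k, l)) \<star> gen (k \<bullet> l)"
  unfolding embed_mult[OF \<tau>_L[OF k l] gen_closed] unfolding A_mult
proof (rule restrict_ext)
  fix y assume y: "y \<in> K"
  let ?s = "\<lambda>x. gen k x \<ast> gen l (inv\<^sub>G x \<bullet> y) \<ast> \<tau> (x, inv\<^sub>G x \<bullet> y)"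
  have e: "l = inv\<^sub>G k \<bullet> y \<longleftrightarrow> k \<bullet> l = y" using K_calc[OF k] y l by metis
  have s1: "?s k = \<tau> (k, l) \<ast> gen (k \<bullet> l) y"
    using k y K_div[OF k y] e \<tau>_c[OF k l] \<tau>_c[OF k K_div[OF k y]] by (auto simp: gen_def)
  have "(\<Oplus>x\<in>K. ?s x) = ?s k"
  proof (rule finsum_single[OF finite_K k])
    show "?s k \<in> carrier \<Omega>" unfolding s1 using \<tau>_c[OF k l] A_val_c[OF gen_closed y] by simp
    show "?s x = \<zero>" if x: "x \<in> K" "x \<noteq> k" for x
      using x A_val_c[OF gen_closed K_div[OF x(1) y]] \<tau>_c[OF x(1) K_div[OF x(1) y]] by (simp add: gen_def)
  qed
  then show "(\<Oplus>x\<in>K. ?s x) = \<tau> (k, l) \<ast> gen (k \<bullet> l) y" using s1 by simp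
qed

text \<open>Both bracketings are double sums over \<open>K\<close>. After replacing y by the
  quotient of y by x in the inner sum, they agree term by term, by the cocycle identity for x, inv x
  y and inv y k.\<close>

lemma A_assoc:
  assumes z: "z \<in> K \<rightarrow>\<^sub>E L" and w: "w \<in> K \<rightarrow>\<^sub>E L" and v: "v \<in> K \<rightarrow>\<^sub>E L"
  shows "z \<star> w \<star> v = z \<star> (w \<star> v)"
proof (rule A_eqI)
  fix k assume k: "k \<in> K"
  note zc = A_val_c[OF z] and wc = A_val_c[OF w] and vc = A_val_c[OF v]
  let ?q = "\<lambda>x k. inv\<^sub>G x \<bullet> k"
  have "(z \<star> w \<star> v) k = (\<Oplus>y\<in>K. (z \<star> w) y \<ast> v (?q y k) \<ast> \<tau> (y, ?q y k))"
    using k by (simp add: A_mult[of "z \<star> w"])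
  also have "\<dots> = (\<Oplus>y\<in>K. \<Oplus>x\<in>K. z x \<ast> w (?q x y) \<ast> \<tau> (x, ?q x y) \<ast> (v (?q y k) \<ast> \<tau> (y, ?q y k)))"
  proof (rule finsum_cong')
    fix y assume y: "y \<in> K"
    have "(\<Oplus>x\<in>K. z x \<ast> w (?q x y) \<ast> \<tau> (x, ?q x y)) \<ast> (v (?q y k) \<ast> \<tau> (y, ?q y k))
      = (\<Oplus>x\<in>K. z x \<ast> w (?q x y) \<ast> \<tau> (x, ?q x y) \<ast> (v (?q y k) \<ast> \<tau> (y, ?q y k)))"
      by (rule finsum_ldistr[OF finite_K]) (use zc wc vc \<tau>_c K_div y k in auto)
    moreover have "(\<Oplus>x\<in>K. z x \<ast> w (?q x y) \<ast> \<tau> (x, ?q x y)) \<in> carrier \<Omega>"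
      by (rule finsum_closed) (use zc wc \<tau>_c K_div y in auto)
    ultimately show "(z \<star> w) y \<ast> v (?q y k) \<ast> \<tau> (y, ?q y k)
      = (\<Oplus>x\<in>K. z x \<ast> w (?q x y) \<ast> \<tau> (x, ?q x y) \<ast> (v (?q y k) \<ast> \<tau> (y, ?q y k)))"
      unfolding A_mult[of z w] restrict_apply'[OF y] using vc[OF K_div[OF y k]] \<tau>_c[OF y K_div[OF y k]] by (simp add: m_assoc)
  qed (use zc wc vc \<tau>_c K_div k in \<open>auto intro!: finsum_closed\<close>)
  also have "\<dots> = (\<Oplus>x\<in>K. \<Oplus>y\<in>K. z x \<ast> w (?q x y) \<ast> \<tau> (x, ?q x y) \<ast> (v (?q y k) \<ast> \<tau> (y, ?q y k)))"
    by (rule finsum_swap[OF finite_K finite_K]) (use zc wc vc \<tau>_c K_div k in auto)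
  also have "\<dots> = (\<Oplus>x\<in>K. z x \<ast> (w \<star> v) (?q x k) \<ast> \<tau> (x, ?q x k))"
  proof (rule finsum_cong')
    fix x assume x: "x \<in> K"
    note xk = K_div[OF x k]
    let ?h = "\<lambda>y. w y \<ast> v (?q y (?q x k)) \<ast> \<tau> (y, ?q y (?q x k))"
    have h: "?h y \<in> carrier \<Omega>" if "y \<in> K" for y using wc vc \<tau>_c K_div that xk by simp
    have "(w \<star> v) (?q x k) = (\<Oplus>y\<in>K. ?h y)" using xk by (simp add: A_mult)
    also have "\<dots> = (\<Oplus>y\<in>(\<bullet>) (inv\<^sub>G x) ` K. ?h y)" unfolding K_translate[OF K_inv[OF x]] ..
    also have "\<dots> = (\<Oplus>y\<in>K. ?h (?q x y))"
      by (rule finsum_reindex[OF _ K_inj[OF K_inv[OF x]]]) (use h x K_div in auto)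
    finally have wv: "(w \<star> v) (?q x k) = (\<Oplus>y\<in>K. ?h (?q x y))" .
    have "z x \<ast> (\<Oplus>y\<in>K. ?h (?q x y)) \<ast> \<tau> (x, ?q x k) = z x \<ast> \<tau> (x, ?q x k) \<ast> (\<Oplus>y\<in>K. ?h (?q x y))"
    proof -
      have "(\<Oplus>y\<in>K. ?h (?q x y)) \<in> carrier \<Omega>" by (rule finsum_closed) (use h x K_div in auto)
      then show ?thesis using zc[OF x] \<tau>_c[OF x xk] by (simp only: m_ac m_closed)
    qed
    also have "\<dots> = (\<Oplus>y\<in>K. z x \<ast> \<tau> (x, ?q x k) \<ast> ?h (?q x y))"
      by (rule finsum_rdistr[OF finite_K]) (use zc \<tau>_c x xk h K_div in auto)
    also have "\<dots> = (\<Oplus>y\<in>K. z x \<ast> w (?q x y) \<ast> \<tau> (x, ?q x y) \<ast> (v (?q y k) \<ast> \<tau> (y, ?q y k)))"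
    proof (rule finsum_cong')
      fix y assume y: "y \<in> K"
      note xy = K_div[OF x y] and yk = K_div[OF y k]
      have q: "?q (?q x y) (?q x k) = ?q y k" by (rule K_calc2(2)[OF x y k])
      have co: "\<tau> (x, ?q x y) \<ast> \<tau> (y, ?q y k) = \<tau> (x, ?q x k) \<ast> \<tau> (?q x y, ?q y k)"
        using \<tau>_cocycle[OF x xy yk] K_calc(1)[OF x y] K_calc2(1)[OF x y k] by simp
      have cl: "z x \<in> carrier \<Omega>" "w (?q x y) \<in> carrier \<Omega>" "v (?q y k) \<in> carrier \<Omega>" "\<tau> (x, ?q x k) \<in> carrier \<Omega>"
        "\<tau> (?q x y, ?q y k) \<in> carrier \<Omega>" "\<tau> (x, ?q x y) \<in> carrier \<Omega>" "\<tau> (y, ?q y k) \<in> carrier \<Omega>"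
        using zc wc vc \<tau>_c x y xy yk xk by auto
      have "z x \<ast> \<tau> (x, ?q x k) \<ast> (w (?q x y) \<ast> v (?q y k) \<ast> \<tau> (?q x y, ?q y k))
        = z x \<ast> w (?q x y) \<ast> v (?q y k) \<ast> (\<tau> (x, ?q x k) \<ast> \<tau> (?q x y, ?q y k))"
        using cl by (simp only: m_ac m_closed)
      also have "\<dots> = z x \<ast> w (?q x y) \<ast> \<tau> (x, ?q x y) \<ast> (v (?q y k) \<ast> \<tau> (y, ?q y k))"
        unfolding co[symmetric] using cl by (simp only: m_ac m_closed)
      finally show "z x \<ast> \<tau> (x, ?q x k) \<ast> ?h (?q x y)
        = z x \<ast> w (?q x y) \<ast> \<tau> (x, ?q x y) \<ast> (v (?q y k) \<ast> \<tau> (y, ?q y k))" unfolding q .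
    qed (use zc wc vc \<tau>_c K_div x k in auto)
    finally show "(\<Oplus>y\<in>K. z x \<ast> w (?q x y) \<ast> \<tau> (x, ?q x y) \<ast> (v (?q y k) \<ast> \<tau> (y, ?q y k)))
      = z x \<ast> (w \<star> v) (?q x k) \<ast> \<tau> (x, ?q x k)" unfolding wv by simp
  qed (use zc \<tau>_c K_div k A_val_c[OF A_mult_closed[OF w v]] in auto)
  also have "\<dots> = (z \<star> (w \<star> v)) k" using k by (simp add: A_mult[of z "w \<star> v"])
  finally show "(z \<star> w \<star> v) k = (z \<star> (w \<star> v)) k" .
qed (use z w v A_mult_closed in auto)

lemma A_one: "\<one>\<^bsub>A\<^esub> = embed \<one>"
  using t1 by (auto simp: embed_def intro!: restrict_ext)

lemma A_distr:
  assumes z: "z \<in> K \<rightarrow>\<^sub>E L" and w: "w \<in> K \<rightarrow>\<^sub>E L" and v: "v \<in> K \<rightarrow>\<^sub>E L"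
  shows "(z \<oplus>\<^bsub>A\<^esub> w) \<star> v = z \<star> v \<oplus>\<^bsub>A\<^esub> w \<star> v" "v \<star> (z \<oplus>\<^bsub>A\<^esub> w) = v \<star> z \<oplus>\<^bsub>A\<^esub> v \<star> w"
proof -
  note zc = A_val_c[OF z] and wc = A_val_c[OF w] and vc = A_val_c[OF v]
  let ?q = "\<lambda>x k. inv\<^sub>G x \<bullet> k"
  show "(z \<oplus>\<^bsub>A\<^esub> w) \<star> v = z \<star> v \<oplus>\<^bsub>A\<^esub> w \<star> v"
    unfolding A_mult A_simps
  proof (rule restrict_ext)
    fix k assume k: "k \<in> K"
    have "(\<Oplus>x\<in>K. (\<lambda>k\<in>K. z k \<oplus> w k) x \<ast> v (?q x k) \<ast> \<tau> (x, ?q x k))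
      = (\<Oplus>x\<in>K. z x \<ast> v (?q x k) \<ast> \<tau> (x, ?q x k) \<oplus> w x \<ast> v (?q x k) \<ast> \<tau> (x, ?q x k))"
      by (rule finsum_cong') (use zc wc vc \<tau>_c K_div k in \<open>auto simp: l_distr\<close>)
    also have "\<dots> = (\<Oplus>x\<in>K. z x \<ast> v (?q x k) \<ast> \<tau> (x, ?q x k)) \<oplus> (\<Oplus>x\<in>K. w x \<ast> v (?q x k) \<ast> \<tau> (x, ?q x k))"
      by (rule finsum_addf) (use zc wc vc \<tau>_c K_div k in auto)
    finally show "(\<Oplus>x\<in>K. (\<lambda>k\<in>K. z k \<oplus> w k) x \<ast> v (?q x k) \<ast> \<tau> (x, ?q x k))
      = (\<lambda>k\<in>K. \<Oplus>x\<in>K. z x \<ast> v (?q x k) \<ast> \<tau> (x, ?q x k)) k \<oplus> (\<lambda>k\<in>K. \<Oplus>x\<in>K. w x \<ast> v (?q x k) \<ast> \<tau> (x, ?q x k)) k"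
      using k by simp
  qed
  show "v \<star> (z \<oplus>\<^bsub>A\<^esub> w) = v \<star> z \<oplus>\<^bsub>A\<^esub> v \<star> w"
    unfolding A_mult A_simps
  proof (rule restrict_ext)
    fix k assume k: "k \<in> K"
    have "(\<Oplus>x\<in>K. v x \<ast> (\<lambda>k\<in>K. z k \<oplus> w k) (?q x k) \<ast> \<tau> (x, ?q x k))
      = (\<Oplus>x\<in>K. v x \<ast> z (?q x k) \<ast> \<tau> (x, ?q x k) \<oplus> v x \<ast> w (?q x k) \<ast> \<tau> (x, ?q x k))"
      by (rule finsum_cong') (use zc wc vc \<tau>_c K_div k in \<open>auto simp: l_distr r_distr\<close>)
    also have "\<dots> = (\<Oplus>x\<in>K. v x \<ast> z (?q x k) \<ast> \<tau> (x, ?q x k)) \<oplus> (\<Oplus>x\<in>K. v x \<ast> w (?q x k) \<ast> \<tau> (x, ?q x k))"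
      by (rule finsum_addf) (use zc wc vc \<tau>_c K_div k in auto)
    finally show "(\<Oplus>x\<in>K. v x \<ast> (\<lambda>k\<in>K. z k \<oplus> w k) (?q x k) \<ast> \<tau> (x, ?q x k))
      = (\<lambda>k\<in>K. \<Oplus>x\<in>K. v x \<ast> z (?q x k) \<ast> \<tau> (x, ?q x k)) k \<oplus> (\<lambda>k\<in>K. \<Oplus>x\<in>K. v x \<ast> w (?q x k) \<ast> \<tau> (x, ?q x k)) k"
      using k by simp
  qed
qed

lemma A_smult: "\<lbrakk>r \<in> L; z \<in> K \<rightarrow>\<^sub>E L\<rbrakk> \<Longrightarrow> r \<odot>\<^bsub>A\<^esub> z = embed r \<star> z"
  by (simp add: embed_mult)

lemma A_ring: "ring A"
proof (rule ringI)
  show "abelian_group A"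
  proof (rule abelian_groupI)
    show "\<zero>\<^bsub>A\<^esub> \<in> carrier A" using L_zero by auto
    fix z assume "z \<in> carrier A"
    then have z: "z \<in> K \<rightarrow>\<^sub>E L" by simp
    show "\<zero>\<^bsub>A\<^esub> \<oplus>\<^bsub>A\<^esub> z = z"
    proof (rule A_eqI)
      show "\<zero>\<^bsub>A\<^esub> \<oplus>\<^bsub>A\<^esub> z \<in> K \<rightarrow>\<^sub>E L" using A_val[OF z] L_add L_zero by auto
    qed (use A_val_c[OF z] z in auto)
    show "\<exists>y\<in>carrier A. y \<oplus>\<^bsub>A\<^esub> z = \<zero>\<^bsub>A\<^esub>"
    proof (rule bexI)
      show "(\<lambda>k\<in>K. \<ominus> z k) \<oplus>\<^bsub>A\<^esub> z = \<zero>\<^bsub>A\<^esub>" using A_val_c[OF z] by (auto intro!: restrict_ext simp: l_neg)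
      show "(\<lambda>k\<in>K. \<ominus> z k) \<in> carrier A" using A_val[OF z] L_ring by auto
    qed
    fix w assume "w \<in> carrier A"
    then have w: "w \<in> K \<rightarrow>\<^sub>E L" by simp
    show "z \<oplus>\<^bsub>A\<^esub> w \<in> carrier A" using A_val[OF z] A_val[OF w] L_add by auto
    show "z \<oplus>\<^bsub>A\<^esub> w = w \<oplus>\<^bsub>A\<^esub> z" using A_val_c[OF z] A_val_c[OF w] by (auto intro!: restrict_ext simp: a_comm)
    fix v assume "v \<in> carrier A"
    then have v: "v \<in> K \<rightarrow>\<^sub>E L" by simp
    show "z \<oplus>\<^bsub>A\<^esub> w \<oplus>\<^bsub>A\<^esub> v = z \<oplus>\<^bsub>A\<^esub> (w \<oplus>\<^bsub>A\<^esub> v)"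
      using A_val_c[OF z] A_val_c[OF w] A_val_c[OF v] by (auto intro!: restrict_ext simp: a_assoc)
  qed
  show "monoid A"
  proof (rule monoidI)
    show "\<one>\<^bsub>A\<^esub> \<in> carrier A" unfolding A_one using embed_closed[OF L_one] by simp
    fix z assume "z \<in> carrier A"
    then have z: "z \<in> K \<rightarrow>\<^sub>E L" by simp
    have "(\<lambda>k\<in>K. \<one> \<ast> z k) = z"
    proof (rule A_eqI)
      show "(\<lambda>k\<in>K. \<one> \<ast> z k) \<in> K \<rightarrow>\<^sub>E L" using A_val[OF z] A_val_c[OF z] by auto
    qed (use z A_val_c[OF z] in auto)
    then show "\<one>\<^bsub>A\<^esub> \<star> z = z" "z \<star> \<one>\<^bsub>A\<^esub> = z"
      unfolding A_one using embed_mult[OF L_one z] mult_embed[OF L_one z] by simp_all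
    fix w assume w: "w \<in> carrier A"
    show "z \<star> w \<in> carrier A" using A_mult_closed[OF z] w by simp
    fix v assume v: "v \<in> carrier A"
    show "z \<star> w \<star> v = z \<star> (w \<star> v)" using A_assoc[OF z] w v by simp
  qed
  fix z w v assume zwv: "z \<in> carrier A" "w \<in> carrier A" "v \<in> carrier A"
  show "(z \<oplus>\<^bsub>A\<^esub> w) \<star> v = z \<star> v \<oplus>\<^bsub>A\<^esub> w \<star> v" "v \<star> (z \<oplus>\<^bsub>A\<^esub> w) = v \<star> z \<oplus>\<^bsub>A\<^esub> v \<star> w"
    using A_distr zwv unfolding A_simps(1) by blast+
qed

lemma embed_central: "\<lbrakk>l \<in> L; z \<in> K \<rightarrow>\<^sub>E L\<rbrakk> \<Longrightarrow> z \<star> embed l = embed l \<star> z"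
  by (simp add: embed_mult mult_embed)

lemma embed_hom: "embed \<in> ring_hom (\<Omega>\<lparr>carrier := L\<rparr>) A"
proof (rule ring_hom_memI)
  show "embed x \<in> carrier A" if "x \<in> carrier (\<Omega>\<lparr>carrier := L\<rparr>)" for x using embed_closed that by simp
  fix x y assume xy: "x \<in> carrier (\<Omega>\<lparr>carrier := L\<rparr>)" "y \<in> carrier (\<Omega>\<lparr>carrier := L\<rparr>)"
  then have c: "x \<in> L" "y \<in> L" "x \<in> carrier \<Omega>" "y \<in> carrier \<Omega>" using L_carrier by auto
  show "embed (x \<otimes>\<^bsub>\<Omega>\<lparr>carrier := L\<rparr>\<^esub> y) = embed x \<star> embed y"
    using embed_mult[OF c(1) embed_closed[OF c(2)]] c t1 by (auto simp: embed_def m_assoc intro!: restrict_ext)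
  show "embed (x \<oplus>\<^bsub>\<Omega>\<lparr>carrier := L\<rparr>\<^esub> y) = embed x \<oplus>\<^bsub>A\<^esub> embed y"
    using c t1 by (auto simp: embed_def l_distr intro!: restrict_ext)
qed (simp add: A_one del: A_simps)

lemma A_assoc_algebra: "assoc_algebra (\<Omega>\<lparr>carrier := F\<rparr>) A"
proof -
  interpret A: ring A by (rule A_ring)
  interpret F: field "\<Omega>\<lparr>carrier := F\<rparr>" by (rule subfield_iff(2)[OF subfield_F])
  have e: "embed (x \<ast> y) = embed x \<star> embed y" "embed (x \<oplus> y) = embed x \<oplus>\<^bsub>A\<^esub> embed y" if "x \<in> L" "y \<in> L" for x y
    using ring_hom_mult[OF embed_hom, of x y] ring_hom_add[OF embed_hom, of x y] that by auto
  have ec: "embed x \<in> carrier A" if "x \<in> L" for x using embed_closed that by simp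
  have s: "r \<odot>\<^bsub>A\<^esub> z = embed r \<star> z" if "r \<in> F" "z \<in> carrier A" for r z
    using A_smult F_in_L that by simp
  note [simp del] = A_simps
  show ?thesis
  proof (intro assoc_algebra.intro module.intro module_axioms.intro assoc_algebra_axioms.intro A_ring A.abelian_group_axioms
      F.is_cring)
    fix z assume z: "z \<in> carrier A"
    show "\<one>\<^bsub>\<Omega>\<lparr>carrier := F\<rparr>\<^esub> \<odot>\<^bsub>A\<^esub> z = z"
      using s[of "\<one>" z] F_ring z A.l_one[OF z] by (simp add: A_one)
    fix r assume "r \<in> carrier (\<Omega>\<lparr>carrier := F\<rparr>)"
    then have r: "r \<in> F" "r \<in> L" using F_in_L by auto
    note er = ec[OF r(2)]
    show "r \<odot>\<^bsub>A\<^esub> z \<in> carrier A" using s r z er by simp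
    {
    fix q assume "q \<in> carrier (\<Omega>\<lparr>carrier := F\<rparr>)"
    then have q: "q \<in> F" "q \<in> L" using F_in_L by auto
    note eq = ec[OF q(2)]
    have rq: "r \<oplus> q \<in> F" "r \<ast> q \<in> F" using F_ring r q by auto
    show "(r \<oplus>\<^bsub>\<Omega>\<lparr>carrier := F\<rparr>\<^esub> q) \<odot>\<^bsub>A\<^esub> z = r \<odot>\<^bsub>A\<^esub> z \<oplus>\<^bsub>A\<^esub> q \<odot>\<^bsub>A\<^esub> z"
      using s r q rq z er eq e by (simp add: A.l_distr)
    show "(r \<otimes>\<^bsub>\<Omega>\<lparr>carrier := F\<rparr>\<^esub> q) \<odot>\<^bsub>A\<^esub> z = r \<odot>\<^bsub>A\<^esub> (q \<odot>\<^bsub>A\<^esub> z)"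
      using s r q rq z er eq e by (simp add: A.m_assoc)
    }
    fix w assume w: "w \<in> carrier A"
    note zw = z w
    show "r \<odot>\<^bsub>A\<^esub> (z \<oplus>\<^bsub>A\<^esub> w) = r \<odot>\<^bsub>A\<^esub> z \<oplus>\<^bsub>A\<^esub> r \<odot>\<^bsub>A\<^esub> w" using s r zw er by (simp add: A.r_distr)
    show "r \<odot>\<^bsub>A\<^esub> z \<star> w = r \<odot>\<^bsub>A\<^esub> (z \<star> w)" using s r zw er by (simp add: A.m_assoc)
    have "z \<star> embed r = embed r \<star> z" using embed_central[OF r(2)] zw by (simp add: A_simps)
    then have "z \<star> (embed r \<star> w) = embed r \<star> (z \<star> w)" using er zw by (simp add: A.m_assoc[symmetric])
    then show "z \<star> (r \<odot>\<^bsub>A\<^esub> w) = r \<odot>\<^bsub>A\<^esub> (z \<star> w)" using s r zw by simp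
  qed
qed

text \<open>The coboundary relation at the pair (1, 1) gives f 1 g \<ast> \<tau> (1, 1) = \<theta> g
  (\<tau> (1, 1)). This makes the action fix the unit and restrict to \<theta> on the copy of
  \<open>L\<close>.\<close>

lemma f_one_inv: "g \<in> carrier G \<Longrightarrow> \<theta> g (inv t1) \<ast> f \<one>\<^sub>G g = inv t1"
proof -
  assume g: "g \<in> carrier G"
  note fc = f_closed[OF K_one g] f_c[OF K_one g]
  have c: "\<theta> g t1 \<in> L" "\<theta> g t1 \<in> carrier \<Omega>" "\<theta> g t1 \<noteq> \<zero>" "\<theta> g (inv t1) \<in> carrier \<Omega>"
    using \<theta>_closed \<theta>_nonzero g t1 L_carrier by auto
  have "f \<one>\<^sub>G g \<ast> (f \<one>\<^sub>G g \<ast> t1) = f \<one>\<^sub>G g \<ast> f \<one>\<^sub>G g \<ast> t1"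
    by (rule m_assoc[symmetric]) (use fc t1 in auto)
  also have "\<dots> = \<theta> g t1 \<ast> f \<one>\<^sub>G g" using f_coboundary[OF K_one K_one g] by simp
  also have "\<dots> = f \<one>\<^sub>G g \<ast> \<theta> g t1" by (rule m_comm) (use fc c in auto)
  finally have "f \<one>\<^sub>G g \<ast> (f \<one>\<^sub>G g \<ast> t1) = f \<one>\<^sub>G g \<ast> \<theta> g t1" .
  then have f1: "f \<one>\<^sub>G g \<ast> t1 = \<theta> g t1" using fc c t1 m_lcancel by auto
  have i: "\<theta> g (inv t1) \<ast> \<theta> g t1 = \<one>" using \<theta>_mult[OF g t1(3,1)] t1 \<theta>_one[OF g] by simp
  have "\<theta> g (inv t1) \<ast> f \<one>\<^sub>G g = \<theta> g (inv t1) \<ast> (f \<one>\<^sub>G g \<ast> t1) \<ast> inv t1"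
    using c fc t1 by (simp add: m_assoc)
  then show ?thesis unfolding f1 i using t1 by simp
qed

lemma act_val: "\<lbrakk>z \<in> K \<rightarrow>\<^sub>E L; k \<in> K\<rbrakk> \<Longrightarrow> act g z k = \<theta> g (z k) \<ast> f k g"
  by (simp add: act_def)

lemma act_closed: "\<lbrakk>g \<in> carrier G; z \<in> K \<rightarrow>\<^sub>E L\<rbrakk> \<Longrightarrow> act g z \<in> K \<rightarrow>\<^sub>E L"
  using \<theta>_closed L_mult f_L A_val by (auto simp: act_def)

text \<open>In each term of the convolution this is the coboundary relation for x and inv x k, whose
  product is k.\<close>

lemma act_mult:
  assumes g: "g \<in> carrier G" and z: "z \<in> K \<rightarrow>\<^sub>E L" and w: "w \<in> K \<rightarrow>\<^sub>E L"
  shows "act g (z \<star> w) = act g z \<star> act g w"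
proof (rule A_eqI)
  fix k assume k: "k \<in> K"
  let ?q = "\<lambda>x. inv\<^sub>G x \<bullet> k"
  have "act g (z \<star> w) k = \<theta> g (\<Oplus>x\<in>K. z x \<ast> w (?q x) \<ast> \<tau> (x, ?q x)) \<ast> f k g"
    unfolding act_val[OF A_mult_closed[OF z w] k] using k by (simp add: A_mult)
  also have "\<dots> = (\<Oplus>x\<in>K. \<theta> g (z x \<ast> w (?q x) \<ast> \<tau> (x, ?q x))) \<ast> f k g"
    by (subst \<theta>_finsum[OF g]) (use z w \<tau>_L K_div k L_mult A_val in auto)
  also have "\<dots> = (\<Oplus>x\<in>K. \<theta> g (z x \<ast> w (?q x) \<ast> \<tau> (x, ?q x)) \<ast> f k g)"
    by (rule finsum_ldistr[OF finite_K f_c[OF k g]]) (use z w \<tau>_L K_div k L_mult A_val \<theta>_closed[OF g] L_carrier in auto)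
  also have "\<dots> = (\<Oplus>x\<in>K. act g z x \<ast> act g w (?q x) \<ast> \<tau> (x, ?q x))"
  proof (rule finsum_cong')
    fix x assume x: "x \<in> K"
    note y = K_div[OF x k]
    note zx = A_val[OF z x] and wy = A_val[OF w y] and t = \<tau>_L[OF x y]
    have cl: "\<theta> g (z x) \<in> carrier \<Omega>" "\<theta> g (w (?q x)) \<in> carrier \<Omega>" "\<theta> g (\<tau> (x, ?q x)) \<in> carrier \<Omega>" "f k g \<in> carrier \<Omega>"
      "f x g \<in> carrier \<Omega>" "f (?q x) g \<in> carrier \<Omega>" "\<tau> (x, ?q x) \<in> carrier \<Omega>"
      using \<theta>_closed[OF g] zx wy t f_c k x y g L_carrier by auto
    have "\<theta> g (z x \<ast> w (?q x) \<ast> \<tau> (x, ?q x)) \<ast> f k g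
      = \<theta> g (z x) \<ast> \<theta> g (w (?q x)) \<ast> (\<theta> g (\<tau> (x, ?q x)) \<ast> f k g)"
      using cl by (simp add: \<theta>_mult[OF g] zx wy t L_mult m_assoc)
    also have "\<theta> g (\<tau> (x, ?q x)) \<ast> f k g = f x g \<ast> f (?q x) g \<ast> \<tau> (x, ?q x)"
      using f_coboundary[OF x y g] K_calc(1)[OF x k] by simp
    also have "\<theta> g (z x) \<ast> \<theta> g (w (?q x)) \<ast> (f x g \<ast> f (?q x) g \<ast> \<tau> (x, ?q x))
      = \<theta> g (z x) \<ast> f x g \<ast> (\<theta> g (w (?q x)) \<ast> f (?q x) g) \<ast> \<tau> (x, ?q x)"
      using cl by (simp only: m_ac m_closed)
    finally show "\<theta> g (z x \<ast> w (?q x) \<ast> \<tau> (x, ?q x)) \<ast> f k g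
      = act g z x \<ast> act g w (?q x) \<ast> \<tau> (x, ?q x)"
      using act_val[OF z x] act_val[OF w y] by simp
  qed (use act_closed[OF g] z w A_val_c \<tau>_c K_div k in auto)
  also have "\<dots> = (act g z \<star> act g w) k" using k by (simp add: A_mult)
  finally show "act g (z \<star> w) k = (act g z \<star> act g w) k" .
qed (use act_closed[OF g] A_mult_closed z w in auto)

lemma act_comp:
  assumes g: "g \<in> carrier G" and h: "h \<in> carrier G" and z: "z \<in> K \<rightarrow>\<^sub>E L"
  shows "act (g \<bullet> h) z = act g (act h z)"
proof (rule A_eqI)
  fix k assume k: "k \<in> K"
  note zk = A_val[OF z k] and fk = f_L[OF k h]
  have c: "\<theta> g (\<theta> h (z k)) \<in> carrier \<Omega>" "f k g \<in> carrier \<Omega>" "\<theta> g (f k h) \<in> carrier \<Omega>"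
    using \<theta>_closed g h zk fk f_c k L_carrier by auto
  show "act (g \<bullet> h) z k = act g (act h z) k"
    using act_val[OF z k] act_val[OF act_closed[OF h z] k] \<theta>_comp[OF g h zk] f_cocycle[OF k g h]
      \<theta>_mult[OF g \<theta>_closed[OF h zk] fk] c by (simp add: m_ac)
qed (use act_closed g h z in auto)

lemma act_one: "z \<in> K \<rightarrow>\<^sub>E L \<Longrightarrow> act \<one>\<^sub>G z = z"
proof (rule A_eqI)
  fix k assume z: "z \<in> K \<rightarrow>\<^sub>E L" and k: "k \<in> K"
  note fk = f_closed[OF k G.one_closed]
  have "f k \<one>\<^sub>G \<ast> f k \<one>\<^sub>G = f k \<one>\<^sub>G \<ast> \<one>"
    using f_cocycle[OF k G.one_closed G.one_closed] \<theta>_id fk L_carrier by simp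
  then have "f k \<one>\<^sub>G = \<one>" using fk L_carrier m_lcancel by blast
  then show "act \<one>\<^sub>G z k = z k" using act_val[OF z k] \<theta>_id A_val[OF z k] L_carrier by simp
qed (use act_closed in auto)

lemma act_alg_aut: "act \<in> hom G (alg_aut_group (\<Omega>\<lparr>carrier := F\<rparr>) A)"
proof -
  have bij: "act g \<in> Bij (K \<rightarrow>\<^sub>E L)" if g: "g \<in> carrier G" for g
  proof -
    have "bij_betw (act g) (K \<rightarrow>\<^sub>E L) (K \<rightarrow>\<^sub>E L)"
      by (rule bij_betwI[where g = "act (inv\<^sub>G g)"])
        (use act_closed g act_comp[of g "inv\<^sub>G g"] act_comp[of "inv\<^sub>G g" g] act_one in auto)
    then show ?thesis by (simp add: Bij_def act_def)
  qed
  have hom: "act g \<in> ring_hom A A" if g: "g \<in> carrier G" for g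
  proof (rule ring_hom_memI)
    show "act g z \<in> carrier A" if "z \<in> carrier A" for z using act_closed[OF g] that by simp
    fix z w assume "z \<in> carrier A" "w \<in> carrier A"
    then have zw: "z \<in> K \<rightarrow>\<^sub>E L" "w \<in> K \<rightarrow>\<^sub>E L" by auto
    show "act g (z \<star> w) = act g z \<star> act g w" by (rule act_mult[OF g zw])
    show "act g (z \<oplus>\<^bsub>A\<^esub> w) = act g z \<oplus>\<^bsub>A\<^esub> act g w"
    proof (rule A_eqI)
      have s: "z \<oplus>\<^bsub>A\<^esub> w \<in> K \<rightarrow>\<^sub>E L" using zw L_add A_val by auto
      show "act g (z \<oplus>\<^bsub>A\<^esub> w) \<in> K \<rightarrow>\<^sub>E L" by (rule act_closed[OF g s])
      show "act g z \<oplus>\<^bsub>A\<^esub> act g w \<in> K \<rightarrow>\<^sub>E L"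
        using act_closed[OF g zw(1)] act_closed[OF g zw(2)] L_add by auto
      fix k assume k: "k \<in> K"
      have c: "\<theta> g (z k) \<in> carrier \<Omega>" "\<theta> g (w k) \<in> carrier \<Omega>" "f k g \<in> carrier \<Omega>"
        using \<theta>_closed[OF g] A_val zw k f_c g L_carrier by auto
      show "act g (z \<oplus>\<^bsub>A\<^esub> w) k = (act g z \<oplus>\<^bsub>A\<^esub> act g w) k"
        unfolding act_val[OF s k] using k act_val[OF zw(1) k] act_val[OF zw(2) k] c
          \<theta>_add[OF g A_val[OF zw(1) k] A_val[OF zw(2) k]] by (simp add: l_distr)
    qed
  next
    have "act g (embed \<one>) = embed \<one>"
    proof (rule A_eqI)
      fix k assume k: "k \<in> K"
      show "act g (embed \<one>) k = embed \<one> k"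
        unfolding act_val[OF embed_closed[OF L_one] k]
        using k f_one_inv[OF g] t1 \<theta>_zero[OF g] f_c[OF k g] by (auto simp: embed_def)
    qed (use act_closed[OF g] embed_closed L_one in auto)
    then show "act g \<one>\<^bsub>A\<^esub> = \<one>\<^bsub>A\<^esub>" unfolding A_one .
  qed
  have lin: "linear_on (\<Omega>\<lparr>carrier := F\<rparr>) A A (act g)" if g: "g \<in> carrier G" for g
    unfolding linear_on_def
  proof (intro ballI)
    fix r z assume "r \<in> carrier (\<Omega>\<lparr>carrier := F\<rparr>)" "z \<in> carrier A"
    then have r: "r \<in> F" "r \<in> L" "r \<in> carrier \<Omega>" and z: "z \<in> K \<rightarrow>\<^sub>E L" using F_in_L L_carrier by auto
    have s: "r \<odot>\<^bsub>A\<^esub> z \<in> K \<rightarrow>\<^sub>E L" using r z L_mult by auto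
    show "act g (r \<odot>\<^bsub>A\<^esub> z) = r \<odot>\<^bsub>A\<^esub> act g z"
    proof (rule A_eqI)
      fix k assume k: "k \<in> K"
      have c: "\<theta> g (z k) \<in> carrier \<Omega>" "f k g \<in> carrier \<Omega>" using \<theta>_closed[OF g] A_val z k f_c g L_carrier by auto
      show "act g (r \<odot>\<^bsub>A\<^esub> z) k = (r \<odot>\<^bsub>A\<^esub> act g z) k"
        unfolding act_val[OF s k] using k act_val[OF z k] c r \<theta>_mult[OF g r(2) A_val[OF z k]] \<theta>_F[OF g r(1)]
        by (simp add: m_assoc)
    next
      show "r \<odot>\<^bsub>A\<^esub> act g z \<in> K \<rightarrow>\<^sub>E L" using act_closed[OF g z] r L_mult by auto
    qed (rule act_closed[OF g s])
  qed
  show ?thesis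
  proof (rule homI)
    fix g h assume gh: "g \<in> carrier G" "h \<in> carrier G"
    show "act g \<in> carrier (alg_aut_group (\<Omega>\<lparr>carrier := F\<rparr>) A)"
      using bij hom lin gh by (simp add: alg_aut_group_def)
    have "act (g \<bullet> h) = compose (K \<rightarrow>\<^sub>E L) (act g) (act h)"
      by (rule extensionalityI[of _ "K \<rightarrow>\<^sub>E L"]) (use act_comp[OF gh] in \<open>auto simp: compose_def act_def\<close>)
    then show "act (g \<bullet> h) = act g \<otimes>\<^bsub>alg_aut_group (\<Omega>\<lparr>carrier := F\<rparr>) A\<^esub> act h"
      using bij gh by (simp add: alg_aut_group_def BijGroup_def)
  qed
qed

lemma A_finsum_val:
  assumes "\<And>i. i \<in> I \<Longrightarrow> h i \<in> K \<rightarrow>\<^sub>E L" "k \<in> K"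
  shows "finsum A h I k = (\<Oplus>i\<in>I. h i k)"
proof -
  interpret A: ring A by (rule A_ring)
  show ?thesis
    by (rule A.finsum_hom[OF abelian_group_axioms, where h = "\<lambda>z. z k"]) (use assms A_val_c in auto)
qed

lemma A_expand:
  assumes "\<And>k. k \<in> K \<Longrightarrow> z k \<in> L" "x \<in> K"
  shows "finsum A (\<lambda>k. embed (z k) \<star> gen k) K x = z x"
proof -
  have "finsum A (\<lambda>k. embed (z k) \<star> gen k) K x = (\<Oplus>k\<in>K. (embed (z k) \<star> gen k) x)"
    by (rule A_finsum_val) (use assms A_mult_closed embed_closed gen_closed in auto)
  also have "\<dots> = (embed (z x) \<star> gen x) x"
    by (rule finsum_single[OF finite_K assms(2)])
      (use assms L_carrier in \<open>auto simp: embed_mult gen_closed, auto simp: gen_def\<close>)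
  also have "\<dots> = z x" using assms L_carrier by (simp add: embed_mult gen_closed) (simp add: gen_def)
  finally show ?thesis .
qed

theorem crossed_data: "crossed_data \<Omega> F G L \<theta> A act embed gen \<tau> f"
proof (intro crossed_data.intro crossed_data_axioms.intro)
  interpret A: ring A by (rule A_ring)
  show "galois_data \<Omega> F G L \<theta>" by (rule galois_data_axioms)
  show "action_algebra (\<Omega>\<lparr>carrier := F\<rparr>) A G act"
    by (intro action_algebra.intro action_algebra_axioms.intro A_assoc_algebra subfield_iff(2)[OF subfield_F]
      subringE(1)[OF subfieldE(1)[OF subfield_F]] G.comm_group_axioms finite_G act_alg_aut)
  show "embed \<in> ring_hom (\<Omega>\<lparr>carrier := L\<rparr>) A" by (rule embed_hom)
  show "embed r = r \<odot>\<^bsub>A\<^esub> \<one>\<^bsub>A\<^esub>" if "r \<in> F" for r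
    using that F_in_L L_carrier t1 by (auto simp: embed_def intro!: restrict_ext)
  show "gen k \<in> carrier A" if "k \<in> K" for k using gen_closed by simp
  show "gen k \<star> embed x = embed x \<star> gen k" if "k \<in> K" "x \<in> L" for k x by (rule embed_central[OF that(2) gen_closed])
  show "gen k \<star> gen l = embed (\<tau> (k, l)) \<star> gen (k \<bullet> l)" if "k \<in> K" "l \<in> K" for k l by (rule gen_mult[OF that])
  show "act g (embed x) = embed (\<theta> g x)" if g: "g \<in> carrier G" and x: "x \<in> L" for g x
  proof (rule A_eqI)
    fix k assume k: "k \<in> K"
    have c: "\<theta> g x \<in> carrier \<Omega>" "\<theta> g (inv t1) \<in> carrier \<Omega>" "f \<one>\<^sub>G g \<in> carrier \<Omega>" "f k g \<in> carrier \<Omega>"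
      using \<theta>_closed[OF g] x t1 f_c g k K_one L_carrier by auto
    have "\<theta> g (x \<ast> inv t1) \<ast> f \<one>\<^sub>G g = \<theta> g x \<ast> inv t1"
      using c f_one_inv[OF g] by (simp add: \<theta>_mult[OF g x t1(3)] m_assoc)
    then show "act g (embed x) k = embed (\<theta> g x) k"
      unfolding act_val[OF embed_closed[OF x] k] using k c \<theta>_zero[OF g] by (auto simp: embed_def)
  qed (use act_closed embed_closed \<theta>_closed g x in auto)
  show "act g (gen k) = embed (f k g) \<star> gen k" if k: "k \<in> K" and g: "g \<in> carrier G" for k g
    unfolding embed_mult[OF f_L[OF k g] gen_closed]
  proof (rule A_eqI)
    fix x assume x: "x \<in> K"
    show "act g (gen k) x = (\<lambda>x\<in>K. f k g \<ast> gen k x) x"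
      unfolding act_val[OF gen_closed x] using x k \<theta>_one[OF g] \<theta>_zero[OF g] f_c[OF k g] f_c[OF x g] by (auto simp: gen_def)
  next
    show "(\<lambda>x\<in>K. f k g \<ast> gen k x) \<in> K \<rightarrow>\<^sub>E L" using f_L[OF k g] A_val[OF gen_closed] L_mult by auto
  qed (rule act_closed[OF g gen_closed])
  show "\<exists>z. (\<forall>k\<in>K. z k \<in> L) \<and> c = finsum A (\<lambda>k. embed (z k) \<star> gen k) K" if "c \<in> carrier A" for c
  proof (intro exI[of _ c] conjI)
    have c: "c \<in> K \<rightarrow>\<^sub>E L" using that by simp
    show "\<forall>k\<in>K. c k \<in> L" using c by blast
    have "(\<lambda>k. embed (c k) \<star> gen k) \<in> K \<rightarrow> carrier A"
      using A_mult_closed[OF embed_closed[OF A_val[OF c]] gen_closed] unfolding A_simps(1) by blast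
    then have "finsum A (\<lambda>k. embed (c k) \<star> gen k) K \<in> carrier A" by (rule A.finsum_closed)
    then show "c = finsum A (\<lambda>k. embed (c k) \<star> gen k) K"
      using c A_expand[of c] A_val[OF c] by (intro A_eqI) auto
  qed
  show "z k = \<zero>" if z: "\<And>k. k \<in> K \<Longrightarrow> z k \<in> L" and eq: "finsum A (\<lambda>k. embed (z k) \<star> gen k) K = \<zero>\<^bsub>A\<^esub>" and k: "k \<in> K" for z k
    using A_expand[of z k] z k unfolding eq by simp
qed (fact \<tau>_closed \<tau>_ext f_closed f_\<tau> nondeg)+

end

section \<open>Transport of structure\<close>

text \<open>The structure of \<open>A\<close> carried along an injection. The crossed algebra
  consists of functions from \<open>K\<close> to \<open>L\<close>, whereas isomorphism classes are
  formed over one given type; this is the bridge.\<close>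

definition image_module :: "('c \<Rightarrow> 'd) \<Rightarrow> ('r, 'c, 'k) module_scheme \<Rightarrow> ('r, 'd) module" where
  "image_module j A = (let i = inv_into (carrier A) j in
    \<lparr>carrier = j ` carrier A, monoid.mult = (\<lambda>x y. j (i x \<otimes>\<^bsub>A\<^esub> i y)), monoid.one = j \<one>\<^bsub>A\<^esub>,
     ring.zero = j \<zero>\<^bsub>A\<^esub>, ring.add = (\<lambda>x y. j (i x \<oplus>\<^bsub>A\<^esub> i y)), module.smult = (\<lambda>r x. j (r \<odot>\<^bsub>A\<^esub> i x))\<rparr>)"

lemma image_module_simps:
  assumes "inj_on j (carrier A)"
  shows "carrier (image_module j A) = j ` carrier A" "\<one>\<^bsub>image_module j A\<^esub> = j \<one>\<^bsub>A\<^esub>" "\<zero>\<^bsub>image_module j A\<^esub> = j \<zero>\<^bsub>A\<^esub>"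
    "\<lbrakk>x \<in> carrier A; y \<in> carrier A\<rbrakk> \<Longrightarrow> j x \<otimes>\<^bsub>image_module j A\<^esub> j y = j (x \<otimes>\<^bsub>A\<^esub> y)"
    "\<lbrakk>x \<in> carrier A; y \<in> carrier A\<rbrakk> \<Longrightarrow> j x \<oplus>\<^bsub>image_module j A\<^esub> j y = j (x \<oplus>\<^bsub>A\<^esub> y)"
    "x \<in> carrier A \<Longrightarrow> r \<odot>\<^bsub>image_module j A\<^esub> j x = j (r \<odot>\<^bsub>A\<^esub> x)"
  using assms by (simp_all add: image_module_def Let_def)

lemma (in action_algebra) image:
  assumes j: "inj_on j (carrier C)"
  defines "B \<equiv> image_module j C" and "\<rho> \<equiv> \<lambda>g. \<lambda>x\<in>j ` carrier C. j (\<sigma> g (inv_into (carrier C) j x))"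
  shows "action_algebra R B G \<rho>" "j \<in> ring_iso C B" "linear_on R C B j"
    "\<lbrakk>g \<in> carrier G; x \<in> carrier C\<rbrakk> \<Longrightarrow> j (\<sigma> g x) = \<rho> g (j x)"
proof -
  note B = image_module_simps[OF j, folded B_def]
  have \<rho>: "\<rho> g (j x) = j (\<sigma> g x)" if "x \<in> carrier C" for g x
    using j that by (simp add: \<rho>_def)
  then show "x \<in> carrier C \<Longrightarrow> j (\<sigma> g x) = \<rho> g (j x)" by simp
  have ring: "ring B"
  proof (rule ringI)
    show "abelian_group B"
    proof (rule abelian_groupI)
      show "\<exists>y\<in>carrier B. y \<oplus>\<^bsub>B\<^esub> x = \<zero>\<^bsub>B\<^esub>" if x: "x \<in> carrier B" for x
      proof -
        obtain a where a: "a \<in> carrier C" "x = j a" using x B(1) by auto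
        have "j (\<ominus> a) \<oplus>\<^bsub>B\<^esub> x = \<zero>\<^bsub>B\<^esub>" using a B by (simp add: C.l_neg)
        then show ?thesis using a B(1) by blast
      qed
    qed (auto simp: B C.a_ac)
    show "monoid B" by (rule monoidI) (auto simp: B C.m_assoc)
  qed (auto simp: B C.l_distr C.r_distr)
  interpret B: ring B by (rule ring)
  have alg: "assoc_algebra R B"
    by (intro assoc_algebra.intro module.intro module_axioms.intro assoc_algebra_axioms.intro ring
        B.abelian_group_axioms C.R.is_cring)
      (auto simp: B C.smult_l_distr C.smult_r_distr C.smult_assoc1 C.smult_mult_left C.smult_mult_right)
  show "j \<in> ring_iso C B"
    by (rule ring_iso_memI) (use j in \<open>auto simp: B bij_betw_def\<close>)
  show "linear_on R C B j" by (simp add: linear_on_def B)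
  have bij: "\<rho> g \<in> Bij (carrier B)" if g: "g \<in> carrier G" for g
  proof -
    have "\<sigma> g ` carrier C = carrier C" using \<sigma>_mem[OF g] by (simp add: Bij_def bij_betw_def)
    then have "(\<lambda>x. j (\<sigma> g x)) ` carrier C = j ` carrier C" by (metis image_image)
    then have "\<rho> g ` carrier B = carrier B" by (simp add: B(1) image_image \<rho> cong: image_cong)
    moreover have "inj_on (\<rho> g) (carrier B)"
    proof (rule inj_onI)
      fix x y assume "x \<in> carrier B" "y \<in> carrier B" and eq: "\<rho> g x = \<rho> g y"
      then obtain a b where ab: "a \<in> carrier C" "b \<in> carrier C" "x = j a" "y = j b" using B(1) by auto
      then have "j (\<sigma> g a) = j (\<sigma> g b)" using eq \<rho> by simp
      then have "\<sigma> g a = \<sigma> g b" using j ab \<sigma>_closed[OF g] by (simp add: inj_on_eq_iff)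
      then show "x = y" using \<sigma>_inj[OF g ab(1,2)] ab(3,4) by simp
    qed
    ultimately show ?thesis by (simp add: Bij_def bij_betw_def B(1)) (simp add: \<rho>_def)
  qed
  have "\<rho> \<in> hom G (alg_aut_group R B)"
  proof (rule homI)
    fix g h assume gh: "g \<in> carrier G" "h \<in> carrier G"
    have "\<rho> g \<in> ring_hom B B"
      by (rule ring_hom_memI) (use gh in \<open>auto simp: B \<rho> \<sigma>_closed \<sigma>_mult \<sigma>_add \<sigma>_one\<close>)
    moreover have "linear_on R B B (\<rho> g)"
      using gh by (auto simp: linear_on_def B \<rho> \<sigma>_closed \<sigma>_smult)
    ultimately show "\<rho> g \<in> carrier (alg_aut_group R B)" using bij gh by (simp add: alg_aut_group_def)
    have "\<rho> (g \<otimes>\<^bsub>G\<^esub> h) = compose (carrier B) (\<rho> g) (\<rho> h)"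
    proof (rule extensionalityI[of _ "carrier B"])
      fix x assume "x \<in> carrier B"
      then obtain a where a: "a \<in> carrier C" "x = j a" using B(1) by auto
      then show "\<rho> (g \<otimes>\<^bsub>G\<^esub> h) x = compose (carrier B) (\<rho> g) (\<rho> h) x"
        using gh by (simp add: compose_def B(1) \<rho> \<sigma>_closed \<sigma>_comp)
    qed (simp_all add: B(1) \<rho>_def)
    then show "\<rho> (g \<otimes>\<^bsub>G\<^esub> h) = \<rho> g \<otimes>\<^bsub>alg_aut_group R B\<^esub> \<rho> h"
      using bij gh by (simp add: alg_aut_group_def BijGroup_def)
  qed
  then show "action_algebra R B G \<rho>"
    by (intro action_algebra.intro action_algebra_axioms.intro alg R.field_axioms G.comm_group_axioms finite_G)
qed

lemma concat_map_eqD: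
  assumes "concat (map f xs) = concat (map g xs)" "\<And>x. x \<in> set xs \<Longrightarrow> length (f x) = length (g x)" "x \<in> set xs"
  shows "f x = g x"
  using assms by (induction xs) auto

context galois_data
begin

text \<open>A function from \<open>K\<close> to \<open>L\<close> is recovered from coefficient lists
  of its values over \<open>F\<close>. These all have the length of one spanning list, so their
  concatenation along an enumeration of \<open>K\<close> can be split again, and j sends it to the
  target type.\<close>

lemma injective_encoding:
  fixes j :: "'a list \<Rightarrow> 'x"
  assumes j: "inj_on j (lists F)"
  obtains i :: "('c \<Rightarrow> 'a) \<Rightarrow> 'x" where "inj_on i (K \<rightarrow>\<^sub>E L)"
proof -
  obtain n where n: "dimension n F L" using finite_dimension_L by (auto simp: finite_dimension_def)
  obtain Us where Us: "set Us \<subseteq> carrier \<Omega>" "Span F Us = L" using exists_base[OF subfield_F n] by blast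
  have "\<exists>Ks. set Ks \<subseteq> F \<and> length Ks = length Us \<and> l = combine Ks Us" if "l \<in> L" for l
    using Span_mem_iff_length_version[OF subfield_F Us(1)] Us(2) that by blast
  \<comment> \<open>One coefficient list is chosen for each l; distinct l get distinct lists because
    \<open>combine\<close> recovers l.\<close>
  then obtain c where c: "\<And>l. l \<in> L \<Longrightarrow> set (c l) \<subseteq> F" "\<And>l. l \<in> L \<Longrightarrow> length (c l) = length Us"
    "\<And>l. l \<in> L \<Longrightarrow> l = combine (c l) Us" by metis
  obtain ks where ks: "set ks = K" using finite_list[OF finite_K] by blast
  have "inj_on (\<lambda>z. j (concat (map (\<lambda>k. c (z k)) ks))) (K \<rightarrow>\<^sub>E L)"
  proof (rule inj_onI)
    fix z w assume z: "z \<in> K \<rightarrow>\<^sub>E L" and w: "w \<in> K \<rightarrow>\<^sub>E L"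
      and eq: "j (concat (map (\<lambda>k. c (z k)) ks)) = j (concat (map (\<lambda>k. c (w k)) ks))"
    have zw: "z k \<in> L" "w k \<in> L" if "k \<in> K" for k using z w that by blast+
    have "concat (map (\<lambda>k. c (z k)) ks) = concat (map (\<lambda>k. c (w k)) ks)"
      by (rule inj_onD[OF j eq]) (use subsetD[OF c(1)[OF zw(1)]] subsetD[OF c(1)[OF zw(2)]] ks in auto)
    then have "c (z k) = c (w k)" if "k \<in> K" for k
      by (rule concat_map_eqD) (use zw c(2) ks that in auto)
    then have "z k = w k" if "k \<in> K" for k using c(3) zw that by metis
    then show "z = w" using z w by (rule_tac PiE_ext) auto
  qed
  then show ?thesis by (rule that)
qed

end

lemma (in cocycle_data) realization:
  fixes j :: "'a list \<Rightarrow> 'x"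
  assumes "inj_on j (lists F)"
  obtains B :: "('a, 'x) module" and \<rho> \<iota> u where "crossed_data \<Omega> F G L \<theta> B \<rho> \<iota> u \<tau> f"
proof -
  interpret X: crossed_data \<Omega> F G L \<theta> A act embed gen \<tau> f by (rule crossed_data)
  obtain i :: "('c \<Rightarrow> 'a) \<Rightarrow> 'x" where "inj_on i (K \<rightarrow>\<^sub>E L)" using injective_encoding[OF assms] .
  then have i: "inj_on i (carrier A)" by simp
  note B = X.A.image[OF i]
  show ?thesis by (rule that, rule X.transport[OF B(1,2,3)], rule B(4))
qed

section \<open>Crossed products with equal invariants\<close>

context crossed_data
begin

lemma one_eq_\<Phi>: "\<one> = \<Phi> (\<lambda>k. if \<one>\<^sub>G = k then inv\<^sub>L (\<tau> (\<one>\<^sub>G, \<one>\<^sub>G)) else \<zero>\<^sub>L)"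
proof -
  have t: "\<tau> (\<one>\<^sub>G, \<one>\<^sub>G) \<in> L" "\<tau> (\<one>\<^sub>G, \<one>\<^sub>G) \<noteq> \<zero>\<^sub>L" using \<tau>_closed[OF D.K_one D.K_one] by auto
  note i = D.L_inv[OF t]
  show ?thesis unfolding \<Phi>_single[OF D.K_one i(1)] one_\<Phi> using \<iota>_mult[OF i(1) t(1)] i(4) \<iota>_one by simp
qed

lemma convolution_closed:
  assumes "\<And>k. k \<in> D.K \<Longrightarrow> z k \<in> L" "\<And>k. k \<in> D.K \<Longrightarrow> w k \<in> L" "k \<in> D.K"
  shows "(\<Oplus>\<^bsub>\<Omega>\<^esub>x\<in>D.K. z x \<ast> w (inv\<^sub>G x \<bullet> k) \<ast> \<tau> (x, inv\<^sub>G x \<bullet> k)) \<in> L"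
  by (rule D.finsum_L) (use assms D.K_inv D.K_mult \<tau>_L L_mult in simp)

lemma smult_\<Phi>:
  assumes "\<And>k. k \<in> D.K \<Longrightarrow> z k \<in> L" "r \<in> F"
  shows "r \<odot>\<^bsub>C\<^esub> \<Phi> z = \<Phi> (\<lambda>k. r \<ast> z k)"
  using \<Phi>_scale[OF assms(1) D.F_in_L[OF assms(2)]] \<iota>_F[OF assms(2)] A.scalar_mult(1)[of r "\<Phi> z"] \<Phi>_closed[OF assms(1)] assms(2)
  by simp

text \<open>Match equal coordinates. Product, unit, scalar multiplication and action are given in
  coordinates by formulas that involve only \<tau>, \<theta> and f, so the bijection respects all of
  them.\<close>

lemma isomorphic:
  assumes B: "crossed_data \<Omega> F G L \<theta> B \<rho> \<kappa> v \<tau> f'"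
    and f': "\<And>k g. \<lbrakk>k \<in> D.K; g \<in> carrier G\<rbrakk> \<Longrightarrow> f' k g = f k g"
  shows "G_algebra_isomorphic (\<Omega>\<lparr>carrier := F\<rparr>) G C \<sigma> B \<rho>"
proof -
  interpret B: crossed_data \<Omega> F G L \<theta> B \<rho> \<kappa> v \<tau> f' by (rule B)
  define coords where "coords c = (SOME z. (\<forall>k\<in>D.K. z k \<in> L) \<and> c = \<Phi> z)" for c
  define \<phi> where "\<phi> c = B.\<Phi> (coords c)" for c
  have coords: "coords c k \<in> L" "c = \<Phi> (coords c)" if "c \<in> carrier C" "k \<in> D.K" for c k
    using someI_ex[OF \<Phi>_surj[OF that(1)]] that(2) by (simp_all add: coords_def)
  have \<phi>\<Phi>: "\<phi> (\<Phi> z) = B.\<Phi> z" if z: "\<And>k. k \<in> D.K \<Longrightarrow> z k \<in> L" for z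
  proof -
    note c = coords[OF \<Phi>_closed[OF z]]
    have "coords (\<Phi> z) k = z k" if "k \<in> D.K" for k
      using \<Phi>_inj[of "coords (\<Phi> z)" z k] c z that D.K_one by auto
    then show ?thesis unfolding \<phi>_def using c(1) z by (intro B.\<Phi>_cong) auto
  qed
  have rep: thesis if "c \<in> carrier C" "\<And>z. \<lbrakk>\<And>k. k \<in> D.K \<Longrightarrow> z k \<in> L; c = \<Phi> z\<rbrakk> \<Longrightarrow> thesis" for c thesis
    using \<Phi>_surj[OF that(1)] that(2) by blast
  have closed: "\<phi> c \<in> carrier B" if c: "c \<in> carrier C" for c
    using c by (rule rep) (simp add: \<phi>\<Phi> B.\<Phi>_closed)
  have iso: "\<phi> \<in> ring_iso C B"
  proof (rule ring_iso_memI)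
    show "\<phi> c \<in> carrier B" if "c \<in> carrier C" for c by (rule closed[OF that])
    fix c d assume c: "c \<in> carrier C" and d: "d \<in> carrier C"
    obtain z where z: "\<And>k. k \<in> D.K \<Longrightarrow> z k \<in> L" "c = \<Phi> z" using rep[OF c] by blast
    obtain w where w: "\<And>k. k \<in> D.K \<Longrightarrow> w k \<in> L" "d = \<Phi> w" using rep[OF d] by blast
    show "\<phi> (c \<otimes> d) = \<phi> c \<otimes>\<^bsub>B\<^esub> \<phi> d"
      using \<Phi>_mult[OF z(1) w(1)] B.\<Phi>_mult[OF z(1) w(1)] \<phi>\<Phi>[OF z(1)] \<phi>\<Phi>[OF w(1)]
        \<phi>\<Phi>[OF convolution_closed[OF z(1) w(1)]] z(2) w(2) by simp
    show "\<phi> (c \<oplus> d) = \<phi> c \<oplus>\<^bsub>B\<^esub> \<phi> d"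
      using \<Phi>_add[OF z(1) w(1)] B.\<Phi>_add[OF z(1) w(1)] \<phi>\<Phi>[OF z(1)] \<phi>\<Phi>[OF w(1)]
        \<phi>\<Phi>[OF L_add[OF z(1) w(1)]] z(2) w(2) by simp
  next
    have "inv\<^sub>L (\<tau> (\<one>\<^sub>G, \<one>\<^sub>G)) \<in> L"
      using \<tau>_closed[OF D.K_one D.K_one] D.L_inv(1) by auto
    then show "\<phi> \<one> = \<one>\<^bsub>B\<^esub>" unfolding one_eq_\<Phi> B.one_eq_\<Phi> by (intro \<phi>\<Phi>) (use L_zero in presburger)
    have "inj_on \<phi> (carrier C)"
    proof (rule inj_onI)
      fix c d assume c: "c \<in> carrier C" and d: "d \<in> carrier C" and eq: "\<phi> c = \<phi> d"
      obtain z where z: "\<And>k. k \<in> D.K \<Longrightarrow> z k \<in> L" "c = \<Phi> z" using rep[OF c] by blast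
      obtain w where w: "\<And>k. k \<in> D.K \<Longrightarrow> w k \<in> L" "d = \<Phi> w" using rep[OF d] by blast
      have zw: "B.\<Phi> z = B.\<Phi> w" using eq \<phi>\<Phi>[OF z(1)] \<phi>\<Phi>[OF w(1)] z(2) w(2) by simp
      have "z k = w k" if "k \<in> D.K" for k by (rule B.\<Phi>_inj[of z w k]) (use z(1) w(1) zw that in auto)
      then show "c = d" unfolding z(2) w(2) using z(1) by (intro \<Phi>_cong)
    qed
    moreover have "\<phi> ` carrier C = carrier B"
    proof
      show "carrier B \<subseteq> \<phi> ` carrier C"
      proof
        fix b assume "b \<in> carrier B"
        then obtain z where z: "\<forall>k\<in>D.K. z k \<in> L" "b = B.\<Phi> z" using B.\<Phi>_surj by blast
        then have "b = \<phi> (\<Phi> z)" using \<phi>\<Phi>[of z] by simp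
        then show "b \<in> \<phi> ` carrier C" using \<Phi>_closed[of z] z(1) by blast
      qed
    qed (use closed in auto)
    ultimately show "bij_betw \<phi> (carrier C) (carrier B)" by (simp add: bij_betw_def)
  qed
  moreover have "linear_on (\<Omega>\<lparr>carrier := F\<rparr>) C B \<phi>"
    unfolding linear_on_def
  proof (intro ballI)
    fix r c assume "r \<in> carrier (\<Omega>\<lparr>carrier := F\<rparr>)" and c: "c \<in> carrier C"
    then have r: "r \<in> F" by simp
    obtain z where z: "\<And>k. k \<in> D.K \<Longrightarrow> z k \<in> L" "c = \<Phi> z" using rep[OF c] by blast
    show "\<phi> (r \<odot>\<^bsub>C\<^esub> c) = r \<odot>\<^bsub>B\<^esub> \<phi> c"
      using smult_\<Phi>[OF z(1) r] B.smult_\<Phi>[OF z(1) r] \<phi>\<Phi>[OF z(1)] \<phi>\<Phi>[OF L_mult[OF D.F_in_L[OF r] z(1)]] z(2) by simp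
  qed
  moreover have "\<phi> (\<sigma> g c) = \<rho> g (\<phi> c)" if g: "g \<in> carrier G" and c: "c \<in> carrier C" for g c
  proof -
    obtain z where z: "\<And>k. k \<in> D.K \<Longrightarrow> z k \<in> L" "c = \<Phi> z" using rep[OF c] by blast
    have t: "\<theta> g (z k) \<ast> f k g \<in> L" if "k \<in> D.K" for k
      using D.\<theta>_closed[OF g z(1)[OF that]] f_L[OF that g] L_mult by blast
    have "\<sigma> g c = \<Phi> (\<lambda>k. \<theta> g (z k) \<ast> f k g)"
      unfolding z(2) by (rule \<Phi>_\<sigma>) (use z(1) g in auto)
    then have "\<phi> (\<sigma> g c) = B.\<Phi> (\<lambda>k. \<theta> g (z k) \<ast> f k g)"
      using \<phi>\<Phi>[of "\<lambda>k. \<theta> g (z k) \<ast> f k g"] t by simp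
    also have "\<dots> = B.\<Phi> (\<lambda>k. \<theta> g (z k) \<ast> f' k g)"
      by (rule B.\<Phi>_cong) (use t f' g in auto)
    also have "\<dots> = \<rho> g (B.\<Phi> z)" by (rule B.\<Phi>_\<sigma>[symmetric]) (use z(1) g in auto)
    also have "B.\<Phi> z = \<phi> c" unfolding z(2) by (rule \<phi>\<Phi>[symmetric]) (rule z(1))
    finally show ?thesis .
  qed
  ultimately show ?thesis unfolding G_algebra_isomorphic_def by blast
qed

end

text \<open>Rescaling by factors in \<open>F\<close> makes the two cocycles equal and leaves f
  alone. The cocycle determines f on \<open>K\<close>, and for normalized data the values on
  \<open>K\<close> determine f altogether, so coordinates can be matched.\<close>

lemma (in normalized_data) isomorphic_if_coset_eq:
  assumes B: "normalized_data \<Omega> F G L \<theta> B \<rho> \<kappa> v \<tau>' f' e"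
    and eq: "coset_B2 \<Omega> F D.KG L \<tau> = coset_B2 \<Omega> F D.KG L \<tau>'"
  shows "G_algebra_isomorphic (\<Omega>\<lparr>carrier := F\<rparr>) G C \<sigma> B \<rho>"
proof -
  interpret B: normalized_data \<Omega> F G L \<theta> B \<rho> \<kappa> v \<tau>' f' e by (rule B)
  obtain c where c: "c \<in> D.K \<rightarrow> F - {\<zero>\<^sub>L}" "\<tau>' = D.twist c \<tau>"
    using D.coset_eqD[OF eq] B.\<tau>_L Lc B.\<tau>_ext by blast
  have cF: "c k \<in> F" "c k \<in> L" "c k \<noteq> \<zero>\<^sub>L" if "k \<in> D.K" for k using c(1) D.F_in_L that by auto
  interpret R: crossed_data \<Omega> F G L \<theta> C \<sigma> \<iota> "\<lambda>k. \<iota> (c k) \<otimes> u k" \<tau>' f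
  proof (rule rescale)
    show "c k \<in> L - {\<zero>\<^sub>L}" if "k \<in> D.K" for k using cF that by simp
    show "f k g = \<theta> g (c k) \<ast> inv\<^sub>L (c k) \<ast> f k g" if "k \<in> D.K" "g \<in> carrier G" for k g
      using D.\<theta>_F[OF that(2) cF(1)[OF that(1)]] D.L_inv(3)[OF cF(2,3)[OF that(1)]] f_L[OF that] Lc by simp
  qed (auto simp: c(2) D.twist_def)
  have K: "f' k x = f k x" if "k \<in> D.K" "x \<in> D.K" for k x
  proof -
    have "f' k x \<ast> \<tau>' (k, x) = f k x \<ast> \<tau>' (k, x)" using B.f_\<tau>[OF that] R.f_\<tau>[OF that] by simp
    moreover have "f' k x \<in> carrier \<Omega>" "f k x \<in> carrier \<Omega>" "\<tau>' (k, x) \<in> carrier \<Omega>" "\<tau>' (k, x) \<noteq> \<zero>\<^sub>L"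
      using B.f_L f_L B.\<tau>_closed[OF that] D.K_carrier that Lc by auto
    ultimately show ?thesis using D.m_rcancel by blast
  qed
  have "f' k g = f k g" if "k \<in> D.K" "g \<in> carrier G" for k g
  proof -
    have "(\<lambda>x\<in>D.K. f' k x) = (\<lambda>x\<in>D.K. f k x)" using K[OF that(1)] by (intro restrict_ext)
    then show ?thesis using normal[OF that] B.normal[OF that] by simp
  qed
  then show ?thesis by (rule R.isomorphic[OF B.crossed_data_axioms])
qed

section \<open>Values of the bicharacter\<close>

lemma (in field) finite_roots_of_unity:
  assumes m: "m > 0"
  shows "finite {x \<in> carrier R. x [^] (m::nat) = \<one>}" "card {x \<in> carrier R. x [^] m = \<one>} \<le> m"
proof -
  \<comment> \<open>The coefficients of X^m - 1, leading one first.\<close>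
  let ?p = "\<one> # replicate (m - 1) \<zero> @ [\<ominus> \<one>]"
  have p: "?p \<in> carrier (poly_ring R)"
    by (auto simp: univ_poly_carrier[symmetric] polynomial_def)
  have "eval ?p x = x [^] m \<ominus> \<one>" if "x \<in> carrier R" for x
    using eval_replicate[of "[\<ominus> \<one>]" x "m - 1"] that m by (simp add: minus_eq)
  then have "{x \<in> carrier R. x [^] m = \<one>} \<subseteq> set_mset (roots ?p)"
    using roots_mem_iff_is_root[OF p] by (auto simp: is_root_def)
  moreover have "card (set_mset (roots ?p)) \<le> m"
  proof -
    have "card (set_mset (roots ?p)) \<le> size (roots ?p)"
      using size_mset_mono[OF mset_set_set_mset_msubset[of "roots ?p"]] by simp
    also have "\<dots> \<le> m" using size_roots_le_degree[OF p] m by simp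
    finally show ?thesis .
  qed
  ultimately show "finite {x \<in> carrier R. x [^] m = \<one>}" "card {x \<in> carrier R. x [^] m = \<one>} \<le> m"
    using finite_subset card_mono[of "set_mset (roots ?p)" "{x \<in> carrier R. x [^] m = \<one>}"] by auto
qed

context galois_data
begin

lemma KG_group: "group KG"
proof -
  have "subgroup K G" by (rule G.subgroupI) (use K_carrier K_one K_inv K_mult in auto)
  then have "group (G\<lparr>carrier := K\<rparr>)" by (rule G.subgroup_imp_group)
  then show ?thesis by (simp add: ker_group_def)
qed

lemma KG_pow: "x [^]\<^bsub>KG\<^esub> (n::nat) = x [^]\<^bsub>G\<^esub> n"
  by (simp add: nat_pow_def)

lemma UF_pow: "x [^]\<^bsub>UF\<^esub> (n::nat) = x [^] n"
  by (simp add: nat_pow_def UF)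

text \<open>The \<open>m\<close>-th roots of unity, for \<open>m\<close> the order of \<open>x\<close>, are exactly the values of
  \<open>\<beta> x\<close>: by nondegeneracy this cyclic image has at least \<open>m\<close> elements.\<close>

lemma root_of_unity_F:
  assumes \<beta>: "alternating_bicharacter KG UF \<beta>" "nondegenerate KG UF \<beta>"
    and x: "x \<in> K" and b: "b \<in> carrier \<Omega>" "\<And>n::nat. x [^]\<^bsub>G\<^esub> n = \<one>\<^sub>G \<Longrightarrow> b [^] n = \<one>"
  shows "b \<in> F"
proof -
  interpret KG: group KG by (rule KG_group)
  interpret UF: comm_group UF by (rule UF(5))
  interpret h: group_hom KG UF "\<beta> x"
    using \<beta>(1) x by unfold_locales (simp add: alternating_bicharacter_def)
  define m where "m = KG.ord x"
  have m: "m > 0" using KG.ord_ge_1[OF finite_K x] by (simp add: m_def)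
  have xm: "x [^]\<^bsub>KG\<^esub> m = \<one>\<^bsub>KG\<^esub>" using KG.pow_ord_eq_1[OF x] by (simp add: m_def)
  have left: "\<beta> (x [^]\<^bsub>KG\<^esub> n) y = \<beta> x y [^]\<^bsub>UF\<^esub> n" if y: "y \<in> K" for y and n :: nat
  proof -
    interpret g: group_hom KG UF "\<lambda>x. \<beta> x y"
      using \<beta>(1) y by unfold_locales (simp add: alternating_bicharacter_def)
    show ?thesis by (rule g.hom_nat_pow[OF x])
  qed
  define H where "H = \<beta> x ` K"
  have HF: "H \<subseteq> F" using h.hom_closed by (auto simp: H_def UF(1))
  have finH: "finite H" by (simp add: H_def finite_K)
  have sub: "subgroup H UF" unfolding H_def by (rule h.img_is_subgroup)
  interpret H: group "UF\<lparr>carrier := H\<rparr>" by (rule UF.subgroup_imp_group[OF sub])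
  have "a [^]\<^bsub>UF\<^esub> card H = \<one>\<^bsub>UF\<^esub>" if "a \<in> H" for a
    using H.pow_order_eq_1[of a] that UF.nat_pow_consistent[of a "card H" H] by (simp add: order_def)
  \<comment> \<open>Values of \<beta> x are killed by the order of the group \<open>H\<close> they
    form, so that power of x pairs trivially with everything and must be the identity.\<close>
  then have "\<beta> (x [^]\<^bsub>KG\<^esub> card H) y = \<one>\<^bsub>UF\<^esub>" if "y \<in> K" for y
    unfolding left[OF that] using that by (simp add: H_def)
  then have "x [^]\<^bsub>KG\<^esub> card H = \<one>\<^bsub>KG\<^esub>"
    using \<beta>(2) KG.nat_pow_closed[OF x] unfolding nondegenerate_def by blast
  then have "m dvd card H" using KG.pow_eq_id[OF x] by (simp add: m_def)
  moreover have "card H > 0" using finH K_one by (auto simp: H_def card_gt_0_iff)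
  ultimately have mH: "m \<le> card H" by (simp add: dvd_imp_le)
  let ?R = "{x \<in> carrier \<Omega>. x [^] m = \<one>}"
  have "\<beta> x y [^] m = \<one>" if y: "y \<in> K" for y
  proof -
    interpret g: group_hom KG UF "\<lambda>x. \<beta> x y"
      using \<beta>(1) y by unfold_locales (simp add: alternating_bicharacter_def)
    show ?thesis using left[OF y, of m] g.hom_one unfolding xm UF_pow by (simp add: UF(3))
  qed
  then have "H \<subseteq> ?R" using HF F_in_L L_carrier by (auto simp: H_def)
  \<comment> \<open>At least m values lie among at most m roots, so \<open>H\<close>, which is
    contained in \<open>F\<close>, consists of all m-th roots of unity in \<Omega>.\<close>
  then have "H = ?R"
    using finite_roots_of_unity[OF m] mH by (intro card_seteq) auto
  moreover have "b \<in> ?R" using b xm by (simp add: KG_pow)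
  ultimately show "b \<in> F" using HF by blast
qed

end

text \<open>A triple only provides an \<open>L\<close>-valued \<beta>. It has to be shown
  multiplicative, from the cocycle identity, and \<open>F\<close>-valued, from the conditions on the
  field and the action, before its restrictions are characters with a chosen extension and
  \<open>Xi_ext\<close> has the intended value.\<close>

lemma T_set_cocycle_data:
  fixes \<Omega> :: "('a, 'm) ring_scheme" (structure) and G :: "('g, 'n) monoid_scheme"
  assumes field: "field \<Omega>" and F: "subfield F \<Omega>" and G: "comm_group G" "finite (carrier G)"
    and choice: "extension_choice \<Omega> F G e" and T: "(L, \<theta>, \<xi>) \<in> T_set \<Omega> F G e"
  obtains \<tau> f where "cocycle_data \<Omega> F G L \<theta> \<tau> f" "\<xi> = coset_B2 \<Omega> F (ker_group \<Omega> F G L \<theta>) L \<tau>"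
    "\<And>k g. \<lbrakk>k \<in> carrier (ker_group \<Omega> F G L \<theta>); g \<in> carrier G\<rbrakk> \<Longrightarrow>
      f k g = e L \<theta> (\<lambda>x\<in>carrier (ker_group \<Omega> F G L \<theta>). f k x) g"
proof -
  have Z: "(L, \<theta>) \<in> Z_set \<Omega> F G" using T by (simp add: T_set_def)
  have gal: "finite_Galois \<Omega> F L" and epi: "\<theta> \<in> epi G (Gal_group \<Omega> F L)" and ext: "\<theta> \<in> extensional (carrier G)"
    using Z by (auto simp: Z_set_def)
  interpret galois_data \<Omega> F G L \<theta>
  proof (intro galois_data.intro galois_data_axioms.intro field G F ext)
    show "subfield L \<Omega>" "F \<subseteq> L" using gal by (auto simp: finite_Galois_def)
    show "\<theta> \<in> hom G (Gal_group \<Omega> F L)" using epi by (simp add: epi_def)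
    show "x \<in> F" if x: "x \<in> L" "\<forall>g\<in>carrier G. \<theta> g x = x" for x
    proof -
      have "\<theta> ` carrier G = carrier (Gal_group \<Omega> F L)" using epi by (simp add: epi_def)
      then have "\<forall>s\<in>carrier (Gal_group \<Omega> F L). s x = x" using x(2) by (metis imageE)
      then show ?thesis using gal x(1) unfolding finite_Galois_def by blast
    qed
  qed
  obtain \<beta>\<^sub>0 where \<beta>\<^sub>0: "alternating_bicharacter KG UF \<beta>\<^sub>0" "nondegenerate KG UF \<beta>\<^sub>0"
    using Z by (auto simp: Z_set_def Let_def)
  define B where "B \<tau> = (\<lambda>x y. \<tau> (x, y) \<otimes>\<^bsub>UL\<^esub> inv\<^bsub>UL\<^esub> \<tau> (y, x))" for \<tau> :: "'g \<times> 'g \<Rightarrow> 'a"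
  obtain \<tau> where \<tau>: "\<tau> \<in> carrier (cocycle_group2 KG UL)" "\<xi> = coset_B2 \<Omega> F KG L \<tau>"
    and nd: "nondegenerate KG UL (B \<tau>)"
    and rel: "\<And>x y g. \<lbrakk>x \<in> K; y \<in> K; g \<in> carrier G\<rbrakk> \<Longrightarrow>
      Xi_ext \<Omega> F G e L \<theta> (B \<tau>) x g \<otimes>\<^bsub>UL\<^esub> Xi_ext \<Omega> F G e L \<theta> (B \<tau>) y g =
        coboundary1 UL \<theta> (\<tau> (x, y)) g \<otimes>\<^bsub>UL\<^esub> Xi_ext \<Omega> F G e L \<theta> (B \<tau>) (x \<otimes>\<^bsub>KG\<^esub> y) g"
    using T unfolding T_set_def Let_def B_def by blast
  define \<beta> where "\<beta> = B \<tau>"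
  define f where "f = Xi_ext \<Omega> F G e L \<theta> \<beta>"
  have \<tau>_closed: "\<tau> (x, y) \<in> L - {\<zero>}" and \<tau>_ext: "\<tau> \<in> extensional (K \<times> K)"
    and \<tau>_cocycle: "z \<in> K \<Longrightarrow> \<tau> (x, y) \<otimes> \<tau> (x \<otimes>\<^bsub>G\<^esub> y, z) = \<tau> (x, y \<otimes>\<^bsub>G\<^esub> z) \<otimes> \<tau> (y, z)"
    if "x \<in> K" "y \<in> K" for x y z
    using \<tau>(1) that by (auto simp: cocycle_group2_def UL PiE_def)
  have \<tau>c: "\<tau> (x, y) \<in> carrier \<Omega>" "\<tau> (x, y) \<in> L" "\<tau> (x, y) \<noteq> \<zero>" if "x \<in> K" "y \<in> K" for x y
    using \<tau>_closed[OF that] L_carrier by auto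
  have \<beta>_eq: "\<beta> x y = \<tau> (x, y) \<otimes> inv \<tau> (y, x)" if "x \<in> K" "y \<in> K" for x y
    using UL(4)[OF \<tau>_closed[OF that(2,1)]] by (simp add: \<beta>_def B_def UL(2))
  have \<beta>L: "\<beta> x y \<in> L" "\<beta> x y \<in> carrier \<Omega>" "\<beta> x y \<noteq> \<zero>" and \<beta>\<tau>: "\<beta> x y \<otimes> \<tau> (y, x) = \<tau> (x, y)" if "x \<in> K" "y \<in> K" for x y
  proof -
    note i = L_inv[OF \<tau>c(2,3)[OF that(2,1)]] and t = \<tau>c[OF that] and t' = \<tau>c[OF that(2,1)]
    show "\<beta> x y \<in> L" unfolding \<beta>_eq[OF that] using i t L_ring by blast
    then show "\<beta> x y \<in> carrier \<Omega>" using L_carrier by blast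
    show "\<beta> x y \<otimes> \<tau> (y, x) = \<tau> (x, y)"
      unfolding \<beta>_eq[OF that] using i t t' L_carrier by (simp add: m_assoc)
    then show "\<beta> x y \<noteq> \<zero>" using t t' by auto
  qed
  \<comment> \<open>The commutator pairing of a cocycle on an abelian group: multiply by \<tau> (z,
    x y) and \<tau> (x, y), use the cocycle identity for (z, x, y), (x, z, y) and (x, y, z), and
    cancel.\<close>
  have \<beta>_mult: "\<beta> (x \<otimes>\<^bsub>G\<^esub> y) z = \<beta> x z \<otimes> \<beta> y z" if x: "x \<in> K" and y: "y \<in> K" and z: "z \<in> K" for x y z
  proof -
    note xy = K_mult[OF x y]
    have comm: "z \<otimes>\<^bsub>G\<^esub> x = x \<otimes>\<^bsub>G\<^esub> z" "z \<otimes>\<^bsub>G\<^esub> y = y \<otimes>\<^bsub>G\<^esub> z" using G.m_comm K_carrier x y z by auto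
    note zx = K_mult[OF z x] and yz = K_mult[OF y z]
    note c = \<beta>L(2)[OF x z] \<beta>L(2)[OF y z] \<beta>L(2)[OF xy z] \<tau>c(1)[OF z x] \<tau>c(1)[OF z xy] \<tau>c(1)[OF x y] \<tau>c(1)[OF zx y]
      \<tau>c(1)[OF x z] \<tau>c(1)[OF z y] \<tau>c(1)[OF x yz] \<tau>c(1)[OF y z] \<tau>c(1)[OF xy z]
    have "(\<beta> x z \<otimes> \<beta> y z) \<otimes> (\<tau> (z, x \<otimes>\<^bsub>G\<^esub> y) \<otimes> \<tau> (x, y))
      = \<beta> y z \<otimes> (\<beta> x z \<otimes> \<tau> (z, x)) \<otimes> \<tau> (z \<otimes>\<^bsub>G\<^esub> x, y)"
      unfolding \<tau>_cocycle[OF z x y, symmetric] using c by (simp only: m_ac m_closed)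
    also have "\<dots> = \<beta> y z \<otimes> (\<tau> (x, z) \<otimes> \<tau> (x \<otimes>\<^bsub>G\<^esub> z, y))"
      unfolding \<beta>\<tau>[OF x z] comm using c by (simp add: m_assoc comm)
    also have "\<dots> = (\<beta> y z \<otimes> \<tau> (z, y)) \<otimes> \<tau> (x, y \<otimes>\<^bsub>G\<^esub> z)"
      unfolding \<tau>_cocycle[OF x z y] comm using c by (simp only: m_ac m_closed)
    also have "\<dots> = \<tau> (x, y \<otimes>\<^bsub>G\<^esub> z) \<otimes> \<tau> (y, z)" unfolding \<beta>\<tau>[OF y z] using c by (simp only: m_comm)
    also have "\<dots> = \<tau> (x, y) \<otimes> (\<beta> (x \<otimes>\<^bsub>G\<^esub> y) z \<otimes> \<tau> (z, x \<otimes>\<^bsub>G\<^esub> y))"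
      unfolding \<beta>\<tau>[OF xy z] by (rule \<tau>_cocycle[OF x y z, symmetric])
    also have "\<dots> = \<beta> (x \<otimes>\<^bsub>G\<^esub> y) z \<otimes> (\<tau> (z, x \<otimes>\<^bsub>G\<^esub> y) \<otimes> \<tau> (x, y))"
      using c by (simp only: m_ac m_closed)
    finally have "(\<beta> x z \<otimes> \<beta> y z) \<otimes> (\<tau> (z, x \<otimes>\<^bsub>G\<^esub> y) \<otimes> \<tau> (x, y))
      = \<beta> (x \<otimes>\<^bsub>G\<^esub> y) z \<otimes> (\<tau> (z, x \<otimes>\<^bsub>G\<^esub> y) \<otimes> \<tau> (x, y))" .
    moreover have "\<tau> (z, x \<otimes>\<^bsub>G\<^esub> y) \<otimes> \<tau> (x, y) \<noteq> \<zero>" using integral c \<tau>c(3)[OF z xy] \<tau>c(3)[OF x y] by blast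
    ultimately show ?thesis using m_rcancel c by (metis m_closed)
  qed
  have \<beta>_one: "\<beta> \<one>\<^bsub>G\<^esub> y = \<one>" if y: "y \<in> K" for y
  proof -
    have "\<beta> \<one>\<^bsub>G\<^esub> y \<otimes> \<beta> \<one>\<^bsub>G\<^esub> y = \<beta> \<one>\<^bsub>G\<^esub> y \<otimes> \<one>" using \<beta>_mult[OF K_one K_one y] \<beta>L[OF K_one y] by simp
    then show ?thesis using m_lcancel \<beta>L[OF K_one y] one_closed by blast
  qed
  \<comment> \<open>The value at (x, y) is killed by every exponent that kills x. Such roots of
    unity lie in \<open>F\<close> because a nondegenerate bicharacter with values in
    \<open>F\<close> exists.\<close>
  have \<beta>F: "\<beta> x y \<in> F" if x: "x \<in> K" and y: "y \<in> K" for x y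
  proof (rule root_of_unity_F[OF \<beta>\<^sub>0 x \<beta>L(2)[OF x y]])
    fix n :: nat assume n: "x [^]\<^bsub>G\<^esub> n = \<one>\<^bsub>G\<^esub>"
    have "x [^]\<^bsub>G\<^esub> n \<in> K \<and> \<beta> (x [^]\<^bsub>G\<^esub> n) y = \<beta> x y [^] n" for n :: nat
      by (induction n) (use x y K_one K_mult \<beta>_one \<beta>_mult in auto)
    then show "\<beta> x y [^] n = \<one>" using n \<beta>_one[OF y] by metis
  qed
  have \<chi>: "(\<lambda>x\<in>K. \<beta> x k) \<in> characters KG UF" if k: "k \<in> K" for k
    using \<beta>F[OF _ k] \<beta>L(3)[OF _ k] \<beta>_mult[OF _ _ k] K_mult by (auto simp: characters_def hom_def UF)
  have fe: "f k = e L \<theta> (\<lambda>x\<in>K. \<beta> x k)" if k: "k \<in> K" for k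
    unfolding f_def by (rule Xi_ext_eq[OF choice Z k]) (rule \<chi>[OF k])
  have fZ: "f k \<in> cocycles1 G UL \<theta>" "restrict (f k) K = (\<lambda>x\<in>K. \<beta> x k)" if k: "k \<in> K" for k
    using choice Z \<chi>[OF k] unfolding fe[OF k] extension_choice_def Let_def by fastforce+
  have fK: "f k x = \<beta> x k" if "k \<in> K" "x \<in> K" for k x
    using fun_cong[OF fZ(2)[OF that(1)], of x] that by simp
  have f_closed: "f k g \<in> L - {\<zero>}" if "k \<in> K" "g \<in> carrier G" for k g
    using fZ(1)[OF that(1)] that(2) by (auto simp: cocycles1_def UL)
  have "cocycle_data \<Omega> F G L \<theta> \<tau> f"
  proof (intro cocycle_data.intro cocycle_data_axioms.intro galois_data_axioms)
    show "\<tau> (x, y) \<in> L - {\<zero>}" if "x \<in> K" "y \<in> K" for x y by (rule \<tau>_closed[OF that])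
    show "\<tau> \<in> extensional (K \<times> K)" by (rule \<tau>_ext[OF K_one K_one])
    show "\<tau> (x, y) \<otimes> \<tau> (x \<otimes>\<^bsub>G\<^esub> y, z) = \<tau> (x, y \<otimes>\<^bsub>G\<^esub> z) \<otimes> \<tau> (y, z)" if "x \<in> K" "y \<in> K" "z \<in> K" for x y z
      by (rule \<tau>_cocycle[OF that])
    show "f k g \<in> L - {\<zero>}" if "k \<in> K" "g \<in> carrier G" for k g by (rule f_closed[OF that])
    show "f k (g \<otimes>\<^bsub>G\<^esub> h) = f k g \<otimes> \<theta> g (f k h)" if "k \<in> K" "g \<in> carrier G" "h \<in> carrier G" for k g h
      using fZ(1)[OF that(1)] that(2,3) by (auto simp: cocycles1_def UL)
    show "f x g \<otimes> f y g \<otimes> \<tau> (x, y) = \<theta> g (\<tau> (x, y)) \<otimes> f (x \<otimes>\<^bsub>G\<^esub> y) g"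
      if xyg: "x \<in> K" "y \<in> K" "g \<in> carrier G" for x y g
    proof -
      note t = \<tau>c[OF xyg(1,2)]
      note ti = L_inv[OF t(2,3)]
      have c: "\<theta> g (\<tau> (x, y)) \<in> carrier \<Omega>" "f (x \<otimes>\<^bsub>G\<^esub> y) g \<in> carrier \<Omega>" "inv \<tau> (x, y) \<in> carrier \<Omega>"
        using \<theta>_closed[OF xyg(3) t(2)] f_closed[OF K_mult[OF xyg(1,2)] xyg(3)] ti L_carrier by auto
      have "f x g \<otimes> f y g = \<theta> g (\<tau> (x, y)) \<otimes> inv \<tau> (x, y) \<otimes> f (x \<otimes>\<^bsub>G\<^esub> y) g"
        using rel[OF xyg] UL(4)[OF \<tau>_closed[OF xyg(1,2)]] by (simp add: f_def \<beta>_def coboundary1_def UL(2))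
      then have "f x g \<otimes> f y g \<otimes> \<tau> (x, y)
        = \<theta> g (\<tau> (x, y)) \<otimes> f (x \<otimes>\<^bsub>G\<^esub> y) g \<otimes> (inv \<tau> (x, y) \<otimes> \<tau> (x, y))"
        using c t(1) by (simp only: m_ac m_closed)
      then show ?thesis using c ti by simp
    qed
    show "f k l \<otimes> \<tau> (k, l) = \<tau> (l, k)" if "k \<in> K" "l \<in> K" for k l
      using fK[OF that] \<beta>\<tau>[OF that(2,1)] by simp
    show "l = \<one>\<^bsub>G\<^esub>" if l: "l \<in> K" "\<forall>k\<in>K. f k l = \<one>" for l
      using nd l fK unfolding nondegenerate_def \<beta>_def[symmetric] by (simp add: UL(3))
  qed
  moreover have "f k g = e L \<theta> (\<lambda>x\<in>K. f k x) g" if k: "k \<in> K" for k g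
  proof -
    have "(\<lambda>x\<in>K. f k x) = (\<lambda>x\<in>K. \<beta> x k)" using fK[OF k] by (intro restrict_ext)
    then show ?thesis using fe[OF k] by simp
  qed
  ultimately show ?thesis using that \<tau>(2) by blast
qed

section \<open>The classification\<close>

lemma bij_betw_quotient:
  assumes r: "r = {(x, y). x \<in> S \<and> y \<in> S \<and> h x = h y}" and T: "h ` S = T"
  shows "h respects r" "bij_betw (\<lambda>A. the_elem (h ` A)) (S // r) T"
proof -
  show "h respects r" by (auto simp: r congruent_def)
  have cls: "r `` {x} = {y \<in> S. h y = h x}" if "x \<in> S" for x using that by (auto simp: r)
  have el: "the_elem (h ` (r `` {x})) = h x" if "x \<in> S" for x
  proof -
    have "h ` (r `` {x}) = {h x}" unfolding cls[OF that] using that by auto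
    then show ?thesis by simp
  qed
  show "bij_betw (\<lambda>A. the_elem (h ` A)) (S // r) T"
    unfolding bij_betw_def
  proof
    show "inj_on (\<lambda>A. the_elem (h ` A)) (S // r)"
      by (auto intro!: inj_onI elim!: quotientE simp: el) (auto simp: r)
    show "(\<lambda>A. the_elem (h ` A)) ` (S // r) = T"
      unfolding T[symmetric] quotient_def by (auto simp: el image_iff)
  qed
qed

locale closure_setting =
  fixes G :: "('g, 'n) monoid_scheme"
    and \<Omega> :: "('a, 'm) ring_scheme"
    and F :: "'a set"
    and e :: "'a set \<Rightarrow> ('g \<Rightarrow> 'a \<Rightarrow> 'a) \<Rightarrow> ('g \<Rightarrow> 'a) \<Rightarrow> 'g \<Rightarrow> 'a"
  assumes G: "comm_group G" "finite (carrier G)"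
    and closure: "algebraic_closure \<Omega> F"
    and choice: "extension_choice \<Omega> F G e"
begin

lemma field: "field \<Omega>" and F: "subfield F \<Omega>"
proof -
  interpret algebraic_closure \<Omega> F by (rule closure)
  show "field \<Omega>" "subfield F \<Omega>" by unfold_locales
qed

lemma field_F: "field (\<Omega>\<lparr>carrier := F\<rparr>)"
  by (rule ring.subfield_iff(2)[OF _ F]) (simp add: field field.is_ring cring.axioms(1) domain.axioms(1) field.axioms(1))

lemma simple_Galois:
  assumes "(C, \<sigma>) \<in> simple_Galois_extensions (\<Omega>\<lparr>carrier := F\<rparr>) G"
  shows "simple_Galois (\<Omega>\<lparr>carrier := F\<rparr>) C G \<sigma>"
proof -
  have g: "Galois_extension (\<Omega>\<lparr>carrier := F\<rparr>) G C \<sigma>" and s: "simple_ring C"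
    using assms by (simp_all add: simple_Galois_extensions_def)
  have "assoc_algebra (\<Omega>\<lparr>carrier := F\<rparr>) C" "\<sigma> \<in> hom G (alg_aut_group (\<Omega>\<lparr>carrier := F\<rparr>) C)"
    using g by (simp_all add: Galois_extension_def fd_algebra_def)
  then show ?thesis
    using g s G field_F
    by (intro simple_Galois.intro simple_Galois_axioms.intro action_algebra.intro action_algebra_axioms.intro)
qed

lemma normalized_dataI:
  assumes "crossed_data \<Omega> F G L \<theta> C \<sigma> \<iota> u \<tau> f"
    and "\<And>k g. \<lbrakk>k \<in> carrier (ker_group \<Omega> F G L \<theta>); g \<in> carrier G\<rbrakk> \<Longrightarrow>
      f k g = e L \<theta> (\<lambda>x\<in>carrier (ker_group \<Omega> F G L \<theta>). f k x) g"
  shows "normalized_data \<Omega> F G L \<theta> C \<sigma> \<iota> u \<tau> f e"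
  unfolding normalized_data_def normalized_data_axioms_def using assms choice by blast

lemma normalized:
  assumes "(C, \<sigma>) \<in> simple_Galois_extensions (\<Omega>\<lparr>carrier := F\<rparr>) G"
  obtains L \<theta> \<iota> u \<tau> f where "normalized_data \<Omega> F G L \<theta> C \<sigma> \<iota> u \<tau> f e"
proof -
  obtain L \<theta> \<iota> u \<tau> f where D: "crossed_data \<Omega> F G L \<theta> C \<sigma> \<iota> u \<tau> f"
    using simple_Galois_crossed_data[OF closure simple_Galois[OF assms]] by blast
  obtain u' \<tau>' f' where N: "crossed_data \<Omega> F G L \<theta> C \<sigma> \<iota> u' \<tau>' f'"
    "\<And>k g. \<lbrakk>k \<in> carrier (ker_group \<Omega> F G L \<theta>); g \<in> carrier G\<rbrakk> \<Longrightarrow>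
      f' k g = e L \<theta> (\<lambda>x\<in>carrier (ker_group \<Omega> F G L \<theta>). f' k x) g"
    using crossed_data.normalize[OF D choice] by metis
  show ?thesis
    by (rule that, rule normalized_dataI[OF N(1)]) (rule N(2))
qed

lemma Psi_mem:
  assumes "x \<in> simple_Galois_extensions (\<Omega>\<lparr>carrier := F\<rparr>) G"
  shows "Psi \<Omega> F G e x \<in> T_set \<Omega> F G e"
proof -
  obtain C \<sigma> where x: "x = (C, \<sigma>)" by (cases x)
  obtain L \<theta> \<iota> u \<tau> f where N: "normalized_data \<Omega> F G L \<theta> C \<sigma> \<iota> u \<tau> f e" using normalized[OF assms[unfolded x]] .
  show ?thesis unfolding x Psi_eq[OF N] by (rule normalized_data.T_mem[OF N])
qed

text \<open>The f extracted from the triple already consists of chosen extensions, so the copied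
  crossed algebra is normalized as it stands and its invariants can be read off directly.\<close>

lemma Psi_surj:
  fixes j :: "'a list \<Rightarrow> 'c"
  assumes j: "inj_on j (lists F)" and T: "t \<in> T_set \<Omega> F G e"
  shows "\<exists>x :: ('a, 'c) module \<times> ('g \<Rightarrow> 'c \<Rightarrow> 'c). x \<in> simple_Galois_extensions (\<Omega>\<lparr>carrier := F\<rparr>) G \<and> Psi \<Omega> F G e x = t"
proof -
  obtain L \<theta> \<xi> where t: "t = (L, \<theta>, \<xi>)" by (cases t)
  let ?K = "carrier (ker_group \<Omega> F G L \<theta>)"
  obtain \<tau> f where cd: "cocycle_data \<Omega> F G L \<theta> \<tau> f" and \<xi>: "\<xi> = coset_B2 \<Omega> F (ker_group \<Omega> F G L \<theta>) L \<tau>"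
    and n: "\<And>k g. \<lbrakk>k \<in> ?K; g \<in> carrier G\<rbrakk> \<Longrightarrow> f k g = e L \<theta> (\<lambda>x\<in>?K. f k x) g"
    using T_set_cocycle_data[OF field F G choice] T t by metis
  obtain B :: "('a, 'c) module" and \<rho> \<iota> u where D: "crossed_data \<Omega> F G L \<theta> B \<rho> \<iota> u \<tau> f"
    using cocycle_data.realization[OF cd j] by blast
  have N: "normalized_data \<Omega> F G L \<theta> B \<rho> \<iota> u \<tau> f e"
    by (rule normalized_dataI[OF D]) (rule n)
  have "(B, \<rho>) \<in> simple_Galois_extensions (\<Omega>\<lparr>carrier := F\<rparr>) G"
    using crossed_data.Galois[OF D] crossed_data.simple[OF D] by (simp add: simple_Galois_extensions_def)
  then show ?thesis using Psi_eq[OF N] t \<xi> by blast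
qed

text \<open>An isomorphism transports the normalized data of \<open>C\<close> to \<open>B\<close>,
  so one set of data computes both invariants. Conversely, equal invariants identify the fields and
  the actions, after which the equal cocycle classes allow coordinates to be matched.\<close>

lemma iso_rel_eq:
  "iso_rel (\<Omega>\<lparr>carrier := F\<rparr>) G = {(x, y). x \<in> simple_Galois_extensions (\<Omega>\<lparr>carrier := F\<rparr>) G \<and>
    y \<in> simple_Galois_extensions (\<Omega>\<lparr>carrier := F\<rparr>) G \<and> Psi \<Omega> F G e x = Psi \<Omega> F G e y}"
proof -
  have "G_algebra_isomorphic (\<Omega>\<lparr>carrier := F\<rparr>) G C \<sigma> B \<rho> \<longleftrightarrow> Psi \<Omega> F G e (C, \<sigma>) = Psi \<Omega> F G e (B, \<rho>)"
    if C: "(C, \<sigma>) \<in> simple_Galois_extensions (\<Omega>\<lparr>carrier := F\<rparr>) G"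
      and B: "(B, \<rho>) \<in> simple_Galois_extensions (\<Omega>\<lparr>carrier := F\<rparr>) G" for C B :: "('a, 'c) module" and \<sigma> \<rho>
  proof -
    obtain L \<theta> \<iota> u \<tau> f where N: "normalized_data \<Omega> F G L \<theta> C \<sigma> \<iota> u \<tau> f e" using normalized[OF C] .
    obtain L' \<theta>' \<kappa> v \<tau>' f' where M: "normalized_data \<Omega> F G L' \<theta>' B \<rho> \<kappa> v \<tau>' f' e" using normalized[OF B] .
    interpret N: normalized_data \<Omega> F G L \<theta> C \<sigma> \<iota> u \<tau> f e by (rule N)
    show ?thesis
    proof
      assume "G_algebra_isomorphic (\<Omega>\<lparr>carrier := F\<rparr>) G C \<sigma> B \<rho>"
      then obtain \<phi> where \<phi>: "\<phi> \<in> ring_iso C B" "linear_on (\<Omega>\<lparr>carrier := F\<rparr>) C B \<phi>"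
        "\<And>g x. \<lbrakk>g \<in> carrier G; x \<in> carrier C\<rbrakk> \<Longrightarrow> \<phi> (\<sigma> g x) = \<rho> g (\<phi> x)"
        unfolding G_algebra_isomorphic_def by blast
      have D: "crossed_data \<Omega> F G L \<theta> B \<rho> (\<lambda>x. \<phi> (\<iota> x)) (\<lambda>k. \<phi> (u k)) \<tau> f"
        by (rule N.transport[OF simple_Galois.axioms(1)[OF simple_Galois[OF B]] \<phi>])
      have "normalized_data \<Omega> F G L \<theta> B \<rho> (\<lambda>x. \<phi> (\<iota> x)) (\<lambda>k. \<phi> (u k)) \<tau> f e"
        by (rule normalized_dataI[OF D]) (rule N.normal)
      from Psi_eq[OF this] Psi_eq[OF N] show "Psi \<Omega> F G e (C, \<sigma>) = Psi \<Omega> F G e (B, \<rho>)" by simp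
    next
      assume eq: "Psi \<Omega> F G e (C, \<sigma>) = Psi \<Omega> F G e (B, \<rho>)"
      have L: "L' = L" "\<theta>' = \<theta>"
        using eq unfolding Psi_eq[OF N] Psi_eq[OF M] by simp_all
      have cos: "coset_B2 \<Omega> F (ker_group \<Omega> F G L \<theta>) L \<tau> = coset_B2 \<Omega> F (ker_group \<Omega> F G L \<theta>) L \<tau>'"
        using eq unfolding Psi_eq[OF N] Psi_eq[OF M] L by simp
      show "G_algebra_isomorphic (\<Omega>\<lparr>carrier := F\<rparr>) G C \<sigma> B \<rho>"
        by (rule N.isomorphic_if_coset_eq[OF M[unfolded L] cos])
    qed
  qed
  then show ?thesis unfolding iso_rel_def by auto
qed

end

theorem corollary4p5:
  fixes G :: "('g, 'n) monoid_scheme"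
    and \<Omega> :: "('a, 'm) ring_scheme"
    and F :: "'a set"
    and e :: "'a set \<Rightarrow> ('g \<Rightarrow> 'a \<Rightarrow> 'a) \<Rightarrow> ('g \<Rightarrow> 'a) \<Rightarrow> 'g \<Rightarrow> 'a"
    and j :: "'a list \<Rightarrow> 'c"
  assumes "comm_group G" and "finite (carrier G)"
    and "algebraic_closure \<Omega> F"
    and "extension_choice \<Omega> F G e"
    \<comment> \<open>every finite-dimensional algebra over \<open>F\<close> has an isomorphic copy with carrier in \<open>'c\<close>\<close>
    and "inj_on j (lists F)"
  shows "Psi \<Omega> F G e respects
      (iso_rel (\<Omega>\<lparr>carrier := F\<rparr>) G :: (('a, 'c) module \<times> ('g \<Rightarrow> 'c \<Rightarrow> 'c)) rel) \<and>
    bij_betw (\<lambda>A. the_elem (Psi \<Omega> F G e ` A))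
      (E_simple (\<Omega>\<lparr>carrier := F\<rparr>) G :: (('a, 'c) module \<times> ('g \<Rightarrow> 'c \<Rightarrow> 'c)) set set)
      (T_set \<Omega> F G e)"
proof -
  interpret closure_setting G \<Omega> F e by (rule closure_setting.intro) (fact assms)+
  let ?S = "simple_Galois_extensions (\<Omega>\<lparr>carrier := F\<rparr>) G :: (('a, 'c) module \<times> ('g \<Rightarrow> 'c \<Rightarrow> 'c)) set"
  \<comment> \<open>Well-definedness and injectivity rest on \<open>iso_rel_eq\<close>, which makes
    isomorphism the same as equality of \<open>Psi\<close>; the image is what remains.\<close>
  have T: "Psi \<Omega> F G e ` ?S = T_set \<Omega> F G e"
    using Psi_mem Psi_surj[OF assms(5)] by blast
  show ?thesis
    unfolding E_simple_def using bij_betw_quotient[OF iso_rel_eq T] by simp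
qed

end
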